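(* Fix the staggered mesh and the time step $\delta t$. Let $(\varepsilon^{(m)})_{m\in\mathbb N}$ be a sequence of positive real numbers tending to zero. Let the associated sequence of initial data $(\rho_0^{\varepsilon^{(m)}},\boldsymbol u_0^{\varepsilon^{(m)}})$ satisfy assumption (I) of the context, and let $(\rho^{(m)},\boldsymbol u^{(m)})$ be a corresponding sequence of solutions of the semi-implicit scheme (SI) with $\varepsilon=\varepsilon^{(m)}$. Assume that the time step satisfies, for all $1\le n\le N$ and independently of $m$, the CFL condition $$\delta t\le\min_{\sigma\in\mathcal E_{\rm int}}\frac{4\,\rho^n_{D_\sigma}|D_\sigma|}{2\sum_{e\in\bar{\mathcal E}(D_\sigma)}\bigl(F_{\sigma,e}(\rho^n,\boldsymbol u^n)\bigr)^-+\varrho(\mathcal A)}.$$ Then $(\rho^{(m)})_m$ tends to the constant function $1$ in $L^\infty((0,T);L^\gamma(\Omega))$ as $m\to+\infty$. Moreover, for all $q\in[1,\min(2,\gamma)]$ there exists $C>0$ such that $$\|\rho^{(m)}-1\|_{L^\infty((0,T);L^q(\Omega))}\le C\,\varepsilon^{(m)}\qquad\text{for $m$ large enough}.$$ In addition, the sequence $(\boldsymbol u^{(m)},\delta p^{(m)})_m$ tends, in any discrete norm, to a limit $(\boldsymbol u,\delta p)$ which is the solution of the following semi-implicit scheme for the incompressible Navier-Stokes equations: knowing $\delta p^n\in L_{\mathcal M}(\Omega)$ and $\boldsymbol u^n\in\mathbf H_{\mathcal E,0}(\Omega)$, solve for $\delta p^{n+1}\in L_{\mathcal M}(\Omega)$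 and $\boldsymbol u^{n+1}\in\mathbf H_{\mathcal E,0}(\Omega)$: $$\mathrm{div}(\boldsymbol u^{n+1})_K=0,\quad\forall K\in\mathcal M,$$ $$\frac1{\delta t}(\boldsymbol u^{n+1}_\sigma-\boldsymbol u^n_\sigma)+\mathbf{div}(\boldsymbol u^n\otimes\boldsymbol u^n)^{\rm up}_\sigma-\mathbf{div}(\boldsymbol\tau(\boldsymbol u^n))_\sigma+(\boldsymbol\nabla\delta p^{n+1})_\sigma=0,\quad\forall\sigma\in\mathcal E_{\rm int}.$$
   Context: Mesh. $d\in\{2,3\}$; $\Omega\subset\mathbb R^d$ is a bounded connected open set, polygonal ($d=2$) or polyhedral ($d=3$). $\mathcal M$ is a finite partition of $\Omega$ into triangles and convex quadrilaterals ($d=2$) or tetrahedra and convex hexahedra ($d=3$); $\mathcal E$ is the set of faces, and each face either lies in $\partial\Omega$ (set $\mathcal E_{\rm ext}$) or is the whole common face $\sigma=K|L$ of two distinct cells (set $\mathcal E_{\rm int}$). $\mathcal E(K)$ is the set of faces of $K$, $\boldsymbol n_{K,\sigma}$ the unit normal to $\sigma$ outward $K$, $|\cdot|$ the measure. Each $K$ is partitioned into half-diamond cells $D_{K,\sigma}$, $\sigma\in\mathcal E(K)$, of equal measure $|K|/\#\mathcal E(K)$ (the cone with basis $\sigma$ and vertex the mass center of $K$ if $K$ is a simplex, rectangle or cuboid; otherwise a given partition with the same connectivities). For $\sigma=K|L$, $D_\sigma=D_{K,\sigma}\cup D_{L,\sigma}$ (and $D_\sigma=D_{K,\sigma}$ for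 $\sigma\in\mathcal E_{\rm ext}\cap\mathcal E(K)$). $\bar{\mathcal E}(D_\sigma)$ is the set of faces of $D_\sigma$ (dual faces); $e=D_\sigma|D_{\sigma'}$ is the dual face separating $D_\sigma$ and $D_{\sigma'}$. Spaces. $L_{\mathcal M}(\Omega)$: functions constant on each $K\in\mathcal M$. $\mathbf H_{\mathcal E,0}(\Omega)$: $\mathbb R^d$-valued functions constant on each $D_\sigma$, with value $0$ for $\sigma\in\mathcal E_{\rm ext}$. Operators. For $\rho\in L_{\mathcal M}(\Omega)$, $\boldsymbol u,\boldsymbol v\in\mathbf H_{\mathcal E,0}(\Omega)$: - $F_{K,\sigma}(\rho,\boldsymbol u)=|\sigma|\rho_\sigma\boldsymbol u_\sigma\cdot\boldsymbol n_{K,\sigma}$ for $\sigma=K|L$, with upwind $\rho_\sigma=\rho_K$ if $\boldsymbol u_\sigma\cdot\boldsymbol n_{K,\sigma}\ge0$, $\rho_\sigma=\rho_L$ otherwise; $F_{K,\sigma}=0$ on external faces; $\mathrm{div}(\rho\boldsymbol u)_K=|K|^{-1}\sum_{\sigma\in\mathcal E(K)}F_{K,\sigma}(\rho,\boldsymbol u)$; $\mathrm{div}(\boldsymbol u)_K=|K|^{-1}\sum_{\sigma\in\mathcal E(K)}|\sigma|\boldsymbol u_\sigma\cdot\boldsymbol n_{K,\sigma}$. - Dual density: $|D_\sigma|\rho_{D_\sigma}=|D_{K,\sigma}|\rho_K+|D_{L,\sigma}|\rho_L$ for $\sigma=K|L$. - Dual mass fluxes $F_{\sigma,e}(\rho,\boldsymbol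 u)$: zero if $e\subset\partial\Omega$; otherwise fixed linear combinations, with constant coefficients, of the primal fluxes at neighbouring faces such that, with $\xi_K^\sigma=|D_{K,\sigma}|/|K|$: (i) $F_{K,\sigma}+\sum_{e\in\bar{\mathcal E}(D_\sigma),e\subset K}F_{\sigma,e}=\xi_K^\sigma\sum_{\sigma'\in\mathcal E(K)}F_{K,\sigma'}$ for all $K$, $\sigma\in\mathcal E(K)$; (ii) $F_{\sigma,e}=-F_{\sigma',e}$ for $e=D_\sigma|D_{\sigma'}$; (iii) $|F_{\sigma,e}|\le\max_{\sigma'\in\mathcal E(K)}|F_{K,\sigma'}|$ for $e\subset K$. - Upwind convection: $\mathbf{div}(\rho\boldsymbol u\otimes\boldsymbol v)^{\rm up}_\sigma=|D_\sigma|^{-1}\sum_{e\in\bar{\mathcal E}(D_\sigma)}F_{\sigma,e}(\rho,\boldsymbol u)\boldsymbol v_e$, where for $e=D_\sigma|D_{\sigma'}$, $\boldsymbol v_e=\boldsymbol v_\sigma$ if $F_{\sigma,e}(\rho,\boldsymbol u)\ge0$, $\boldsymbol v_e=\boldsymbol v_{\sigma'}$ otherwise; $\mathbf{div}(\boldsymbol u\otimes\boldsymbol v)^{\rm up}$ is this operator with $\rho\equiv1$. - $\mathbf{div}(\boldsymbol\tau(\boldsymbol u))_\sigma=-\frac{\mu}{|D_\sigma|}\sum_K\int_K\boldsymbol\nabla\hat{\boldsymbol u}\cdot\boldsymbol\nabla\zeta_\sigma-\frac{\mu+\lambda}{|D_\sigma|}\sum_K\int_K\mathrm{div}(\hat{\boldsymbol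 u})\boldsymbol\nabla\zeta_\sigma$, with $\mu>0$, $\mu+\lambda>0$, $\hat{\boldsymbol u}=\sum_\sigma\boldsymbol u_\sigma\zeta_\sigma$, and $(\zeta_\sigma)_{\sigma\in\mathcal E}$ the Crouzeix-Raviart (simplicial cells) / parametric Rannacher-Turek (quadrangular, hexahedral cells; reference space spanned by $1,x_i,x_i^2-x_{i+1}^2$, composed with the inverse $Q_1$ mapping) shape functions, with zero mean jump through internal faces and $|\sigma'|^{-1}\int_{\sigma'}\zeta_\sigma=\delta_{\sigma\sigma'}$. - $\mathcal A$ is the symmetric positive-definite matrix of size $d\,\#\mathcal E_{\rm int}$ with $(\mathcal A\boldsymbol u,\boldsymbol v)=\sum_{\sigma\in\mathcal E_{\rm int}}|D_\sigma|(-\mathbf{div}(\boldsymbol\tau(\boldsymbol u))_\sigma)\cdot\boldsymbol v_\sigma$ (canonical scalar product of $\mathbb R^{d\#\mathcal E_{\rm int}}$), $\varrho(\mathcal A)$ its spectral radius. - For $q\in L_{\mathcal M}(\Omega)$ and $\sigma=K|L$: $(\boldsymbol\nabla q)_\sigma=\frac{|\sigma|}{|D_\sigma|}(q_L-q_K)\boldsymbol n_{K,\sigma}$. For $a\in\mathbb R$, $a^-=-\min(a,0)\ge 0$. Equation of state: $p=\rho^\gamma$, $\gamma\ge1$; $p^n_K=(\rho^n_K)^\gamma$. $T>0$, $\delta t>0$, $N=\lfloor T/\delta t\rfloor$. Semi-implicit scheme (SI) with Mach number $\varepsilon>0$. Initialization: $\rho^0_K=|K|^{-1}\int_K\rho_0^\varepsilon$,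 $\boldsymbol u_\sigma^0=|\sigma|^{-1}\int_\sigma\boldsymbol u_0^\varepsilon$ ($\sigma\in\mathcal E_{\rm int}$), and $\rho^{-1}$ is given by $\frac1{\delta t}(\rho_K^0-\rho_K^{-1})+\mathrm{div}(\rho^0\boldsymbol u^0)_K=0$ for all $K$. For $0\le n\le N-1$ find $\rho^{n+1}\in L_{\mathcal M}(\Omega)$, $\boldsymbol u^{n+1}\in\mathbf H_{\mathcal E,0}(\Omega)$ with $$\tfrac1{\delta t}(\rho_K^{n+1}-\rho_K^n)+\mathrm{div}(\rho^{n+1}\boldsymbol u^{n+1})_K=0\ \ \forall K\in\mathcal M,$$ $$\tfrac1{\delta t}(\rho^n_{D_\sigma}\boldsymbol u^{n+1}_\sigma-\rho^{n-1}_{D_\sigma}\boldsymbol u^n_\sigma)+\mathbf{div}(\rho^n\boldsymbol u^n\otimes\boldsymbol u^n)^{\rm up}_\sigma-\mathbf{div}(\boldsymbol\tau(\boldsymbol u^n))_\sigma+\tfrac1{\varepsilon^2}(\boldsymbol\nabla p^{n+1})_\sigma=0\ \ \forall\sigma\in\mathcal E_{\rm int}.$$ Assumption (I): $\rho_0^\varepsilon>0$, $\rho_0^\varepsilon\in L^\infty(\Omega)$, $\boldsymbol u_0^\varepsilon\in H^1_0(\Omega)^d$, and there is $C$ independent of $\varepsilon$ with $\|\boldsymbol u_0^\varepsilon\|_{H^1(\Omega)^d}+\frac1\varepsilon\|\mathrm{div}\,\boldsymbol u_0^\varepsilon\|_{L^2(\Omega)}+\frac1{\varepsilon}\|\rho_0^\varepsilon-1\|_{L^\infty(\Omega)}\le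 C$; moreover $\boldsymbol u_0^\varepsilon$ converges in $L^2(\Omega)^d$ to some $\boldsymbol u_0\in L^2(\Omega)^d$. Notation. $\delta p^n_K=(p^n_K-m(p^n))/\varepsilon^2$ with $m(p^n)=|\Omega|^{-1}\sum_K|K|p^n_K$. Discrete solutions are identified with functions piecewise constant in time; the $L^\infty((0,T);L^q)$ norm is the maximum over the discrete times $0\le n\le N$ of the $L^q(\Omega)$ norms. A "discrete norm" is any norm on the (finite-dimensional) space of discrete functions.
   Formalization: Convergence of δp is stated at the time levels 1≤n≤N only: under (I) the initial δp^0 can grow like 1/ε (e.g. ρ_0=1+εφ), and it does not enter the limit scheme; the limit pressure is the zero-mean one, since the scheme fixes δp only up to a constant. *)

theory Defs
  imports "HOL-Analysis.Analysis" "HOL-Probability.Essential_Supremum"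
begin

section \<open>Function spaces on a domain\<close>

definition L2 :: "(real^'d) set \<Rightarrow> (real^'d \<Rightarrow> 'b::euclidean_space) set" where
  "L2 \<Omega> = {f. f \<in> borel_measurable (lebesgue_on \<Omega>) \<and> integrable (lebesgue_on \<Omega>) (\<lambda>x. (norm (f x))\<^sup>2)}"

definition l2_norm :: "(real^'d) set \<Rightarrow> (real^'d \<Rightarrow> 'b::euclidean_space) \<Rightarrow> real" where
  "l2_norm \<Omega> f = sqrt (LINT x|lebesgue_on \<Omega>. (norm (f x))\<^sup>2)"

definition lq_norm :: "(real^'d) set \<Rightarrow> real \<Rightarrow> (real^'d \<Rightarrow> real) \<Rightarrow> real" where
  "lq_norm \<Omega> q f = (LINT x|lebesgue_on \<Omega>. \<bar>f x\<bar> powr q) powr (1 / q)"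

definition linf_norm :: "(real^'d) set \<Rightarrow> (real^'d \<Rightarrow> real) \<Rightarrow> ereal" where
  "linf_norm \<Omega> f = esssup (lebesgue_on \<Omega>) (\<lambda>x. ereal \<bar>f x\<bar>)"

definition pd :: "'d \<Rightarrow> (real^'d \<Rightarrow> real) \<Rightarrow> real^'d \<Rightarrow> real" where
  "pd i f x = frechet_derivative f (at x) (axis i 1)"

definition grad :: "(real^'d \<Rightarrow> real) \<Rightarrow> real^'d \<Rightarrow> real^'d" where
  "grad f x = (\<chi> i. pd i f x)"

definition divergence :: "(real^'d \<Rightarrow> real^'d) \<Rightarrow> real^'d \<Rightarrow> real" where
  "divergence v x = (\<Sum>i\<in>UNIV. pd i (\<lambda>y. v y $ i) x)"

text \<open>Infinitely differentiable: every iterated partial derivative is differentiable everywhere.\<close>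

definition smooth :: "(real^'d \<Rightarrow> real) \<Rightarrow> bool" where
  "smooth f \<longleftrightarrow> (\<forall>is. fold pd is f differentiable_on UNIV)"

definition test_function :: "(real^'d) set \<Rightarrow> (real^'d \<Rightarrow> real) \<Rightarrow> bool" where
  "test_function \<Omega> \<phi> \<longleftrightarrow> smooth \<phi> \<and> compact (closure {x. \<phi> x \<noteq> 0}) \<and> closure {x. \<phi> x \<noteq> 0} \<subseteq> \<Omega>"

definition weak_gradient :: "(real^'d) set \<Rightarrow> (real^'d \<Rightarrow> real) \<Rightarrow> (real^'d \<Rightarrow> real^'d) \<Rightarrow> bool" where
  "weak_gradient \<Omega> f G \<longleftrightarrow> G \<in> L2 \<Omega> \<and>
     (\<forall>\<phi> i. test_function \<Omega> \<phi> \<longrightarrow>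
        (LINT x|lebesgue_on \<Omega>. f x * pd i \<phi> x) = - (LINT x|lebesgue_on \<Omega>. G x $ i * \<phi> x))"

definition H1 :: "(real^'d) set \<Rightarrow> (real^'d \<Rightarrow> real) set" where
  "H1 \<Omega> = {f \<in> L2 \<Omega>. \<exists>G. weak_gradient \<Omega> f G}"

definition wgrad :: "(real^'d) set \<Rightarrow> (real^'d \<Rightarrow> real) \<Rightarrow> real^'d \<Rightarrow> real^'d" where
  "wgrad \<Omega> f = (SOME G. weak_gradient \<Omega> f G)"

text \<open>A sequence of test functions converging to \<open>f\<close> in the \<open>H1\<close> norm.\<close>

definition h1_approx :: "(real^'d) set \<Rightarrow> (nat \<Rightarrow> real^'d \<Rightarrow> real) \<Rightarrow> (real^'d \<Rightarrow> real) \<Rightarrow> bool" where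
  "h1_approx \<Omega> \<phi> f \<longleftrightarrow> (\<forall>k. test_function \<Omega> (\<phi> k)) \<and>
     (\<lambda>k. l2_norm \<Omega> (\<lambda>x. \<phi> k x - f x)) \<longlonglongrightarrow> 0 \<and>
     (\<lambda>k. l2_norm \<Omega> (\<lambda>x. grad (\<phi> k) x - wgrad \<Omega> f x)) \<longlonglongrightarrow> 0"

definition H10 :: "(real^'d) set \<Rightarrow> (real^'d \<Rightarrow> real) set" where
  "H10 \<Omega> = {f \<in> H1 \<Omega>. \<exists>\<phi>. h1_approx \<Omega> \<phi> f}"

definition h1_norm :: "(real^'d) set \<Rightarrow> (real^'d \<Rightarrow> real^'d) \<Rightarrow> real" where
  "h1_norm \<Omega> u = sqrt ((l2_norm \<Omega> u)\<^sup>2 + (\<Sum>i\<in>UNIV. (l2_norm \<Omega> (wgrad \<Omega> (\<lambda>x. u x $ i)))\<^sup>2))"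

definition weak_div :: "(real^'d) set \<Rightarrow> (real^'d \<Rightarrow> real^'d) \<Rightarrow> real^'d \<Rightarrow> real" where
  "weak_div \<Omega> u x = (\<Sum>i\<in>UNIV. wgrad \<Omega> (\<lambda>y. u y $ i) x $ i)"

section \<open>Surface measure and traces on flat faces\<close>

text \<open>The \<open>(d-1)\<close>-dimensional Lebesgue measure on a subset of a hyperplane: the image under the
  orthogonal projection of the \<open>d\<close>-dimensional measure on the right cylinder of height \<open>1\<close>
  around \<open>\<sigma>\<close>.\<close>

definition cylinder :: "(real^'d) set \<Rightarrow> (real^'d) set" where
  "cylinder \<sigma> = {x. closest_point (affine hull \<sigma>) x \<in> \<sigma> \<and> dist x (closest_point (affine hull \<sigma>) x) \<le> 1/2}"

definition surf :: "(real^'d) set \<Rightarrow> (real^'d) measure" where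
  "surf \<sigma> = distr (restrict_space lborel (cylinder \<sigma>)) borel (closest_point (affine hull \<sigma>))"

definition area :: "(real^'d) set \<Rightarrow> real" where
  "area \<sigma> = measure (surf \<sigma>) \<sigma>"

definition face_mean :: "(real^'d) set \<Rightarrow> (real^'d \<Rightarrow> 'b::euclidean_space) \<Rightarrow> 'b" where
  "face_mean \<sigma> f = (1 / area \<sigma>) *\<^sub>R (LINT x:\<sigma>|surf \<sigma>. f x)"

text \<open>\<open>g\<close> is the trace on \<open>\<sigma>\<close> of \<open>f \<in> H10 \<Omega>\<close>: the trace operator is the continuous extension to
  \<open>H10 \<Omega>\<close>, with values in \<open>L2(\<sigma>)\<close>, of the restriction of test functions to \<open>\<sigma>\<close>.\<close>

definition is_trace ::
  "(real^'d) set \<Rightarrow> (real^'d) set \<Rightarrow> (real^'d \<Rightarrow> real) \<Rightarrow> (real^'d \<Rightarrow> real) \<Rightarrow> bool" where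
  "is_trace \<Omega> \<sigma> f g \<longleftrightarrow> set_integrable (surf \<sigma>) \<sigma> g \<and> set_integrable (surf \<sigma>) \<sigma> (\<lambda>x. (g x)\<^sup>2) \<and>
     (\<forall>\<phi>. h1_approx \<Omega> \<phi> f \<longrightarrow> (\<lambda>k. LINT x:\<sigma>|surf \<sigma>. (\<phi> k x - g x)\<^sup>2) \<longlonglongrightarrow> 0)"

section \<open>Cells and local finite element spaces\<close>

abbreviation vol :: "(real^'d) set \<Rightarrow> real" where
  "vol A \<equiv> measure lebesgue A"

definition facets :: "(real^'d) set \<Rightarrow> (real^'d) set set" where
  "facets K = {\<sigma>. \<sigma> facet_of K}"

definition simplex_cell :: "(real^'d) set \<Rightarrow> bool" where
  "simplex_cell K \<longleftrightarrow> int CARD('d) simplex K"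

text \<open>The vertices of the reference cube are indexed by the sets \<open>s\<close> of coordinates equal to \<open>1\<close>;
  \<open>v s\<close> is the vertex of the actual cell associated with \<open>s\<close>.\<close>

definition q1_map :: "('d::finite set \<Rightarrow> real^'d) \<Rightarrow> real^'d \<Rightarrow> real^'d" where
  "q1_map v x = (\<Sum>s\<in>UNIV. (\<Prod>i\<in>UNIV. if i \<in> s then x $ i else 1 - x $ i) *\<^sub>R v s)"

text \<open>Convex quadrilaterals (\<open>d = 2\<close>) and convex hexahedra (\<open>d = 3\<close>), that is convex polytopes
  which have the combinatorial structure of the cube. The last three clauses say that the inverse
  \<open>Q\<^sub>1\<close> mapping, from which the parametric Rannacher-Turek element is built, exists and is regular.\<close>

definition q1_cell :: "(real^'d) set \<Rightarrow> ('d::finite set \<Rightarrow> real^'d) \<Rightarrow> bool" where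
  "q1_cell K v \<longleftrightarrow> K = convex hull (range v) \<and> inj v \<and> {x. x extreme_point_of K} = range v \<and>
     facets K = (\<Union>i. {convex hull (v ` {s. i \<in> s}), convex hull (v ` {s. i \<notin> s})}) \<and>
     inj_on (q1_map v) (cbox 0 1) \<and> q1_map v ` cbox 0 1 = K \<and>
     (\<forall>x\<in>cbox 0 1. det (matrix (frechet_derivative (q1_map v) (at x))) \<noteq> 0)"

definition rectangular_cell :: "(real^'d) set \<Rightarrow> bool" where
  "rectangular_cell K \<longleftrightarrow> (\<exists>a (b :: 'd \<Rightarrow> real^'d). (\<forall>i. b i \<noteq> 0) \<and> (\<forall>i j. i \<noteq> j \<longrightarrow> b i \<bullet> b j = 0) \<and>
     K = (\<lambda>t. a + (\<Sum>i\<in>UNIV. (t $ i) *\<^sub>R b i)) ` cbox 0 1)"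

definition rt_poly :: "(real^'d \<Rightarrow> real) \<Rightarrow> bool" where
  "rt_poly p \<longleftrightarrow> (\<exists>a b c. \<forall>x. p x =
     a + (\<Sum>i\<in>UNIV. b i * x $ i) + (\<Sum>i\<in>UNIV. \<Sum>j\<in>UNIV. c i j * ((x $ i)\<^sup>2 - (x $ j)\<^sup>2)))"

text \<open>Crouzeix-Raviart on simplices, parametric Rannacher-Turek on the other cells. The latter
  space does not depend on the numbering \<open>v\<close> of the vertices.\<close>

definition local_space :: "(real^'d) set \<Rightarrow> (real^'d \<Rightarrow> real) \<Rightarrow> bool" where
  "local_space K f \<longleftrightarrow>
     (simplex_cell K \<and> (\<exists>a b. \<forall>x\<in>K. f x = a + b \<bullet> x)) \<or>
     (\<exists>v p. q1_cell K v \<and> rt_poly p \<and> (\<forall>x\<in>cbox 0 1. f (q1_map v x) = p x))"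

definition mass_center :: "(real^'d) set \<Rightarrow> real^'d" where
  "mass_center K = (1 / vol K) *\<^sub>R (LINT x:K|lebesgue. x)"

definition outward_normal :: "(real^'d) set \<Rightarrow> (real^'d) set \<Rightarrow> real^'d" where
  "outward_normal K \<sigma> =
     (THE n. norm n = 1 \<and> (\<exists>c. (\<forall>x\<in>K. n \<bullet> x \<le> c) \<and> (\<forall>x\<in>\<sigma>. n \<bullet> x = c)))"

section \<open>Staggered discretization\<close>

text \<open>Cells and half-diamonds are closed sets. \<open>shape S \<sigma> K\<close> is the restriction to \<open>K\<close> of the
  shape function attached to \<open>\<sigma>\<close> (which is two-valued on faces). \<open>fluxcoef S K \<sigma> \<sigma>' \<tau>\<close> is the
  coefficient of the primal flux \<open>F\<^bsub>K,\<tau>\<^esub>\<close> in the dual flux from \<open>\<sigma>\<close> to \<open>\<sigma>'\<close> inside \<open>K\<close>.\<close>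

record ('d::finite) staggered =
  region :: "(real^'d) set"
  cells :: "(real^'d) set set"
  halfdiam :: "(real^'d) set \<Rightarrow> (real^'d) set \<Rightarrow> (real^'d) set"
  fluxcoef :: "(real^'d) set \<Rightarrow> (real^'d) set \<Rightarrow> (real^'d) set \<Rightarrow> (real^'d) set \<Rightarrow> real"
  shape :: "(real^'d) set \<Rightarrow> (real^'d) set \<Rightarrow> real^'d \<Rightarrow> real"

text \<open>An element of the space of cellwise constant functions is identified with the family of its
  values on the cells, and an element of \<open>HE0 S\<close> with the family of its values on the diamond cells,
  indexed by the faces.\<close>

type_synonym 'd cellfun = "(real^'d) set \<Rightarrow> real"
type_synonym 'd facefun = "(real^'d) set \<Rightarrow> real^'d"

definition faces :: "'d::finite staggered \<Rightarrow> (real^'d) set set" where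
  "faces S = (\<Union>K\<in>cells S. facets K)"

definition ext_faces :: "'d::finite staggered \<Rightarrow> (real^'d) set set" where
  "ext_faces S = {\<sigma> \<in> faces S. \<sigma> \<subseteq> frontier (region S)}"

definition int_faces :: "'d::finite staggered \<Rightarrow> (real^'d) set set" where
  "int_faces S = faces S - ext_faces S"

definition cells_of :: "'d::finite staggered \<Rightarrow> (real^'d) set \<Rightarrow> (real^'d) set set" where
  "cells_of S \<sigma> = {K \<in> cells S. \<sigma> \<in> facets K}"

definition other_cell :: "'d::finite staggered \<Rightarrow> (real^'d) set \<Rightarrow> (real^'d) set \<Rightarrow> (real^'d) set" where
  "other_cell S K \<sigma> = (THE L. L \<in> cells_of S \<sigma> \<and> L \<noteq> K)"

definition diam :: "'d::finite staggered \<Rightarrow> (real^'d) set \<Rightarrow> (real^'d) set" where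
  "diam S \<sigma> = (\<Union>K\<in>cells_of S \<sigma>. halfdiam S K \<sigma>)"

definition HE0 :: "'d::finite staggered \<Rightarrow> 'd facefun set" where
  "HE0 S = {u. \<forall>\<sigma>\<in>ext_faces S. u \<sigma> = 0}"

definition polyhedral_boundary :: "(real^'d) set \<Rightarrow> bool" where
  "polyhedral_boundary \<Omega> \<longleftrightarrow> (\<exists>P. finite P \<and>
     (\<forall>A\<in>P. polytope A \<and> aff_dim A = int CARD('d) - 1) \<and> frontier \<Omega> = \<Union>P)"

definition primal_mesh :: "'d::finite staggered \<Rightarrow> bool" where
  "primal_mesh S \<longleftrightarrow>
     open (region S) \<and> bounded (region S) \<and> connected (region S) \<and> region S \<noteq> {} \<and>
     polyhedral_boundary (region S) \<and>
     finite (cells S) \<and> (\<forall>K\<in>cells S. simplex_cell K \<or> (\<exists>v. q1_cell K v)) \<and>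
     (\<forall>K\<in>cells S. \<forall>L\<in>cells S. K \<noteq> L \<longrightarrow> interior K \<inter> interior L = {}) \<and>
     \<Union>(cells S) = closure (region S) \<and>
     (\<forall>\<sigma>\<in>int_faces S. \<exists>K\<in>cells S. \<exists>L\<in>cells S.
        K \<noteq> L \<and> \<sigma> \<in> facets K \<and> \<sigma> \<in> facets L \<and> K \<inter> L = \<sigma>)"

text \<open>The last clause says that the half-diamonds form a partition of \<open>K\<close> with the same
  connectivities as the partition of \<open>K\<close> into the cones with bases the faces and a common vertex \<open>c\<close>:
  they are the images of these cones by a homeomorphism of \<open>K\<close> preserving its faces.\<close>

definition half_diamonds :: "'d::finite staggered \<Rightarrow> bool" where
  "half_diamonds S \<longleftrightarrow> (\<forall>K\<in>cells S.
     (\<forall>\<sigma>\<in>facets K. vol (halfdiam S K \<sigma>) = vol K / card (facets K)) \<and>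
     (simplex_cell K \<or> rectangular_cell K \<longrightarrow>
        (\<forall>\<sigma>\<in>facets K. halfdiam S K \<sigma> = convex hull (insert (mass_center K) \<sigma>))) \<and>
     (\<exists>c h h'. c \<in> interior K \<and> homeomorphism K K h h' \<and> (\<forall>\<sigma>\<in>facets K. h ` \<sigma> = \<sigma>) \<and>
        (\<forall>\<sigma>\<in>facets K. halfdiam S K \<sigma> = h ` (convex hull (insert c \<sigma>)))))"

definition shape_functions :: "'d::finite staggered \<Rightarrow> bool" where
  "shape_functions S \<longleftrightarrow> (\<forall>\<sigma>\<in>faces S. \<forall>K\<in>cells S. local_space K (shape S \<sigma> K) \<and>
     (\<forall>\<sigma>'\<in>facets K. face_mean \<sigma>' (shape S \<sigma> K) = (if \<sigma>' = \<sigma> then 1 else 0)))"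

subsection \<open>Mass fluxes and divergence\<close>

definition flux :: "'d::finite staggered \<Rightarrow> 'd cellfun \<Rightarrow> 'd facefun \<Rightarrow> (real^'d) set \<Rightarrow> (real^'d) set \<Rightarrow> real" where
  "flux S \<rho> u K \<sigma> =
     (if \<sigma> \<in> ext_faces S then 0
      else area \<sigma> * (if u \<sigma> \<bullet> outward_normal K \<sigma> \<ge> 0 then \<rho> K else \<rho> (other_cell S K \<sigma>))
        * (u \<sigma> \<bullet> outward_normal K \<sigma>))"

definition div_mass :: "'d::finite staggered \<Rightarrow> 'd cellfun \<Rightarrow> 'd facefun \<Rightarrow> 'd cellfun" where
  "div_mass S \<rho> u K = (1 / vol K) * (\<Sum>\<sigma>\<in>facets K. flux S \<rho> u K \<sigma>)"

definition div_vel :: "'d::finite staggered \<Rightarrow> 'd facefun \<Rightarrow> 'd cellfun" where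
  "div_vel S u K = (1 / vol K) * (\<Sum>\<sigma>\<in>facets K. area \<sigma> * (u \<sigma> \<bullet> outward_normal K \<sigma>))"

definition dual_density :: "'d::finite staggered \<Rightarrow> 'd cellfun \<Rightarrow> (real^'d) set \<Rightarrow> real" where
  "dual_density S \<rho> \<sigma> = (\<Sum>K\<in>cells_of S \<sigma>. vol (halfdiam S K \<sigma>) * \<rho> K) / vol (diam S \<sigma>)"

subsection \<open>Dual fluxes and convection\<close>

text \<open>The dual face between the half-diamonds of two faces \<open>\<sigma>\<close>, \<open>\<sigma>'\<close> of \<open>K\<close> exists iff \<open>\<sigma>\<close> and \<open>\<sigma>'\<close>
  have a common \<open>(d-2)\<close>-dimensional face, of which it is (up to homeomorphism) the cone.
  Hence the dual faces of \<open>diam S \<sigma>\<close> not contained in the boundary of the domain are indexed by the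
  pairs \<open>(K, \<sigma>')\<close> with \<open>K \<in> cells_of S \<sigma>\<close> and \<open>\<sigma>' \<in> dual_nbrs K \<sigma>\<close>; the flux through the other
  ones is zero.\<close>

definition dual_nbrs :: "(real^'d) set \<Rightarrow> (real^'d) set \<Rightarrow> (real^'d) set set" where
  "dual_nbrs K \<sigma> = {\<sigma>' \<in> facets K. \<sigma>' \<noteq> \<sigma> \<and> aff_dim (\<sigma> \<inter> \<sigma>') = int CARD('d) - 2}"

definition dual_flux ::
  "'d::finite staggered \<Rightarrow> 'd cellfun \<Rightarrow> 'd facefun \<Rightarrow> (real^'d) set \<Rightarrow> (real^'d) set \<Rightarrow> (real^'d) set \<Rightarrow> real" where
  "dual_flux S \<rho> u K \<sigma> \<sigma>' = (\<Sum>\<tau>\<in>facets K. fluxcoef S K \<sigma> \<sigma>' \<tau> * flux S \<rho> u K \<tau>)"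

definition dual_flux_conditions :: "'d::finite staggered \<Rightarrow> bool" where
  "dual_flux_conditions S \<longleftrightarrow> (\<forall>\<rho>. \<forall>u\<in>HE0 S. \<forall>K\<in>cells S. \<forall>\<sigma>\<in>facets K.
     flux S \<rho> u K \<sigma> + (\<Sum>\<sigma>'\<in>dual_nbrs K \<sigma>. dual_flux S \<rho> u K \<sigma> \<sigma>')
       = vol (halfdiam S K \<sigma>) / vol K * (\<Sum>\<sigma>'\<in>facets K. flux S \<rho> u K \<sigma>') \<and>
     (\<forall>\<sigma>'\<in>dual_nbrs K \<sigma>. dual_flux S \<rho> u K \<sigma> \<sigma>' = - dual_flux S \<rho> u K \<sigma>' \<sigma> \<and>
        \<bar>dual_flux S \<rho> u K \<sigma> \<sigma>'\<bar> \<le> Max ((\<lambda>\<tau>. \<bar>flux S \<rho> u K \<tau>\<bar>) ` facets K)))"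

definition staggered_mesh :: "'d::finite staggered \<Rightarrow> bool" where
  "staggered_mesh S \<longleftrightarrow>
     primal_mesh S \<and> half_diamonds S \<and> shape_functions S \<and> dual_flux_conditions S"

definition conv_up :: "'d::finite staggered \<Rightarrow> 'd cellfun \<Rightarrow> 'd facefun \<Rightarrow> 'd facefun \<Rightarrow> 'd facefun" where
  "conv_up S \<rho> u v \<sigma> = (1 / vol (diam S \<sigma>)) *\<^sub>R
     (\<Sum>K\<in>cells_of S \<sigma>. \<Sum>\<sigma>'\<in>dual_nbrs K \<sigma>.
        dual_flux S \<rho> u K \<sigma> \<sigma>' *\<^sub>R (if dual_flux S \<rho> u K \<sigma> \<sigma>' \<ge> 0 then v \<sigma> else v \<sigma>'))"

subsection \<open>Viscous term and pressure gradient\<close>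

definition uhat :: "'d::finite staggered \<Rightarrow> 'd facefun \<Rightarrow> (real^'d) set \<Rightarrow> real^'d \<Rightarrow> real^'d" where
  "uhat S u K x = (\<Sum>\<sigma>\<in>faces S. shape S \<sigma> K x *\<^sub>R u \<sigma>)"

definition div_tau :: "'d::finite staggered \<Rightarrow> real \<Rightarrow> real \<Rightarrow> 'd facefun \<Rightarrow> 'd facefun" where
  "div_tau S \<mu> lam u \<sigma> =
     - (\<mu> / vol (diam S \<sigma>)) *\<^sub>R (\<Sum>K\<in>cells S. LINT x:interior K|lebesgue.
          (\<chi> i. grad (\<lambda>y. uhat S u K y $ i) x \<bullet> grad (shape S \<sigma> K) x))
     - ((\<mu> + lam) / vol (diam S \<sigma>)) *\<^sub>R (\<Sum>K\<in>cells S. LINT x:interior K|lebesgue.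
          divergence (uhat S u K) x *\<^sub>R grad (shape S \<sigma> K) x)"

text \<open>For \<open>\<sigma> = K|L\<close> the value does not depend on which of the two cells is chosen as \<open>K\<close>.\<close>

definition grad_p :: "'d::finite staggered \<Rightarrow> 'd cellfun \<Rightarrow> 'd facefun" where
  "grad_p S q \<sigma> = (let K = (SOME K. K \<in> cells_of S \<sigma>); L = other_cell S K \<sigma> in
     (area \<sigma> / vol (diam S \<sigma>) * (q L - q K)) *\<^sub>R outward_normal K \<sigma>)"

definition visc_matrix ::
  "'d::finite staggered \<Rightarrow> real \<Rightarrow> real \<Rightarrow> (real^'d) set \<times> 'd \<Rightarrow> (real^'d) set \<times> 'd \<Rightarrow> real" where
  "visc_matrix S \<mu> lam = (\<lambda>(\<sigma>, i) (\<tau>, j).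
     vol (diam S \<sigma>) * (- (div_tau S \<mu> lam (\<lambda>\<tau>'. if \<tau>' = \<tau> then axis j 1 else 0) \<sigma>)) $ i)"

text \<open>Spectral radius of a real square matrix with rows and columns indexed by the finite set \<open>I\<close>.\<close>

definition spec_radius :: "'i set \<Rightarrow> ('i \<Rightarrow> 'i \<Rightarrow> real) \<Rightarrow> real" where
  "spec_radius I A = Max (cmod ` {z. \<exists>w. (\<exists>i\<in>I. w i \<noteq> 0) \<and>
     (\<forall>i\<in>I. (\<Sum>j\<in>I. complex_of_real (A i j) * w j) = z * w i)})"

section \<open>Schemes\<close>

text \<open>Times are indexed by integers, so as to accommodate the density at level \<open>-1\<close>.\<close>

definition SI_init ::
  "'d::finite staggered \<Rightarrow> real \<Rightarrow> (real^'d \<Rightarrow> real) \<Rightarrow> (real^'d \<Rightarrow> real^'d) \<Rightarrow>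
   (int \<Rightarrow> 'd cellfun) \<Rightarrow> (int \<Rightarrow> 'd facefun) \<Rightarrow> bool" where
  "SI_init S \<delta>t \<rho>0 u0 \<rho> u \<longleftrightarrow>
     (\<forall>K\<in>cells S. \<rho> 0 K = (1 / vol K) * (LINT x:interior K|lebesgue. \<rho>0 x)) \<and>
     u 0 \<in> HE0 S \<and>
     (\<forall>\<sigma>\<in>int_faces S. \<exists>g. (\<forall>i. is_trace (region S) \<sigma> (\<lambda>x. u0 x $ i) (\<lambda>x. g x $ i)) \<and>
        u 0 \<sigma> = face_mean \<sigma> g) \<and>
     (\<forall>K\<in>cells S. (1 / \<delta>t) * (\<rho> 0 K - \<rho> (-1) K) + div_mass S (\<rho> 0) (u 0) K = 0)"

definition SI_step ::
  "'d::finite staggered \<Rightarrow> real \<Rightarrow> real \<Rightarrow> real \<Rightarrow> real \<Rightarrow> real \<Rightarrow>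
   (int \<Rightarrow> 'd cellfun) \<Rightarrow> (int \<Rightarrow> 'd facefun) \<Rightarrow> int \<Rightarrow> bool" where
  "SI_step S \<mu> lam \<gamma> \<delta>t \<epsilon> \<rho> u n \<longleftrightarrow>
     u (n + 1) \<in> HE0 S \<and>
     (\<forall>K\<in>cells S. (1 / \<delta>t) * (\<rho> (n + 1) K - \<rho> n K) + div_mass S (\<rho> (n + 1)) (u (n + 1)) K = 0) \<and>
     (\<forall>\<sigma>\<in>int_faces S.
        (1 / \<delta>t) *\<^sub>R (dual_density S (\<rho> n) \<sigma> *\<^sub>R u (n + 1) \<sigma> - dual_density S (\<rho> (n - 1)) \<sigma> *\<^sub>R u n \<sigma>)
        + conv_up S (\<rho> n) (u n) (u n) \<sigma> - div_tau S \<mu> lam (u n) \<sigma>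
        + (1 / \<epsilon>\<^sup>2) *\<^sub>R grad_p S (\<lambda>K. \<rho> (n + 1) K powr \<gamma>) \<sigma> = 0)"

definition SI_solution ::
  "'d::finite staggered \<Rightarrow> real \<Rightarrow> real \<Rightarrow> real \<Rightarrow> real \<Rightarrow> int \<Rightarrow> real \<Rightarrow>
   (real^'d \<Rightarrow> real) \<Rightarrow> (real^'d \<Rightarrow> real^'d) \<Rightarrow> (int \<Rightarrow> 'd cellfun) \<Rightarrow> (int \<Rightarrow> 'd facefun) \<Rightarrow> bool" where
  "SI_solution S \<mu> lam \<gamma> \<delta>t N \<epsilon> \<rho>0 u0 \<rho> u \<longleftrightarrow>
     SI_init S \<delta>t \<rho>0 u0 \<rho> u \<and> (\<forall>n\<in>{0..<N}. SI_step S \<mu> lam \<gamma> \<delta>t \<epsilon> \<rho> u n)"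

definition incompressible_step ::
  "'d::finite staggered \<Rightarrow> real \<Rightarrow> real \<Rightarrow> real \<Rightarrow> 'd facefun \<Rightarrow> 'd facefun \<Rightarrow> 'd cellfun \<Rightarrow> bool" where
  "incompressible_step S \<mu> lam \<delta>t u u' \<delta>p' \<longleftrightarrow>
     u' \<in> HE0 S \<and> (\<forall>K\<in>cells S. div_vel S u' K = 0) \<and>
     (\<forall>\<sigma>\<in>int_faces S.
        (1 / \<delta>t) *\<^sub>R (u' \<sigma> - u \<sigma>) + conv_up S (\<lambda>K. 1) u u \<sigma> - div_tau S \<mu> lam u \<sigma> + grad_p S \<delta>p' \<sigma> = 0)"

definition CFL ::
  "'d::finite staggered \<Rightarrow> real \<Rightarrow> real \<Rightarrow> real \<Rightarrow> 'd cellfun \<Rightarrow> 'd facefun \<Rightarrow> bool" where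
  "CFL S \<mu> lam \<delta>t \<rho> u \<longleftrightarrow> (\<forall>\<sigma>\<in>int_faces S.
     \<delta>t \<le> 4 * dual_density S \<rho> \<sigma> * vol (diam S \<sigma>) /
       (2 * (\<Sum>K\<in>cells_of S \<sigma>. \<Sum>\<sigma>'\<in>dual_nbrs K \<sigma>. - min (dual_flux S \<rho> u K \<sigma> \<sigma>') 0)
        + spec_radius (int_faces S \<times> UNIV) (visc_matrix S \<mu> lam)))"

definition data_assumption ::
  "(real^'d) set \<Rightarrow> (nat \<Rightarrow> real) \<Rightarrow> (nat \<Rightarrow> real^'d \<Rightarrow> real) \<Rightarrow> (nat \<Rightarrow> real^'d \<Rightarrow> real^'d) \<Rightarrow> bool" where
  "data_assumption \<Omega> \<epsilon> \<rho>0 u0 \<longleftrightarrow>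
     (\<forall>m. (AE x in lebesgue_on \<Omega>. \<rho>0 m x > 0) \<and> \<rho>0 m \<in> borel_measurable (lebesgue_on \<Omega>) \<and>
        linf_norm \<Omega> (\<rho>0 m) < \<infinity> \<and> (\<forall>i. (\<lambda>x. u0 m x $ i) \<in> H10 \<Omega>)) \<and>
     (\<exists>C::real. \<forall>m. ereal (h1_norm \<Omega> (u0 m)) + ereal (1 / \<epsilon> m * l2_norm \<Omega> (weak_div \<Omega> (u0 m)))
        + ereal (1 / \<epsilon> m) * linf_norm \<Omega> (\<lambda>x. \<rho>0 m x - 1) \<le> ereal C) \<and>
     (\<exists>u00\<in>L2 \<Omega>. (\<lambda>m. l2_norm \<Omega> (\<lambda>x. u0 m x - u00 x)) \<longlonglongrightarrow> 0)"

section \<open>Norms of discrete functions\<close>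

definition cell_mean :: "'d::finite staggered \<Rightarrow> 'd cellfun \<Rightarrow> real" where
  "cell_mean S q = (1 / vol (region S)) * (\<Sum>K\<in>cells S. vol K * q K)"

definition delta_p :: "'d::finite staggered \<Rightarrow> real \<Rightarrow> real \<Rightarrow> 'd cellfun \<Rightarrow> 'd cellfun" where
  "delta_p S \<gamma> \<epsilon> \<rho> K = (\<rho> K powr \<gamma> - cell_mean S (\<lambda>L. \<rho> L powr \<gamma>)) / \<epsilon>\<^sup>2"

definition cellwise :: "'d::finite staggered \<Rightarrow> 'd cellfun \<Rightarrow> real^'d \<Rightarrow> real" where
  "cellwise S q x = (\<Sum>K\<in>cells S. q K * indicator (interior K) x)"

definition linf_lq_norm :: "'d::finite staggered \<Rightarrow> int \<Rightarrow> real \<Rightarrow> (int \<Rightarrow> real^'d \<Rightarrow> real) \<Rightarrow> real" where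
  "linf_lq_norm S N q f = Max ((\<lambda>n. lq_norm (region S) q (f n)) ` {0..N})"

text \<open>\<open>\<nu>\<close> is a norm on the space of families indexed by \<open>I\<close>, such a family being given by any
  function which coincides with it on \<open>I\<close>.\<close>

definition discrete_norm :: "'i set \<Rightarrow> (('i \<Rightarrow> 'b::real_vector) \<Rightarrow> real) \<Rightarrow> bool" where
  "discrete_norm I \<nu> \<longleftrightarrow>
     (\<forall>f. \<nu> f = 0 \<longleftrightarrow> (\<forall>i\<in>I. f i = 0)) \<and>
     (\<forall>c f. \<nu> (\<lambda>i. c *\<^sub>R f i) = \<bar>c\<bar> * \<nu> f) \<and>
     (\<forall>f g. \<nu> (\<lambda>i. f i + g i) \<le> \<nu> f + \<nu> g)"

end

(* Testing the momentum balance with the velocity times the upwind density makes the pressure work equal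
   to the mass flux tested with the pressure. Since (p - 1)(rho - 1) >= (rho - 1)^2 for p = rho^gamma, one
   step started from a density within O(eps) of 1 and bounded velocities ends with a density within O(eps)
   of 1 and a bounded velocity. On the mesh, the pair (u, p), p of zero mean, is controlled linearly by the
   residuals u + dt grad p and div u, because the mesh is connected. The residuals of the scheme converge
   as eps tends to 0, so (u, delta p) is Cauchy, and the same estimate gives uniqueness for the limit
   scheme. For the initial step, face means converge by the trace inequality, and the divergence theorem
   on each cell turns ||div u0|| = O(eps) into a vanishing discrete divergence, whence rho^{-1} tends to 1. *)

theory Submission
  imports Defs "HOL-Probability.Sinc_Integral"
begin

section \<open>Full-dimensional polytopes: facet normals, half-space representation, local shape at
  a facet\<close>

section \<open>Convex polytopes and their facets\<close>

text \<open>Mesh and time step are fixed, so constants may depend on them and on the time level, and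
  the limit is taken by induction on \<open>n\<close>. What is carried along is the positivity of
  the density at level \<open>n\<close>, its distance O(\<epsilon>) to 1, the limit 1 of the density
  at level \<open>n - 1\<close>, and the convergence of the velocity at level \<open>n\<close>: mere
  boundedness would not give limits to the explicit terms of the next momentum balance. No
  subsequence is ever extracted. The obstacle is that a density within O(\<epsilon>) of 1 only makes
  \<open>delta_p\<close> of order 1/\<epsilon>. The rescaled pressure is therefore never estimated
  from the density; it is recovered together with the velocity from the two residuals. The base case
  carries most of the analysis. The initial velocities are bounded in H1 but converge only in L2, so
  the trace inequality must have the form of a product of the L2 norms of the function and of its
  gradient. Since \<open>surf\<close> is defined by projecting a cylinder of unit height, that
  inequality and the divergence theorem both come from one Fubini formula along the normal of a
  hyperplane.\<close>

lemma inner_orthogonal_unit: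
  fixes n n' :: "'a::euclidean_space"
  assumes n: "norm n = 1" and orth: "\<And>w. n \<bullet> w = 0 \<Longrightarrow> n' \<bullet> w = 0"
  shows "n' = (n' \<bullet> n) *\<^sub>R n"
proof -
  have nn: "n \<bullet> n = 1" using n by (simp add: norm_eq_1)
  let ?w = "n' - (n' \<bullet> n) *\<^sub>R n"
  have 1: "n \<bullet> ?w = 0" using nn by (simp add: inner_diff_right inner_commute)
  then have "n' \<bullet> ?w = 0" by (rule orth)
  then have "?w \<bullet> ?w = 0" using 1 by (simp add: inner_diff_left)
  then show ?thesis by simp
qed

lemma inner_unit_eq_one:
  fixes n n' :: "'a::euclidean_space"
  assumes n: "norm n = 1" and n': "norm n' = 1" and eq: "n' = k *\<^sub>R n"
  shows "n' = n \<or> n' = - n"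
proof -
  have "\<bar>k\<bar> = 1" using n n' eq by simp
  then show ?thesis using eq by (auto simp: abs_if split: if_splits)
qed

text \<open>The level of the supporting hyperplane: the normal is constant on a facet, so any of its
  points gives the same value.\<close>

definition facet_offset :: "(real^'d) set \<Rightarrow> (real^'d) set \<Rightarrow> real" where
  "facet_offset K \<sigma> = outward_normal K \<sigma> \<bullet> (SOME y. y \<in> \<sigma>)"

text \<open>Simplices and \<open>Q_1\<close> cells share these two properties, which suffice for all
  facts on facets, normals and boundary integrals.\<close>

locale convex_body =
  fixes K :: "(real^'d::finite) set"
  assumes polytope: "polytope K" and interior: "interior K \<noteq> {}"
begin

lemma compact: "compact K" and convex: "convex K" and polyhedron: "polyhedron K" and closed: "closed K"
  using polytope by (auto simp: polytope_imp_compact polytope_imp_convex polytope_imp_polyhedron polytope_imp_closed)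

lemma aff: "affine hull K = UNIV"
  using interior affine_hull_nonempty_interior by blast

lemma finite_facets: "finite (facets K)"
  unfolding facets_def by (rule finite_polytope_facets[OF polytope])

lemma closure_interior: "closure (interior K) = K"
  using closed convex interior convex_closure_interior by fastforce

lemma vol_pos: "vol K > 0"
proof -
  have "\<not> negligible K" using interior negligible_convex_interior[OF convex] by simp
  then have "vol K \<noteq> 0" using lmeasurable_compact[OF compact] by (simp add: negligible_iff_measure)
  then show ?thesis using measure_nonneg[of lebesgue K] by linarith
qed

text \<open>\<open>outward_normal\<close> is a definite description, and its uniqueness is settled
  here. The affine hull of a facet is a whole hyperplane, which fixes a unit normal up to sign; the
  wrong sign would squeeze \<open>K\<close> into that hyperplane, against its nonempty
  interior.\<close>

lemma outward_normal_props:
  "\<exists>n c. norm n = 1 \<and> K \<subseteq> {x. n \<bullet> x \<le> c} \<and> \<sigma> = K \<inter> {x. n \<bullet> x = c} \<and> affine hull \<sigma> = {x. n \<bullet> x = c} \<and>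
     outward_normal K \<sigma> = n \<and> facet_offset K \<sigma> = c \<and> \<sigma> \<noteq> {}"
  if "\<sigma> \<in> facets K"
proof -
  have fo: "\<sigma> facet_of K" using that by (simp add: facets_def)
  obtain a b where a: "a \<noteq> 0" "K \<subseteq> {x. a \<bullet> x \<le> b}" "\<sigma> = K \<inter> {x. a \<bullet> x = b}"
    using facet_of_polyhedron[OF polyhedron fo] by metis
  define n c where "n = a /\<^sub>R norm a" and "c = b / norm a"
  have n: "norm n = 1" using a by (simp add: n_def)
  have le: "n \<bullet> x \<le> c \<longleftrightarrow> a \<bullet> x \<le> b" and eq: "n \<bullet> x = c \<longleftrightarrow> a \<bullet> x = b" for x
    using a(1) by (auto simp: n_def c_def field_simps)
  have K: "K \<subseteq> {x. n \<bullet> x \<le> c}" and s: "\<sigma> = K \<inter> {x. n \<bullet> x = c}" using a le eq by auto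
  have ne: "\<sigma> \<noteq> {}" using fo by (auto simp: facet_of_def)
  have "aff_dim \<sigma> = int CARD('d) - 1"
    using fo aff aff_dim_affine_hull[of K] by (simp add: facet_of_def)
  then have ad: "aff_dim (affine hull \<sigma>) = aff_dim {x. n \<bullet> x = c}"
    using n by (subst aff_dim_hyperplane) auto
  have sub: "affine hull \<sigma> \<subseteq> {x. n \<bullet> x = c}"
    by (rule hull_minimal) (use s in \<open>auto simp: affine_hyperplane\<close>)
  have ah: "affine hull \<sigma> = {x. n \<bullet> x = c}"
    by (rule affine_dim_equal[OF affine_affine_hull affine_hyperplane _ sub ad]) (simp add: ne)
  have un: "n' = n" if n': "norm n' = 1 \<and> (\<exists>c. (\<forall>x\<in>K. n' \<bullet> x \<le> c) \<and> (\<forall>x\<in>\<sigma>. n' \<bullet> x = c))" for n'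
  proof -
    obtain c' where c': "\<forall>x\<in>K. n' \<bullet> x \<le> c'" "\<forall>x\<in>\<sigma>. n' \<bullet> x = c'" using n' by blast
    have sub': "{x. n \<bullet> x = c} \<subseteq> {x. n' \<bullet> x = c'}"
      unfolding ah[symmetric] by (rule hull_minimal) (use c' in \<open>auto simp: affine_hyperplane\<close>)
    obtain y where y: "y \<in> \<sigma>" using ne by auto
    then have yn: "n \<bullet> y = c" using s by auto
    have "n' \<bullet> w = 0" if "n \<bullet> w = 0" for w
    proof -
      have "y + w \<in> {x. n \<bullet> x = c}" using yn that by (simp add: inner_add_right)
      then have "n' \<bullet> (y + w) = c'" using sub' by blast
      then show ?thesis using c' y by (simp add: inner_add_right)
    qed
    then have "n' = (n' \<bullet> n) *\<^sub>R n" by (rule inner_orthogonal_unit[OF n])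
    then consider "n' = n" | "n' = - n" using inner_unit_eq_one n n' by blast
    then show ?thesis
    proof cases
      case 2
      then have "c' = - c" using c' y yn by auto
      have "n \<bullet> x = c" if "x \<in> K" for x
      proof -
        have "n' \<bullet> x \<le> c'" "n \<bullet> x \<le> c" using c'(1) K that by auto
        then show ?thesis using 2 \<open>c' = - c\<close> by simp
      qed
      then have "K \<subseteq> {x. n \<bullet> x = c}" by blast
      then have "interior K \<subseteq> interior {x. n \<bullet> x = c}" by (rule interior_mono)
      moreover have "interior {x. n \<bullet> x = c} = {}" using n by (subst interior_hyperplane) auto
      ultimately show ?thesis using interior by simp
    qed
  qed
  have on: "outward_normal K \<sigma> = n"
    unfolding outward_normal_def
  proof (rule the_equality)
    have "\<forall>x\<in>K. n \<bullet> x \<le> c" "\<forall>x\<in>\<sigma>. n \<bullet> x = c" using K s by blast+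
    then show "norm n = 1 \<and> (\<exists>c. (\<forall>x\<in>K. n \<bullet> x \<le> c) \<and> (\<forall>x\<in>\<sigma>. n \<bullet> x = c))" using n by blast
  qed (rule un)
  have "(SOME y. y \<in> \<sigma>) \<in> \<sigma>" using ne by (simp add: some_in_eq)
  then have "facet_offset K \<sigma> = c" unfolding facet_offset_def on using s by blast
  then show ?thesis using n K s ah on ne by blast
qed

lemma norm_normal: "\<sigma> \<in> facets K \<Longrightarrow> norm (outward_normal K \<sigma>) = 1"
  and normal_le: "\<sigma> \<in> facets K \<Longrightarrow> x \<in> K \<Longrightarrow> outward_normal K \<sigma> \<bullet> x \<le> facet_offset K \<sigma>"
  and facet_eq: "\<sigma> \<in> facets K \<Longrightarrow> \<sigma> = K \<inter> {x. outward_normal K \<sigma> \<bullet> x = facet_offset K \<sigma>}"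
  and facet_aff: "\<sigma> \<in> facets K \<Longrightarrow> affine hull \<sigma> = {x. outward_normal K \<sigma> \<bullet> x = facet_offset K \<sigma>}"
  and facet_nonempty: "\<sigma> \<in> facets K \<Longrightarrow> \<sigma> \<noteq> {}"
  using outward_normal_props[of \<sigma>] by auto

lemma interior_less: "\<sigma> \<in> facets K \<Longrightarrow> x \<in> interior K \<Longrightarrow> outward_normal K \<sigma> \<bullet> x < facet_offset K \<sigma>"
proof -
  assume s: "\<sigma> \<in> facets K" and x: "x \<in> interior K"
  have "interior K \<subseteq> interior {x. outward_normal K \<sigma> \<bullet> x \<le> facet_offset K \<sigma>}"
    by (rule interior_mono) (use normal_le[OF s] in auto)
  moreover have "outward_normal K \<sigma> \<noteq> 0" using norm_normal[OF s] by auto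
  ultimately show ?thesis using x by auto
qed

text \<open>A segment from an interior point to a point outside \<open>K\<close> crosses the
  frontier on some facet. If the outer point satisfied the inequality of that facet, the crossing
  point would satisfy it strictly.\<close>

lemma eq_Inter_halfspaces: "K = {x. \<forall>\<sigma>\<in>facets K. outward_normal K \<sigma> \<bullet> x \<le> facet_offset K \<sigma>}"
proof
  show "K \<subseteq> {x. \<forall>\<sigma>\<in>facets K. outward_normal K \<sigma> \<bullet> x \<le> facet_offset K \<sigma>}" using normal_le by auto
  show "{x. \<forall>\<sigma>\<in>facets K. outward_normal K \<sigma> \<bullet> x \<le> facet_offset K \<sigma>} \<subseteq> K"
  proof (rule subsetI, rule ccontr)
    fix x assume x: "x \<in> {x. \<forall>\<sigma>\<in>facets K. outward_normal K \<sigma> \<bullet> x \<le> facet_offset K \<sigma>}" and xK: "x \<notin> K"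
    obtain y where y: "y \<in> interior K" using interior by auto
    have "closed_segment y x \<inter> frontier K \<noteq> {}"
      by (rule connected_Int_frontier) (use y xK interior_subset in auto)
    then obtain z where z: "z \<in> frontier K" "z \<in> closed_segment y x" by auto
    have zK: "z \<in> K" "z \<noteq> y" using z(1) closed y by (auto simp: frontier_def)
    have "z \<in> rel_frontier K" using z(1) rel_frontier_nonempty_interior[OF interior] by simp
    then obtain \<sigma> where s: "\<sigma> \<in> facets K" "z \<in> \<sigma>"
      unfolding rel_frontier_of_polyhedron[OF polyhedron] by (auto simp: facets_def)
    let ?n = "outward_normal K \<sigma>" and ?c = "facet_offset K \<sigma>"
    have nz: "?n \<bullet> z = ?c" using facet_eq[OF s(1)] s(2) by auto
    obtain t where t: "0 \<le> t" "t \<le> 1" "z = (1 - t) *\<^sub>R y + t *\<^sub>R x" using z(2) by (auto simp: in_segment)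
    have "t \<noteq> 1" using t(3) zK xK by auto
    then have "t < 1" using t by simp
    have "?n \<bullet> z = (1 - t) * (?n \<bullet> y) + t * (?n \<bullet> x)" by (simp add: t inner_add_right)
    also have "\<dots> < (1 - t) * ?c + t * ?c"
      using interior_less[OF s(1) y] x s(1) t \<open>t < 1\<close> by (intro add_less_le_mono mult_strict_left_mono mult_left_mono) auto
    also have "\<dots> = ?c" by (simp add: algebra_simps)
    finally show False using nz by simp
  qed
qed

text \<open>Equal normals at a common point would give equal offsets, hence equal facets; opposite
  normals would leave no room for an interior point. This settles the degenerate case when the
  hyperplane of one facet is cut by those of the others.\<close>

lemma parallel_facets:
  assumes s: "\<sigma> \<in> facets K" and t: "\<tau> \<in> facets K" and ne: "\<sigma> \<noteq> \<tau>"
    and par: "outward_normal K \<tau> = k *\<^sub>R outward_normal K \<sigma>" and y: "outward_normal K \<sigma> \<bullet> y = facet_offset K \<sigma>"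
  shows "outward_normal K \<tau> \<bullet> y \<noteq> facet_offset K \<tau>"
proof
  assume y': "outward_normal K \<tau> \<bullet> y = facet_offset K \<tau>"
  consider "outward_normal K \<tau> = outward_normal K \<sigma>" | "outward_normal K \<tau> = - outward_normal K \<sigma>"
    using inner_unit_eq_one norm_normal s t par by metis
  then show False
  proof cases
    case 1
    then have "facet_offset K \<tau> = facet_offset K \<sigma>" using y y' by simp
    then show False using facet_eq[OF s] facet_eq[OF t] 1 ne by simp
  next
    case 2
    obtain x where x: "x \<in> interior K" using interior by auto
    have "outward_normal K \<sigma> \<bullet> x < facet_offset K \<sigma>" "outward_normal K \<tau> \<bullet> x < facet_offset K \<tau>"
      using interior_less s t x by auto
    then show False using y y' 2 by simp
  qed
qed

text \<open>Otherwise \<open>y\<close> lies in both facets, and a face meeting the relative interior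
  of \<sigma> contains \<sigma>; then \<sigma> would be a proper face of \<tau> of the same
  dimension.\<close>

lemma rel_interior_facet_less:
  assumes s: "\<sigma> \<in> facets K" and t: "\<tau> \<in> facets K" and ne: "\<sigma> \<noteq> \<tau>" and y: "y \<in> rel_interior \<sigma>"
  shows "outward_normal K \<tau> \<bullet> y < facet_offset K \<tau>"
proof (rule ccontr)
  assume nl: "\<not> outward_normal K \<tau> \<bullet> y < facet_offset K \<tau>"
  have ys: "y \<in> \<sigma>" using y rel_interior_subset by auto
  have yK: "y \<in> K" using ys facet_eq[OF s] by auto
  have "outward_normal K \<tau> \<bullet> y = facet_offset K \<tau>" using nl normal_le[OF t yK] by linarith
  then have "y \<in> \<tau>" using facet_eq[OF t] yK by blast
  have st: "\<sigma> face_of K" "\<tau> face_of K" "aff_dim \<sigma> = aff_dim \<tau>"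
    using s t by (auto simp: facets_def facet_of_def)
  have "\<sigma> \<subseteq> \<tau>"
    by (rule subset_of_face_of[OF st(2) face_of_imp_subset[OF st(1)]]) (use y \<open>y \<in> \<tau>\<close> in blast)
  then have "\<sigma> face_of \<tau>"
    using face_of_imp_subset[OF st(2)] face_of_subset[OF st(1)] by blast
  then show False using face_of_aff_dim_lt[of \<tau> \<sigma>] st(3) ne face_of_imp_convex[OF st(2)] by simp
qed

text \<open>At a relative interior point of \<sigma> all other facet inequalities are strict, hence
  persist on a ball where only the one of \<sigma> remains. This local picture decides how two cells
  can share a facet.\<close>

lemma facet_half_ball:
  assumes s: "\<sigma> \<in> facets K" and y: "y \<in> rel_interior \<sigma>"
  obtains r where "r > 0" "ball y r \<inter> {x. outward_normal K \<sigma> \<bullet> x \<le> facet_offset K \<sigma>} \<subseteq> K"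
proof -
  define U where "U = (\<Inter>\<tau>\<in>facets K - {\<sigma>}. {x. outward_normal K \<tau> \<bullet> x < facet_offset K \<tau>})"
  have "open U" unfolding U_def
    by (intro open_INT finite_Diff finite_facets ballI open_halfspace_lt)
  moreover have "y \<in> U" unfolding U_def using rel_interior_facet_less[OF s _ _ y] by auto
  ultimately obtain r where r: "r > 0" "ball y r \<subseteq> U" by (meson openE)
  have "x \<in> K" if "x \<in> ball y r" "outward_normal K \<sigma> \<bullet> x \<le> facet_offset K \<sigma>" for x
  proof -
    have "x \<in> U" using that r by auto
    then have "\<forall>\<tau>\<in>facets K. outward_normal K \<tau> \<bullet> x \<le> facet_offset K \<tau>"
      using that unfolding U_def by (auto intro: less_imp_le)
    then show ?thesis by (subst eq_Inter_halfspaces) simp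
  qed
  then have "ball y r \<inter> {x. outward_normal K \<sigma> \<bullet> x \<le> facet_offset K \<sigma>} \<subseteq> K" by blast
  then show ?thesis using that r(1) by blast
qed

lemma facet_half_ball_interior:
  assumes s: "\<sigma> \<in> facets K" and y: "y \<in> rel_interior \<sigma>"
  obtains r where "r > 0" "ball y r \<inter> {x. outward_normal K \<sigma> \<bullet> x \<le> facet_offset K \<sigma>} \<subseteq> K"
    "ball y r \<inter> {x. outward_normal K \<sigma> \<bullet> x < facet_offset K \<sigma>} \<subseteq> interior K"
proof -
  obtain r where r: "r > 0" "ball y r \<inter> {x. outward_normal K \<sigma> \<bullet> x \<le> facet_offset K \<sigma>} \<subseteq> K"
    using facet_half_ball[OF assms] .
  have "ball y r \<inter> {x. outward_normal K \<sigma> \<bullet> x < facet_offset K \<sigma>} \<subseteq> interior K"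
    proof (rule interior_maximal)
    show "ball y r \<inter> {x. outward_normal K \<sigma> \<bullet> x < facet_offset K \<sigma>} \<subseteq> K" using r(2) less_imp_le by blast
    show "open (ball y r \<inter> {x. outward_normal K \<sigma> \<bullet> x < facet_offset K \<sigma>})"
      by (intro open_Int open_ball open_halfspace_lt)
  qed
  then show ?thesis using that r by blast
qed

lemma facet_polytope: "\<sigma> \<in> facets K \<Longrightarrow> polytope \<sigma>"
  using polytope unfolding facets_def by (metis face_of_polytope_polytope facet_of_imp_face_of mem_Collect_eq)

lemma rel_interior_facet_nonempty: "\<sigma> \<in> facets K \<Longrightarrow> rel_interior \<sigma> \<noteq> {}"
  using facet_nonempty facet_polytope polytope_imp_convex rel_interior_eq_empty by blast

lemma aff_dim_facet: "\<sigma> \<in> facets K \<Longrightarrow> aff_dim \<sigma> = int CARD('d) - 1"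
  using aff aff_dim_affine_hull[of K] by (simp add: facets_def facet_of_def)

end

section \<open>Fubini's formula in the direction of a unit normal\<close>

section \<open>Slicing along a hyperplane\<close>

text \<open>For a unit vector \<open>n\<close>, the orthogonal projection on the hyperplane
  \<open>n \<bullet> x = c\<close>.\<close>

definition hproj :: "'a::euclidean_space \<Rightarrow> real \<Rightarrow> 'a \<Rightarrow> 'a" where
  "hproj n c x = x - (n \<bullet> x - c) *\<^sub>R n"

text \<open>Thickness one, as for the cylinder in \<open>surf\<close>: integrating over the slab a
  function of the projection alone is integrating over the hyperplane.\<close>

definition slab :: "'a::euclidean_space \<Rightarrow> real \<Rightarrow> 'a set" where
  "slab n c = {x. \<bar>n \<bullet> x - c\<bar> \<le> 1/2}"

lemma hproj_measurable [measurable]: "hproj n c \<in> borel_measurable borel"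
  unfolding hproj_def by measurable

lemma slice_map_measurable [measurable]:
  "(\<lambda>z::'a::euclidean_space \<times> real. hproj n c (fst z) - (d * snd z) *\<^sub>R n) \<in> borel_measurable borel"
  unfolding hproj_def by (intro borel_measurable_continuous_onI continuous_intros)

lemma slab_borel [measurable]: "slab n c \<in> sets borel"
  unfolding slab_def by measurable

lemma slab_fst_measurable [measurable]:
  "(\<lambda>z::'a::euclidean_space \<times> real. indicator (slab n c) (fst z) :: ennreal) \<in> borel_measurable borel"
  "(\<lambda>z::'a::euclidean_space \<times> real. indicator (slab n c) (fst z) :: real) \<in> borel_measurable borel"
  unfolding borel_prod[symmetric] by measurable

lemma inner_hproj: "norm n = 1 \<Longrightarrow> n \<bullet> hproj n c x = c"
  by (simp add: hproj_def inner_diff_right norm_eq_1)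

lemma closest_point_hyperplane:
  assumes n: "norm n = 1"
  shows "closest_point {x. n \<bullet> x = c} x = hproj n c x"
proof (rule closest_point_unique[symmetric])
  show "convex {x. n \<bullet> x = c}" "closed {x. n \<bullet> x = c}"
    by (auto simp: convex_hyperplane closed_hyperplane)
  show "hproj n c x \<in> {x. n \<bullet> x = c}" using n by (simp add: inner_hproj)
  show "\<forall>z\<in>{x. n \<bullet> x = c}. dist x (hproj n c x) \<le> dist x z"
  proof
    fix z assume z: "z \<in> {x. n \<bullet> x = c}"
    have "dist x (hproj n c x) = \<bar>n \<bullet> x - c\<bar>" using n by (simp add: hproj_def dist_norm)
    also have "\<dots> = \<bar>n \<bullet> (x - z)\<bar>" using z by (simp add: inner_diff_right)
    also have "\<dots> \<le> norm n * norm (x - z)" by (rule Cauchy_Schwarz_ineq2)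
    finally show "dist x (hproj n c x) \<le> dist x z" using n by (simp add: dist_norm)
  qed
qed

text \<open>The integral over the hyperplane is spread over the slab of unit thickness, so no
  coordinates are chosen. After a shift of the line parameter the inner integral runs over the
  normal line through \<open>x\<close>; exchanging the integrals and translating \<open>x\<close>
  leaves the length of that line inside the slab, which is 1. The factor \<open>d\<close> rescales
  the normal coordinate and later stretches a boundary layer of width \<open>d\<close> to unit
  width.\<close>

lemma nn_integral_slices:
  fixes F :: "'a::euclidean_space \<Rightarrow> ennreal"
  assumes n: "norm n = 1" and d: "d > 0" and [measurable]: "F \<in> borel_measurable borel"
  shows "(\<integral>\<^sup>+x. F x \<partial>lborel) =
    (\<integral>\<^sup>+x. indicator (slab n c) x * (ennreal d * (\<integral>\<^sup>+t. F (hproj n c x - (d * t) *\<^sub>R n) \<partial>lborel)) \<partial>lborel)"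
proof -
  have nn: "n \<bullet> n = 1" using n by (simp add: norm_eq_1)
  have shift: "ennreal d * (\<integral>\<^sup>+t. F (hproj n c x - (d * t) *\<^sub>R n) \<partial>lborel) = (\<integral>\<^sup>+t. F (x - t *\<^sub>R n) \<partial>lborel)" for x
    using d by (subst (2) nn_integral_real_affine[where c = d and t = "n \<bullet> x - c"])
      (auto simp: hproj_def algebra_simps)
  have ind: "(\<integral>\<^sup>+t. indicator (slab n c) (x + t *\<^sub>R n) \<partial>lborel) = 1" for x
  proof -
    have "(\<integral>\<^sup>+t. indicator (slab n c) (x + t *\<^sub>R n) \<partial>lborel)
        = (\<integral>\<^sup>+t. indicator {c - n \<bullet> x - 1/2 .. c - n \<bullet> x + 1/2} t \<partial>lborel)"
    proof (rule nn_integral_cong)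
      fix t :: real
      have "\<bar>n \<bullet> (x + t *\<^sub>R n) - c\<bar> \<le> 1/2 \<longleftrightarrow> c - n \<bullet> x - 1/2 \<le> t \<and> t \<le> c - n \<bullet> x + 1/2"
        unfolding abs_le_iff by (simp add: inner_add_right nn) linarith
      then show "indicator (slab n c) (x + t *\<^sub>R n) = (indicator {c - n \<bullet> x - 1/2 .. c - n \<bullet> x + 1/2} t :: ennreal)"
        by (simp add: slab_def indicator_def)
    qed
    then show ?thesis by simp
  qed
  have "(\<integral>\<^sup>+x. indicator (slab n c) x * (\<integral>\<^sup>+t. F (x - t *\<^sub>R n) \<partial>lborel) \<partial>lborel)
      = (\<integral>\<^sup>+x. \<integral>\<^sup>+t. indicator (slab n c) x * F (x - t *\<^sub>R n) \<partial>lborel \<partial>lborel)"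
    by (intro nn_integral_cong nn_integral_cmult[symmetric]) measurable
  also have "\<dots> = (\<integral>\<^sup>+t. \<integral>\<^sup>+x. indicator (slab n c) x * F (x - t *\<^sub>R n) \<partial>lborel \<partial>lborel)"
    by (rule lborel_pair.Fubini'[where f = "\<lambda>x t. indicator (slab n c) x * F (x - t *\<^sub>R n)", symmetric])
      measurable
  also have "\<dots> = (\<integral>\<^sup>+t. \<integral>\<^sup>+x. indicator (slab n c) (x + t *\<^sub>R n) * F x \<partial>lborel \<partial>lborel)"
  proof (rule nn_integral_cong)
    fix t :: real
    have "(\<integral>\<^sup>+x. indicator (slab n c) x * F (x - t *\<^sub>R n) \<partial>lborel)
        = (\<integral>\<^sup>+x. indicator (slab n c) x * F (x - t *\<^sub>R n) \<partial>distr lborel borel ((+) (t *\<^sub>R n)))"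
      by (simp only: lborel_distr_plus)
    also have "\<dots> = (\<integral>\<^sup>+x. indicator (slab n c) (x + t *\<^sub>R n) * F x \<partial>lborel)"
      by (subst nn_integral_distr) (auto simp: algebra_simps)
    finally show "(\<integral>\<^sup>+x. indicator (slab n c) x * F (x - t *\<^sub>R n) \<partial>lborel)
      = (\<integral>\<^sup>+x. indicator (slab n c) (x + t *\<^sub>R n) * F x \<partial>lborel)" .
  qed
  also have "\<dots> = (\<integral>\<^sup>+x. \<integral>\<^sup>+t. indicator (slab n c) (x + t *\<^sub>R n) * F x \<partial>lborel \<partial>lborel)"
    by (rule lborel_pair.Fubini'[where f = "\<lambda>x t. indicator (slab n c) (x + t *\<^sub>R n) * F x"])
      measurable
  also have "\<dots> = (\<integral>\<^sup>+x. F x \<partial>lborel)"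
  proof (rule nn_integral_cong)
    fix x
    have "(\<integral>\<^sup>+t. indicator (slab n c) (x + t *\<^sub>R n) * F x \<partial>lborel) =
        (\<integral>\<^sup>+t. indicator (slab n c) (x + t *\<^sub>R n) \<partial>lborel) * F x"
      by (rule nn_integral_multc) measurable
    then show "(\<integral>\<^sup>+t. indicator (slab n c) (x + t *\<^sub>R n) * F x \<partial>lborel) = F x"
      by (simp add: ind)
  qed
  finally show ?thesis by (simp add: shift)
qed

definition slice_measure :: "'a::euclidean_space \<Rightarrow> real \<Rightarrow> ('a \<times> real) measure" where
  "slice_measure n c = density lborel (\<lambda>z. ennreal (indicator (slab n c) (fst z)))"

text \<open>As an identity of measures the formula transports to signed integrands, integrability
  included.\<close>

lemma distr_slices:
  assumes n: "norm n = 1" and d: "d > 0"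
  shows "lborel = density (distr (slice_measure n c) borel (\<lambda>z. hproj n c (fst z) - (d * snd z) *\<^sub>R n)) (\<lambda>_. ennreal d)"
    (is "_ = density (distr _ _ ?\<Phi>) _")
proof (rule measure_eqI)
  show "sets lborel = sets (density (distr (slice_measure n c) borel ?\<Phi>) (\<lambda>_. ennreal d))" by simp
  fix A :: "'a set" assume A: "A \<in> sets lborel"
  then have [measurable]: "A \<in> sets borel" by simp
  have [measurable]: "?\<Phi> \<in> borel_measurable (slice_measure n c)"
    unfolding slice_measure_def by simp
  have "emeasure (density (distr (slice_measure n c) borel ?\<Phi>) (\<lambda>_. ennreal d)) A
     = (\<integral>\<^sup>+z. ennreal d * indicator A (?\<Phi> z) \<partial>slice_measure n c)"
    by (subst emeasure_density) (auto simp: nn_integral_distr)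
  also have "\<dots> = (\<integral>\<^sup>+z. indicator (slab n c) (fst z) * (ennreal d * indicator A (?\<Phi> z)) \<partial>lborel)"
    unfolding slice_measure_def by (subst nn_integral_density) (auto simp: ennreal_indicator)
  also have "\<dots> = (\<integral>\<^sup>+x. \<integral>\<^sup>+t. indicator (slab n c) x * (ennreal d * indicator A (hproj n c x - (d * t) *\<^sub>R n)) \<partial>lborel \<partial>lborel)"
    unfolding lborel_prod[symmetric] by (subst lborel.nn_integral_fst[symmetric]) (unfold lborel_prod, auto)
  also have "\<dots> = (\<integral>\<^sup>+x. indicator A x \<partial>lborel)"
    by (subst nn_integral_slices[OF n d, of "indicator A" c]) (auto simp: nn_integral_cmult)
  finally show "emeasure lborel A = emeasure (density (distr (slice_measure n c) borel ?\<Phi>) (\<lambda>_. ennreal d)) A"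
    by simp
qed

lemma slice_integral:
  fixes F :: "'a::euclidean_space \<Rightarrow> real"
  assumes n: "norm n = 1" and d: "d > 0" and F: "integrable lborel F"
  shows "integrable lborel (\<lambda>z. indicator (slab n c) (fst z) * (d * F (hproj n c (fst z) - (d * snd z) *\<^sub>R n)))"
    and "(LINT x|lborel. F x) = (LINT z|lborel. indicator (slab n c) (fst z) * (d * F (hproj n c (fst z) - (d * snd z) *\<^sub>R n)))"
proof -
  let ?\<Phi> = "\<lambda>z. hproj n c (fst z) - (d * snd z) *\<^sub>R n"
  have [measurable]: "F \<in> borel_measurable borel" using F borel_measurable_integrable by force
  have [measurable]: "?\<Phi> \<in> borel_measurable (slice_measure n c)"
    unfolding slice_measure_def by simp
  let ?D = "density (distr (slice_measure n c) borel ?\<Phi>) (\<lambda>_. ennreal d)"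
  have "integrable ?D F" using F distr_slices[OF n d, of c] by simp
  then have 1: "integrable (slice_measure n c) (\<lambda>z. d * F (?\<Phi> z))"
    using d by (subst (asm) integrable_density) (auto simp: integrable_distr_eq)
  then show "integrable lborel (\<lambda>z. indicator (slab n c) (fst z) * (d * F (?\<Phi> z)))"
    unfolding slice_measure_def by (subst (asm) integrable_density) auto
  have "(LINT x|lborel. F x) = (LINT x|?D. F x)" using distr_slices[OF n d, of c] by simp
  also have "\<dots> = (LINT z|slice_measure n c. d * F (?\<Phi> z))"
    using d by (subst integral_density) (auto simp: integral_distr)
  also have "\<dots> = (LINT z|lborel. indicator (slab n c) (fst z) * (d * F (?\<Phi> z)))"
    unfolding slice_measure_def by (subst integral_density) auto
  finally show "(LINT x|lborel. F x) = (LINT z|lborel. indicator (slab n c) (fst z) * (d * F (?\<Phi> z)))" .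
qed

section \<open>One-dimensional integration along normal lines: trace inequality and vanishing
  integrals of derivatives\<close>

section \<open>Compactly supported differentiable functions\<close>

text \<open>Compactly supported C1 functions on the whole space. Unlike test functions they are tied
  to no domain, and they are closed under differences.\<close>

definition c1c :: "(real^'d::finite \<Rightarrow> real) \<Rightarrow> bool" where
  "c1c \<phi> \<longleftrightarrow> (\<forall>x. \<phi> differentiable at x) \<and> (\<forall>i. continuous_on UNIV (pd i \<phi>)) \<and> bounded {x. \<phi> x \<noteq> 0}"

lemma c1c_continuous: "c1c \<phi> \<Longrightarrow> continuous_on UNIV \<phi>"
  by (auto simp: c1c_def intro!: differentiable_imp_continuous_within continuous_at_imp_continuous_on)

lemma test_function_c1c:
  assumes "test_function \<Omega> \<phi>"
  shows "c1c \<phi>"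
  unfolding c1c_def
proof (intro conjI allI)
  have sm: "smooth \<phi>" and cpt: "compact (closure {x. \<phi> x \<noteq> 0})"
    using assms by (auto simp: test_function_def)
  show "\<phi> differentiable at x" for x
    using sm[unfolded smooth_def, rule_format, of "[]"] by (simp add: differentiable_on_def)
  show "continuous_on UNIV (pd i \<phi>)" for i
    using sm[unfolded smooth_def, rule_format, of "[i]"] by (simp add: differentiable_imp_continuous_on)
  show "bounded {x. \<phi> x \<noteq> 0}" using cpt compact_imp_bounded bounded_closure bounded_subset closure_subset by metis
qed

lemma grad_inner_axis: "grad f x \<bullet> axis i 1 = pd i f x"
  by (simp add: grad_def inner_axis)

lemma has_derivative_grad:
  fixes f :: "real^'d::finite \<Rightarrow> real"
  assumes "f differentiable at x"
  shows "(f has_derivative (\<lambda>h. grad f x \<bullet> h)) (at x)"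
proof -
  have D: "(f has_derivative frechet_derivative f (at x)) (at x)"
    using assms frechet_derivative_works by blast
  then have lin: "linear (frechet_derivative f (at x))" by (rule has_derivative_linear)
  have "frechet_derivative f (at x) h = grad f x \<bullet> h" for h
  proof -
    have "frechet_derivative f (at x) h = frechet_derivative f (at x) (\<Sum>i\<in>UNIV. (h $ i) *\<^sub>R axis i 1)"
      by (simp only: basis_expansion scalar_mult_eq_scaleR[symmetric])
    also have "\<dots> = grad f x \<bullet> h"
      by (simp add: linear_sum[OF lin] linear_cmul[OF lin] grad_def pd_def inner_vec_def mult.commute)
    finally show ?thesis .
  qed
  then show ?thesis using D by (metis (no_types, lifting) ext)
qed

lemma grad_eqI:
  fixes f :: "real^'d::finite \<Rightarrow> real"
  assumes "(f has_derivative (\<lambda>h. g \<bullet> h)) (at x)"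
  shows "grad f x = g"
proof -
  have "frechet_derivative f (at x) = (\<lambda>h. g \<bullet> h)" using frechet_derivative_at[OF assms] by simp
  then show ?thesis by (simp add: grad_def pd_def inner_axis vec_eq_iff)
qed

lemma c1c_grad_continuous: "c1c \<phi> \<Longrightarrow> continuous_on UNIV (grad \<phi>)"
  unfolding c1c_def grad_def by (intro continuous_on_vec_lambda) auto

lemma continuous_bounded_support_integrable:
  fixes f :: "'a::euclidean_space \<Rightarrow> real"
  assumes c: "continuous_on UNIV f" and b: "bounded {x. f x \<noteq> 0}"
  shows "integrable lborel f"
proof -
  obtain R where R: "{x. f x \<noteq> 0} \<subseteq> cball 0 R" using b unfolding bounded_iff by (auto simp: subset_iff)
  have "integrable lborel (\<lambda>x. indicator (cball 0 R) x *\<^sub>R f x)"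
    by (rule borel_integrable_compact) (auto intro: continuous_on_subset[OF c])
  moreover have "(\<lambda>x. indicator (cball 0 R) x *\<^sub>R f x) = f" using R by (auto simp: indicator_def fun_eq_iff)
  ultimately show ?thesis by simp
qed

lemma bounded_support_derivative:
  fixes f :: "'a::euclidean_space \<Rightarrow> real"
  assumes D: "\<And>x. (f has_derivative D x) (at x)" and b: "bounded {x. f x \<noteq> 0}"
  shows "{x. D x v \<noteq> 0} \<subseteq> closure {x. f x \<noteq> 0}" "bounded {x. D x v \<noteq> 0}"
proof -
  show sub: "{x. D x v \<noteq> 0} \<subseteq> closure {x. f x \<noteq> 0}"
  proof (rule subsetI, rule ccontr)
    fix x assume x: "x \<in> {x. D x v \<noteq> 0}" and nx: "x \<notin> closure {x. f x \<noteq> 0}"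
    have "((\<lambda>x. 0) has_derivative D x) (at x)"
      by (rule has_derivative_transform_within_open[OF D, of "- closure {x. f x \<noteq> 0}"])
        (use nx closure_subset[of "{x. f x \<noteq> 0}"] in auto)
    then have "D x = (\<lambda>_. 0)" using has_derivative_unique[OF _ has_derivative_const] by blast
    then show False using x by simp
  qed
  show "bounded {x. D x v \<noteq> 0}" using bounded_subset[OF bounded_closure[OF b] sub] .
qed

lemma c1c_grad_support:
  assumes "c1c \<phi>"
  shows "{x. grad \<phi> x \<noteq> 0} \<subseteq> closure {x. \<phi> x \<noteq> 0}"
proof
  fix x assume "x \<in> {x. grad \<phi> x \<noteq> 0}"
  then obtain i where "grad \<phi> x $ i \<noteq> 0" by (auto simp: vec_eq_iff)
  then have "x \<in> {x. grad \<phi> x \<bullet> axis i 1 \<noteq> 0}" by (simp add: inner_axis)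
  then show "x \<in> closure {x. \<phi> x \<noteq> 0}"
    using bounded_support_derivative(1)[of \<phi> "\<lambda>x h. grad \<phi> x \<bullet> h" "axis i 1"] assms has_derivative_grad
    by (auto simp: c1c_def)
qed

text \<open>The square of \<phi> vanishes far out on the ray from \<open>y\<close> in direction
  \<open>- n\<close>, so by the fundamental theorem of calculus its value at \<open>y\<close> is
  minus the integral of its derivative along the ray. The bound uses the whole line because that is
  what slicing integrates.\<close>

lemma trace_pointwise:
  assumes \<phi>: "c1c \<phi>" and n: "norm n = 1"
  shows "ennreal ((\<phi> y)\<^sup>2) \<le> (\<integral>\<^sup>+t. ennreal (2 * \<bar>\<phi> (y - t *\<^sub>R n)\<bar> * norm (grad \<phi> (y - t *\<^sub>R n))) \<partial>lborel)"
proof -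
  have diff: "\<And>x. (\<phi> has_derivative (\<lambda>h. grad \<phi> x \<bullet> h)) (at x)"
    using \<phi> has_derivative_grad by (auto simp: c1c_def)
  obtain B where B: "\<And>x. \<phi> x \<noteq> 0 \<Longrightarrow> norm x \<le> B"
    using \<phi> unfolding c1c_def bounded_iff by auto
  \<comment> \<open>Large enough for \<open>y - R *\<^sub>R n\<close> to leave the ball of radius
    \<open>B\<close>, which contains the support.\<close>
  define R where "R = \<bar>B\<bar> + norm y + 1"
  have "R > 0" unfolding R_def using norm_ge_zero[of y] by linarith
  have "norm (R *\<^sub>R n) \<le> norm (y - R *\<^sub>R n) + norm y"
    by (metis norm_triangle_sub norm_minus_commute add.commute)
  then have "norm (y - R *\<^sub>R n) > B" using n \<open>R > 0\<close> unfolding R_def by auto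
  then have z: "\<phi> (y - R *\<^sub>R n) = 0" using B by force
  let ?F = "\<lambda>t. (\<phi> (y - t *\<^sub>R n))\<^sup>2"
  let ?f = "\<lambda>t. - (2 * \<phi> (y - t *\<^sub>R n) * (grad \<phi> (y - t *\<^sub>R n) \<bullet> n))"
  have der: "(?F has_vector_derivative ?f t) (at t within {0..R})" for t
  proof -
    have "((\<lambda>t. y - t *\<^sub>R n) has_derivative (\<lambda>h. - (h *\<^sub>R n))) (at t within {0..R})"
      by (auto intro!: derivative_eq_intros)
    then have "((\<lambda>t. \<phi> (y - t *\<^sub>R n)) has_derivative (\<lambda>h. grad \<phi> (y - t *\<^sub>R n) \<bullet> (- (h *\<^sub>R n)))) (at t within {0..R})"
      by (rule has_derivative_compose) (rule diff)
    then have "(?F has_derivative (\<lambda>h. 2 * (grad \<phi> (y - t *\<^sub>R n) \<bullet> (- (h *\<^sub>R n))) * \<phi> (y - t *\<^sub>R n))) (at t within {0..R})"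
      by (rule has_derivative_eq_rhs[OF has_derivative_power[where n = 2]]) (simp add: fun_eq_iff)
    then show ?thesis unfolding has_vector_derivative_def
      by (rule has_derivative_eq_rhs) (auto simp: algebra_simps)
  qed
  have cont: "continuous_on {0..R} ?f"
    by (intro continuous_intros continuous_on_compose2[OF c1c_continuous[OF \<phi>]]
        continuous_on_compose2[OF c1c_grad_continuous[OF \<phi>]]) auto
  have eq: "(LINT t|lborel. indicator {0..R} t *\<^sub>R ?f t) = ?F R - ?F 0"
    by (rule integral_FTC_Icc[OF _ der cont]) (use \<open>R > 0\<close> in auto)
  have int: "integrable lborel (\<lambda>t. indicator {0..R} t *\<^sub>R ?f t)"
    by (rule borel_integrable_compact) (use cont in auto)
  have "(\<phi> y)\<^sup>2 = norm (LINT t|lborel. indicator {0..R} t *\<^sub>R ?f t)"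
    unfolding eq using z by simp
  then have "ennreal ((\<phi> y)\<^sup>2) \<le> (\<integral>\<^sup>+t. norm (indicator {0..R} t *\<^sub>R ?f t) \<partial>lborel)"
    using integral_norm_bound_ennreal[OF int] by metis
  also have "\<dots> \<le> (\<integral>\<^sup>+t. ennreal (2 * \<bar>\<phi> (y - t *\<^sub>R n)\<bar> * norm (grad \<phi> (y - t *\<^sub>R n))) \<partial>lborel)"
  proof (intro nn_integral_mono ennreal_leI)
    fix t
    have "\<bar>grad \<phi> (y - t *\<^sub>R n) \<bullet> n\<bar> \<le> norm (grad \<phi> (y - t *\<^sub>R n))"
      using Cauchy_Schwarz_ineq2[of "grad \<phi> (y - t *\<^sub>R n)" n] n by simp
    then show "norm (indicator {0..R} t *\<^sub>R ?f t) \<le> 2 * \<bar>\<phi> (y - t *\<^sub>R n)\<bar> * norm (grad \<phi> (y - t *\<^sub>R n))"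
      by (auto simp: indicator_def abs_mult mult_left_mono)
  qed
  finally show ?thesis .
qed

lemma Cauchy_Schwarz_integral:
  fixes f g :: "'a \<Rightarrow> real"
  assumes [measurable]: "f \<in> borel_measurable M" "g \<in> borel_measurable M"
    and f: "integrable M (\<lambda>x. (f x)\<^sup>2)" and g: "integrable M (\<lambda>x. (g x)\<^sup>2)"
  shows "integrable M (\<lambda>x. f x * g x)"
    and "\<bar>LINT x|M. f x * g x\<bar> \<le> sqrt (LINT x|M. (f x)\<^sup>2) * sqrt (LINT x|M. (g x)\<^sup>2)"
proof -
  show int: "integrable M (\<lambda>x. f x * g x)"
  proof (rule Bochner_Integration.integrable_bound)
    show "integrable M (\<lambda>x. (f x)\<^sup>2 + (g x)\<^sup>2)" using f g by simp
    show "AE x in M. norm (f x * g x) \<le> norm ((f x)\<^sup>2 + (g x)\<^sup>2)"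
    proof (rule AE_I2)
      fix x
      have "2 * \<bar>f x\<bar> * \<bar>g x\<bar> \<le> \<bar>f x\<bar>\<^sup>2 + \<bar>g x\<bar>\<^sup>2" by (rule sum_squares_bound)
      moreover have "0 \<le> \<bar>f x\<bar> * \<bar>g x\<bar>" by simp
      ultimately have "\<bar>f x\<bar> * \<bar>g x\<bar> \<le> (f x)\<^sup>2 + (g x)\<^sup>2" by (simp only: power2_abs)
      then show "norm (f x * g x) \<le> norm ((f x)\<^sup>2 + (g x)\<^sup>2)" by (simp add: abs_mult)
    qed
  qed simp
  let ?A = "LINT x|M. (f x)\<^sup>2" and ?B = "LINT x|M. (g x)\<^sup>2" and ?I = "LINT x|M. f x * g x"
  have AB: "0 \<le> ?A" "0 \<le> ?B" by simp_all
  have "ennreal \<bar>?I\<bar> \<le> (\<integral>\<^sup>+x. ennreal \<bar>f x\<bar> * ennreal \<bar>g x\<bar> \<partial>M)"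
    using integral_norm_bound_ennreal[OF int] by (simp add: abs_mult ennreal_mult)
  then have "(ennreal \<bar>?I\<bar>)\<^sup>2 \<le> (\<integral>\<^sup>+x. ennreal \<bar>f x\<bar> * ennreal \<bar>g x\<bar> \<partial>M)\<^sup>2"
    by (rule power_mono) simp
  also have "\<dots> \<le> (\<integral>\<^sup>+x. (ennreal \<bar>f x\<bar>)\<^sup>2 \<partial>M) * (\<integral>\<^sup>+x. (ennreal \<bar>g x\<bar>)\<^sup>2 \<partial>M)"
    by (rule Cauchy_Schwarz_nn_integral) measurable
  also have "\<dots> = ennreal ?A * ennreal ?B"
    using f g by (simp add: ennreal_power nn_integral_eq_integral)
  finally have "ennreal (\<bar>?I\<bar>\<^sup>2) \<le> ennreal (?A * ?B)"
    using AB by (simp only: ennreal_power[OF abs_ge_zero] ennreal_mult)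
  then have "\<bar>?I\<bar>\<^sup>2 \<le> ?A * ?B" using AB by (subst (asm) ennreal_le_iff) auto
  then show "\<bar>?I\<bar> \<le> sqrt ?A * sqrt ?B" by (simp add: real_le_rsqrt real_sqrt_mult[symmetric])
qed

lemma cylinder_eq:
  fixes \<sigma> :: "(real^'d::finite) set"
  assumes n: "norm n = 1" and aff: "affine hull \<sigma> = {x. n \<bullet> x = c}"
  shows "cylinder \<sigma> = {x. x \<in> slab n c \<and> hproj n c x \<in> \<sigma>}"
proof -
  have "dist x (hproj n c x) = \<bar>n \<bullet> x - c\<bar>" for x using n by (simp add: hproj_def dist_norm)
  then show ?thesis unfolding cylinder_def aff closest_point_hyperplane[OF n] slab_def by auto
qed

lemma cylinder_borel:
  fixes \<sigma> :: "(real^'d::finite) set"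
  assumes n: "norm n = 1" and aff: "affine hull \<sigma> = {x. n \<bullet> x = c}" and [measurable]: "\<sigma> \<in> sets borel"
  shows "cylinder \<sigma> \<in> sets borel"
proof -
  have "{x \<in> space borel. x \<in> slab n c \<and> hproj n c x \<in> \<sigma>} \<in> sets borel" by measurable
  then show ?thesis unfolding cylinder_eq[OF n aff] by simp
qed

text \<open>\<open>surf\<close> is an image measure, so a face integral is a Lebesgue integral over
  the cylinder of the integrand composed with the projection. Measurability is asked only on
  \<sigma>, the integrand being arbitrary elsewhere.\<close>

lemma surf_integral:
  fixes \<sigma> :: "(real^'d::finite) set" and f :: "real^'d \<Rightarrow> 'b::euclidean_space"
  assumes n: "norm n = 1" and aff: "affine hull \<sigma> = {x. n \<bullet> x = c}" and s[measurable]: "\<sigma> \<in> sets borel"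
    and [measurable]: "(\<lambda>x. indicator \<sigma> x *\<^sub>R f x) \<in> borel_measurable borel"
  shows "(LINT x:\<sigma>|surf \<sigma>. f x) = (LINT x|lborel. indicator (cylinder \<sigma>) x *\<^sub>R f (hproj n c x))"
proof -
  have [measurable]: "cylinder \<sigma> \<in> sets borel" using cylinder_borel[OF n aff s] .
  have m: "hproj n c \<in> restrict_space lborel (cylinder \<sigma>) \<rightarrow>\<^sub>M borel"
    by (rule measurable_restrict_space1) simp
  have "(LINT x:\<sigma>|surf \<sigma>. f x) = (LINT x|restrict_space lborel (cylinder \<sigma>). indicator \<sigma> (hproj n c x) *\<^sub>R f (hproj n c x))"
    unfolding set_lebesgue_integral_def surf_def aff closest_point_hyperplane[OF n]
    by (rule integral_distr[OF m]) simp
  also have "\<dots> = (LINT x|lborel. indicator (cylinder \<sigma>) x *\<^sub>R (indicator \<sigma> (hproj n c x) *\<^sub>R f (hproj n c x)))"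
    by (rule integral_restrict_space) simp
  also have "\<dots> = (LINT x|lborel. indicator (cylinder \<sigma>) x *\<^sub>R f (hproj n c x))"
    by (intro Bochner_Integration.integral_cong) (auto simp: indicator_def cylinder_eq[OF n aff])
  finally show ?thesis .
qed

lemma c1c_square_integrable:
  assumes "c1c \<phi>"
  shows "integrable lborel (\<lambda>x. (\<phi> x)\<^sup>2)" "integrable lborel (\<lambda>x. (norm (grad \<phi> x))\<^sup>2)"
    "integrable lborel (\<lambda>x. \<bar>\<phi> x\<bar> * norm (grad \<phi> x))" "integrable lborel (pd i \<phi>)"
    "bounded {x. pd i \<phi> x \<noteq> 0}"
proof -
  note c = c1c_continuous[OF assms] and g = c1c_grad_continuous[OF assms]
  have b: "bounded {x. \<phi> x \<noteq> 0}" using assms by (simp add: c1c_def)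
  have bg: "bounded {x. grad \<phi> x \<noteq> 0}"
    using bounded_subset[OF bounded_closure[OF b] c1c_grad_support[OF assms]] .
  show "integrable lborel (\<lambda>x. (\<phi> x)\<^sup>2)"
    by (rule continuous_bounded_support_integrable) (use c b in \<open>auto intro!: continuous_intros\<close>)
  show "integrable lborel (\<lambda>x. (norm (grad \<phi> x))\<^sup>2)"
    by (rule continuous_bounded_support_integrable) (use g bg in \<open>auto intro!: continuous_intros\<close>)
  show "integrable lborel (\<lambda>x. \<bar>\<phi> x\<bar> * norm (grad \<phi> x))"
    by (rule continuous_bounded_support_integrable)
      (use c g in \<open>auto intro!: continuous_intros bounded_subset[OF b]\<close>)
  show bp: "bounded {x. pd i \<phi> x \<noteq> 0}"
    by (rule bounded_subset[OF bg]) (auto simp: grad_def vec_eq_iff)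
  show "integrable lborel (pd i \<phi>)"
    by (rule continuous_bounded_support_integrable[OF _ bp]) (use assms in \<open>auto simp: c1c_def\<close>)
qed

text \<open>The pointwise bound is integrated over the slab and unfolded by slicing with
  \<open>d = 1\<close>. The product on the right is essential: it is small when the function is
  small in L2 while its gradient is only bounded.\<close>

lemma trace_inequality:
  fixes \<sigma> :: "(real^'d::finite) set"
  assumes n: "norm n = 1" and aff: "affine hull \<sigma> = {x. n \<bullet> x = c}" and s[measurable]: "\<sigma> \<in> sets borel"
    and \<phi>: "c1c \<phi>"
  shows "(LINT x:\<sigma>|surf \<sigma>. (\<phi> x)\<^sup>2) \<le> 2 * (sqrt (LINT x|lborel. (\<phi> x)\<^sup>2) * sqrt (LINT x|lborel. (norm (grad \<phi> x))\<^sup>2))"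
proof -
  have [measurable]: "\<phi> \<in> borel_measurable borel" "grad \<phi> \<in> borel_measurable borel"
    using c1c_continuous[OF \<phi>] c1c_grad_continuous[OF \<phi>] by (auto intro: borel_measurable_continuous_onI)
  have [measurable]: "cylinder \<sigma> \<in> sets borel" using cylinder_borel[OF n aff s] .
  let ?h = "\<lambda>x. indicator (cylinder \<sigma>) x *\<^sub>R (\<phi> (hproj n c x))\<^sup>2"
  let ?G = "\<lambda>x. 2 * \<bar>\<phi> x\<bar> * norm (grad \<phi> x)"
  have "(LINT x:\<sigma>|surf \<sigma>. (\<phi> x)\<^sup>2) = (LINT x|lborel. ?h x)"
    by (rule surf_integral[OF n aff s]) simp
  \<comment> \<open>A non-integrable integrand has integral 0 by convention, so the inequality holds
    in that case too.\<close>
  also have "ennreal \<dots> \<le> (\<integral>\<^sup>+x. ennreal (?h x) \<partial>lborel)"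
    by (cases "integrable lborel ?h") (auto simp: nn_integral_eq_integral not_integrable_integral_eq)
  also have "\<dots> \<le> (\<integral>\<^sup>+x. indicator (slab n c) x * (ennreal 1 * (\<integral>\<^sup>+t. ennreal (?G (hproj n c x - (1 * t) *\<^sub>R n)) \<partial>lborel)) \<partial>lborel)"
  proof (rule nn_integral_mono)
    fix x
    show "ennreal (?h x) \<le> indicator (slab n c) x * (ennreal 1 * (\<integral>\<^sup>+t. ennreal (?G (hproj n c x - (1 * t) *\<^sub>R n)) \<partial>lborel))"
      using trace_pointwise[OF \<phi> n, of "hproj n c x"]
      by (cases "x \<in> cylinder \<sigma>") (auto simp: cylinder_eq[OF n aff])
  qed
  also have "\<dots> = (\<integral>\<^sup>+x. ennreal (?G x) \<partial>lborel)"
    by (rule nn_integral_slices[OF n, symmetric]) auto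
  also have "\<dots> = ennreal (LINT x|lborel. ?G x)"
    using c1c_square_integrable(3)[OF \<phi>] by (intro nn_integral_eq_integral) (auto simp: mult.assoc)
  finally have "(LINT x:\<sigma>|surf \<sigma>. (\<phi> x)\<^sup>2) \<le> (LINT x|lborel. ?G x)"
    by (subst (asm) ennreal_le_iff) auto
  also have "\<dots> = 2 * (LINT x|lborel. \<bar>\<phi> x\<bar> * norm (grad \<phi> x))" by (simp add: mult.assoc)
  also have "\<dots> \<le> 2 * (sqrt (LINT x|lborel. \<bar>\<phi> x\<bar>\<^sup>2) * sqrt (LINT x|lborel. (norm (grad \<phi> x))\<^sup>2))"
    using Cauchy_Schwarz_integral(2)[of "\<lambda>x. \<bar>\<phi> x\<bar>" lborel "\<lambda>x. norm (grad \<phi> x)"] c1c_square_integrable(1,2)[OF \<phi>]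
    by auto
  finally show ?thesis by simp
qed

text \<open>On each line in direction \<open>v\<close> the integrand is the derivative of a
  compactly supported function of one variable; slicing reduces the integral to these.\<close>

lemma integral_directional_derivative:
  fixes w :: "'a::euclidean_space \<Rightarrow> real"
  assumes D: "\<And>x. (w has_derivative D x) (at x)" and c: "continuous_on UNIV (\<lambda>x. D x v)"
    and b: "bounded {x. w x \<noteq> 0}" and v: "norm v = 1"
  shows "(LINT x|lborel. D x v) = 0"
proof -
  have F: "integrable lborel (\<lambda>x. D x v)"
    by (rule continuous_bounded_support_integrable[OF c bounded_support_derivative(2)[OF D b]])
  note sl = slice_integral[OF v zero_less_one F, of 0]
  let ?G = "\<lambda>z. indicator (slab v 0) (fst z) * (1 * D (hproj v 0 (fst z) - (1 * snd z) *\<^sub>R v) v)"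
  have inner: "(LINT t|lborel. D (y - t *\<^sub>R v) v) = 0" for y
  proof -
    obtain B where B: "\<And>x. w x \<noteq> 0 \<Longrightarrow> norm x \<le> B" using b unfolding bounded_iff by auto
    obtain B' where B': "\<And>x. D x v \<noteq> 0 \<Longrightarrow> norm x \<le> B'"
      using bounded_support_derivative(2)[OF D b, of v] unfolding bounded_iff by auto
    define R where "R = \<bar>B\<bar> + \<bar>B'\<bar> + norm y + 1"
    have R0: "R > 0" unfolding R_def using norm_ge_zero[of y] by linarith
    have far: "norm (y - t *\<^sub>R v) > B \<and> norm (y - t *\<^sub>R v) > B'" if "\<bar>t\<bar> \<ge> R" for t
    proof -
      have "norm (t *\<^sub>R v) \<le> norm (y - t *\<^sub>R v) + norm y"
        by (metis norm_triangle_sub norm_minus_commute add.commute)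
      then show ?thesis using v that unfolding R_def by auto
    qed
    have wR: "w (y - R *\<^sub>R v) = 0" "w (y - (- R) *\<^sub>R v) = 0"
      using far[of R] far[of "-R"] B[of "y - R *\<^sub>R v"] B[of "y - (-R) *\<^sub>R v"] R0 by force+
    have der: "((\<lambda>t. w (y - t *\<^sub>R v)) has_vector_derivative (- D (y - t *\<^sub>R v) v)) (at t within {-R..R})" for t
    proof -
      have "((\<lambda>t. y - t *\<^sub>R v) has_derivative (\<lambda>h. - (h *\<^sub>R v))) (at t within {-R..R})"
        by (auto intro!: derivative_eq_intros)
      then have "((\<lambda>t. w (y - t *\<^sub>R v)) has_derivative (\<lambda>h. D (y - t *\<^sub>R v) (- (h *\<^sub>R v)))) (at t within {-R..R})"
        by (rule has_derivative_compose) (rule D)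
      then show ?thesis unfolding has_vector_derivative_def
        by (rule has_derivative_eq_rhs)
          (simp add: fun_eq_iff linear_neg[OF has_derivative_linear[OF D]] linear_cmul[OF has_derivative_linear[OF D]])
    qed
    have cont: "continuous_on {-R..R} (\<lambda>t. - D (y - t *\<^sub>R v) v)"
      by (intro continuous_intros continuous_on_compose2[OF c]) auto
    have "(LINT t|lborel. indicator {-R..R} t *\<^sub>R (- D (y - t *\<^sub>R v) v)) = w (y - R *\<^sub>R v) - w (y - (- R) *\<^sub>R v)"
      by (rule integral_FTC_Icc[OF _ der cont]) (use R0 in auto)
    then have "(LINT t|lborel. indicator {-R..R} t *\<^sub>R (- D (y - t *\<^sub>R v) v)) = 0" using wR by simp
    moreover have "(\<lambda>t. indicator {-R..R} t *\<^sub>R (- D (y - t *\<^sub>R v) v)) = (\<lambda>t. - D (y - t *\<^sub>R v) v)"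
    proof
      fix t
      have "D (y - t *\<^sub>R v) v = 0" if "t \<notin> {-R..R}"
        using far[of t] B'[of "y - t *\<^sub>R v"] that R0 by force
      then show "indicator {-R..R} t *\<^sub>R (- D (y - t *\<^sub>R v) v) = - D (y - t *\<^sub>R v) v"
        by (cases "t \<in> {-R..R}") auto
    qed
    ultimately have "(LINT t|lborel. - D (y - t *\<^sub>R v) v) = 0" by (simp only:)
    then show ?thesis by simp
  qed
  have "(LINT x|lborel. D x v) = (LINT z|(lborel \<Otimes>\<^sub>M lborel). ?G z)" unfolding lborel_prod by (rule sl(2))
  also have "\<dots> = (LINT x|lborel. LINT t|lborel. ?G (x, t))"
    by (rule lborel_pair.integral_fst'[symmetric]) (unfold lborel_prod, rule sl(1))
  also have "\<dots> = 0" by (simp add: inner)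
  finally show ?thesis .
qed

section \<open>Gauss-Green formula by smoothing the indicator function of a polytope\<close>

section \<open>The divergence theorem on a convex polytope\<close>

text \<open>A smooth Heaviside function. Its derivative \<open>cutoff'\<close> is the Cauchy
  density, of integral 1, so that rescaled copies concentrate at 0 with unit mass.\<close>

definition cutoff :: "real \<Rightarrow> real" where
  "cutoff s = 1/2 + arctan s / pi"

definition cutoff' :: "real \<Rightarrow> real" where
  "cutoff' s = inverse (1 + s\<^sup>2) / pi"

lemma cutoff_bounds: "0 \<le> cutoff s" "cutoff s \<le> 1" "\<bar>cutoff s\<bar> \<le> 1"
proof -
  have "- (1/2) \<le> arctan s / pi" "arctan s / pi \<le> 1/2"
    using arctan_bounded[of s] pi_gt_zero by (auto simp: field_simps)
  then show "0 \<le> cutoff s" "cutoff s \<le> 1" "\<bar>cutoff s\<bar> \<le> 1" unfolding cutoff_def by linarith+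
qed

lemma cutoff_derivative: "(cutoff has_real_derivative cutoff' s) (at s)"
proof -
  have "((\<lambda>s. 1/2 + arctan s / pi) has_real_derivative 0 + inverse (1 + s\<^sup>2) / pi) (at s)"
    by (intro DERIV_add DERIV_const DERIV_cdivide DERIV_arctan)
  then show ?thesis by (simp add: cutoff_def[abs_def] cutoff'_def)
qed

lemma cutoff'_nonneg: "0 \<le> cutoff' s"
  by (simp add: cutoff'_def add_nonneg_nonneg)

lemma cutoff_continuous [continuous_intros]: "continuous_on A f \<Longrightarrow> continuous_on A (\<lambda>x. cutoff (f x))"
  unfolding cutoff_def by (intro continuous_intros) auto

lemma cutoff'_continuous [continuous_intros]:
  assumes "continuous_on A f"
  shows "continuous_on A (\<lambda>x. cutoff' (f x))"
proof -
  have "1 + (f x)\<^sup>2 \<noteq> 0" for x by (metis add_pos_nonneg less_numeral_extra(1) less_numeral_extra(3) zero_le_power2)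
  then show ?thesis unfolding cutoff'_def using assms by (intro continuous_intros) auto
qed

lemma cutoff_at_top: "(cutoff \<longlongrightarrow> 1) at_top"
proof -
  have "((\<lambda>s. 1/2 + arctan s / pi) \<longlongrightarrow> 1/2 + (pi/2) / pi) at_top"
    by (intro tendsto_intros tendsto_arctan_at_top) auto
  then show ?thesis by (simp add: cutoff_def[abs_def])
qed

lemma cutoff_at_bot: "(cutoff \<longlongrightarrow> 0) at_bot"
proof -
  have "((\<lambda>s. 1/2 + arctan s / pi) \<longlongrightarrow> 1/2 + (- (pi/2)) / pi) at_bot"
    by (intro tendsto_intros tendsto_arctan_at_bot) auto
  then show ?thesis by (simp add: cutoff_def[abs_def])
qed

lemma cutoff'_integral: "integrable lborel cutoff'" "(LINT s|lborel. cutoff' s) = 1"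
proof -
  have "integrable lborel (\<lambda>x::real. inverse (1 + x\<^sup>2))"
    using integrable_inverse_1_plus_square by (simp add: set_integrable_def)
  then show "integrable lborel cutoff'" unfolding cutoff'_def[abs_def] by simp
  have "(LINT s|lborel. inverse (1 + s\<^sup>2)) = pi"
    using LBINT_inverse_1_plus_square by (simp add: interval_lebesgue_integral_def set_lebesgue_integral_def)
  then show "(LINT s|lborel. cutoff' s) = 1" by (simp add: cutoff'_def[abs_def])
qed

lemma filterlim_affine_Suc:
  fixes a b :: real
  shows "a > 0 \<Longrightarrow> filterlim (\<lambda>k. real (Suc k) * a + b) at_top sequentially"
    and "a < 0 \<Longrightarrow> filterlim (\<lambda>k. real (Suc k) * a + b) at_bot sequentially"
proof -
  have S: "filterlim (\<lambda>k. real (Suc k)) at_top sequentially"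
    using filterlim_Suc filterlim_real_sequentially by (rule filterlim_compose[rotated])
  show "filterlim (\<lambda>k. real (Suc k) * a + b) at_top sequentially" if "a > 0"
  proof -
    have "filterlim (\<lambda>k. b + real (Suc k) * a) at_top sequentially"
      using that by (intro filterlim_tendsto_add_at_top[OF tendsto_const] filterlim_at_top_mult_tendsto_pos[OF tendsto_const _ S]) auto
    then show ?thesis by (simp add: add.commute)
  qed
  show "filterlim (\<lambda>k. real (Suc k) * a + b) at_bot sequentially" if "a < 0"
  proof -
    have "filterlim (\<lambda>k. (- b) + real (Suc k) * (- a)) at_top sequentially"
      using that by (intro filterlim_tendsto_add_at_top[OF tendsto_const] filterlim_at_top_mult_tendsto_pos[OF tendsto_const _ S]) auto
    then show ?thesis unfolding filterlim_uminus_at_bot by (simp add: algebra_simps)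
  qed
qed

text \<open>One factor tending to 0 suffices because the others stay in [0, 1]. The bounded
  perturbation \<open>b\<close> is there for points displaced along a normal by a distance of order
  \<open>1 / (k + 1)\<close>.\<close>

lemma cutoff_prod_limit:
  fixes a b :: "'i \<Rightarrow> real"
  assumes fin: "finite I" and nz: "\<And>i. i \<in> I \<Longrightarrow> a i \<noteq> 0"
  shows "(\<lambda>k. \<Prod>i\<in>I. cutoff (real (Suc k) * a i + b i)) \<longlonglongrightarrow> (if \<forall>i\<in>I. a i > 0 then 1 else 0)"
proof (cases "\<forall>i\<in>I. a i > 0")
  case True
  have "(\<lambda>k. \<Prod>i\<in>I. cutoff (real (Suc k) * a i + b i)) \<longlonglongrightarrow> (\<Prod>i\<in>I. 1)"
    by (intro tendsto_prod filterlim_compose[OF cutoff_at_top] filterlim_affine_Suc(1)) (use True in auto)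
  then show ?thesis using True by simp
next
  case False
  then obtain j where j: "j \<in> I" "a j < 0" using nz by (meson linorder_neqE_linordered_idom)
  have lim: "(\<lambda>k. cutoff (real (Suc k) * a j + b j)) \<longlonglongrightarrow> 0"
    by (intro filterlim_compose[OF cutoff_at_bot] filterlim_affine_Suc(2) j)
  have "(\<lambda>k. \<Prod>i\<in>I. cutoff (real (Suc k) * a i + b i)) \<longlonglongrightarrow> 0"
  proof (rule tendsto_sandwich[OF _ _ tendsto_const lim])
    show "\<forall>\<^sub>F k in sequentially. 0 \<le> (\<Prod>i\<in>I. cutoff (real (Suc k) * a i + b i))"
      by (intro always_eventually allI prod_nonneg) (auto simp: cutoff_bounds)
    show "\<forall>\<^sub>F k in sequentially. (\<Prod>i\<in>I. cutoff (real (Suc k) * a i + b i)) \<le> cutoff (real (Suc k) * a j + b j)"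
    proof (intro always_eventually allI)
      fix k
      have "(\<Prod>i\<in>I. cutoff (real (Suc k) * a i + b i)) = cutoff (real (Suc k) * a j + b j) * (\<Prod>i\<in>I - {j}. cutoff (real (Suc k) * a i + b i))"
        by (rule prod.remove[OF fin j(1)])
      also have "\<dots> \<le> cutoff (real (Suc k) * a j + b j) * 1"
        by (intro mult_left_mono prod_le_1) (auto simp: cutoff_bounds)
      finally show "(\<Prod>i\<in>I. cutoff (real (Suc k) * a i + b i)) \<le> cutoff (real (Suc k) * a j + b j)" by simp
    qed
  qed
  then show ?thesis using False by auto
qed

text \<open>Pythagoras: \<open>hproj n c x - c *\<^sub>R n\<close> is the component of
  \<open>x\<close> orthogonal to \<open>n\<close>, the shortest vector of its normal line. Hence the
  points of the slab whose normal line meets a bounded support form a bounded set.\<close>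

lemma norm_hproj_le:
  assumes n: "norm n = 1"
  shows "norm (hproj n c x - c *\<^sub>R n) \<le> norm (hproj n c x - t *\<^sub>R n)"
proof -
  define p where "p = hproj n c x - c *\<^sub>R n"
  have nn: "n \<bullet> n = 1" using n by (simp add: norm_eq_1)
  have np: "n \<bullet> p = 0" using nn inner_hproj[OF n] by (simp add: p_def inner_diff_right)
  have "(p + s *\<^sub>R n) \<bullet> (p + s *\<^sub>R n) = p \<bullet> p + s\<^sup>2" for s
    using np nn by (simp add: inner_add_left inner_add_right inner_commute power2_eq_square)
  then have "p \<bullet> p \<le> (p + (c - t) *\<^sub>R n) \<bullet> (p + (c - t) *\<^sub>R n)" by simp
  moreover have "hproj n c x - t *\<^sub>R n = p + (c - t) *\<^sub>R n" by (simp add: p_def algebra_simps)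
  ultimately show ?thesis by (metis norm_le p_def)
qed

lemma norm_slab_le:
  assumes n: "norm n = 1" and x: "x \<in> slab n c"
  shows "norm x \<le> norm (hproj n c x - c *\<^sub>R n) + \<bar>c\<bar> + 1/2"
proof -
  have "x = (hproj n c x - c *\<^sub>R n) + (c *\<^sub>R n + (n \<bullet> x - c) *\<^sub>R n)" by (simp add: hproj_def)
  then have "norm x \<le> norm (hproj n c x - c *\<^sub>R n) + norm (c *\<^sub>R n + (n \<bullet> x - c) *\<^sub>R n)"
    using norm_triangle_ineq by metis
  also have "norm (c *\<^sub>R n + (n \<bullet> x - c) *\<^sub>R n) \<le> norm (c *\<^sub>R n) + norm ((n \<bullet> x - c) *\<^sub>R n)"
    by (rule norm_triangle_ineq)
  finally show ?thesis using n x by (simp add: slab_def)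
qed

context convex_body
begin

abbreviation "nv \<equiv> outward_normal K"
abbreviation "cv \<equiv> facet_offset K"

text \<open>For \<open>F = facets K\<close> a smooth approximation of the indicator of
  \<open>K\<close> at scale \<open>1 / (k + 1)\<close>. The set \<open>F\<close> is a parameter
  because the product rule removes one facet at a time.\<close>

definition cut :: "(real^'d) set set \<Rightarrow> nat \<Rightarrow> real^'d \<Rightarrow> real" where
  "cut F k x = (\<Prod>\<tau>\<in>F. cutoff (real (Suc k) * (cv \<tau> - nv \<tau> \<bullet> x)))"

lemma cut_bounds: "0 \<le> cut F k x" "cut F k x \<le> 1" "\<bar>cut F k x\<bar> \<le> 1"
proof -
  show 1: "0 \<le> cut F k x" unfolding cut_def by (intro prod_nonneg) (auto simp: cutoff_bounds)
  show 2: "cut F k x \<le> 1" unfolding cut_def by (intro prod_le_1) (auto simp: cutoff_bounds)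
  show "\<bar>cut F k x\<bar> \<le> 1" using 1 2 by simp
qed

lemma cut_continuous [continuous_intros]:
  "continuous_on A f \<Longrightarrow> continuous_on A (\<lambda>x. cut F k (f x))"
  unfolding cut_def by (intro continuous_intros)

lemma cut_derivative:
  "(cut F k has_derivative (\<lambda>h. \<Sum>\<tau>\<in>F. (cutoff' (real (Suc k) * (cv \<tau> - nv \<tau> \<bullet> x)) * (real (Suc k) * (- (nv \<tau> \<bullet> h)))) * cut (F - {\<tau>}) k x)) (at x)"
proof -
  have "((\<lambda>x. cutoff (real (Suc k) * (cv \<tau> - nv \<tau> \<bullet> x))) has_derivative
     (\<lambda>h. cutoff' (real (Suc k) * (cv \<tau> - nv \<tau> \<bullet> x)) * (real (Suc k) * (- (nv \<tau> \<bullet> h))))) (at x)" for \<tau>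
  proof -
    have "((\<lambda>x. real (Suc k) * (cv \<tau> - nv \<tau> \<bullet> x)) has_derivative (\<lambda>h. real (Suc k) * (- (nv \<tau> \<bullet> h)))) (at x)"
      by (rule derivative_eq_intros | simp)+
    from has_derivative_compose[OF this, of cutoff] cutoff_derivative[unfolded has_field_derivative_def]
    show ?thesis by blast
  qed
  then show ?thesis unfolding cut_def by (rule has_derivative_prod)
qed

text \<open>After projection the equation of another facet becomes \<open>w \<bullet> x = e\<close>,
  where \<open>w\<close> is the part of its normal tangential to \<sigma>. This is a null set if
  \<open>w\<close> is nonzero; if \<open>w = 0\<close> the facets are parallel and the equation has
  no solution.\<close>

lemma facets_degenerate_null:
  assumes s: "\<sigma> \<in> facets K"
  shows "AE x in lborel. \<forall>\<tau>\<in>facets K - {\<sigma>}. cv \<tau> - nv \<tau> \<bullet> hproj (nv \<sigma>) (cv \<sigma>) x \<noteq> 0"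
proof (rule AE_finite_allI)
  show "finite (facets K - {\<sigma>})" using finite_facets by simp
  fix \<tau> assume t: "\<tau> \<in> facets K - {\<sigma>}"
  let ?n = "nv \<sigma>" and ?c = "cv \<sigma>"
  define w where "w = nv \<tau> - (nv \<tau> \<bullet> ?n) *\<^sub>R ?n"
  define e where "e = cv \<tau> - (nv \<tau> \<bullet> ?n) * ?c"
  have eq: "cv \<tau> - nv \<tau> \<bullet> hproj ?n ?c x = e - w \<bullet> x" for x
    by (simp add: w_def e_def hproj_def algebra_simps inner_diff_left inner_diff_right)
  show "AE x in lborel. cv \<tau> - nv \<tau> \<bullet> hproj ?n ?c x \<noteq> 0"
  proof (cases "w = 0")
    case True
    then have "nv \<tau> = (nv \<tau> \<bullet> ?n) *\<^sub>R ?n" by (simp add: w_def)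
    then have "nv \<tau> \<bullet> hproj ?n ?c x \<noteq> cv \<tau>" for x
      using parallel_facets[OF s, of \<tau>] t inner_hproj[OF norm_normal[OF s]] by blast
    then show ?thesis by force
  next
    case False
    then have "negligible {x. w \<bullet> x = e}" by (simp add: negligible_hyperplane)
    moreover have "{x. w \<bullet> x = e} \<in> sets borel" by (intro borel_closed closed_hyperplane)
    ultimately have "{x. w \<bullet> x = e} \<in> null_sets lborel"
      by (simp add: negligible_iff_null_sets null_sets_completion_iff)
    then show ?thesis by (rule AE_I') (auto simp: eq)
  qed
qed

lemma facet_closed: "\<sigma> \<in> facets K \<Longrightarrow> \<sigma> \<in> sets borel"
  using facet_polytope polytope_imp_closed by (intro borel_closed) blast

text \<open>At distance of order \<open>1 / (k + 1)\<close> from the hyperplane of \<sigma>, the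
  argument of every other cutoff is its value at \<open>y\<close>, scaled up, plus a bounded shift.
  Only the sign at \<open>y\<close> survives, and the signs decide membership in \<sigma>.\<close>

lemma cut_facet_limit:
  assumes s: "\<sigma> \<in> facets K" and y: "nv \<sigma> \<bullet> y = cv \<sigma>" and nz: "\<forall>\<tau>\<in>facets K - {\<sigma>}. cv \<tau> - nv \<tau> \<bullet> y \<noteq> 0"
  shows "(\<lambda>k. cut (facets K - {\<sigma>}) k (y - (1 / real (Suc k) * t) *\<^sub>R nv \<sigma>)) \<longlonglongrightarrow> indicator \<sigma> y"
proof -
  have eq: "real (Suc k) * (cv \<tau> - nv \<tau> \<bullet> (y - (1 / real (Suc k) * t) *\<^sub>R nv \<sigma>))
    = real (Suc k) * (cv \<tau> - nv \<tau> \<bullet> y) + t * (nv \<tau> \<bullet> nv \<sigma>)" for k \<tau>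
    by (simp add: inner_diff_right field_simps del: of_nat_Suc)
  have "(\<forall>\<tau>\<in>facets K - {\<sigma>}. cv \<tau> - nv \<tau> \<bullet> y > 0) \<longleftrightarrow> y \<in> \<sigma>"
  proof
    assume "\<forall>\<tau>\<in>facets K - {\<sigma>}. cv \<tau> - nv \<tau> \<bullet> y > 0"
    then have "\<forall>\<tau>\<in>facets K. nv \<tau> \<bullet> y \<le> cv \<tau>" using y by (metis Diff_iff diff_gt_0_iff_gt empty_iff insert_iff less_imp_le order_refl)
    then have "y \<in> K" by (subst eq_Inter_halfspaces) simp
    then show "y \<in> \<sigma>" using facet_eq[OF s] y by blast
  next
    assume "y \<in> \<sigma>"
    then have "y \<in> K" using facet_eq[OF s] by blast
    then show "\<forall>\<tau>\<in>facets K - {\<sigma>}. cv \<tau> - nv \<tau> \<bullet> y > 0" using nz normal_le by (metis DiffD1 diff_gt_0_iff_gt diff_self order_le_less)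
  qed
  then have ind: "(if \<forall>\<tau>\<in>facets K - {\<sigma>}. cv \<tau> - nv \<tau> \<bullet> y > 0 then 1 else 0) = (indicator \<sigma> y :: real)"
    by (simp add: indicator_def)
  show ?thesis unfolding cut_def eq ind[symmetric]
    by (rule cutoff_prod_limit) (use finite_facets nz in auto)
qed

lemma AE_off_hyperplane:
  fixes w :: "'a::euclidean_space"
  assumes "w \<noteq> 0"
  shows "AE x in lborel. w \<bullet> x \<noteq> e"
proof -
  have "negligible {x. w \<bullet> x = e}" using assms by (simp add: negligible_hyperplane)
  moreover have "{x. w \<bullet> x = e} \<in> sets borel" by (intro borel_closed closed_hyperplane)
  ultimately have "{x. w \<bullet> x = e} \<in> null_sets lborel"
    by (simp add: negligible_iff_null_sets null_sets_completion_iff)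
  then show ?thesis by (rule AE_I') auto
qed

lemma cut_limit: "AE x in lborel. (\<lambda>k. cut (facets K) k x) \<longlonglongrightarrow> indicator K x"
proof -
  have "AE x in lborel. \<forall>\<tau>\<in>facets K. nv \<tau> \<bullet> x \<noteq> cv \<tau>"
    using norm_normal by (intro AE_finite_allI[OF finite_facets] AE_off_hyperplane) force
  then show ?thesis
  proof eventually_elim
    case (elim x)
    then have nz: "\<forall>\<tau>\<in>facets K. cv \<tau> - nv \<tau> \<bullet> x \<noteq> 0" by force
    have "(\<forall>\<tau>\<in>facets K. cv \<tau> - nv \<tau> \<bullet> x > 0) \<longleftrightarrow> x \<in> K"
    proof
      assume "\<forall>\<tau>\<in>facets K. cv \<tau> - nv \<tau> \<bullet> x > 0"
      then show "x \<in> K" by (subst eq_Inter_halfspaces) (auto intro: less_imp_le)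
    next
      assume "x \<in> K"
      then show "\<forall>\<tau>\<in>facets K. cv \<tau> - nv \<tau> \<bullet> x > 0"
        using nz normal_le by (metis diff_gt_0_iff_gt diff_self order_le_less)
    qed
    then have ind: "(if \<forall>\<tau>\<in>facets K. cv \<tau> - nv \<tau> \<bullet> x > 0 then 1 else 0) = (indicator K x :: real)"
      by (simp add: indicator_def)
    show ?case
      using cutoff_prod_limit[OF finite_facets, of "\<lambda>\<tau>. cv \<tau> - nv \<tau> \<bullet> x" "\<lambda>_. 0"] nz ind
      by (simp add: cut_def del: of_nat_Suc)
  qed
qed

text \<open>The contribution of \<sigma> to the derivative of \<open>cut (facets K) k\<close>, with
  the factor \<open>- nv \<sigma>\<close> taken out and multiplied by \<phi>: a layer that
  concentrates on \<sigma> as \<open>k\<close> grows.\<close>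

definition facet_layer :: "(real^'d \<Rightarrow> real) \<Rightarrow> (real^'d) set \<Rightarrow> nat \<Rightarrow> real^'d \<Rightarrow> real" where
  "facet_layer \<phi> \<sigma> k x = real (Suc k) * cutoff' (real (Suc k) * (cv \<sigma> - nv \<sigma> \<bullet> x)) * cut (facets K - {\<sigma>}) k x * \<phi> x"

lemma facet_layer_integrable:
  assumes "c1c \<phi>"
  shows "integrable lborel (facet_layer \<phi> \<sigma> k)"
proof -
  have b: "bounded {x. \<phi> x \<noteq> 0}" using assms by (simp add: c1c_def)
  show ?thesis unfolding facet_layer_def[abs_def]
    by (rule continuous_bounded_support_integrable)
      (auto intro!: continuous_intros c1c_continuous[OF assms] bounded_subset[OF b])
qed

text \<open>The derivative of the compactly supported function \<open>cut (facets K) k x * \<phi> x\<close> has integral zero.\<close>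

lemma cut_integral:
  assumes \<phi>: "c1c \<phi>"
  shows "(LINT x|lborel. cut (facets K) k x * pd i \<phi> x) = (\<Sum>\<sigma>\<in>facets K. nv \<sigma> $ i * (LINT x|lborel. facet_layer \<phi> \<sigma> k x))"
proof -
  let ?D = "\<lambda>x h. cut (facets K) k x * (grad \<phi> x \<bullet> h) + (\<Sum>\<sigma>\<in>facets K. (cutoff' (real (Suc k) * (cv \<sigma> - nv \<sigma> \<bullet> x)) * (real (Suc k) * (- (nv \<sigma> \<bullet> h)))) * cut (facets K - {\<sigma>}) k x) * \<phi> x"
  have diff: "\<And>x. (\<phi> has_derivative (\<lambda>h. grad \<phi> x \<bullet> h)) (at x)"
    using \<phi> has_derivative_grad by (auto simp: c1c_def)
  have D: "((\<lambda>x. cut (facets K) k x * \<phi> x) has_derivative ?D x) (at x)" for x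
    by (rule has_derivative_mult[OF cut_derivative diff])
  have bs: "bounded {x. \<phi> x \<noteq> 0}" using \<phi> by (simp add: c1c_def)
  have c: "continuous_on UNIV (\<lambda>x. ?D x (axis i 1))"
    by (intro continuous_intros c1c_continuous[OF \<phi>] c1c_grad_continuous[OF \<phi>])
  have b: "bounded {x. cut (facets K) k x * \<phi> x \<noteq> 0}"
    by (rule bounded_subset[OF bs]) auto
  have z: "(LINT x|lborel. ?D x (axis i 1)) = 0"
    by (rule integral_directional_derivative[OF D c b]) simp
  have Deq: "?D x (axis i 1) = cut (facets K) k x * pd i \<phi> x - (\<Sum>\<sigma>\<in>facets K. nv \<sigma> $ i * facet_layer \<phi> \<sigma> k x)" for x
  proof -
    have "(\<Sum>\<sigma>\<in>facets K. (cutoff' (real (Suc k) * (cv \<sigma> - nv \<sigma> \<bullet> x)) * (real (Suc k) * (- (nv \<sigma> \<bullet> axis i 1)))) * cut (facets K - {\<sigma>}) k x) * \<phi> x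
      = - (\<Sum>\<sigma>\<in>facets K. nv \<sigma> $ i * facet_layer \<phi> \<sigma> k x)"
      unfolding sum_distrib_right sum_negf[symmetric]
      by (rule sum.cong) (simp_all add: inner_axis facet_layer_def del: of_nat_Suc)
    then show ?thesis by (simp add: grad_inner_axis)
  qed
  have i1: "integrable lborel (\<lambda>x. cut (facets K) k x * pd i \<phi> x)"
    by (rule continuous_bounded_support_integrable)
      (use \<phi> in \<open>auto simp: c1c_def intro!: continuous_intros bounded_subset[OF c1c_square_integrable(5)[OF \<phi>]]\<close>)
  have i2: "integrable lborel (\<lambda>x. \<Sum>\<sigma>\<in>facets K. nv \<sigma> $ i * facet_layer \<phi> \<sigma> k x)"
    using facet_layer_integrable[OF \<phi>] by auto
  have "(LINT x|lborel. cut (facets K) k x * pd i \<phi> x) - (LINT x|lborel. (\<Sum>\<sigma>\<in>facets K. nv \<sigma> $ i * facet_layer \<phi> \<sigma> k x)) = 0"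
    using z unfolding Deq using i1 i2 by simp
  then show ?thesis using facet_layer_integrable[OF \<phi>] by (simp add: integral_sum)
qed

text \<open>Slicing with \<open>d = 1 / (k + 1)\<close> stretches the layer to unit width: the
  factor \<open>k + 1\<close> cancels and the argument of \<open>cutoff'\<close> becomes the normal
  coordinate itself. The remaining factors converge to their values on the hyperplane, and the unit
  mass of \<open>cutoff'\<close> integrates the normal coordinate out.\<close>

lemma facet_layer_limit:
  assumes \<phi>: "c1c \<phi>" and s: "\<sigma> \<in> facets K"
  shows "(\<lambda>k. LINT x|lborel. facet_layer \<phi> \<sigma> k x) \<longlonglongrightarrow> (LINT x:\<sigma>|surf \<sigma>. \<phi> x)"
proof -
  let ?n = "nv \<sigma>" and ?c = "cv \<sigma>"
  have n: "norm ?n = 1" using norm_normal[OF s] .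
  have sb[measurable]: "\<sigma> \<in> sets borel" using facet_closed[OF s] .
  have [measurable]: "\<phi> \<in> borel_measurable borel"
    using c1c_continuous[OF \<phi>] by (auto intro: borel_measurable_continuous_onI)
  have [measurable]: "cutoff' \<in> borel_measurable borel"
    using cutoff'_integral(1) borel_measurable_integrable by force
  let ?\<Phi> = "\<lambda>k z. hproj ?n ?c (fst z) - (1 / real (Suc k) * snd z) *\<^sub>R ?n"
  define G where "G k z = indicator (slab ?n ?c) (fst z) * (cutoff' (snd z) * cut (facets K - {\<sigma>}) k (?\<Phi> k z) * \<phi> (?\<Phi> k z))" for k z
  define L where "L z = indicator (slab ?n ?c) (fst z) * (cutoff' (snd z) * indicator \<sigma> (hproj ?n ?c (fst z)) * \<phi> (hproj ?n ?c (fst z)))" for z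
  have eq: "(LINT x|lborel. facet_layer \<phi> \<sigma> k x) = (LINT z|lborel. G k z)"
    and Gint: "integrable lborel (G k)" for k
  proof -
    have d: "1 / real (Suc k) > 0" by simp
    have "indicator (slab ?n ?c) (fst z) * (1 / real (Suc k) * facet_layer \<phi> \<sigma> k (?\<Phi> k z)) = G k z" for z
    proof -
      have "real (Suc k) * (?c - ?n \<bullet> ?\<Phi> k z) = snd z"
        using n by (simp add: inner_diff_right inner_hproj norm_eq_1 del: of_nat_Suc)
      then show ?thesis by (simp add: facet_layer_def G_def del: of_nat_Suc)
    qed
    then show "(LINT x|lborel. facet_layer \<phi> \<sigma> k x) = (LINT z|lborel. G k z)" "integrable lborel (G k)"
      using slice_integral[OF n d facet_layer_integrable[OF \<phi>, of \<sigma> k], of ?c] by simp_all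
  qed
  obtain B where B: "\<And>x. \<phi> x \<noteq> 0 \<Longrightarrow> norm x \<le> B" using \<phi> unfolding c1c_def bounded_iff by auto
  obtain M where M: "\<And>x. \<bar>\<phi> x\<bar> \<le> M"
  proof -
    have "compact (\<phi> ` cball 0 B)"
      by (intro compact_continuous_image continuous_on_subset[OF c1c_continuous[OF \<phi>]]) auto
    then obtain M where "\<forall>y\<in>\<phi> ` cball 0 B. norm y \<le> M" using compact_imp_bounded bounded_iff by metis
    then have "\<bar>\<phi> x\<bar> \<le> max M 0" for x using B[of x] by (cases "\<phi> x = 0") force+
    then show ?thesis by (rule that)
  qed
  have M0: "0 \<le> M" using M[of 0] by linarith
  \<comment> \<open>Dominating function. The radius is that of \<open>norm_slab_le\<close>: for a
    slab point outside this ball the normal line misses the support of \<phi>, whatever the value of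
    \<open>k\<close>.\<close>
  define W where "W z = M * (indicator (cball 0 (B + \<bar>?c\<bar> + 1/2)) (fst z) * cutoff' (snd z))" for z :: "(real^'d) \<times> real"
  have W: "integrable lborel W"
  proof -
    have "integrable (lborel \<Otimes>\<^sub>M lborel) (\<lambda>z::(real^'d) \<times> real. indicator (cball 0 (B + \<bar>?c\<bar> + 1/2)) (fst z) * cutoff' (snd z))"
    proof (rule lborel_pair.Fubini_integrable)
      show "integrable lborel (\<lambda>x::real^'d. LINT y|lborel. norm (indicator (cball 0 (B + \<bar>?c\<bar> + 1/2)) (fst (x, y)) * cutoff' (snd (x, y))))"
        using emeasure_lborel_cball_finite[of "0::real^'d" "B + \<bar>?c\<bar> + 1/2"]
        by (simp add: abs_mult cutoff'_nonneg cutoff'_integral(2) integrable_indicator_iff)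
      show "AE x in lborel. integrable lborel (\<lambda>y. indicator (cball 0 (B + \<bar>?c\<bar> + 1/2)) (fst (x::real^'d, y)) * cutoff' (snd (x, y)))"
        using cutoff'_integral(1) by simp
      have [measurable]: "cball (0::real^'d) (B + \<bar>?c\<bar> + 1/2) \<in> sets borel" by simp
      show "(\<lambda>z::(real^'d) \<times> real. indicator (cball 0 (B + \<bar>?c\<bar> + 1/2)) (fst z) * cutoff' (snd z))
          \<in> borel_measurable (lborel \<Otimes>\<^sub>M lborel)"
        by (intro borel_measurable_times measurable_compose[OF measurable_fst borel_measurable_indicator]
            measurable_compose[OF measurable_snd]) (simp_all add: borel_measurable_integrable[OF cutoff'_integral(1)])
    qed
    then show ?thesis unfolding W_def lborel_prod by simp
  qed
  have bound: "norm (G k z) \<le> W z" for k z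
  proof (cases "fst z \<in> slab ?n ?c \<and> \<phi> (?\<Phi> k z) \<noteq> 0")
    case False
    then show ?thesis using M0 cutoff'_nonneg by (auto simp: G_def W_def)
  next
    case True
    let ?x = "fst z" and ?t = "1 / real (Suc k) * snd z"
    have "norm (hproj ?n ?c ?x - ?c *\<^sub>R ?n) \<le> norm (?\<Phi> k z)"
      by (rule norm_hproj_le[OF n])
    also have "\<dots> \<le> B" using True B by blast
    finally have 1: "norm (hproj ?n ?c ?x - ?c *\<^sub>R ?n) \<le> B" .
    have "norm ?x \<le> norm (hproj ?n ?c ?x - ?c *\<^sub>R ?n) + \<bar>?c\<bar> + 1/2"
      by (rule norm_slab_le[OF n]) (use True in simp)
    also have "\<dots> \<le> B + \<bar>?c\<bar> + 1/2" using 1 by simp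
    finally have "fst z \<in> cball 0 (B + \<bar>?c\<bar> + 1/2)" by simp
    then have "W z = M * cutoff' (snd z)" by (simp add: W_def)
    moreover have "norm (G k z) = cutoff' (snd z) * (cut (facets K - {\<sigma>}) k (?\<Phi> k z) * \<bar>\<phi> (?\<Phi> k z)\<bar>)"
      using True cutoff'_nonneg cut_bounds(1) by (simp add: G_def abs_mult)
    moreover have "cut (facets K - {\<sigma>}) k (?\<Phi> k z) * \<bar>\<phi> (?\<Phi> k z)\<bar> \<le> 1 * M"
      using M cut_bounds by (intro mult_mono) auto
    ultimately show ?thesis using cutoff'_nonneg by (simp add: mult.commute[of M] mult_left_mono)
  qed
  have AEz: "AE z in lborel. (\<lambda>k. G k z) \<longlonglongrightarrow> L z"
  proof -
    let ?P = "\<lambda>x. \<forall>\<tau>\<in>facets K - {\<sigma>}. cv \<tau> - nv \<tau> \<bullet> hproj ?n ?c x \<noteq> 0"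
    have "{z \<in> space (lborel \<Otimes>\<^sub>M lborel). ?P (fst z)} \<in> sets (lborel \<Otimes>\<^sub>M (lborel :: real measure))"
    proof (rule sets.sets_Collect_finite_All)
      show "finite (facets K - {\<sigma>})" using finite_facets by simp
      show "{z \<in> space (lborel \<Otimes>\<^sub>M lborel). cv \<tau> - nv \<tau> \<bullet> hproj ?n ?c (fst z) \<noteq> 0} \<in> sets (lborel \<Otimes>\<^sub>M (lborel :: real measure))" for \<tau>
        by measurable
    qed
    then have "AE z in lborel \<Otimes>\<^sub>M (lborel :: real measure). ?P (fst z)"
      using facets_degenerate_null[OF s] by (intro lborel_pair.AE_pair_measure) auto
    then show ?thesis unfolding lborel_prod
    proof eventually_elim
      case (elim z)
      let ?y = "hproj ?n ?c (fst z)"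
      have "(\<lambda>k. ?y - (1 / real (Suc k) * snd z) *\<^sub>R ?n) \<longlonglongrightarrow> ?y - (0 * snd z) *\<^sub>R ?n"
        by (intro tendsto_intros LIMSEQ_Suc[OF lim_1_over_n])
      then have 1: "(\<lambda>k. \<phi> (?\<Phi> k z)) \<longlonglongrightarrow> \<phi> ?y"
        using c1c_continuous[OF \<phi>] by (intro isCont_tendsto_compose[of _ \<phi>]) (auto simp: continuous_on_eq_continuous_at)
      have 2: "(\<lambda>k. cut (facets K - {\<sigma>}) k (?\<Phi> k z)) \<longlonglongrightarrow> indicator \<sigma> ?y"
        by (rule cut_facet_limit[OF s inner_hproj[OF n] elim])
      show ?case unfolding G_def L_def
        by (intro tendsto_mult tendsto_const 1 2)
    qed
  qed
  have Lm: "L \<in> borel_measurable lborel"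
  proof -
    have "L \<in> borel_measurable (borel \<Otimes>\<^sub>M borel)" unfolding L_def by measurable
    then show ?thesis unfolding borel_prod by simp
  qed
  have lim: "(\<lambda>k. LINT z|lborel. G k z) \<longlonglongrightarrow> (LINT z|lborel. L z)"
    by (rule integral_dominated_convergence[OF Lm borel_measurable_integrable[OF Gint] W AEz])
      (use bound in auto)
  have Lint: "integrable lborel L"
    by (rule integrable_dominated_convergence[OF Lm borel_measurable_integrable[OF Gint] W AEz])
      (use bound in auto)
  have "(LINT z|lborel. L z) = (LINT z|(lborel \<Otimes>\<^sub>M lborel). L z)" unfolding lborel_prod ..
  also have "\<dots> = (LINT x|lborel. LINT t|lborel. L (x, t))"
    by (rule lborel_pair.integral_fst'[symmetric]) (unfold lborel_prod, rule Lint)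
  also have "\<dots> = (LINT x|lborel. indicator (cylinder \<sigma>) x *\<^sub>R \<phi> (hproj ?n ?c x))"
  proof (rule Bochner_Integration.integral_cong[OF refl])
    fix x :: "real^'d"
    have "(LINT t|lborel. L (x, t)) = (LINT t|lborel. cutoff' t * (indicator (slab ?n ?c) x * (indicator \<sigma> (hproj ?n ?c x) * \<phi> (hproj ?n ?c x))))"
      by (simp add: L_def mult_ac)
    also have "\<dots> = indicator (slab ?n ?c) x * (indicator \<sigma> (hproj ?n ?c x) * \<phi> (hproj ?n ?c x))"
      by (subst integral_mult_left_zero) (simp add: cutoff'_integral(2))
    finally show "(LINT t|lborel. L (x, t)) = indicator (cylinder \<sigma>) x *\<^sub>R \<phi> (hproj ?n ?c x)"
      by (simp add: cylinder_eq[OF n facet_aff[OF s]] indicator_def)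
  qed
  also have "\<dots> = (LINT x:\<sigma>|surf \<sigma>. \<phi> x)"
    by (rule surf_integral[OF n facet_aff[OF s] sb, symmetric]) simp
  finally show ?thesis using lim by (simp add: eq)
qed

text \<open>The limit of \<open>cut_integral\<close>: the smooth cutoffs tend to the indicator of
  \<open>K\<close> almost everywhere, and each layer tends to its face integral.\<close>

theorem divergence_theorem:
  assumes \<phi>: "c1c \<phi>"
  shows "(LINT x:K|lborel. pd i \<phi> x) = (\<Sum>\<sigma>\<in>facets K. nv \<sigma> $ i * (LINT x:\<sigma>|surf \<sigma>. \<phi> x))"
proof -
  have [measurable]: "pd i \<phi> \<in> borel_measurable borel"
    using \<phi> by (auto simp: c1c_def intro: borel_measurable_continuous_onI)
  have [measurable]: "cut F k \<in> borel_measurable borel" for F k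
    by (intro borel_measurable_continuous_onI continuous_intros)
  have [measurable]: "K \<in> sets borel" using closed by (rule borel_closed)
  have "(\<lambda>k. LINT x|lborel. cut (facets K) k x * pd i \<phi> x) \<longlonglongrightarrow> (LINT x|lborel. indicator K x * pd i \<phi> x)"
  proof (rule integral_dominated_convergence[where w = "\<lambda>x. \<bar>pd i \<phi> x\<bar>"])
    show "integrable lborel (\<lambda>x. \<bar>pd i \<phi> x\<bar>)" using c1c_square_integrable(4)[OF \<phi>] by simp
    show "AE x in lborel. (\<lambda>k. cut (facets K) k x * pd i \<phi> x) \<longlonglongrightarrow> indicator K x * pd i \<phi> x"
      using cut_limit by eventually_elim (intro tendsto_mult tendsto_const)
    show "AE x in lborel. norm (cut (facets K) k x * pd i \<phi> x) \<le> \<bar>pd i \<phi> x\<bar>" for k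
      using cut_bounds(3) by (auto simp: abs_mult intro!: mult_left_le_one_le)
  qed auto
  moreover have "(\<lambda>k. LINT x|lborel. cut (facets K) k x * pd i \<phi> x) \<longlonglongrightarrow> (\<Sum>\<sigma>\<in>facets K. nv \<sigma> $ i * (LINT x:\<sigma>|surf \<sigma>. \<phi> x))"
    unfolding cut_integral[OF \<phi>] by (intro tendsto_intros facet_layer_limit[OF \<phi>])
  ultimately show ?thesis unfolding set_lebesgue_integral_def using LIMSEQ_unique by fastforce
qed

end

section \<open>Cells as convex bodies, adjacency, volumes, and connectedness through interior
  faces\<close>

section \<open>Geometry of the mesh\<close>

lemma q1_map_continuous: "continuous_on A (q1_map v)"
proof -
  have "continuous_on A (\<lambda>x::real^'a::finite. if i \<in> s then x $ i else 1 - x $ i)" for i :: 'a and s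
    by (cases "i \<in> s") (auto intro!: continuous_intros)
  then show ?thesis unfolding q1_map_def[abs_def] by (intro continuous_intros)
qed

lemma negligible_low_aff_dim:
  fixes A :: "'a::euclidean_space set"
  assumes "aff_dim A < int DIM('a)"
  shows "negligible A"
proof -
  have "negligible (affine hull A)"
    using assms low_dim_interior[of "affine hull A"] negligible_convex_interior[OF convex_affine_hull[of A]]
    by (simp add: aff_dim_affine_hull)
  then show ?thesis using negligible_subset hull_subset by metis
qed

lemma simplex_cell_convex_body:
  fixes K :: "(real^'d::finite) set"
  assumes "simplex_cell K"
  shows "convex_body K"
proof
  obtain C where C: "\<not> affine_dependent C" "int (card C) = int CARD('d) + 1" "K = convex hull C"
    using assms unfolding simplex_cell_def simplex_def by auto
  have fin: "finite C" using C(1) aff_independent_finite by blast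
  show "polytope K" using C(3) fin polytope_convex_hull by blast
  have "aff_dim K = int CARD('d)" using C aff_dim_affine_independent[of C] by (simp add: aff_dim_convex_hull)
  then have "affine hull K = UNIV" using aff_dim_eq_full[of K] by simp
  then have "interior K = rel_interior K" using rel_interior_interior by blast
  moreover have "K \<noteq> {}" using \<open>aff_dim K = _\<close> by auto
  ultimately show "interior K \<noteq> {}" using C(3) convex_convex_hull rel_interior_eq_empty by metis
qed

text \<open>The interior is nonempty by invariance of domain: the open cube has an open image under
  the continuous injective map \<open>q1_map v\<close>.\<close>

lemma q1_cell_convex_body:
  fixes K :: "(real^'d::finite) set"
  assumes "q1_cell K v"
  shows "convex_body K"
proof
  have K: "K = convex hull (range v)" "inj_on (q1_map v) (cbox 0 1)" "q1_map v ` cbox 0 1 = K"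
    using assms by (auto simp: q1_cell_def)
  show "polytope K" unfolding K(1) by (intro polytope_convex_hull) simp
  have "open (q1_map v ` box 0 1)"
    by (rule invariance_of_domain[OF q1_map_continuous open_box inj_on_subset[OF K(2) box_subset_cbox]])
  moreover have "q1_map v ` box 0 1 \<subseteq> K" using K(3) box_subset_cbox by blast
  ultimately have "q1_map v ` box 0 1 \<subseteq> interior K" by (rule interior_maximal[rotated])
  moreover have "box (0::real^'d) 1 \<noteq> {}" by (simp add: box_ne_empty Basis_vec_def inner_axis)
  ultimately show "interior K \<noteq> {}" by blast
qed

lemma hyperplane_unit_normal:
  fixes a b :: "'a::euclidean_space"
  assumes a: "norm a = 1" and b: "norm b = 1" and eq: "{x. a \<bullet> x = c} = {x. b \<bullet> x = d}" and y: "a \<bullet> y = c"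
  shows "b = a \<or> b = - a"
proof -
  have by': "b \<bullet> y = d" using eq y by blast
  have "b \<bullet> w = 0" if "a \<bullet> w = 0" for w
  proof -
    have "y + w \<in> {x. a \<bullet> x = c}" using y that by (simp add: inner_add_right)
    then have "b \<bullet> (y + w) = d" using eq by blast
    then show ?thesis using by' by (simp add: inner_add_right)
  qed
  then show ?thesis using inner_orthogonal_unit[OF a] inner_unit_eq_one[OF a b] by blast
qed

locale staggered_discretization =
  fixes S :: "'d::finite staggered"
  assumes dim: "CARD('d) = 2 \<or> CARD('d) = 3"
    and mesh: "staggered_mesh S"
begin

lemma primal: "primal_mesh S"
  using mesh by (simp add: staggered_mesh_def)

lemma finite_cells: "finite (cells S)"
  using primal by (simp add: primal_mesh_def)

lemma region_props: "open (region S)" "bounded (region S)" "connected (region S)" "region S \<noteq> {}"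
  using primal by (auto simp: primal_mesh_def)

lemma Union_cells: "\<Union>(cells S) = closure (region S)"
  using primal by (simp add: primal_mesh_def)

lemma cell_body: "K \<in> cells S \<Longrightarrow> convex_body K"
proof -
  assume "K \<in> cells S"
  moreover have "\<forall>K\<in>cells S. simplex_cell K \<or> (\<exists>v. q1_cell K v)" using primal by (simp add: primal_mesh_def)
  ultimately show ?thesis using simplex_cell_convex_body q1_cell_convex_body by blast
qed

lemma interiors_disjoint: "K \<in> cells S \<Longrightarrow> L \<in> cells S \<Longrightarrow> K \<noteq> L \<Longrightarrow> interior K \<inter> interior L = {}"
  using primal by (simp add: primal_mesh_def)

lemma interior_disjoint_cell:
  assumes "K \<in> cells S" "L \<in> cells S" "K \<noteq> L"
  shows "interior K \<inter> L = {}"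
  using interiors_disjoint[OF assms] open_Int_closure_eq_empty[OF open_interior, of K "interior L"]
    convex_body.closure_interior[OF cell_body[OF assms(2)]] by simp

lemma finite_faces: "finite (faces S)"
  unfolding faces_def using finite_cells convex_body.finite_facets[OF cell_body] by auto

lemma finite_int_faces: "finite (int_faces S)"
  using finite_faces by (simp add: int_faces_def)

lemma faces_split: "K \<in> cells S \<Longrightarrow> \<sigma> \<in> facets K \<Longrightarrow> \<sigma> \<in> int_faces S \<or> \<sigma> \<in> ext_faces S"
  by (auto simp: int_faces_def faces_def)

lemma faces_union: "faces S = int_faces S \<union> ext_faces S"
  by (auto simp: int_faces_def ext_faces_def)

lemma int_not_ext: "\<sigma> \<in> int_faces S \<Longrightarrow> \<sigma> \<notin> ext_faces S"
  by (simp add: int_faces_def)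

text \<open>Two unit normals of one hyperplane are equal or opposite. If they were equal, both cells
  would contain the same open half ball at a relative interior point of \<sigma>, and their
  interiors would meet.\<close>

lemma opposite_normals:
  assumes K: "K \<in> cells S" and L: "L \<in> cells S" and KL: "K \<noteq> L" and sK: "\<sigma> \<in> facets K" and sL: "\<sigma> \<in> facets L"
  shows "outward_normal L \<sigma> = - outward_normal K \<sigma>"
proof (rule ccontr)
  assume ne: "outward_normal L \<sigma> \<noteq> - outward_normal K \<sigma>"
  interpret K: convex_body K by (rule cell_body[OF K])
  interpret L: convex_body L by (rule cell_body[OF L])
  let ?n = "outward_normal K \<sigma>" and ?c = "facet_offset K \<sigma>"
  obtain y where y: "y \<in> rel_interior \<sigma>" using K.rel_interior_facet_nonempty[OF sK] by auto
  then have ys: "y \<in> \<sigma>" using rel_interior_subset by auto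
  have yK: "?n \<bullet> y = ?c" using K.facet_eq[OF sK] ys by blast
  have yL: "outward_normal L \<sigma> \<bullet> y = facet_offset L \<sigma>" using L.facet_eq[OF sL] ys by blast
  have n: "norm ?n = 1" by (rule K.norm_normal[OF sK])
  have "{x. ?n \<bullet> x = ?c} = {x. outward_normal L \<sigma> \<bullet> x = facet_offset L \<sigma>}"
    using K.facet_aff[OF sK] L.facet_aff[OF sL] by simp
  then have eq: "outward_normal L \<sigma> = ?n"
    using hyperplane_unit_normal[OF n L.norm_normal[OF sL] _ yK] ne by blast
  then have ceq: "facet_offset L \<sigma> = ?c" using yK yL by simp
  obtain r where r: "r > 0" "ball y r \<inter> {x. ?n \<bullet> x < ?c} \<subseteq> interior K"
    using K.facet_half_ball_interior[OF sK y] .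
  obtain r' where r': "r' > 0" "ball y r' \<inter> {x. ?n \<bullet> x < ?c} \<subseteq> interior L"
    using L.facet_half_ball_interior[OF sL y] unfolding eq ceq .
  define p where "p = y - (min r r' / 2) *\<^sub>R ?n"
  have "dist y p < r" "dist y p < r'" using r r' n by (auto simp: p_def dist_norm)
  moreover have "?n \<bullet> p < ?c" using yK n r r' by (simp add: p_def inner_diff_right norm_eq_1)
  ultimately have "p \<in> interior K \<inter> interior L" using r r' by auto
  then show False using interiors_disjoint[OF K L KL] by simp
qed

text \<open>A third cell with facet \<sigma> would have a normal opposite to those of both
  \<open>K\<close> and \<open>L\<close>, which are opposite to each other. Hence
  \<open>other_cell\<close> is well defined at interior faces.\<close>

lemma int_face_cells:
  assumes "\<sigma> \<in> int_faces S"
  obtains K L where "K \<in> cells S" "L \<in> cells S" "K \<noteq> L" "\<sigma> \<in> facets K" "\<sigma> \<in> facets L" "K \<inter> L = \<sigma>"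
    "cells_of S \<sigma> = {K, L}" "outward_normal L \<sigma> = - outward_normal K \<sigma>"
proof -
  have "\<forall>\<sigma>\<in>int_faces S. \<exists>K\<in>cells S. \<exists>L\<in>cells S. K \<noteq> L \<and> \<sigma> \<in> facets K \<and> \<sigma> \<in> facets L \<and> K \<inter> L = \<sigma>"
    using primal by (simp add: primal_mesh_def)
  then obtain K L where KL: "K \<in> cells S" "L \<in> cells S" "K \<noteq> L" "\<sigma> \<in> facets K" "\<sigma> \<in> facets L" "K \<inter> L = \<sigma>"
    using assms by meson
  have "M = K \<or> M = L" if M: "M \<in> cells_of S \<sigma>" for M
  proof (rule ccontr)
    assume "\<not> (M = K \<or> M = L)"
    then have ne: "M \<noteq> K" "M \<noteq> L" by auto
    have M': "M \<in> cells S" "\<sigma> \<in> facets M" using M by (auto simp: cells_of_def)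
    have "outward_normal M \<sigma> = - outward_normal K \<sigma>"
      by (rule opposite_normals[OF KL(1) M'(1) ne(1)[symmetric] KL(4) M'(2)])
    moreover have "outward_normal M \<sigma> = - outward_normal L \<sigma>"
      by (rule opposite_normals[OF KL(2) M'(1) ne(2)[symmetric] KL(5) M'(2)])
    moreover have "outward_normal L \<sigma> = - outward_normal K \<sigma>"
      by (rule opposite_normals[OF KL(1-5)])
    ultimately have eq: "outward_normal K \<sigma> = - outward_normal K \<sigma>" by (simp only: minus_minus)
    have "outward_normal K \<sigma> \<bullet> outward_normal K \<sigma> = - (outward_normal K \<sigma> \<bullet> outward_normal K \<sigma>)"
      using arg_cong[OF eq, of "\<lambda>v. v \<bullet> outward_normal K \<sigma>"] by simp
    then show False using convex_body.norm_normal[OF cell_body[OF KL(1)] KL(4)] by auto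
  qed
  then have "cells_of S \<sigma> = {K, L}" using KL by (auto simp: cells_of_def)
  then show ?thesis using that KL opposite_normals[OF KL(1-5)] by blast
qed

lemma other_cell_eq:
  assumes "cells_of S \<sigma> = {K, L}" "K \<noteq> L"
  shows "other_cell S K \<sigma> = L" "other_cell S L \<sigma> = K"
  using assms unfolding other_cell_def by (auto intro!: the_equality)

text \<open>A half-diamond is a topological cone: compactness and inclusion come from the
  homeomorphism of \<open>K\<close>, positive volume from the equal-measure clause.\<close>

lemma halfdiam_props:
  assumes K: "K \<in> cells S" and s: "\<sigma> \<in> facets K"
  shows "compact (halfdiam S K \<sigma>)" "halfdiam S K \<sigma> \<subseteq> K" "vol (halfdiam S K \<sigma>) > 0"
proof -
  interpret K: convex_body K by (rule cell_body[OF K])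
  have hd: "half_diamonds S" using mesh by (simp add: staggered_mesh_def)
  then obtain c h h' where h: "c \<in> interior K" "homeomorphism K K h h'" "halfdiam S K \<sigma> = h ` (convex hull (insert c \<sigma>))"
    using K s unfolding half_diamonds_def by meson
  have "insert c \<sigma> \<subseteq> K" using h(1) interior_subset K.facet_eq[OF s] by blast
  then have sub: "convex hull (insert c \<sigma>) \<subseteq> K" by (rule hull_minimal) (rule K.convex)
  have hc: "continuous_on K h" "h ` K = K" using h(2) by (auto simp: homeomorphism_def)
  have "compact \<sigma>" using K.facet_polytope[OF s] polytope_imp_compact by blast
  then have "compact (convex hull (insert c \<sigma>))" by (intro compact_convex_hull compact_insert)
  then show "compact (halfdiam S K \<sigma>)" unfolding h(3)
    by (intro compact_continuous_image continuous_on_subset[OF hc(1) sub])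
  show "halfdiam S K \<sigma> \<subseteq> K" unfolding h(3) using sub hc(2) by blast
  have "vol (halfdiam S K \<sigma>) = vol K / card (facets K)"
    using hd K s unfolding half_diamonds_def by meson
  moreover have "card (facets K) > 0" using s K.finite_facets by (auto simp: card_gt_0_iff)
  ultimately show "vol (halfdiam S K \<sigma>) > 0" using K.vol_pos by simp
qed

lemma cells_Int_negligible:
  assumes "K \<in> cells S" "L \<in> cells S" "K \<noteq> L"
  shows "negligible (K \<inter> L)"
proof -
  have "K \<inter> L \<subseteq> frontier K"
    using interior_disjoint_cell[OF assms] convex_body.closed[OF cell_body[OF assms(1)]]
    by (auto simp: frontier_def)
  then show ?thesis using negligible_convex_frontier[OF convex_body.convex[OF cell_body[OF assms(1)]]] negligible_subset by blast
qed

lemma cell_lmeasurable: "K \<in> cells S \<Longrightarrow> K \<in> lmeasurable"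
  using convex_body.compact[OF cell_body] lmeasurable_compact by blast

lemma vol_diam:
  assumes s: "\<sigma> \<in> int_faces S"
  shows "vol (diam S \<sigma>) = (\<Sum>K\<in>cells_of S \<sigma>. vol (halfdiam S K \<sigma>))" "vol (diam S \<sigma>) > 0"
proof -
  have c: "K \<in> cells S" "\<sigma> \<in> facets K" if "K \<in> cells_of S \<sigma>" for K using that by (auto simp: cells_of_def)
  have fin: "finite (cells_of S \<sigma>)" using finite_cells by (simp add: cells_of_def)
  show eq: "vol (diam S \<sigma>) = (\<Sum>K\<in>cells_of S \<sigma>. vol (halfdiam S K \<sigma>))"
    unfolding diam_def
  proof (rule measure_negligible_finite_Union_image[OF fin])
    show "halfdiam S K \<sigma> \<in> lmeasurable" if "K \<in> cells_of S \<sigma>" for K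
      using halfdiam_props(1)[OF c[OF that]] lmeasurable_compact by blast
    show "pairwise (\<lambda>K L. negligible (halfdiam S K \<sigma> \<inter> halfdiam S L \<sigma>)) (cells_of S \<sigma>)"
      unfolding pairwise_def
    proof (intro ballI impI)
      fix K L assume KL: "K \<in> cells_of S \<sigma>" "L \<in> cells_of S \<sigma>" "K \<noteq> L"
      have "halfdiam S K \<sigma> \<inter> halfdiam S L \<sigma> \<subseteq> K \<inter> L" using halfdiam_props(2) c KL by blast
      then show "negligible (halfdiam S K \<sigma> \<inter> halfdiam S L \<sigma>)"
        using cells_Int_negligible c KL negligible_subset by metis
    qed
  qed
  obtain K L where "cells_of S \<sigma> = {K, L}" using int_face_cells[OF s] by metis
  then show "vol (diam S \<sigma>) > 0" unfolding eq using fin halfdiam_props(3) c by (intro sum_pos) auto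
qed

lemma frontier_region_negligible: "negligible (frontier (region S))"
proof -
  have "polyhedral_boundary (region S)" using primal by (simp add: primal_mesh_def)
  then obtain P where P: "finite P" "\<forall>A\<in>P. polytope A \<and> aff_dim A = int CARD('d) - 1" "frontier (region S) = \<Union>P"
    unfolding polyhedral_boundary_def by meson
  show ?thesis unfolding P(3)
  proof (rule negligible_Union[OF P(1)])
    show "negligible A" if "A \<in> P" for A using P(2) that by (intro negligible_low_aff_dim) auto
  qed
qed

lemma cells_nonempty: "cells S \<noteq> {}"
  using Union_cells region_props(4) closure_subset by fastforce

lemma region_lmeasurable: "region S \<in> lmeasurable"
  using region_props by (simp add: lmeasurable_open)

text \<open>The cells overlap only in their frontiers, and their union exceeds the open region only
  by its frontier, which lies in finitely many polytopes of dimension \<open>d - 1\<close>; all of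
  these are null sets.\<close>

lemma sum_vol_cells: "(\<Sum>K\<in>cells S. vol K) = vol (region S)"
proof -
  have "vol (\<Union>(cells S)) = (\<Sum>K\<in>cells S. vol K)"
    by (rule measure_negligible_finite_Union[OF finite_cells cell_lmeasurable])
      (auto simp: pairwise_def cells_Int_negligible)
  moreover have "vol (closure (region S)) = vol (region S)"
  proof (rule measure_negligible_symdiff[OF region_lmeasurable])
    have "(region S - closure (region S)) \<union> (closure (region S) - region S) \<subseteq> frontier (region S)"
      using closure_subset interior_subset by (auto simp: frontier_def)
    then show "negligible ((region S - closure (region S)) \<union> (closure (region S) - region S))"
      using frontier_region_negligible negligible_subset by blast
  qed
  ultimately show ?thesis unfolding Union_cells by simp
qed

lemma vol_cell_pos: "K \<in> cells S \<Longrightarrow> vol K > 0"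
  using convex_body.vol_pos[OF cell_body] .

lemma vol_region_pos: "vol (region S) > 0"
  unfolding sum_vol_cells[symmetric] using finite_cells cells_nonempty vol_cell_pos by (intro sum_pos) auto

lemma cellwise_eq:
  assumes "K \<in> cells S" "x \<in> interior K"
  shows "cellwise S q x = q K"
proof -
  have "cellwise S q x = (\<Sum>L\<in>cells S. if L = K then q K else 0)"
    unfolding cellwise_def
  proof (rule sum.cong[OF refl])
    fix L assume L: "L \<in> cells S"
    show "q L * indicator (interior L) x = (if L = K then q K else 0)"
      using interiors_disjoint[OF L assms(1)] assms(2) by (auto simp: indicator_def)
  qed
  then show ?thesis using finite_cells assms(1) by simp
qed

lemma AE_in_cell_interior: "AE x in lebesgue_on (region S). \<exists>K\<in>cells S. x \<in> interior K"
proof -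
  have "negligible (\<Union>K\<in>cells S. frontier K)"
    using finite_cells negligible_convex_frontier convex_body.convex[OF cell_body]
    by (intro negligible_Union) auto
  then have "(\<Union>K\<in>cells S. frontier K) \<in> null_sets lebesgue" by (simp add: negligible_iff_null_sets)
  then have "AE x in lebesgue. x \<notin> (\<Union>K\<in>cells S. frontier K)" by (rule AE_not_in)
  then have "AE x in lebesgue. x \<in> region S \<longrightarrow> (\<exists>K\<in>cells S. x \<in> interior K)"
  proof eventually_elim
    case (elim x)
    show ?case
    proof
      assume "x \<in> region S"
      then have "x \<in> \<Union>(cells S)" using Union_cells closure_subset by blast
      then obtain K where "K \<in> cells S" "x \<in> K" by blast
      then show "\<exists>K\<in>cells S. x \<in> interior K" using elim closure_subset by (fastforce simp: frontier_def)
    qed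
  qed
  then show ?thesis
    using fmeasurableD[OF region_lmeasurable] by (subst AE_restrict_space_iff) auto
qed

text \<open>Projection does not increase distances, so the cylinder contains a ball around a
  relative interior point of \<sigma>. Boundedness of the cylinder counts as well, since
  \<open>measure\<close> is 0 on sets of infinite measure.\<close>

lemma area_pos:
  assumes K: "K \<in> cells S" and s: "\<sigma> \<in> facets K"
  shows "area \<sigma> > 0"
proof -
  interpret K: convex_body K by (rule cell_body[OF K])
  let ?n = "outward_normal K \<sigma>" and ?c = "facet_offset K \<sigma>"
  have n: "norm ?n = 1" and aff: "affine hull \<sigma> = {x. ?n \<bullet> x = ?c}"
    using K.norm_normal[OF s] K.facet_aff[OF s] .
  have sb[measurable]: "\<sigma> \<in> sets borel" by (rule K.facet_closed[OF s])
  have [measurable]: "cylinder \<sigma> \<in> sets borel" by (rule cylinder_borel[OF n aff sb])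
  have m: "hproj ?n ?c \<in> restrict_space lborel (cylinder \<sigma>) \<rightarrow>\<^sub>M borel"
    by (rule measurable_restrict_space1) simp
  have e: "emeasure (surf \<sigma>) \<sigma> = emeasure lborel (cylinder \<sigma>)"
  proof -
    have "emeasure (surf \<sigma>) \<sigma> = emeasure (restrict_space lborel (cylinder \<sigma>)) (hproj ?n ?c -` \<sigma> \<inter> cylinder \<sigma>)"
      unfolding surf_def aff closest_point_hyperplane[OF n]
      by (subst emeasure_distr[OF m sb]) (simp add: space_restrict_space)
    also have "hproj ?n ?c -` \<sigma> \<inter> cylinder \<sigma> = cylinder \<sigma>" by (auto simp: cylinder_eq[OF n aff])
    finally show ?thesis by (simp add: emeasure_restrict_space)
  qed
  have "bounded \<sigma>" using K.facet_polytope[OF s] polytope_imp_bounded by blast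
  then obtain B where B: "\<And>x. x \<in> \<sigma> \<Longrightarrow> norm x \<le> B" unfolding bounded_iff by auto
  have "norm x \<le> B + \<bar>?c\<bar> + \<bar>?c\<bar> + 1/2" if x: "x \<in> cylinder \<sigma>" for x
  proof -
    have x': "x \<in> slab ?n ?c" "hproj ?n ?c x \<in> \<sigma>" using x by (auto simp: cylinder_eq[OF n aff])
    have "norm (hproj ?n ?c x - ?c *\<^sub>R ?n) \<le> norm (hproj ?n ?c x) + norm (?c *\<^sub>R ?n)" by (rule norm_triangle_ineq4)
    then show ?thesis using norm_slab_le[OF n x'(1)] B[OF x'(2)] n by simp
  qed
  then have bnd: "bounded (cylinder \<sigma>)" unfolding bounded_iff by blast
  have fin: "emeasure lborel (cylinder \<sigma>) < \<infinity>" by (rule emeasure_bounded_finite[OF bnd])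
  obtain y where y: "y \<in> rel_interior \<sigma>" using K.rel_interior_facet_nonempty[OF s] by auto
  then obtain r where r: "r > 0" "ball y r \<inter> affine hull \<sigma> \<subseteq> \<sigma>" by (auto simp: mem_rel_interior_ball)
  have ys: "y \<in> \<sigma>" using y rel_interior_subset by auto
  have yn: "?n \<bullet> y = ?c" using K.facet_eq[OF s] ys by blast
  have "ball y (min r (1/2)) \<subseteq> cylinder \<sigma>"
  proof
    fix x assume x: "x \<in> ball y (min r (1/2))"
    have "dist (closest_point (affine hull \<sigma>) y) (closest_point (affine hull \<sigma>) x) \<le> dist y x"
      by (rule closest_point_lipschitz) (use K.facet_nonempty[OF s] in auto)
    moreover have "closest_point (affine hull \<sigma>) y = y"
      by (rule closest_point_self) (use ys hull_inc in fast)
    moreover have "closest_point (affine hull \<sigma>) x \<in> affine hull \<sigma>"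
      by (rule closest_point_in_set) (use K.facet_nonempty[OF s] in auto)
    ultimately have 1: "hproj ?n ?c x \<in> \<sigma>" using x r(2) by (auto simp: aff closest_point_hyperplane[OF n])
    have "\<bar>?n \<bullet> x - ?c\<bar> = \<bar>?n \<bullet> (x - y)\<bar>" using yn by (simp add: inner_diff_right)
    also have "\<dots> \<le> norm ?n * norm (x - y)" by (rule Cauchy_Schwarz_ineq2)
    finally have "x \<in> slab ?n ?c" using x n by (auto simp: slab_def dist_norm norm_minus_commute)
    then show "x \<in> cylinder \<sigma>" using 1 by (simp add: cylinder_eq[OF n aff])
  qed
  then have "emeasure lborel (ball y (min r (1/2))) \<le> emeasure lborel (cylinder \<sigma>)" by (rule emeasure_mono) simp
  moreover have "emeasure lborel (ball y (min r (1/2))) > 0"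
    using r content_ball_pos[of "min r (1/2)" y] by (simp add: measure_def enn2real_positive_iff)
  ultimately have "emeasure lborel (cylinder \<sigma>) > 0" by (rule order_less_le_trans[rotated])
  then show ?thesis using fin unfolding area_def measure_def e by (simp add: enn2real_positive_iff)
qed

text \<open>If \<open>A\<close> were not everything, the closed unions over \<open>A\<close> and
  over its complement would share a point \<open>z\<close> of the connected region. Two cells may
  touch at \<open>z\<close> along a vertex or an edge only, so one walks from \<open>K\<close> to
  \<open>L\<close> inside a ball around \<open>z\<close>, along a segment with a generic end point
  that avoids all faces of codimension two. Where the segment passes from \<open>A\<close> to the
  complement it crosses the relative interior of a facet, and the cell behind that facet must be the
  one in the complement.\<close>

lemma cells_connected:
  assumes A: "A \<subseteq> cells S" "A \<noteq> {}"
    and step: "\<And>K L \<sigma>. K \<in> A \<Longrightarrow> L \<in> cells S \<Longrightarrow> \<sigma> \<in> int_faces S \<Longrightarrow> cells_of S \<sigma> = {K, L} \<Longrightarrow> L \<in> A"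
  shows "A = cells S"
proof (rule ccontr)
  assume "A \<noteq> cells S"
  define B where "B = cells S - A"
  have B: "B \<noteq> {}" "B \<subseteq> cells S" "A \<union> B = cells S" "A \<inter> B = {}" using A \<open>A \<noteq> cells S\<close> by (auto simp: B_def)
  have closed_Un: "closed (\<Union>C)" if "C \<subseteq> cells S" for C
    using that finite_subset[OF that finite_cells] convex_body.closed[OF cell_body] by (intro closed_Union) auto
  have cov: "region S \<subseteq> \<Union>A \<union> \<Union>B" using Union_cells closure_subset B(3) by blast
  have meet: "\<Union>C \<inter> region S \<noteq> {}" if "C \<subseteq> cells S" "C \<noteq> {}" for C
  proof -
    obtain K where K: "K \<in> C" "K \<in> cells S" using \<open>C \<noteq> {}\<close> \<open>C \<subseteq> cells S\<close> by blast
    interpret K: convex_body K by (rule cell_body[OF K(2)])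
    have "interior K \<inter> closure (region S) \<noteq> {}"
      using K.interior interior_subset K(2) unfolding Union_cells[symmetric] by blast
    then have "interior K \<inter> region S \<noteq> {}" using open_Int_closure_eq_empty by blast
    then show ?thesis using K(1) interior_subset by blast
  qed
  have "\<Union>A \<inter> \<Union>B \<inter> region S \<noteq> {}"
    using region_props(3) closed_Un[OF A(1)] closed_Un[OF B(2)] cov meet[OF A] meet[OF B(2,1)]
    unfolding connected_closed by blast
  then obtain z K L where z: "z \<in> region S" and K: "K \<in> A" "z \<in> K" and L: "L \<in> B" "z \<in> L" by blast
  obtain r where r: "r > 0" "ball z r \<subseteq> region S" using z region_props(1) openE by blast
  have near: "interior M \<inter> ball p s \<noteq> {}" if M: "M \<in> cells S" "p \<in> M" "s > 0" for M p s
  proof -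
    interpret M: convex_body M by (rule cell_body[OF M(1)])
    have "p \<in> closure (interior M)" using M.closure_interior M(2) by simp
    then have "ball p s \<inter> closure (interior M) \<noteq> {}" using M(3) centre_in_ball by blast
    then show ?thesis using open_Int_closure_eq_empty[OF open_ball] by blast
  qed
  have Kc: "K \<in> cells S" and Lc: "L \<in> cells S" using A B K L by auto
  obtain a where a: "a \<in> interior K" "a \<in> ball z r" using near[OF Kc K(2) r(1)] by auto
  \<comment> \<open>All faces of codimension two, obtained as facets of facets.\<close>
  define E where "E = (\<Union>M\<in>cells S. \<Union>\<sigma>\<in>facets M. facets \<sigma>)"
  have finE: "finite E" unfolding E_def
  proof (intro finite_UN_I finite_cells)
    show "finite (facets M)" if "M \<in> cells S" for M using convex_body.finite_facets[OF cell_body[OF that]] .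
    show "finite (facets \<sigma>)" if "M \<in> cells S" "\<sigma> \<in> facets M" for M \<sigma>
      using convex_body.facet_polytope[OF cell_body[OF that(1)] that(2)] finite_polytope_facets
      by (simp add: facets_def)
  qed
  have Edim: "aff_dim e = int CARD('d) - 2" if e: "e \<in> E" for e
  proof -
    obtain M \<sigma> where M: "M \<in> cells S" "\<sigma> \<in> facets M" "e \<in> facets \<sigma>" using e by (auto simp: E_def)
    have "aff_dim e = aff_dim \<sigma> - 1" using M(3) by (simp add: facets_def facet_of_def)
    then show ?thesis using convex_body.aff_dim_facet[OF cell_body[OF M(1)] M(2)] by simp
  qed
  \<comment> \<open>A segment from \<open>a\<close> that meets \<open>e\<close> away from
    \<open>a\<close> ends in this affine hull, whose dimension is at most \<open>d - 1\<close>. Thus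
    almost every end point is admissible.\<close>
  define N where "N = (\<Union>e\<in>E. affine hull (insert a e))"
  have "negligible N" unfolding N_def
  proof (rule negligible_Union)
    show "finite ((\<lambda>e. affine hull (insert a e)) ` E)" using finE by simp
    fix t assume "t \<in> (\<lambda>e. affine hull (insert a e)) ` E"
    then obtain e where e: "e \<in> E" "t = affine hull (insert a e)" by blast
    have "aff_dim (insert a e) < int CARD('d)" using Edim[OF e(1)] by (simp add: aff_dim_insert)
    then show "negligible t" unfolding e(2) by (intro negligible_low_aff_dim) (simp add: aff_dim_affine_hull)
  qed
  moreover have "\<not> negligible (interior L \<inter> ball z r)"
    using near[OF Lc L(2) r(1)] by (intro open_not_negligible) auto
  ultimately have "\<not> (interior L \<inter> ball z r \<subseteq> N)" using negligible_subset by blast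
  then obtain b where b: "b \<in> interior L" "b \<in> ball z r" "b \<notin> N" by blast
  define T where "T = closed_segment a b"
  have T: "T \<subseteq> region S" unfolding T_def using closed_segment_subset[OF a(2) b(2) convex_ball] r(2) by blast
  have Te: "x \<notin> e" if x: "x \<in> T" and e: "e \<in> E" for x e
  proof
    assume xe: "x \<in> e"
    obtain t where t: "0 \<le> t" "t \<le> 1" "x = (1 - t) *\<^sub>R a + t *\<^sub>R b" using x by (auto simp: T_def in_segment)
    obtain M \<sigma> where M: "M \<in> cells S" "\<sigma> \<in> facets M" "e \<in> facets \<sigma>" using e by (auto simp: E_def)
    interpret M: convex_body M by (rule cell_body[OF M(1)])
    have xs: "x \<in> \<sigma>" using M(3) xe by (auto simp: facets_def facet_of_def dest: face_of_imp_subset)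
    have xM: "x \<in> M" "outward_normal M \<sigma> \<bullet> x = facet_offset M \<sigma>" using xs M.facet_eq[OF M(2)] by blast+
    \<comment> \<open>The point \<open>a\<close> is interior to \<open>K\<close>, whereas
      \<open>x\<close> lies on a facet; hence the equation for \<open>x\<close> can be solved for
      \<open>b\<close>.\<close>
    have "t \<noteq> 0"
    proof
      assume "t = 0"
      then have "x = a" using t by simp
      then have "x \<in> interior K" using a by simp
      then have "M = K" using interior_disjoint_cell[OF Kc M(1)] xM by blast
      then show False using M.interior_less[OF M(2)] xM(2) \<open>x \<in> interior K\<close> by force
    qed
    have "(1 - 1/t) *\<^sub>R a + (1/t) *\<^sub>R x = ((1 - 1/t) + (1 - t)/t) *\<^sub>R a + b"
      using \<open>t \<noteq> 0\<close> by (simp add: t(3) scaleR_add_left scaleR_add_right)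
    moreover have "(1 - 1/t) + (1 - t)/t = 0" using \<open>t \<noteq> 0\<close> by (simp add: field_simps)
    ultimately have "b = (1 - 1/t) *\<^sub>R a + (1/t) *\<^sub>R x" by simp
    moreover have "(1 - 1/t) *\<^sub>R a + (1/t) *\<^sub>R x \<in> affine hull (insert a e)"
      by (rule mem_affine[OF affine_affine_hull]) (use xe in \<open>auto intro: hull_inc\<close>)
    ultimately show False using b(3) e by (auto simp: N_def)
  qed
  have "\<Union>A \<inter> \<Union>B \<inter> T \<noteq> {}"
  proof -
    have "connected T" by (simp add: T_def)
    moreover have "T \<subseteq> \<Union>A \<union> \<Union>B" using T cov by blast
    moreover have "a \<in> \<Union>A \<inter> T" "b \<in> \<Union>B \<inter> T" using a b K L interior_subset by (auto simp: T_def)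
    ultimately show ?thesis using closed_Un[OF A(1)] closed_Un[OF B(2)] unfolding connected_closed by blast
  qed
  then obtain y K' L' where y: "y \<in> T" and K': "K' \<in> A" "y \<in> K'" and L': "L' \<in> B" "y \<in> L'" by blast
  have Kc': "K' \<in> cells S" and Lc': "L' \<in> cells S" and KL': "K' \<noteq> L'" using A B K' L' by auto
  interpret K': convex_body K' by (rule cell_body[OF Kc'])
  have "y \<in> frontier K'"
    using interior_disjoint_cell[OF Kc' Lc' KL'] K' L' closure_subset by (auto simp: frontier_def)
  then have "y \<in> rel_frontier K'" using rel_frontier_nonempty_interior[OF K'.interior] by simp
  then obtain \<sigma> where s: "\<sigma> \<in> facets K'" "y \<in> \<sigma>"
    unfolding rel_frontier_of_polyhedron[OF K'.polyhedron] by (auto simp: facets_def)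
  have yri: "y \<in> rel_interior \<sigma>"
  proof (rule ccontr)
    assume "y \<notin> rel_interior \<sigma>"
    then have "y \<in> \<sigma> - rel_interior \<sigma>" using s(2) by simp
    then obtain e where "e \<in> facets \<sigma>" "y \<in> e"
      using rel_boundary_of_polyhedron[OF polytope_imp_polyhedron[OF K'.facet_polytope[OF s(1)]]]
      by (auto simp: facets_def)
    then show False using Te[OF y] Kc' s(1) by (auto simp: E_def)
  qed
  have "y \<notin> frontier (region S)"
    using T y region_props(1) by (auto simp: frontier_def interior_open)
  then have "\<sigma> \<notin> ext_faces S" using s(2) by (auto simp: ext_faces_def)
  then have sint: "\<sigma> \<in> int_faces S" using faces_split[OF Kc' s(1)] by blast
  have "K' \<in> cells_of S \<sigma>" using Kc' s(1) by (simp add: cells_of_def)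
  moreover obtain K1 L1 where KL1: "K1 \<in> cells S" "L1 \<in> cells S" "K1 \<noteq> L1" "\<sigma> \<in> facets K1" "\<sigma> \<in> facets L1"
    "cells_of S \<sigma> = {K1, L1}"
    using int_face_cells[OF sint] .
  ultimately consider "K' = K1" | "K' = L1" by blast
  then obtain M where M: "M \<in> cells S" "M \<noteq> K'" "\<sigma> \<in> facets M" "cells_of S \<sigma> = {K', M}"
  proof cases
    case 1
    then show ?thesis using that[of L1] KL1 by simp
  next
    case 2
    then show ?thesis using that[of K1] KL1 by (simp add: insert_commute)
  qed
  interpret M: convex_body M by (rule cell_body[OF M(1)])
  have nM: "outward_normal M \<sigma> = - outward_normal K' \<sigma>" using opposite_normals[OF Kc' M(1) _ s(1) M(3)] M(2) by simp
  have yK: "outward_normal K' \<sigma> \<bullet> y = facet_offset K' \<sigma>" using K'.facet_eq[OF s(1)] s(2) by blast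
  have yM: "outward_normal M \<sigma> \<bullet> y = facet_offset M \<sigma>" using M.facet_eq[OF M(3)] s(2) by blast
  have cM: "facet_offset M \<sigma> = - facet_offset K' \<sigma>" using yK yM nM by simp
  obtain r1 where r1: "r1 > 0" "ball y r1 \<inter> {x. outward_normal K' \<sigma> \<bullet> x \<le> facet_offset K' \<sigma>} \<subseteq> K'"
    using K'.facet_half_ball[OF s(1) yri] .
  obtain r2 where r2: "r2 > 0" "ball y r2 \<inter> {x. - outward_normal K' \<sigma> \<bullet> x \<le> - facet_offset K' \<sigma>} \<subseteq> M"
    using M.facet_half_ball[OF M(3) yri] unfolding nM cM .
  \<comment> \<open>The half balls of \<open>K'\<close> and \<open>M\<close> on the two sides of
    \<sigma> fill a ball around \<open>y\<close>, and the interior of \<open>L'\<close> comes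
    arbitrarily close to \<open>y\<close>, so it meets one of them.\<close>
  have "interior L' \<inter> ball y (min r1 r2) \<noteq> {}" by (rule near[OF Lc' L'(2)]) (use r1 r2 in simp)
  then obtain p where p: "p \<in> interior L'" "p \<in> ball y (min r1 r2)" by blast
  have "p \<in> K' \<or> p \<in> M"
    using p(2) r1(2) r2(2) by (cases "outward_normal K' \<sigma> \<bullet> p \<le> facet_offset K' \<sigma>") auto
  then have "p \<in> M" using interior_disjoint_cell[OF Lc' Kc'] KL' p(1) by blast
  then have "L' = M" using interior_disjoint_cell[OF Lc' M(1)] p(1) by blast
  then have "L' \<in> A" using step[OF K'(1) Lc' sint] M(4) by simp
  then show False using L' B by blast
qed

end

section \<open>Discrete integration by parts, a Poincare inequality, and stability of the
  velocity-pressure system\<close>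

section \<open>Discrete calculus\<close>

text \<open>The positive root of \<open>t\<^sup>2 = m * (t + 1)\<close> is at most
  \<open>m + 1\<close>.\<close>

lemma quadratic_bound:
  fixes y Q m :: real
  assumes y: "0 \<le> y" and Q: "0 \<le> Q" and m: "0 \<le> m" and le: "y\<^sup>2 \<le> m * (y * Q + Q\<^sup>2)"
  shows "y \<le> (m + 1) * Q"
proof (rule ccontr)
  assume "\<not> y \<le> (m + 1) * Q"
  then obtain s where s: "y = (m + 1) * Q + s" "s > 0" by (metis add.commute diff_add_cancel diff_gt_0_iff_gt not_le)
  have "y\<^sup>2 - m * (y * Q + Q\<^sup>2) = Q\<^sup>2 + (m + 2) * (Q * s) + s\<^sup>2"
    unfolding s(1) by (simp add: algebra_simps power2_eq_square)
  moreover have "(m + 2) * (Q * s) \<ge> 0" "s\<^sup>2 > 0" using s Q m by auto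
  ultimately show False using le zero_le_power2[of Q] by linarith
qed

context staggered_discretization
begin

lemma sum_cells_facets:
  fixes \<Phi> :: "(real^'d) set \<Rightarrow> (real^'d) set \<Rightarrow> 'b::comm_monoid_add"
  shows "(\<Sum>K\<in>cells S. \<Sum>\<sigma>\<in>facets K. if \<sigma> \<in> int_faces S then \<Phi> K \<sigma> else 0) = (\<Sum>\<sigma>\<in>int_faces S. \<Sum>K\<in>cells_of S \<sigma>. \<Phi> K \<sigma>)"
proof -
  have "(\<Sum>\<sigma>\<in>facets K. if \<sigma> \<in> int_faces S then \<Phi> K \<sigma> else 0) = (\<Sum>\<sigma>\<in>int_faces S. if K \<in> cells_of S \<sigma> then \<Phi> K \<sigma> else 0)"
    if K: "K \<in> cells S" for K
  proof -
    have fin: "finite (facets K)" using convex_body.finite_facets[OF cell_body[OF K]] .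
    have "(\<Sum>\<sigma>\<in>facets K. if \<sigma> \<in> int_faces S then \<Phi> K \<sigma> else 0) = (\<Sum>\<sigma>\<in>facets K \<inter> int_faces S. \<Phi> K \<sigma>)"
      using sum.inter_restrict[OF fin] by metis
    also have "\<dots> = (\<Sum>\<sigma>\<in>int_faces S \<inter> {\<sigma>. K \<in> cells_of S \<sigma>}. \<Phi> K \<sigma>)"
      using K by (intro sum.cong) (auto simp: cells_of_def)
    also have "\<dots> = (\<Sum>\<sigma>\<in>int_faces S. if K \<in> cells_of S \<sigma> then \<Phi> K \<sigma> else 0)"
      by (simp add: sum.inter_restrict[OF finite_int_faces])
    finally show ?thesis .
  qed
  then have "(\<Sum>K\<in>cells S. \<Sum>\<sigma>\<in>facets K. if \<sigma> \<in> int_faces S then \<Phi> K \<sigma> else 0)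
      = (\<Sum>K\<in>cells S. \<Sum>\<sigma>\<in>int_faces S. if K \<in> cells_of S \<sigma> then \<Phi> K \<sigma> else 0)"
    by (rule sum.cong[OF refl])
  also have "\<dots> = (\<Sum>\<sigma>\<in>int_faces S. \<Sum>K\<in>cells S. if K \<in> cells_of S \<sigma> then \<Phi> K \<sigma> else 0)"
    by (rule sum.swap)
  also have "\<dots> = (\<Sum>\<sigma>\<in>int_faces S. \<Sum>K\<in>cells_of S \<sigma>. \<Phi> K \<sigma>)"
  proof (rule sum.cong[OF refl])
    fix \<sigma>
    have "cells S \<inter> cells_of S \<sigma> = cells_of S \<sigma>" by (auto simp: cells_of_def)
    then show "(\<Sum>K\<in>cells S. if K \<in> cells_of S \<sigma> then \<Phi> K \<sigma> else 0) = (\<Sum>K\<in>cells_of S \<sigma>. \<Phi> K \<sigma>)"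
      using sum.inter_restrict[OF finite_cells, of "\<lambda>K. \<Phi> K \<sigma>" "cells_of S \<sigma>"] by simp
  qed
  finally show ?thesis .
qed

text \<open>The same choice as in \<open>grad_p\<close>; it fixes an orientation of every interior
  face.\<close>

definition first_cell :: "(real^'d) set \<Rightarrow> (real^'d) set" where
  "first_cell \<sigma> = (SOME K. K \<in> cells_of S \<sigma>)"

definition second_cell :: "(real^'d) set \<Rightarrow> (real^'d) set" where
  "second_cell \<sigma> = other_cell S (first_cell \<sigma>) \<sigma>"

lemma face_cells:
  assumes "\<sigma> \<in> int_faces S"
  shows "cells_of S \<sigma> = {first_cell \<sigma>, second_cell \<sigma>}" "first_cell \<sigma> \<noteq> second_cell \<sigma>"
    "outward_normal (second_cell \<sigma>) \<sigma> = - outward_normal (first_cell \<sigma>) \<sigma>"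
    "other_cell S (second_cell \<sigma>) \<sigma> = first_cell \<sigma>"
    "first_cell \<sigma> \<in> cells S" "second_cell \<sigma> \<in> cells S" "\<sigma> \<in> facets (first_cell \<sigma>)" "\<sigma> \<in> facets (second_cell \<sigma>)"
proof -
  obtain K L where KL: "K \<in> cells S" "L \<in> cells S" "K \<noteq> L" "\<sigma> \<in> facets K" "\<sigma> \<in> facets L"
    "cells_of S \<sigma> = {K, L}" "outward_normal L \<sigma> = - outward_normal K \<sigma>"
    using int_face_cells[OF assms] by metis
  have "first_cell \<sigma> \<in> cells_of S \<sigma>" unfolding first_cell_def by (rule someI[of _ K]) (simp add: KL)
  then have "first_cell \<sigma> = K \<or> first_cell \<sigma> = L" by (simp add: KL(6))
  then have "cells_of S \<sigma> = {first_cell \<sigma>, second_cell \<sigma>} \<and> first_cell \<sigma> \<noteq> second_cell \<sigma> \<and>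
    outward_normal (second_cell \<sigma>) \<sigma> = - outward_normal (first_cell \<sigma>) \<sigma> \<and>
    other_cell S (second_cell \<sigma>) \<sigma> = first_cell \<sigma> \<and>
    first_cell \<sigma> \<in> cells S \<and> second_cell \<sigma> \<in> cells S \<and> \<sigma> \<in> facets (first_cell \<sigma>) \<and> \<sigma> \<in> facets (second_cell \<sigma>)"
    using KL other_cell_eq[OF KL(6,3)] unfolding second_cell_def
    by (elim disjE) (simp_all add: insert_commute)
  then show "cells_of S \<sigma> = {first_cell \<sigma>, second_cell \<sigma>}" "first_cell \<sigma> \<noteq> second_cell \<sigma>"
    "outward_normal (second_cell \<sigma>) \<sigma> = - outward_normal (first_cell \<sigma>) \<sigma>"
    "other_cell S (second_cell \<sigma>) \<sigma> = first_cell \<sigma>"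
    "first_cell \<sigma> \<in> cells S" "second_cell \<sigma> \<in> cells S" "\<sigma> \<in> facets (first_cell \<sigma>)" "\<sigma> \<in> facets (second_cell \<sigma>)"
    by blast+
qed

lemma norm_face_normal: "\<sigma> \<in> int_faces S \<Longrightarrow> norm (outward_normal (first_cell \<sigma>) \<sigma>) = 1"
  using convex_body.norm_normal[OF cell_body[OF face_cells(5)] face_cells(7)] by simp

lemma area_int_pos: "\<sigma> \<in> int_faces S \<Longrightarrow> area \<sigma> > 0"
  using area_pos[OF face_cells(5) face_cells(7)] by simp

definition upwind :: "'d cellfun \<Rightarrow> 'd facefun \<Rightarrow> (real^'d) set \<Rightarrow> real" where
  "upwind \<rho> u \<sigma> = (if u \<sigma> \<bullet> outward_normal (first_cell \<sigma>) \<sigma> \<ge> 0 then \<rho> (first_cell \<sigma>) else \<rho> (second_cell \<sigma>))"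

lemma upwind_cases: "upwind \<rho> u \<sigma> = \<rho> (first_cell \<sigma>) \<or> upwind \<rho> u \<sigma> = \<rho> (second_cell \<sigma>)"
  by (simp add: upwind_def)

text \<open>Seen from \<open>second_cell\<close> both the sign of the normal velocity and the order
  of the cells are reversed, so the two cells select the same density. At zero normal velocity they
  may differ, but then the flux vanishes.\<close>

lemma flux_upwind:
  assumes s: "\<sigma> \<in> int_faces S" and K: "K \<in> cells_of S \<sigma>"
  shows "flux S \<rho> u K \<sigma> = area \<sigma> * upwind \<rho> u \<sigma> * (u \<sigma> \<bullet> outward_normal K \<sigma>)"
proof -
  consider "K = first_cell \<sigma>" | "K = second_cell \<sigma>" using K face_cells(1)[OF s] by auto
  then show ?thesis
    using int_not_ext[OF s] face_cells(3,4)[OF s]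
    by cases (auto simp: flux_def upwind_def second_cell_def[symmetric])
qed

lemma grad_p_eq:
  "grad_p S q \<sigma> = (area \<sigma> / vol (diam S \<sigma>) * (q (second_cell \<sigma>) - q (first_cell \<sigma>))) *\<^sub>R outward_normal (first_cell \<sigma>) \<sigma>"
  by (simp add: grad_p_def Let_def first_cell_def second_cell_def)

lemma grad_p_linear:
  "grad_p S (\<lambda>K. a * q K + b) \<sigma> = a *\<^sub>R grad_p S q \<sigma>"
  "grad_p S (\<lambda>K. q K - r K) \<sigma> = grad_p S q \<sigma> - grad_p S r \<sigma>"
proof -
  have "a * q (second_cell \<sigma>) + b - (a * q (first_cell \<sigma>) + b) = a * (q (second_cell \<sigma>) - q (first_cell \<sigma>))"
    by (simp add: right_diff_distrib)
  then show "grad_p S (\<lambda>K. a * q K + b) \<sigma> = a *\<^sub>R grad_p S q \<sigma>" by (simp add: grad_p_eq)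
  have "q (second_cell \<sigma>) - r (second_cell \<sigma>) - (q (first_cell \<sigma>) - r (first_cell \<sigma>))
    = (q (second_cell \<sigma>) - q (first_cell \<sigma>)) - (r (second_cell \<sigma>) - r (first_cell \<sigma>))" by simp
  then show "grad_p S (\<lambda>K. q K - r K) \<sigma> = grad_p S q \<sigma> - grad_p S r \<sigma>"
    by (simp only: grad_p_eq right_diff_distrib[of "area \<sigma> / vol (diam S \<sigma>)"] scaleR_diff_left)
qed

text \<open>Discrete duality with the upwind density as weight: the two fluxes through an interior
  face are opposite, so its two cells together leave the jump of \<open>q\<close>, and external
  faces carry no flux. Since the fluxes need not be linear in \<rho> and \<open>u\<close>, the
  weight has to be exactly the upwind value.\<close>

lemma grad_flux:
  "(\<Sum>\<sigma>\<in>int_faces S. vol (diam S \<sigma>) * (upwind \<rho> u \<sigma> * (grad_p S q \<sigma> \<bullet> u \<sigma>)))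
    = - (\<Sum>K\<in>cells S. q K * (\<Sum>\<sigma>\<in>facets K. flux S \<rho> u K \<sigma>))"
proof -
  have "(\<Sum>K\<in>cells S. q K * (\<Sum>\<sigma>\<in>facets K. flux S \<rho> u K \<sigma>))
      = (\<Sum>K\<in>cells S. \<Sum>\<sigma>\<in>facets K. if \<sigma> \<in> int_faces S then q K * flux S \<rho> u K \<sigma> else 0)"
    unfolding sum_distrib_left
  proof (intro sum.cong refl)
    fix K \<sigma> assume "K \<in> cells S" "\<sigma> \<in> facets K"
    then show "q K * flux S \<rho> u K \<sigma> = (if \<sigma> \<in> int_faces S then q K * flux S \<rho> u K \<sigma> else 0)"
      using faces_split by (auto simp: flux_def)
  qed
  also have "\<dots> = (\<Sum>\<sigma>\<in>int_faces S. \<Sum>K\<in>cells_of S \<sigma>. q K * flux S \<rho> u K \<sigma>)"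
    by (rule sum_cells_facets)
  also have "\<dots> = (\<Sum>\<sigma>\<in>int_faces S. - (vol (diam S \<sigma>) * (upwind \<rho> u \<sigma> * (grad_p S q \<sigma> \<bullet> u \<sigma>))))"
  proof (rule sum.cong[OF refl])
    fix \<sigma> assume s: "\<sigma> \<in> int_faces S"
    have "(\<Sum>K\<in>cells_of S \<sigma>. q K * flux S \<rho> u K \<sigma>)
        = (\<Sum>K\<in>{first_cell \<sigma>, second_cell \<sigma>}. q K * (area \<sigma> * upwind \<rho> u \<sigma> * (u \<sigma> \<bullet> outward_normal K \<sigma>)))"
      using face_cells(1)[OF s] flux_upwind[OF s] by (intro sum.cong) auto
    also have "\<dots> = - (upwind \<rho> u \<sigma> * (area \<sigma> * (q (second_cell \<sigma>) - q (first_cell \<sigma>)) * (u \<sigma> \<bullet> outward_normal (first_cell \<sigma>) \<sigma>)))"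
      using face_cells(2,3)[OF s] by (simp add: algebra_simps)
    also have "area \<sigma> * (q (second_cell \<sigma>) - q (first_cell \<sigma>)) * (u \<sigma> \<bullet> outward_normal (first_cell \<sigma>) \<sigma>)
        = vol (diam S \<sigma>) * (grad_p S q \<sigma> \<bullet> u \<sigma>)"
      using vol_diam(2)[OF s] by (simp add: grad_p_eq inner_commute)
    also have "- (upwind \<rho> u \<sigma> * (vol (diam S \<sigma>) * (grad_p S q \<sigma> \<bullet> u \<sigma>)))
        = - (vol (diam S \<sigma>) * (upwind \<rho> u \<sigma> * (grad_p S q \<sigma> \<bullet> u \<sigma>)))" by simp
    finally show "(\<Sum>K\<in>cells_of S \<sigma>. q K * flux S \<rho> u K \<sigma>) = - (vol (diam S \<sigma>) * (upwind \<rho> u \<sigma> * (grad_p S q \<sigma> \<bullet> u \<sigma>)))" .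
  qed
  finally show ?thesis by (simp add: sum_negf)
qed

lemma div_mass_eq: "K \<in> cells S \<Longrightarrow> (\<Sum>\<sigma>\<in>facets K. flux S \<rho> u K \<sigma>) = vol K * div_mass S \<rho> u K"
  using vol_cell_pos[of K] by (simp add: div_mass_def)

lemma div_vel_eq_mass:
  assumes u: "u \<in> HE0 S"
  shows "div_vel S u K = div_mass S (\<lambda>_. 1) u K"
proof -
  have "area \<sigma> * (u \<sigma> \<bullet> outward_normal K \<sigma>) = flux S (\<lambda>_. 1) u K \<sigma>" for \<sigma>
    using u by (simp add: flux_def HE0_def)
  then show ?thesis by (simp add: div_vel_def div_mass_def)
qed

lemma grad_div:
  assumes u: "u \<in> HE0 S"
  shows "(\<Sum>\<sigma>\<in>int_faces S. vol (diam S \<sigma>) * (grad_p S q \<sigma> \<bullet> u \<sigma>)) = - (\<Sum>K\<in>cells S. q K * (vol K * div_vel S u K))"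
proof -
  have "upwind (\<lambda>_. 1) u \<sigma> = 1" for \<sigma> by (simp add: upwind_def)
  then show ?thesis
    using grad_flux[of "\<lambda>_. 1" u q] div_mass_eq by (simp add: div_vel_eq_mass[OF u] cong: sum.cong)
qed

lemma total_flux: "(\<Sum>K\<in>cells S. vol K * div_mass S \<rho> u K) = 0"
proof -
  have "grad_p S (\<lambda>_. 1) \<sigma> = 0" for \<sigma> by (simp add: grad_p_eq)
  then have z: "(\<Sum>K\<in>cells S. 1 * (\<Sum>\<sigma>\<in>facets K. flux S \<rho> u K \<sigma>)) = 0"
    using grad_flux[of \<rho> u "\<lambda>_. 1"] by simp
  have "(\<Sum>K\<in>cells S. vol K * div_mass S \<rho> u K) = (\<Sum>K\<in>cells S. 1 * (\<Sum>\<sigma>\<in>facets K. flux S \<rho> u K \<sigma>))"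
    by (rule sum.cong) (simp_all add: div_mass_eq)
  then show ?thesis using z by (rule trans)
qed

definition grad_size :: "'d cellfun \<Rightarrow> real" where
  "grad_size q = (\<Sum>\<sigma>\<in>int_faces S. norm (grad_p S q \<sigma>))"

lemma grad_size_nonneg: "0 \<le> grad_size q"
  by (simp add: grad_size_def sum_nonneg)

lemma jump_bound:
  assumes s: "\<sigma> \<in> int_faces S" and KL: "cells_of S \<sigma> = {K, L}"
  shows "\<bar>q K - q L\<bar> \<le> vol (diam S \<sigma>) / area \<sigma> * grad_size q"
proof -
  have "{K, L} = {first_cell \<sigma>, second_cell \<sigma>}" by (rule trans[OF KL[symmetric] face_cells(1)[OF s]])
  then have "\<bar>q K - q L\<bar> = \<bar>q (second_cell \<sigma>) - q (first_cell \<sigma>)\<bar>"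
    unfolding doubleton_eq_iff by (elim disjE conjE) (simp_all only: abs_minus_commute)
  also have "\<dots> = vol (diam S \<sigma>) / area \<sigma> * norm (grad_p S q \<sigma>)"
    using vol_diam(2)[OF s] area_int_pos[OF s] norm_face_normal[OF s]
    by (simp add: grad_p_eq abs_mult)
  also have "\<dots> \<le> vol (diam S \<sigma>) / area \<sigma> * grad_size q"
  proof (rule mult_left_mono)
    show "norm (grad_p S q \<sigma>) \<le> grad_size q"
      unfolding grad_size_def by (rule member_le_sum[OF s]) (auto simp: finite_int_faces)
    show "0 \<le> vol (diam S \<sigma>) / area \<sigma>" using vol_diam(2)[OF s] area_int_pos[OF s] by simp
  qed
  finally show ?thesis .
qed

text \<open>The cells reachable from \<open>K\<close> with some finite constant are closed under
  crossing an interior face, since the jump there is a multiple of the discrete gradient.\<close>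

lemma oscillation_pair:
  assumes K: "K \<in> cells S" and L: "L \<in> cells S"
  shows "\<exists>C\<ge>0. \<forall>q. \<bar>q K - q L\<bar> \<le> C * grad_size q"
proof -
  define A where "A = {L \<in> cells S. \<exists>C\<ge>0. \<forall>q. \<bar>q K - q L\<bar> \<le> C * grad_size q}"
  have "A = cells S"
  proof (rule cells_connected)
    show "A \<subseteq> cells S" unfolding A_def by (rule Collect_restrict)
    have "\<exists>C\<ge>0. \<forall>q. \<bar>q K - q K\<bar> \<le> C * grad_size q" by (rule exI[of _ 0]) simp
    then have "K \<in> A" using K by (simp add: A_def)
    then show "A \<noteq> {}" by blast
    fix M L \<sigma> assume M: "M \<in> A" and L: "L \<in> cells S" and s: "\<sigma> \<in> int_faces S" and cml: "cells_of S \<sigma> = {M, L}"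
    have "\<exists>C\<ge>0. \<forall>q. \<bar>q K - q M\<bar> \<le> C * grad_size q" using M by (simp add: A_def)
    then obtain C where C: "C \<ge> 0" "\<And>q. \<bar>q K - q M\<bar> \<le> C * grad_size q" by blast
    let ?D = "vol (diam S \<sigma>) / area \<sigma>"
    have D: "?D \<ge> 0" using vol_diam(2)[OF s] area_int_pos[OF s] by simp
    have "\<bar>q K - q L\<bar> \<le> (C + ?D) * grad_size q" for q
    proof -
      have "\<bar>q K - q L\<bar> \<le> \<bar>q K - q M\<bar> + \<bar>q M - q L\<bar>" by simp
      also have "\<dots> \<le> C * grad_size q + ?D * grad_size q" by (intro add_mono C jump_bound[OF s cml])
      finally show ?thesis by (simp add: distrib_right)
    qed
    moreover have "C + ?D \<ge> 0" using C(1) D by simp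
    ultimately have "\<exists>C\<ge>0. \<forall>q. \<bar>q K - q L\<bar> \<le> C * grad_size q" by blast
    then show "L \<in> A" using L by (simp add: A_def)
  qed
  then show ?thesis using L by (auto simp: A_def)
qed

text \<open>A discrete Poincare inequality: with zero mean, \<open>q K\<close> is the
  volume-weighted average of the differences \<open>q K - q L\<close>.\<close>

lemma mean_zero_bound:
  "\<exists>C\<ge>0. \<forall>q. cell_mean S q = 0 \<longrightarrow> (\<forall>K\<in>cells S. \<bar>q K\<bar> \<le> C * grad_size q)"
proof -
  obtain C where C: "\<And>K L. K \<in> cells S \<Longrightarrow> L \<in> cells S \<Longrightarrow> C K L \<ge> 0 \<and> (\<forall>q. \<bar>q K - q L\<bar> \<le> C K L * grad_size q)"
    using oscillation_pair by metis
  define C' where "C' = (\<Sum>K\<in>cells S. \<Sum>L\<in>cells S. C K L)"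
  have le: "\<bar>q K - q L\<bar> \<le> C' * grad_size q" if "K \<in> cells S" "L \<in> cells S" for q K L
  proof -
    have "C K L \<le> (\<Sum>L\<in>cells S. C K L)" using that C finite_cells by (intro member_le_sum) auto
    also have "\<dots> \<le> C'" unfolding C'_def
      using that C finite_cells by (intro member_le_sum[of K "cells S" "\<lambda>K. \<Sum>L\<in>cells S. C K L"] sum_nonneg) auto
    finally show ?thesis using C that grad_size_nonneg mult_right_mono order_trans by meson
  qed
  have C'0: "C' \<ge> 0" unfolding C'_def using C by (intro sum_nonneg) auto
  have "\<bar>q K\<bar> \<le> C' * grad_size q" if q: "cell_mean S q = 0" and K: "K \<in> cells S" for q K
  proof -
    have "(\<Sum>L\<in>cells S. vol L * q L) = 0" using q vol_region_pos by (simp add: cell_mean_def)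
    then have "vol (region S) * q K = (\<Sum>L\<in>cells S. vol L * (q K - q L))"
      by (simp add: right_diff_distrib sum_subtractf sum_distrib_right[symmetric] sum_vol_cells)
    then have "\<bar>vol (region S) * q K\<bar> = \<bar>\<Sum>L\<in>cells S. vol L * (q K - q L)\<bar>" by (rule arg_cong)
    then have "vol (region S) * \<bar>q K\<bar> = \<bar>\<Sum>L\<in>cells S. vol L * (q K - q L)\<bar>"
      using vol_region_pos by (simp add: abs_mult)
    also have "\<dots> \<le> (\<Sum>L\<in>cells S. \<bar>vol L * (q K - q L)\<bar>)" by (rule sum_abs)
    also have "\<dots> \<le> (\<Sum>L\<in>cells S. vol L * (C' * grad_size q))"
      using le[OF K] by (intro sum_mono) (auto simp: abs_mult intro!: mult_left_mono)
    also have "\<dots> = vol (region S) * (C' * grad_size q)"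
      by (simp add: sum_distrib_right[symmetric] sum_vol_cells)
    finally show ?thesis using vol_region_pos by simp
  qed
  then show ?thesis using C'0 by blast
qed

text \<open>Testing with \<open>u\<close> makes the pressure disappear up to the divergence of \<open>u\<close>, and a pressure
  of zero mean is controlled by its discrete gradient because the mesh is connected.\<close>

lemma saddle_point_stability:
  assumes dt: "\<delta>t > 0"
  shows "\<exists>C. \<forall>u\<in>HE0 S. \<forall>q. cell_mean S q = 0 \<longrightarrow>
    (\<Sum>\<sigma>\<in>int_faces S. norm (u \<sigma>)) + (\<Sum>K\<in>cells S. \<bar>q K\<bar>)
     \<le> C * ((\<Sum>\<sigma>\<in>int_faces S. norm (u \<sigma> + \<delta>t *\<^sub>R grad_p S q \<sigma>)) + (\<Sum>K\<in>cells S. \<bar>div_vel S u K\<bar>))"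
proof -
  obtain C0 where C0: "C0 \<ge> 0" "\<And>q K. cell_mean S q = 0 \<Longrightarrow> K \<in> cells S \<Longrightarrow> \<bar>q K\<bar> \<le> C0 * grad_size q"
    using mean_zero_bound by blast
  define Dm where "Dm = (\<Sum>\<sigma>\<in>int_faces S. vol (diam S \<sigma>))"
  define V where "V = vol (region S)"
  \<comment> \<open>\<open>k\<close> converts the weighted square norm of the velocity back into the
    plain sum of norms; \<open>m\<close> collects the constants of the quadratic inequality between
    \<open>y\<close> and \<open>Q\<close> below.\<close>
  define k where "k = (\<Sum>\<sigma>\<in>int_faces S. 1 / sqrt (vol (diam S \<sigma>)))"
  define m where "m = k\<^sup>2 * (Dm + V * C0)"
  have "Dm \<ge> 0" unfolding Dm_def by (rule sum_nonneg) simp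
  moreover have "V \<ge> 0" by (simp add: V_def)
  moreover have "k \<ge> 0" unfolding k_def by (rule sum_nonneg) simp
  ultimately have pos: "Dm \<ge> 0" "V \<ge> 0" "k \<ge> 0" "m \<ge> 0" using C0(1) by (simp_all add: m_def)
  define C where "C = (m + 1) + real (card (cells S)) * (C0 * ((1 + (m + 1)) / \<delta>t))"
  have "(\<Sum>\<sigma>\<in>int_faces S. norm (u \<sigma>)) + (\<Sum>K\<in>cells S. \<bar>q K\<bar>)
     \<le> C * ((\<Sum>\<sigma>\<in>int_faces S. norm (u \<sigma> + \<delta>t *\<^sub>R grad_p S q \<sigma>)) + (\<Sum>K\<in>cells S. \<bar>div_vel S u K\<bar>))"
    if u: "u \<in> HE0 S" and q: "cell_mean S q = 0" for u q
  proof -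
    define e where "e \<sigma> = u \<sigma> + \<delta>t *\<^sub>R grad_p S q \<sigma>" for \<sigma>
    define Q where "Q = (\<Sum>\<sigma>\<in>int_faces S. norm (e \<sigma>)) + (\<Sum>K\<in>cells S. \<bar>div_vel S u K\<bar>)"
    define y where "y = (\<Sum>\<sigma>\<in>int_faces S. norm (u \<sigma>))"
    define G where "G = grad_size q"
    have y0: "y \<ge> 0" and Q0: "Q \<ge> 0" by (auto simp: y_def Q_def intro!: add_nonneg_nonneg sum_nonneg)
    have eQ: "norm (e \<sigma>) \<le> Q" if "\<sigma> \<in> int_faces S" for \<sigma>
    proof -
      have "norm (e \<sigma>) \<le> (\<Sum>\<sigma>\<in>int_faces S. norm (e \<sigma>))" by (rule member_le_sum[OF that]) (simp_all add: finite_int_faces)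
      moreover have "0 \<le> (\<Sum>K\<in>cells S. \<bar>div_vel S u K\<bar>)" by (rule sum_nonneg) simp
      ultimately show ?thesis unfolding Q_def by linarith
    qed
    have dQ: "\<bar>div_vel S u K\<bar> \<le> Q" if "K \<in> cells S" for K
    proof -
      have "\<bar>div_vel S u K\<bar> \<le> (\<Sum>K\<in>cells S. \<bar>div_vel S u K\<bar>)" by (rule member_le_sum[OF that]) (simp_all add: finite_cells)
      moreover have "0 \<le> (\<Sum>\<sigma>\<in>int_faces S. norm (e \<sigma>))" by (rule sum_nonneg) simp
      ultimately show ?thesis unfolding Q_def by linarith
    qed
    have uy: "norm (u \<sigma>) \<le> y" if "\<sigma> \<in> int_faces S" for \<sigma>
      using member_le_sum[OF that, of "\<lambda>\<sigma>. norm (u \<sigma>)"] finite_int_faces by (simp add: y_def)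
    \<comment> \<open>The pressure gradient is bounded by residual plus velocity, so that the
      product of pressure and divergence is of order \<open>(Q + y) * Q\<close>, without a term in
      \<open>y\<^sup>2\<close>.\<close>
    have "\<delta>t * G = (\<Sum>\<sigma>\<in>int_faces S. norm (e \<sigma> - u \<sigma>))"
      using dt by (simp add: G_def grad_size_def e_def sum_distrib_left)
    also have "\<dots> \<le> (\<Sum>\<sigma>\<in>int_faces S. norm (e \<sigma>) + norm (u \<sigma>))"
      by (intro sum_mono norm_triangle_ineq4)
    also have "\<dots> \<le> Q + y" by (simp add: sum.distrib Q_def y_def sum_nonneg)
    finally have dG: "\<delta>t * G \<le> Q + y" .
    \<comment> \<open>In one factor, \<open>u\<close> is replaced by the residual \<open>e\<close>
      minus \<delta>t times the pressure gradient; discrete duality then moves the gradient onto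
      \<open>div_vel S u\<close>.\<close>
    define W where "W = (\<Sum>\<sigma>\<in>int_faces S. vol (diam S \<sigma>) * (u \<sigma> \<bullet> u \<sigma>))"
    have "W = (\<Sum>\<sigma>\<in>int_faces S. vol (diam S \<sigma>) * (e \<sigma> \<bullet> u \<sigma>)) - \<delta>t * (\<Sum>\<sigma>\<in>int_faces S. vol (diam S \<sigma>) * (grad_p S q \<sigma> \<bullet> u \<sigma>))"
      by (simp add: W_def e_def inner_add_left distrib_left sum.distrib sum_distrib_left mult_ac)
    also have "\<dots> = (\<Sum>\<sigma>\<in>int_faces S. vol (diam S \<sigma>) * (e \<sigma> \<bullet> u \<sigma>)) + \<delta>t * (\<Sum>K\<in>cells S. q K * (vol K * div_vel S u K))"
      by (simp add: grad_div[OF u])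
    also have "\<dots> \<le> Dm * (Q * y) + \<delta>t * (V * (C0 * G * Q))"
    proof (intro add_mono mult_left_mono)
      show "(\<Sum>\<sigma>\<in>int_faces S. vol (diam S \<sigma>) * (e \<sigma> \<bullet> u \<sigma>)) \<le> Dm * (Q * y)"
        unfolding Dm_def sum_distrib_right
      proof (intro sum_mono mult_left_mono)
        fix \<sigma> assume s: "\<sigma> \<in> int_faces S"
        have "e \<sigma> \<bullet> u \<sigma> \<le> norm (e \<sigma>) * norm (u \<sigma>)" by (rule norm_cauchy_schwarz)
        also have "\<dots> \<le> Q * y" using eQ[OF s] uy[OF s] Q0 by (intro mult_mono) auto
        finally show "e \<sigma> \<bullet> u \<sigma> \<le> Q * y" .
      qed simp
      show "(\<Sum>K\<in>cells S. q K * (vol K * div_vel S u K)) \<le> V * (C0 * G * Q)"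
        unfolding V_def sum_vol_cells[symmetric] sum_distrib_right
      proof (intro sum_mono)
        fix K assume K: "K \<in> cells S"
        have "q K * div_vel S u K \<le> \<bar>q K\<bar> * \<bar>div_vel S u K\<bar>" by (metis abs_ge_self abs_mult)
        also have "\<dots> \<le> C0 * G * Q"
          using C0(2)[OF q K] dQ[OF K] Q0 by (intro mult_mono) (auto simp: G_def C0(1) grad_size_nonneg)
        finally show "q K * (vol K * div_vel S u K) \<le> vol K * (C0 * G * Q)"
          using vol_cell_pos[OF K] by (metis less_imp_le mult.left_commute mult_left_mono)
      qed
    qed (use dt in auto)
    also have "\<dots> = Dm * (Q * y) + V * C0 * Q * (\<delta>t * G)" by (simp add: algebra_simps)
    also have "\<dots> \<le> Dm * (Q * y) + V * C0 * Q * (Q + y)"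
      using dG pos C0(1) Q0 by (intro add_left_mono mult_left_mono) auto
    also have "\<dots> \<le> (Dm + V * C0) * (y * Q + Q\<^sup>2)"
      using pos Q0 y0 by (simp add: algebra_simps power2_eq_square)
    finally have W: "W \<le> (Dm + V * C0) * (y * Q + Q\<^sup>2)" .
    have W0: "W \<ge> 0" unfolding W_def by (intro sum_nonneg) auto
    have "y \<le> (\<Sum>\<sigma>\<in>int_faces S. sqrt W * (1 / sqrt (vol (diam S \<sigma>))))"
      unfolding y_def
    proof (rule sum_mono)
      fix \<sigma> assume s: "\<sigma> \<in> int_faces S"
      have "vol (diam S \<sigma>) * (u \<sigma> \<bullet> u \<sigma>) \<le> W" unfolding W_def
        by (rule member_le_sum[OF s]) (auto simp: finite_int_faces)
      then have "(norm (u \<sigma>))\<^sup>2 \<le> W / vol (diam S \<sigma>)"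
        using vol_diam(2)[OF s] by (simp add: power2_norm_eq_inner field_simps)
      then have "norm (u \<sigma>) \<le> sqrt (W / vol (diam S \<sigma>))" by (rule real_le_rsqrt)
      then show "norm (u \<sigma>) \<le> sqrt W * (1 / sqrt (vol (diam S \<sigma>)))" by (simp add: real_sqrt_divide)
    qed
    also have "\<dots> = sqrt W * k" by (simp add: k_def sum_distrib_left)
    finally have "y\<^sup>2 \<le> (sqrt W * k)\<^sup>2" using y0 by (rule power_mono)
    also have "\<dots> = k\<^sup>2 * W" using W0 by (simp add: power_mult_distrib)
    also have "\<dots> \<le> k\<^sup>2 * ((Dm + V * C0) * (y * Q + Q\<^sup>2))" by (rule mult_left_mono[OF W]) simp
    finally have y2: "y\<^sup>2 \<le> m * (y * Q + Q\<^sup>2)" by (simp add: m_def mult.assoc)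
    have yQ: "y \<le> (m + 1) * Q"
      by (rule quadratic_bound[OF y0 Q0 pos(4) y2])
    have "(\<Sum>K\<in>cells S. \<bar>q K\<bar>) \<le> (\<Sum>K\<in>cells S. C0 * ((1 + (m + 1)) / \<delta>t) * Q)"
    proof (rule sum_mono)
      fix K assume K: "K \<in> cells S"
      have "G \<le> (1 + (m + 1)) / \<delta>t * Q" using dG yQ dt by (simp add: field_simps)
      then have "C0 * G \<le> C0 * ((1 + (m + 1)) / \<delta>t * Q)" by (rule mult_left_mono) (rule C0(1))
      then show "\<bar>q K\<bar> \<le> C0 * ((1 + (m + 1)) / \<delta>t) * Q" using C0(2)[OF q K] by (simp add: G_def mult.assoc)
    qed
    then have "y + (\<Sum>K\<in>cells S. \<bar>q K\<bar>) \<le> C * Q" using yQ by (simp add: C_def algebra_simps)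
    then show ?thesis by (simp add: y_def Q_def e_def)
  qed
  then show ?thesis by blast
qed

end

section \<open>Regularity of the shape functions, and the viscous term as a linear map of the face
  values\<close>

section \<open>Gradients of the shape functions\<close>

definition q1_factor :: "'d \<Rightarrow> 'd set \<Rightarrow> real^'d \<Rightarrow> real" where
  "q1_factor i s x = (if i \<in> s then x $ i else 1 - x $ i)"

definition q1_deriv :: "('d::finite set \<Rightarrow> real^'d) \<Rightarrow> real^'d \<Rightarrow> real^'d \<Rightarrow> real^'d" where
  "q1_deriv v x h = (\<Sum>s\<in>UNIV. (\<Sum>i\<in>UNIV. (if i \<in> s then h $ i else - h $ i) * (\<Prod>j\<in>UNIV - {i}. q1_factor j s x)) *\<^sub>R v s)"

lemma q1_factor_derivative:
  fixes x :: "real^'d::finite"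
  shows "(q1_factor i s has_derivative (\<lambda>h. if i \<in> s then h $ i else - h $ i)) (at x)"
proof -
  have 1: "((\<lambda>x::real^'d. x $ i) has_derivative (\<lambda>h. h $ i)) (at x)"
    by (rule bounded_linear.has_derivative[OF bounded_linear_vec_nth has_derivative_ident])
  then have 2: "((\<lambda>x::real^'d. 1 - x $ i) has_derivative (\<lambda>h. 0 - h $ i)) (at x)"
    by (intro has_derivative_diff has_derivative_const)
  show ?thesis unfolding q1_factor_def[abs_def] using 1 2 by (cases "i \<in> s") simp_all
qed

lemma q1_factor_continuous: "continuous_on A (q1_factor i s)"
  unfolding q1_factor_def[abs_def] by (cases "i \<in> s") (auto intro!: continuous_intros)

lemma q1_map_derivative: "(q1_map v has_derivative q1_deriv v x) (at x)"
proof -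
  have "((\<lambda>x. \<Sum>s\<in>UNIV. (\<Prod>i\<in>UNIV. q1_factor i s x) *\<^sub>R v s) has_derivative q1_deriv v x) (at x)"
    unfolding q1_deriv_def[abs_def]
    by (intro has_derivative_sum has_derivative_scaleR_left has_derivative_prod q1_factor_derivative)
  then show ?thesis by (simp add: q1_map_def[abs_def] q1_factor_def)
qed

lemma q1_deriv_continuous: "continuous_on A (\<lambda>x. q1_deriv v x h)"
  unfolding q1_deriv_def by (intro continuous_intros q1_factor_continuous)

lemma continuous_on_det:
  fixes A :: "'a::topological_space \<Rightarrow> real^'n::finite^'n"
  assumes "\<And>i j. continuous_on S (\<lambda>x. A x $ i $ j)"
  shows "continuous_on S (\<lambda>x. det (A x))"
  unfolding det_def by (intro continuous_intros assms)

lemma rt_poly_gradient: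
  fixes p :: "real^'d::finite \<Rightarrow> real"
  assumes "rt_poly p"
  shows "\<exists>g. continuous_on UNIV g \<and> (\<forall>x. (p has_derivative (\<lambda>h. g x \<bullet> h)) (at x))"
proof -
  obtain a b c where p: "\<And>x. p x = a + (\<Sum>i\<in>UNIV. b i * x $ i) + (\<Sum>i\<in>UNIV. \<Sum>j\<in>UNIV. c i j * ((x $ i)\<^sup>2 - (x $ j)\<^sup>2))"
    using assms unfolding rt_poly_def by blast
  define D where "D x h = (\<Sum>i\<in>UNIV. b i * h $ i) + (\<Sum>i\<in>UNIV. \<Sum>j\<in>UNIV. c i j * (2 * (x $ i * h $ i) - 2 * (x $ j * h $ j)))" for x h :: "real^'d"
  have nth: "((\<lambda>x::real^'d. x $ i) has_derivative (\<lambda>h. h $ i)) (at x)" for i x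
    by (rule bounded_linear.has_derivative[OF bounded_linear_vec_nth has_derivative_ident])
  have sq: "((\<lambda>x::real^'d. (x $ i)\<^sup>2) has_derivative (\<lambda>h. 2 * (x $ i * h $ i))) (at x)" for i x
    using has_derivative_power[OF nth[of i x], of 2] by (simp add: mult_ac)
  have D: "(p has_derivative D x) (at x)" for x
  proof -
    have "((\<lambda>x. a + (\<Sum>i\<in>UNIV. b i * x $ i) + (\<Sum>i\<in>UNIV. \<Sum>j\<in>UNIV. c i j * ((x $ i)\<^sup>2 - (x $ j)\<^sup>2))) has_derivative
      (\<lambda>h. 0 + (\<Sum>i\<in>UNIV. b i * h $ i) + (\<Sum>i\<in>UNIV. \<Sum>j\<in>UNIV. c i j * (2 * (x $ i * h $ i) - 2 * (x $ j * h $ j))))) (at x)"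
      by (intro has_derivative_add has_derivative_const has_derivative_sum has_derivative_mult_right nth has_derivative_diff sq)
    then show ?thesis by (simp add: p[abs_def] D_def[abs_def])
  qed
  have "grad p x = (\<chi> i. D x (axis i 1))" for x
  proof -
    have "frechet_derivative p (at x) = D x" using frechet_derivative_at[OF D] by simp
    then show ?thesis by (simp add: grad_def pd_def)
  qed
  then have "grad p = (\<lambda>x. \<chi> i. D x (axis i 1))" by blast
  moreover have "continuous_on UNIV (\<lambda>x. \<chi> i. D x (axis i 1))"
    unfolding D_def by (intro continuous_intros)
  ultimately have "continuous_on UNIV (grad p)" by simp
  moreover have "(p has_derivative (\<lambda>h. grad p x \<bullet> h)) (at x)" for x
    by (rule has_derivative_grad) (use D in \<open>auto simp: differentiable_def\<close>)
  ultimately show ?thesis by blast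
qed

text \<open>Continuity and boundedness make products of gradients integrable on bounded open cells.
  Integrability is what allows the integrals in \<open>div_tau\<close> to be split: without it the
  integral is 0 by convention and need not be additive.\<close>

definition regular_on :: "(real^'d::finite) set \<Rightarrow> (real^'d \<Rightarrow> real) \<Rightarrow> bool" where
  "regular_on U f \<longleftrightarrow> (\<forall>x\<in>U. f differentiable at x) \<and> continuous_on U (grad f) \<and> bounded (grad f ` U)"

lemma regular_onI:
  fixes f :: "real^'d::finite \<Rightarrow> real"
  assumes "\<And>x. x \<in> U \<Longrightarrow> (f has_derivative (\<lambda>h. g x \<bullet> h)) (at x)" "continuous_on U g" "bounded (g ` U)"
  shows "regular_on U f"
proof -
  have eq: "grad f x = g x" if "x \<in> U" for x using grad_eqI[OF assms(1)[OF that]] .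
  have "continuous_on U (grad f)" using assms(2) eq by (simp cong: continuous_on_cong)
  moreover have "grad f ` U = g ` U" using eq by (simp cong: image_cong)
  moreover have "f differentiable at x" if "x \<in> U" for x using assms(1)[OF that] by (auto simp: differentiable_def)
  ultimately show ?thesis using assms(3) unfolding regular_on_def by simp
qed

lemma affine_regular:
  fixes f :: "real^'d::finite \<Rightarrow> real"
  assumes "\<And>x. x \<in> K \<Longrightarrow> f x = a + b \<bullet> x"
  shows "regular_on (interior K) f"
proof (rule regular_onI)
  show "bounded ((\<lambda>_. b) ` interior K)" by (rule bounded_subset[of "{b}"]) auto
  show "continuous_on (interior K) (\<lambda>_. b)" by simp
  fix x assume x: "x \<in> interior K"
  have "((\<lambda>x. a + b \<bullet> x) has_derivative (\<lambda>h. b \<bullet> h)) (at x)" by (auto intro!: derivative_eq_intros)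
  then show "(f has_derivative (\<lambda>h. (\<lambda>_. b) x \<bullet> h)) (at x)"
    by (rule has_derivative_transform_within_open[OF _ open_interior x]) (use assms interior_subset in fastforce)
qed

text \<open>The gradient of a mapped function solves a linear system whose matrix is the transposed Jacobian;
  Cramer's rule shows its continuity and boundedness.\<close>

lemma q1_cell_regular:
  fixes f :: "real^'d::finite \<Rightarrow> real"
  assumes q: "q1_cell K v" and p: "rt_poly p" and f: "\<And>x. x \<in> cbox 0 1 \<Longrightarrow> f (q1_map v x) = p x"
  shows "regular_on (interior K) f"
proof -
  let ?C = "cbox (0::real^'d) 1"
  have inj: "inj_on (q1_map v) ?C" and img: "q1_map v ` ?C = K"
    and det: "\<And>x. x \<in> ?C \<Longrightarrow> det (matrix (q1_deriv v x)) \<noteq> 0"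
  proof -
    show "inj_on (q1_map v) ?C" "q1_map v ` ?C = K" using q by (auto simp: q1_cell_def)
    have fd: "frechet_derivative (q1_map v) (at x) = q1_deriv v x" for x
      by (rule frechet_derivative_at[OF q1_map_derivative, symmetric])
    have "\<forall>x\<in>?C. det (matrix (frechet_derivative (q1_map v) (at x))) \<noteq> 0" using q by (simp add: q1_cell_def)
    then show "\<And>x. x \<in> ?C \<Longrightarrow> det (matrix (q1_deriv v x)) \<noteq> 0" by (simp add: fd)
  qed
  obtain gp where gp: "continuous_on UNIV gp" "\<And>x. (p has_derivative (\<lambda>h. gp x \<bullet> h)) (at x)"
    using rt_poly_gradient[OF p] by blast
  define g where "g = inv_into ?C (q1_map v)"
  have gq: "g (q1_map v x) = x" if "x \<in> ?C" for x unfolding g_def using inj that by (rule inv_into_f_f)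
  have qg: "q1_map v (g y) = y" and gC: "g y \<in> ?C" if "y \<in> K" for y
    using that unfolding g_def img[symmetric] by (auto intro: f_inv_into_f inv_into_into)
  have gcont: "continuous_on K g"
    unfolding img[symmetric] by (rule continuous_on_inv) (use gq q1_map_continuous in \<open>auto simp: compact_cbox\<close>)
  define A where "A x = transpose (matrix (q1_deriv v x))" for x
  \<comment> \<open>Cramer's formula for the solution of \<open>A x *v \<Psi> x = gp x\<close>, that
    is, the gradient of \<open>f\<close> at the image point, written in reference
    coordinates.\<close>
  define \<Psi> where "\<Psi> x = (\<chi> k. det (\<chi> i j. if j = k then gp x $ i else A x $ i $ j) / det (A x))" for x
  have linD: "linear (q1_deriv v x)" for x using has_derivative_linear[OF q1_map_derivative] .
  have \<Psi>eq: "\<Psi> x \<bullet> q1_deriv v x h = gp x \<bullet> h" if x: "x \<in> ?C" for x h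
  proof -
    have "det (A x) \<noteq> 0" using det[OF x] by (simp add: A_def)
    then have "A x *v \<Psi> x = gp x" using cramer[of "A x" "\<Psi> x" "gp x"] by (simp add: \<Psi>_def)
    then have "gp x \<bullet> h = (transpose (matrix (q1_deriv v x)) *v \<Psi> x) \<bullet> h" by (simp add: A_def)
    also have "\<dots> = \<Psi> x \<bullet> (matrix (q1_deriv v x) *v h)" by (simp add: dot_lmul_matrix[symmetric] transpose_matrix_vector)
    also have "matrix (q1_deriv v x) *v h = q1_deriv v x h" by (rule fun_cong[OF matrix_vector_mul(2)[OF linD]])
    finally show ?thesis by simp
  qed
  have \<Psi>cont: "continuous_on ?C \<Psi>"
  proof -
    have Ac: "continuous_on ?C (\<lambda>x. A x $ i $ j)" for i j
      unfolding A_def transpose_def matrix_def by (simp add: continuous_on_component q1_deriv_continuous)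
    have gpc: "continuous_on ?C (\<lambda>x. gp x $ i)" for i
      by (intro continuous_on_component continuous_on_subset[OF gp(1)]) auto
    have "continuous_on ?C (\<lambda>x. if j = k then gp x $ i else A x $ i $ j)" for i j k
      using Ac gpc by (cases "j = k") auto
    then have "continuous_on ?C (\<lambda>x. det (\<chi> i j. if j = k then gp x $ i else A x $ i $ j))" for k
      by (intro continuous_on_det) simp
    moreover have "continuous_on ?C (\<lambda>x. det (A x))" by (intro continuous_on_det Ac)
    moreover have "\<forall>x\<in>?C. det (A x) \<noteq> 0" using det by (simp add: A_def)
    ultimately show ?thesis unfolding \<Psi>_def by (intro continuous_on_vec_lambda continuous_on_divide)
  qed
  show ?thesis
  proof (rule regular_onI)
    show "continuous_on (interior K) (\<lambda>y. \<Psi> (g y))"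
      by (rule continuous_on_compose2[OF \<Psi>cont continuous_on_subset[OF gcont interior_subset]])
        (use gC interior_subset in blast)
    have "compact (\<Psi> ` ?C)" by (rule compact_continuous_image[OF \<Psi>cont compact_cbox])
    then have "bounded (\<Psi> ` ?C)" by (rule compact_imp_bounded)
    then show "bounded ((\<lambda>y. \<Psi> (g y)) ` interior K)"
      by (rule bounded_subset) (use gC interior_subset in blast)
    fix y assume y: "y \<in> interior K"
    then have yK: "y \<in> K" using interior_subset by blast
    let ?x = "g y"
    have "invertible (matrix (q1_deriv v ?x))" using det[OF gC[OF yK]] by (simp add: invertible_det_nz)
    then obtain B where inv: "B ** matrix (q1_deriv v ?x) = mat 1" "matrix (q1_deriv v ?x) ** B = mat 1"
      unfolding invertible_def by blast
    \<comment> \<open>The inverse Jacobian. It is the derivative of \<open>g\<close>, because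
      \<open>g\<close> is already known to be continuous.\<close>
    define g' where "g' h = B *v h" for h
    have blg: "bounded_linear g'" unfolding g'_def[abs_def] by (rule matrix_vector_mul_bounded_linear)
    have Dm: "q1_deriv v ?x h = matrix (q1_deriv v ?x) *v h" for h by (rule fun_cong[OF matrix_vector_mul(2)[OF linD], symmetric])
    have g'D: "g' \<circ> q1_deriv v ?x = id"
      using inv(1) by (simp add: fun_eq_iff g'_def Dm matrix_vector_mul_assoc)
    have Dg': "q1_deriv v ?x (g' h) = h" for h
      using inv(2) by (simp add: g'_def Dm matrix_vector_mul_assoc)
    have gcy: "continuous (at y) g"
      using continuous_on_interior[OF gcont y] .
    have "(g has_derivative g') (at y)"
      by (rule has_derivative_inverse_basic[OF q1_map_derivative blg g'D gcy open_interior y])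
        (use qg interior_subset in blast)
    then have "((\<lambda>y. p (g y)) has_derivative (\<lambda>h. gp ?x \<bullet> g' h)) (at y)"
      by (rule has_derivative_compose) (rule gp(2))
    moreover have "gp ?x \<bullet> g' h = \<Psi> ?x \<bullet> h" for h
      using \<Psi>eq[OF gC[OF yK], of "g' h"] Dg' by simp
    ultimately have "((\<lambda>y. p (g y)) has_derivative (\<lambda>h. \<Psi> ?x \<bullet> h)) (at y)" by simp
    then show "(f has_derivative (\<lambda>h. \<Psi> (g y) \<bullet> h)) (at y)"
    proof (rule has_derivative_transform_within_open[OF _ open_interior y])
      fix z assume "z \<in> interior K"
      then have "z \<in> K" using interior_subset by blast
      then show "p (g z) = f z" using f[OF gC] qg by metis
    qed
  qed
qed

lemma local_space_regular:
  assumes "local_space K f"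
  shows "regular_on (interior K) f"
  using assms unfolding local_space_def
proof (elim disjE conjE exE)
  fix a b assume "\<forall>x\<in>K. f x = a + b \<bullet> x"
  then show ?thesis by (intro affine_regular) blast
next
  fix v p assume "q1_cell K v" "rt_poly p" "\<forall>x\<in>cbox 0 1. f (q1_map v x) = p x"
  then show ?thesis by (intro q1_cell_regular) blast+
qed

lemma bounded_continuous_set_integrable:
  fixes f :: "'a::euclidean_space \<Rightarrow> 'b::euclidean_space"
  assumes U: "open U" "bounded U" and c: "continuous_on U f" and b: "bounded (f ` U)"
  shows "set_integrable lebesgue U f"
proof -
  obtain B where B: "\<And>x. x \<in> U \<Longrightarrow> norm (f x) \<le> B" using b unfolding bounded_iff by auto
  have Ub: "U \<in> sets borel" using U(1) by (rule borel_open)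
  have m: "(\<lambda>x. indicator U x *\<^sub>R f x) \<in> borel_measurable lebesgue"
    by (rule measurable_completion) (use borel_measurable_continuous_on_indicator[OF Ub c] in simp)
  have U': "U \<in> lmeasurable" using U by (simp add: lmeasurable_open)
  show ?thesis unfolding set_integrable_def
  proof (rule Bochner_Integration.integrable_bound[OF _ m])
    show "integrable lebesgue (\<lambda>x. B * indicator U x)"
      using U' by (simp add: lmeasurable_iff_integrable)
    show "AE x in lebesgue. norm (indicator U x *\<^sub>R f x) \<le> norm (B * indicator U x)"
    proof (rule AE_I2)
      fix x
      show "norm (indicator U x *\<^sub>R f x) \<le> norm (B * indicator U x)"
        using order_trans[OF B abs_ge_self] by (cases "x \<in> U") simp_all
    qed
  qed
qed

context staggered_discretization
begin

lemma shape_regular: "K \<in> cells S \<Longrightarrow> \<sigma> \<in> faces S \<Longrightarrow> regular_on (interior K) (shape S \<sigma> K)"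
  using mesh local_space_regular unfolding staggered_mesh_def shape_functions_def by blast

lemma grad_uhat:
  assumes K: "K \<in> cells S" and x: "x \<in> interior K"
  shows "grad (\<lambda>y. uhat S u K y $ i) x = (\<Sum>\<tau>\<in>faces S. (u \<tau> $ i) *\<^sub>R grad (shape S \<tau> K) x)"
proof (rule grad_eqI)
  have "(shape S \<tau> K has_derivative (\<lambda>h. grad (shape S \<tau> K) x \<bullet> h)) (at x)" if "\<tau> \<in> faces S" for \<tau>
    using shape_regular[OF K that] x unfolding regular_on_def by (intro has_derivative_grad) blast
  then have "((\<lambda>y. \<Sum>\<tau>\<in>faces S. (u \<tau> $ i) * shape S \<tau> K y) has_derivative (\<lambda>h. \<Sum>\<tau>\<in>faces S. (u \<tau> $ i) * (grad (shape S \<tau> K) x \<bullet> h))) (at x)"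
    by (intro has_derivative_sum has_derivative_mult_right)
  then show "((\<lambda>y. uhat S u K y $ i) has_derivative (\<lambda>h. (\<Sum>\<tau>\<in>faces S. (u \<tau> $ i) *\<^sub>R grad (shape S \<tau> K) x) \<bullet> h)) (at x)"
    by (simp add: uhat_def inner_sum_left mult.commute)
qed

lemma divergence_uhat:
  assumes "K \<in> cells S" "x \<in> interior K"
  shows "divergence (uhat S u K) x = (\<Sum>\<tau>\<in>faces S. \<Sum>i\<in>UNIV. u \<tau> $ i * grad (shape S \<tau> K) x $ i)"
proof -
  have "pd i (\<lambda>y. uhat S u K y $ i) x = (\<Sum>\<tau>\<in>faces S. u \<tau> $ i * grad (shape S \<tau> K) x $ i)" for i
    using grad_inner_axis[of "\<lambda>y. uhat S u K y $ i" x i] by (simp add: grad_uhat[OF assms] inner_axis)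
  then show ?thesis unfolding divergence_def by (simp add: sum.swap[of _ "faces S"])
qed

lemma interior_cell: "K \<in> cells S \<Longrightarrow> open (interior K) \<and> bounded (interior K)"
  using convex_body.compact[OF cell_body] compact_imp_bounded bounded_subset interior_subset open_interior by metis

lemma grad_shape_integrable:
  assumes K: "K \<in> cells S" and s: "\<sigma> \<in> faces S" and t: "\<tau> \<in> faces S"
  shows "set_integrable lebesgue (interior K) (\<lambda>x. grad (shape S \<tau> K) x \<bullet> grad (shape S \<sigma> K) x)"
    "set_integrable lebesgue (interior K) (\<lambda>x. (grad (shape S \<tau> K) x $ i) *\<^sub>R grad (shape S \<sigma> K) x)"
proof -
  have U: "open (interior K)" "bounded (interior K)" using interior_cell[OF K] by auto
  have r: "regular_on (interior K) (shape S \<sigma> K)" "regular_on (interior K) (shape S \<tau> K)"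
    using shape_regular K s t by auto
  have c: "continuous_on (interior K) (grad (shape S \<sigma> K))" "continuous_on (interior K) (grad (shape S \<tau> K))"
    using r by (auto simp: regular_on_def)
  obtain A where A: "\<And>x. x \<in> interior K \<Longrightarrow> norm (grad (shape S \<sigma> K) x) \<le> A"
    using r(1) unfolding regular_on_def bounded_iff by auto
  obtain B where B: "\<And>x. x \<in> interior K \<Longrightarrow> norm (grad (shape S \<tau> K) x) \<le> B"
    using r(2) unfolding regular_on_def bounded_iff by auto
  have "norm (grad (shape S \<tau> K) x \<bullet> grad (shape S \<sigma> K) x) \<le> B * A" if "x \<in> interior K" for x
    using order_trans[OF Cauchy_Schwarz_ineq2 mult_mono[OF B[OF that] A[OF that]]] order_trans[OF norm_ge_zero B[OF that]] by simp
  then show "set_integrable lebesgue (interior K) (\<lambda>x. grad (shape S \<tau> K) x \<bullet> grad (shape S \<sigma> K) x)"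
    by (intro bounded_continuous_set_integrable[OF U] continuous_intros c) (auto simp: bounded_iff)
  have "norm ((grad (shape S \<tau> K) x $ i) *\<^sub>R grad (shape S \<sigma> K) x) \<le> B * A" if "x \<in> interior K" for x
    using mult_mono[OF order_trans[OF component_le_norm_cart B[OF that]] A[OF that]] order_trans[OF norm_ge_zero B[OF that]] by simp
  then show "set_integrable lebesgue (interior K) (\<lambda>x. (grad (shape S \<tau> K) x $ i) *\<^sub>R grad (shape S \<sigma> K) x)"
    by (intro bounded_continuous_set_integrable[OF U] continuous_intros c) (auto simp: bounded_iff)
qed

text \<open>The coefficients on the right do not involve \<open>u\<close>, so that convergence of
  the finitely many face values passes to the viscous term.\<close>

lemma div_tau_eq:
  assumes s: "\<sigma> \<in> faces S"
  shows "div_tau S \<mu> lam u \<sigma> =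
    - (\<mu> / vol (diam S \<sigma>)) *\<^sub>R (\<Sum>K\<in>cells S. \<Sum>\<tau>\<in>faces S.
        (LINT x:interior K|lebesgue. grad (shape S \<tau> K) x \<bullet> grad (shape S \<sigma> K) x) *\<^sub>R u \<tau>)
    - ((\<mu> + lam) / vol (diam S \<sigma>)) *\<^sub>R (\<Sum>K\<in>cells S. \<Sum>\<tau>\<in>faces S. \<Sum>i\<in>UNIV.
        (u \<tau> $ i) *\<^sub>R (LINT x:interior K|lebesgue. (grad (shape S \<tau> K) x $ i) *\<^sub>R grad (shape S \<sigma> K) x))"
proof -
  have 1: "(LINT x:interior K|lebesgue. (\<chi> i. grad (\<lambda>y. uhat S u K y $ i) x \<bullet> grad (shape S \<sigma> K) x))
     = (\<Sum>\<tau>\<in>faces S. (LINT x:interior K|lebesgue. grad (shape S \<tau> K) x \<bullet> grad (shape S \<sigma> K) x) *\<^sub>R u \<tau>)"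
    if K: "K \<in> cells S" for K
  proof -
    have "(LINT x:interior K|lebesgue. (\<chi> i. grad (\<lambda>y. uhat S u K y $ i) x \<bullet> grad (shape S \<sigma> K) x))
        = (LINT x:interior K|lebesgue. \<Sum>\<tau>\<in>faces S. (grad (shape S \<tau> K) x \<bullet> grad (shape S \<sigma> K) x) *\<^sub>R u \<tau>)"
      by (rule set_lebesgue_integral_cong)
        (simp_all add: grad_uhat[OF K] vec_eq_iff inner_sum_left mult.commute)
    also have "\<dots> = (\<Sum>\<tau>\<in>faces S. LINT x:interior K|lebesgue. (grad (shape S \<tau> K) x \<bullet> grad (shape S \<sigma> K) x) *\<^sub>R u \<tau>)"
      unfolding set_lebesgue_integral_def scaleR_sum_right
      by (rule Bochner_Integration.integral_sum)
        (use grad_shape_integrable(1)[OF K s] in \<open>simp add: set_integrable_def\<close>)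
    also have "\<dots> = (\<Sum>\<tau>\<in>faces S. (LINT x:interior K|lebesgue. grad (shape S \<tau> K) x \<bullet> grad (shape S \<sigma> K) x) *\<^sub>R u \<tau>)"
      unfolding set_lebesgue_integral_def using grad_shape_integrable(1)[OF K s]
      by (intro sum.cong refl) (simp add: set_integrable_def)
    finally show ?thesis .
  qed
  have 2: "(LINT x:interior K|lebesgue. divergence (uhat S u K) x *\<^sub>R grad (shape S \<sigma> K) x)
     = (\<Sum>\<tau>\<in>faces S. \<Sum>i\<in>UNIV. (u \<tau> $ i) *\<^sub>R (LINT x:interior K|lebesgue. (grad (shape S \<tau> K) x $ i) *\<^sub>R grad (shape S \<sigma> K) x))"
    if K: "K \<in> cells S" for K
  proof -
    have "(LINT x:interior K|lebesgue. divergence (uhat S u K) x *\<^sub>R grad (shape S \<sigma> K) x)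
        = (LINT x:interior K|lebesgue. \<Sum>\<tau>\<in>faces S. \<Sum>i\<in>UNIV. (u \<tau> $ i) *\<^sub>R ((grad (shape S \<tau> K) x $ i) *\<^sub>R grad (shape S \<sigma> K) x))"
      by (rule set_lebesgue_integral_cong) (simp_all add: divergence_uhat[OF K] scaleR_sum_left)
    also have "\<dots> = (LINT x|lebesgue. (\<Sum>\<tau>\<in>faces S. \<Sum>i\<in>UNIV. (u \<tau> $ i) *\<^sub>R (indicator (interior K) x *\<^sub>R ((grad (shape S \<tau> K) x $ i) *\<^sub>R grad (shape S \<sigma> K) x))))"
      unfolding set_lebesgue_integral_def scaleR_sum_right by (simp only: scaleR_left_commute)
    also have "\<dots> = (\<Sum>\<tau>\<in>faces S. \<Sum>i\<in>UNIV. (LINT x|lebesgue. (u \<tau> $ i) *\<^sub>R (indicator (interior K) x *\<^sub>R ((grad (shape S \<tau> K) x $ i) *\<^sub>R grad (shape S \<sigma> K) x))))"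
    proof -
      have int: "integrable lebesgue (\<lambda>x. (u \<tau> $ i) *\<^sub>R (indicator (interior K) x *\<^sub>R ((grad (shape S \<tau> K) x $ i) *\<^sub>R grad (shape S \<sigma> K) x)))"
        if "\<tau> \<in> faces S" for \<tau> i
        using grad_shape_integrable(2)[OF K s that] unfolding set_integrable_def by (rule integrable_scaleR_right)
      show ?thesis
        by (subst Bochner_Integration.integral_sum)
          (auto intro!: Bochner_Integration.integrable_sum int sum.cong Bochner_Integration.integral_sum simp del: scaleR_scaleR integral_scaleR_right)
    qed
    also have "\<dots> = (\<Sum>\<tau>\<in>faces S. \<Sum>i\<in>UNIV. (u \<tau> $ i) *\<^sub>R (LINT x:interior K|lebesgue. (grad (shape S \<tau> K) x $ i) *\<^sub>R grad (shape S \<sigma> K) x))"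
      unfolding set_lebesgue_integral_def by (intro sum.cong refl integral_scaleR_right)
    finally show ?thesis .
  qed
  show ?thesis unfolding div_tau_def using 1 2 by (simp cong: sum.cong)
qed

lemma div_tau_tendsto:
  assumes "\<sigma> \<in> faces S" "\<And>\<tau>. \<tau> \<in> faces S \<Longrightarrow> ((\<lambda>m. u m \<tau>) \<longlongrightarrow> ul \<tau>) F"
  shows "((\<lambda>m. div_tau S \<mu> lam (u m) \<sigma>) \<longlongrightarrow> div_tau S \<mu> lam ul \<sigma>) F"
  unfolding div_tau_eq[OF assms(1)] by (intro tendsto_intros assms(2))

end

section \<open>Continuity of the discrete operators, positivity, and the estimates for one time
  step\<close>

section \<open>One step of the scheme\<close>

text \<open>For \<open>g \<ge> 1\<close> the power moves \<open>x\<close> further away from 1, which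
  gives the first bound; the second is the mean value theorem, with the derivative evaluated at the
  right end \<open>R\<close>.\<close>

lemma powr_monotone_bounds:
  fixes x g R :: real
  assumes x: "0 < x" "x \<le> R" and R: "1 \<le> R" and g: "1 \<le> g"
  shows "(x - 1)\<^sup>2 \<le> (x - 1) * (x powr g - 1)" and "\<bar>x powr g - 1\<bar> \<le> g * R powr (g - 1) * \<bar>x - 1\<bar>"
proof -
  have "(x - 1) * (x - 1) \<le> (x - 1) * (x powr g - 1)"
  proof (cases "1 \<le> x")
    case True
    then have "x powr 1 \<le> x powr g" using g by (intro powr_mono)
    then show ?thesis using True x by (intro mult_left_mono) auto
  next
    case False
    then have "x powr g \<le> x powr 1" using g x by (intro powr_mono') auto
    then show ?thesis using False x by (intro mult_left_mono_neg) auto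
  qed
  then show "(x - 1)\<^sup>2 \<le> (x - 1) * (x powr g - 1)" by (simp add: power2_eq_square)
  have der: "((\<lambda>t. t powr g) has_real_derivative g * t powr (g - 1)) (at t)" if "t > 0" for t
    using that by (rule has_real_derivative_powr)
  have bnd: "g * t powr (g - 1) \<le> g * R powr (g - 1)" "0 \<le> g * t powr (g - 1)" if "0 < t" "t \<le> R" for t
    using that g by (auto intro!: mult_left_mono powr_mono2)
  consider "x = 1" | "1 < x" | "x < 1" by linarith
  then show "\<bar>x powr g - 1\<bar> \<le> g * R powr (g - 1) * \<bar>x - 1\<bar>"
  proof cases
    case 1
    then show ?thesis by simp
  next
    case 2
    obtain t where t: "1 < t" "t < x" "x powr g - 1 powr g = (x - 1) * (g * t powr (g - 1))"
      using MVT2[OF 2, of "\<lambda>t. t powr g" "\<lambda>t. g * t powr (g - 1)"] der by force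
    have "\<bar>x powr g - 1\<bar> = g * t powr (g - 1) * \<bar>x - 1\<bar>" using t bnd(2)[of t] x g by (simp add: abs_mult)
    also have "\<dots> \<le> g * R powr (g - 1) * \<bar>x - 1\<bar>" using bnd(1)[of t] t x by (intro mult_right_mono) auto
    finally show ?thesis .
  next
    case 3
    obtain t where t: "x < t" "t < 1" "1 powr g - x powr g = (1 - x) * (g * t powr (g - 1))"
      using MVT2[OF 3, of "\<lambda>t. t powr g" "\<lambda>t. g * t powr (g - 1)"] der x by force
    have "\<bar>x powr g - 1\<bar> = g * t powr (g - 1) * \<bar>x - 1\<bar>"
      using t(3) bnd(2)[of t] t(1,2) x R by (metis abs_minus_commute abs_mult abs_of_nonneg less_trans mult.commute order.strict_iff_order order_trans powr_one_eq_one)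
    also have "\<dots> \<le> g * R powr (g - 1) * \<bar>x - 1\<bar>" using bnd(1)[of t] t x R by (intro mult_right_mono) auto
    finally show ?thesis .
  qed
qed

context staggered_discretization
begin

lemma conv_face_cell_props:
  assumes "K \<in> cells S" "\<sigma> \<in> facets K" "\<sigma> \<in> int_faces S"
  shows "K \<in> cells_of S \<sigma>" "other_cell S K \<sigma> \<in> cells S"
proof -
  show K: "K \<in> cells_of S \<sigma>" using assms by (simp add: cells_of_def)
  then have "K = first_cell \<sigma> \<or> K = second_cell \<sigma>" using face_cells(1)[OF assms(3)] by blast
  then show "other_cell S K \<sigma> \<in> cells S"
    using face_cells(4-6)[OF assms(3)] second_cell_def by metis
qed

text \<open>Writing the flux with positive and negative parts shows that it is continuous in density
  and velocity, although the upwind choice jumps.\<close>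

lemma flux_eq:
  "flux S \<rho> u K \<sigma> = (if \<sigma> \<in> ext_faces S then 0 else
     area \<sigma> * (\<rho> K * max 0 (u \<sigma> \<bullet> outward_normal K \<sigma>) - \<rho> (other_cell S K \<sigma>) * max 0 (- (u \<sigma> \<bullet> outward_normal K \<sigma>))))"
  by (simp add: flux_def max_def)

lemma flux_tendsto:
  assumes K: "K \<in> cells S" and s: "\<sigma> \<in> facets K"
    and r: "\<And>K. K \<in> cells S \<Longrightarrow> ((\<lambda>m. \<rho> m K) \<longlongrightarrow> \<rho>l K) F"
    and u: "\<And>\<sigma>. \<sigma> \<in> faces S \<Longrightarrow> ((\<lambda>m. u m \<sigma>) \<longlongrightarrow> ul \<sigma>) F"
  shows "((\<lambda>m. flux S (\<rho> m) (u m) K \<sigma>) \<longlongrightarrow> flux S \<rho>l ul K \<sigma>) F"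
proof (cases "\<sigma> \<in> ext_faces S")
  case True
  then show ?thesis by (simp add: flux_eq)
next
  case False
  then have i: "\<sigma> \<in> int_faces S" using faces_split[OF K s] by simp
  have f: "\<sigma> \<in> faces S" using i by (simp add: faces_union)
  show ?thesis unfolding flux_eq using False
    by (simp only: if_False) (intro tendsto_intros r u K f conv_face_cell_props(2)[OF K s i])
qed

lemma div_mass_tendsto:
  assumes K: "K \<in> cells S"
    and r: "\<And>K. K \<in> cells S \<Longrightarrow> ((\<lambda>m. \<rho> m K) \<longlongrightarrow> \<rho>l K) F"
    and u: "\<And>\<sigma>. \<sigma> \<in> faces S \<Longrightarrow> ((\<lambda>m. u m \<sigma>) \<longlongrightarrow> ul \<sigma>) F"
  shows "((\<lambda>m. div_mass S (\<rho> m) (u m) K) \<longlongrightarrow> div_mass S \<rho>l ul K) F"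
  unfolding div_mass_def by (intro tendsto_intros flux_tendsto[OF K _ r u])

text \<open>The same device for the convection term: continuity survives a change of sign of a dual
  flux.\<close>

lemma conv_up_eq:
  "conv_up S \<rho> u v \<sigma> = (1 / vol (diam S \<sigma>)) *\<^sub>R (\<Sum>K\<in>cells_of S \<sigma>. \<Sum>\<sigma>'\<in>dual_nbrs K \<sigma>.
     max 0 (dual_flux S \<rho> u K \<sigma> \<sigma>') *\<^sub>R v \<sigma> - max 0 (- dual_flux S \<rho> u K \<sigma> \<sigma>') *\<^sub>R v \<sigma>')"
  unfolding conv_up_def by (intro arg_cong2[where f = scaleR] refl sum.cong) (simp add: max_def)

lemma conv_up_tendsto:
  assumes s: "\<sigma> \<in> faces S"
    and r: "\<And>K. K \<in> cells S \<Longrightarrow> ((\<lambda>m. \<rho> m K) \<longlongrightarrow> \<rho>l K) F"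
    and u: "\<And>\<sigma>. \<sigma> \<in> faces S \<Longrightarrow> ((\<lambda>m. u m \<sigma>) \<longlongrightarrow> ul \<sigma>) F"
  shows "((\<lambda>m. conv_up S (\<rho> m) (u m) (u m) \<sigma>) \<longlongrightarrow> conv_up S \<rho>l ul ul \<sigma>) F"
proof -
  have "((\<lambda>m. dual_flux S (\<rho> m) (u m) K \<sigma> \<sigma>') \<longlongrightarrow> dual_flux S \<rho>l ul K \<sigma> \<sigma>') F" if "K \<in> cells_of S \<sigma>" for K \<sigma>'
    using that unfolding dual_flux_def cells_of_def by (intro tendsto_intros flux_tendsto[OF _ _ r u]) auto
  moreover have "\<sigma>' \<in> faces S" if "K \<in> cells_of S \<sigma>" "\<sigma>' \<in> dual_nbrs K \<sigma>" for K \<sigma>'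
    using that by (auto simp: faces_def cells_of_def dual_nbrs_def)
  ultimately show ?thesis unfolding conv_up_eq by (intro tendsto_intros u s)
qed

lemma dual_density_tendsto:
  assumes r: "\<And>K. K \<in> cells S \<Longrightarrow> ((\<lambda>m. \<rho> m K) \<longlongrightarrow> \<rho>l K) F" and s: "\<sigma> \<in> int_faces S"
  shows "((\<lambda>m. dual_density S (\<rho> m) \<sigma>) \<longlongrightarrow> dual_density S \<rho>l \<sigma>) F"
  unfolding dual_density_def using vol_diam(2)[OF s] by (intro tendsto_intros r) (auto simp: cells_of_def)

lemma dual_density_one: "\<sigma> \<in> int_faces S \<Longrightarrow> dual_density S (\<lambda>_. 1) \<sigma> = 1"
  using vol_diam[of \<sigma>] by (simp add: dual_density_def)

lemma div_vel_tendsto: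
  assumes K: "K \<in> cells S" and u: "\<And>\<sigma>. \<sigma> \<in> faces S \<Longrightarrow> ((\<lambda>m. u m \<sigma>) \<longlongrightarrow> ul \<sigma>) F"
  shows "((\<lambda>m. div_vel S (u m) K) \<longlongrightarrow> div_vel S ul K) F"
  unfolding div_vel_def using K by (intro tendsto_intros u) (auto simp: faces_def)

lemma grad_p_tendsto:
  assumes s: "\<sigma> \<in> int_faces S" and q: "\<And>K. K \<in> cells S \<Longrightarrow> ((\<lambda>m. q m K) \<longlongrightarrow> ql K) F"
  shows "((\<lambda>m. grad_p S (q m) \<sigma>) \<longlongrightarrow> grad_p S ql \<sigma>) F"
  unfolding grad_p_eq by (intro tendsto_intros q face_cells(5,6)[OF s])

text \<open>Sum the mass balance over the cells where the density is not positive.\<close>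

lemma density_positive:
  assumes dt: "\<delta>t > 0" and pos: "\<And>K. K \<in> cells S \<Longrightarrow> \<rho> K > 0"
    and mass: "\<And>K. K \<in> cells S \<Longrightarrow> (1 / \<delta>t) * (\<rho>' K - \<rho> K) + div_mass S \<rho>' u K = 0"
    and K: "K \<in> cells S"
  shows "\<rho>' K > 0"
proof (rule ccontr)
  assume neg: "\<not> \<rho>' K > 0"
  define q :: "(real^'d) set \<Rightarrow> real" where "q L = (if \<rho>' L > 0 then 0 else 1)" for L
  \<comment> \<open>What leaves the set of nonpositive cells carries a nonpositive density, what
    enters it carries a positive one; so the net outflow is at most 0 and the mass of this set
    cannot decrease.\<close>
  have face: "0 \<le> vol (diam S \<sigma>) * (upwind \<rho>' u \<sigma> * (grad_p S q \<sigma> \<bullet> u \<sigma>))" if s: "\<sigma> \<in> int_faces S" for \<sigma>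
  proof -
    define w where "w = u \<sigma> \<bullet> outward_normal (first_cell \<sigma>) \<sigma>"
    have "vol (diam S \<sigma>) * (upwind \<rho>' u \<sigma> * (grad_p S q \<sigma> \<bullet> u \<sigma>))
        = area \<sigma> * (upwind \<rho>' u \<sigma> * ((q (second_cell \<sigma>) - q (first_cell \<sigma>)) * w))"
      using vol_diam(2)[OF s] by (simp add: grad_p_eq w_def inner_commute)
    moreover have "0 \<le> upwind \<rho>' u \<sigma> * ((q (second_cell \<sigma>) - q (first_cell \<sigma>)) * w)"
      unfolding upwind_def w_def[symmetric] q_def
      by (simp add: zero_le_mult_iff mult_le_0_iff)
    ultimately show ?thesis using mult_nonneg_nonneg[OF less_imp_le[OF area_int_pos[OF s]]] by metis
  qed
  have "0 \<le> (\<Sum>\<sigma>\<in>int_faces S. vol (diam S \<sigma>) * (upwind \<rho>' u \<sigma> * (grad_p S q \<sigma> \<bullet> u \<sigma>)))"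
    by (rule sum_nonneg) (rule face)
  also have "\<dots> = - (\<Sum>L\<in>cells S. q L * (vol L * div_mass S \<rho>' u L))"
    unfolding grad_flux using div_mass_eq by (simp cong: sum.cong)
  also have "\<dots> = (\<Sum>L\<in>cells S. q L * (vol L * ((1 / \<delta>t) * (\<rho>' L - \<rho> L))))"
    unfolding sum_negf[symmetric]
  proof (rule sum.cong[OF refl])
    fix L assume "L \<in> cells S"
    then have "div_mass S \<rho>' u L = - ((1 / \<delta>t) * (\<rho>' L - \<rho> L))" using mass[of L] by linarith
    then show "- (q L * (vol L * div_mass S \<rho>' u L)) = q L * (vol L * ((1 / \<delta>t) * (\<rho>' L - \<rho> L)))" by simp
  qed
  also have "\<dots> < 0"
  proof -
    have nonpos: "q L * (vol L * ((1 / \<delta>t) * (\<rho>' L - \<rho> L))) \<le> 0" if L: "L \<in> cells S" for L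
    proof (cases "\<rho>' L > 0")
      case False
      have "(1 / \<delta>t) * (\<rho>' L - \<rho> L) \<le> 0" using False pos[OF L] dt by (intro mult_nonneg_nonpos) auto
      then have "vol L * ((1 / \<delta>t) * (\<rho>' L - \<rho> L)) \<le> 0" by (rule mult_nonneg_nonpos[rotated]) simp
      then show ?thesis using False by (simp only: q_def if_False mult_1)
    qed (simp add: q_def)
    have "q K * (vol K * ((1 / \<delta>t) * (\<rho>' K - \<rho> K))) < 0"
    proof -
      have "(1 / \<delta>t) * (\<rho>' K - \<rho> K) < 0" using neg pos[OF K] dt by (intro mult_pos_neg) auto
      then show ?thesis using vol_cell_pos[OF K] neg by (simp only: q_def if_False mult_1 mult_pos_neg)
    qed
    then have "(\<Sum>L\<in>cells S. q L * (vol L * ((1 / \<delta>t) * (\<rho>' L - \<rho> L)))) < (\<Sum>L\<in>cells S. 0)"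
      by (intro sum_strict_mono_ex1) (use finite_cells nonpos K in auto)
    then show ?thesis by simp
  qed
  finally show False by simp
qed

text \<open>The momentum balance is tested with the velocity times the upwind density, so that the
  pressure work is exactly the mass flux tested with the pressure.\<close>

lemma energy_step:
  assumes g1: "\<gamma> \<ge> 1" and dt: "\<delta>t > 0" and G: "G \<ge> 0" and A: "A \<ge> 0"
  shows "\<exists>B U. B \<ge> 0 \<and> (\<forall>\<epsilon> \<rho> \<rho>' u' g dn. 0 < \<epsilon> \<and> \<epsilon> \<le> 1 \<and>
     (\<forall>K\<in>cells S. \<rho> K > 0 \<and> \<rho>' K > 0 \<and> \<bar>\<rho> K - 1\<bar> \<le> A * \<epsilon> \<and> (1 / \<delta>t) * (\<rho>' K - \<rho> K) + div_mass S \<rho>' u' K = 0) \<and>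
     (\<forall>\<sigma>\<in>int_faces S. dn \<sigma> \<ge> 1/2 \<and> norm (g \<sigma>) \<le> G \<and>
        dn \<sigma> *\<^sub>R u' \<sigma> - g \<sigma> + (\<delta>t / \<epsilon>\<^sup>2) *\<^sub>R grad_p S (\<lambda>K. \<rho>' K powr \<gamma>) \<sigma> = 0) \<longrightarrow>
     (\<forall>K\<in>cells S. \<bar>\<rho>' K - 1\<bar> \<le> B * \<epsilon>) \<and> (B * \<epsilon> \<le> 1/2 \<longrightarrow> (\<forall>\<sigma>\<in>int_faces S. norm (u' \<sigma>) \<le> U)))"
proof -
  define V where "V = vol (region S)"
  define Dm where "Dm = (\<Sum>\<sigma>\<in>int_faces S. vol (diam S \<sigma>))"
  \<comment> \<open>None of these constants involves \<epsilon>. \<open>R\<close> bounds the new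
    density, since mass is conserved and the old mass is at most \<open>V * (1 + A)\<close>;
    \<open>L\<close> is the Lipschitz constant of the power on (0, \<open>R\<close>];
    \<open>M\<close> bounds the squared density error divided by \<open>\<epsilon>\<^sup>2\<close>;
    \<open>Z\<close> bounds the kinetic energy.\<close>
  define R where "R = (\<Sum>K\<in>cells S. 1 / vol K) * (V * (1 + A)) + 1"
  define L where "L = \<gamma> * R powr (\<gamma> - 1)"
  define M where "M = V * (L * A)\<^sup>2 + 2 * (Dm * (R * G\<^sup>2))"
  define B where "B = (\<Sum>K\<in>cells S. sqrt (M / vol K))"
  define Z where "Z = V * (L * B * (B + A)) + Dm * (R * G\<^sup>2)"
  define U where "U = (\<Sum>\<sigma>\<in>int_faces S. sqrt (8 * Z / vol (diam S \<sigma>)))"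
  have V0: "V \<ge> 0" by (simp add: V_def)
  have Dm0: "Dm \<ge> 0" unfolding Dm_def by (rule sum_nonneg) simp
  have iv0: "0 \<le> (\<Sum>K\<in>cells S. 1 / vol K)" by (rule sum_nonneg) simp
  have R1: "R \<ge> 1" unfolding R_def using iv0 V0 A by simp
  have L0: "L \<ge> 0" unfolding L_def using g1 by simp
  have M0: "M \<ge> 0" unfolding M_def using V0 Dm0 R1 by simp
  have B0: "B \<ge> 0" unfolding B_def using M0 by (intro sum_nonneg) simp
  have Z0: "Z \<ge> 0" unfolding Z_def using V0 L0 B0 A Dm0 R1 by simp
  have main: "(\<forall>K\<in>cells S. \<bar>\<rho>' K - 1\<bar> \<le> B * \<epsilon>) \<and> (B * \<epsilon> \<le> 1/2 \<longrightarrow> (\<forall>\<sigma>\<in>int_faces S. norm (u' \<sigma>) \<le> U))"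
    if e: "0 < \<epsilon>" "\<epsilon> \<le> 1"
      and pos: "\<And>K. K \<in> cells S \<Longrightarrow> \<rho> K > 0" and pos': "\<And>K. K \<in> cells S \<Longrightarrow> \<rho>' K > 0"
      and near: "\<And>K. K \<in> cells S \<Longrightarrow> \<bar>\<rho> K - 1\<bar> \<le> A * \<epsilon>"
      and mass: "\<And>K. K \<in> cells S \<Longrightarrow> (1 / \<delta>t) * (\<rho>' K - \<rho> K) + div_mass S \<rho>' u' K = 0"
      and dn: "\<And>\<sigma>. \<sigma> \<in> int_faces S \<Longrightarrow> dn \<sigma> \<ge> 1/2" and gG: "\<And>\<sigma>. \<sigma> \<in> int_faces S \<Longrightarrow> norm (g \<sigma>) \<le> G"
      and mom: "\<And>\<sigma>. \<sigma> \<in> int_faces S \<Longrightarrow> dn \<sigma> *\<^sub>R u' \<sigma> - g \<sigma> + (\<delta>t / \<epsilon>\<^sup>2) *\<^sub>R grad_p S (\<lambda>K. \<rho>' K powr \<gamma>) \<sigma> = 0"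
    for \<epsilon> \<rho> \<rho>' u' g dn
  proof -
    have vmass: "vol K * (\<rho>' K - \<rho> K) = - \<delta>t * (vol K * div_mass S \<rho>' u' K)" if "K \<in> cells S" for K
    proof -
      have "(1 / \<delta>t) * (\<rho>' K - \<rho> K) = - div_mass S \<rho>' u' K" using mass[OF that] by linarith
      then have "\<rho>' K - \<rho> K = - (\<delta>t * div_mass S \<rho>' u' K)" using dt by (simp add: field_simps)
      then show ?thesis by simp
    qed
    have cons: "(\<Sum>K\<in>cells S. vol K * (\<rho>' K - \<rho> K)) = 0"
      using total_flux[of \<rho>' u'] vmass by (simp add: sum_distrib_left[symmetric] sum_negf cong: sum.cong)
    have rhoR: "\<rho>' K \<le> R" if K: "K \<in> cells S" for K
    proof -
      have "vol K * \<rho>' K \<le> (\<Sum>K\<in>cells S. vol K * \<rho>' K)"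
        by (rule member_le_sum[OF K]) (use pos' vol_cell_pos finite_cells in \<open>auto intro: less_imp_le\<close>)
      also have "\<dots> = (\<Sum>K\<in>cells S. vol K * \<rho> K)" using cons by (simp add: right_diff_distrib sum_subtractf)
      also have "\<dots> \<le> (\<Sum>K\<in>cells S. vol K * (1 + A))"
      proof (intro sum_mono mult_left_mono)
        fix K assume "K \<in> cells S"
        then have "\<bar>\<rho> K - 1\<bar> \<le> A * 1" using near e A by (meson mult_left_mono order_trans)
        then show "\<rho> K \<le> 1 + A" by linarith
      qed simp
      also have "\<dots> = V * (1 + A)" by (simp add: V_def sum_vol_cells[symmetric] sum_distrib_right)
      finally have "\<rho>' K \<le> (1 / vol K) * (V * (1 + A))" using vol_cell_pos[OF K] by (simp add: field_simps)
      also have "\<dots> \<le> (\<Sum>K\<in>cells S. 1 / vol K) * (V * (1 + A))"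
      proof (rule mult_right_mono)
        show "1 / vol K \<le> (\<Sum>K\<in>cells S. 1 / vol K)" by (rule member_le_sum[OF K]) (simp_all add: finite_cells)
      qed (use V0 A in simp)
      finally show ?thesis by (simp add: R_def)
    qed
    define x where "x K = \<rho>' K - 1" for K
    define p where "p K = \<rho>' K powr \<gamma> - 1" for K
    have xp: "(x K)\<^sup>2 \<le> p K * x K" "\<bar>p K\<bar> \<le> L * \<bar>x K\<bar>" if "K \<in> cells S" for K
      using powr_monotone_bounds[OF pos'[OF that] rhoR[OF that] R1 g1] by (auto simp: x_def p_def L_def mult.commute)
    define up where "up = upwind \<rho>' u'"
    have up: "0 < up \<sigma>" "up \<sigma> \<le> R" if "\<sigma> \<in> int_faces S" for \<sigma>
      using upwind_cases[of \<rho>' u' \<sigma>] pos' rhoR face_cells(5,6)[OF that] unfolding up_def by auto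
    define E where "E = (\<Sum>\<sigma>\<in>int_faces S. vol (diam S \<sigma>) * (up \<sigma> * (dn \<sigma> * (u' \<sigma> \<bullet> u' \<sigma>) - g \<sigma> \<bullet> u' \<sigma>)))"
    have "E = (\<Sum>\<sigma>\<in>int_faces S. - (\<delta>t / \<epsilon>\<^sup>2) * (vol (diam S \<sigma>) * (up \<sigma> * (grad_p S (\<lambda>K. \<rho>' K powr \<gamma>) \<sigma> \<bullet> u' \<sigma>))))"
      unfolding E_def
    proof (rule sum.cong[OF refl])
      fix \<sigma> assume "\<sigma> \<in> int_faces S"
      then have "dn \<sigma> *\<^sub>R u' \<sigma> - g \<sigma> = - ((\<delta>t / \<epsilon>\<^sup>2) *\<^sub>R grad_p S (\<lambda>K. \<rho>' K powr \<gamma>) \<sigma>)"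
        using mom[of \<sigma>] by (simp add: eq_neg_iff_add_eq_0)
      then have "(dn \<sigma> *\<^sub>R u' \<sigma> - g \<sigma>) \<bullet> u' \<sigma> = - ((\<delta>t / \<epsilon>\<^sup>2) *\<^sub>R grad_p S (\<lambda>K. \<rho>' K powr \<gamma>) \<sigma>) \<bullet> u' \<sigma>" by simp
      then have "dn \<sigma> * (u' \<sigma> \<bullet> u' \<sigma>) - g \<sigma> \<bullet> u' \<sigma> = - (\<delta>t / \<epsilon>\<^sup>2) * (grad_p S (\<lambda>K. \<rho>' K powr \<gamma>) \<sigma> \<bullet> u' \<sigma>)"
        by (simp add: inner_diff_left)
      then show "vol (diam S \<sigma>) * (up \<sigma> * (dn \<sigma> * (u' \<sigma> \<bullet> u' \<sigma>) - g \<sigma> \<bullet> u' \<sigma>))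
        = - (\<delta>t / \<epsilon>\<^sup>2) * (vol (diam S \<sigma>) * (up \<sigma> * (grad_p S (\<lambda>K. \<rho>' K powr \<gamma>) \<sigma> \<bullet> u' \<sigma>)))"
        by (simp only: mult.left_commute)
    qed
    also have "\<dots> = - (\<delta>t / \<epsilon>\<^sup>2) * (- (\<Sum>K\<in>cells S. \<rho>' K powr \<gamma> * (\<Sum>\<sigma>\<in>facets K. flux S \<rho>' u' K \<sigma>)))"
      by (simp only: sum_distrib_left[symmetric] up_def grad_flux)
    also have "(\<Sum>K\<in>cells S. \<rho>' K powr \<gamma> * (\<Sum>\<sigma>\<in>facets K. flux S \<rho>' u' K \<sigma>))
        = (\<Sum>K\<in>cells S. - (1 / \<delta>t) * (\<rho>' K powr \<gamma> * (vol K * (\<rho>' K - \<rho> K))))"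
      by (rule sum.cong[OF refl]) (use dt in \<open>simp add: vmass div_mass_eq\<close>)
    also have "\<dots> = - (1 / \<delta>t) * (\<Sum>K\<in>cells S. \<rho>' K powr \<gamma> * (vol K * (\<rho>' K - \<rho> K)))"
      by (simp only: sum_distrib_left)
    \<comment> \<open>Conservation of mass permits replacing the pressure by its deviation from 1,
      the quantity that is small.\<close>
    also have "(\<Sum>K\<in>cells S. \<rho>' K powr \<gamma> * (vol K * (\<rho>' K - \<rho> K))) = (\<Sum>K\<in>cells S. vol K * (p K * (\<rho>' K - \<rho> K)))"
    proof -
      have "(\<Sum>K\<in>cells S. vol K * (p K * (\<rho>' K - \<rho> K)))
          = (\<Sum>K\<in>cells S. \<rho>' K powr \<gamma> * (vol K * (\<rho>' K - \<rho> K)) - vol K * (\<rho>' K - \<rho> K))"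
        by (rule sum.cong[OF refl]) (simp add: p_def algebra_simps)
      then show ?thesis using cons by (simp add: sum_subtractf)
    qed
    finally have E: "\<epsilon>\<^sup>2 * E = - (\<Sum>K\<in>cells S. vol K * (p K * (\<rho>' K - \<rho> K)))"
      using dt e by (simp add: field_simps)
    have low: "(norm (u' \<sigma>))\<^sup>2 / 4 - G\<^sup>2 \<le> dn \<sigma> * (u' \<sigma> \<bullet> u' \<sigma>) - g \<sigma> \<bullet> u' \<sigma>" if s: "\<sigma> \<in> int_faces S" for \<sigma>
    proof -
      let ?t = "norm (u' \<sigma>)"
      have "g \<sigma> \<bullet> u' \<sigma> \<le> norm (g \<sigma>) * ?t" by (rule norm_cauchy_schwarz)
      also have "\<dots> \<le> G * ?t" using gG[OF s] by (intro mult_right_mono) auto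
      finally have 1: "g \<sigma> \<bullet> u' \<sigma> \<le> G * ?t" .
      have "1/2 * ?t\<^sup>2 \<le> dn \<sigma> * ?t\<^sup>2" using dn[OF s] by (intro mult_right_mono) auto
      then have 2: "?t\<^sup>2 / 2 \<le> dn \<sigma> * (u' \<sigma> \<bullet> u' \<sigma>)" by (simp add: power2_norm_eq_inner)
      have "0 \<le> (?t / 2 - G)\<^sup>2" by simp
      also have "\<dots> = ?t\<^sup>2 / 4 - G * ?t + G\<^sup>2" by (simp add: power2_diff power_divide)
      finally show ?thesis using 1 2 by linarith
    qed
    have Elow: "(\<Sum>\<sigma>\<in>int_faces S. vol (diam S \<sigma>) * (up \<sigma> * ((norm (u' \<sigma>))\<^sup>2 / 4))) - Dm * (R * G\<^sup>2) \<le> E"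
    proof -
      have "(\<Sum>\<sigma>\<in>int_faces S. vol (diam S \<sigma>) * (up \<sigma> * ((norm (u' \<sigma>))\<^sup>2 / 4))) - Dm * (R * G\<^sup>2)
          = (\<Sum>\<sigma>\<in>int_faces S. vol (diam S \<sigma>) * (up \<sigma> * ((norm (u' \<sigma>))\<^sup>2 / 4) - R * G\<^sup>2))"
        by (simp add: Dm_def right_diff_distrib sum_subtractf sum_distrib_right)
      also have "\<dots> \<le> E" unfolding E_def
      proof (intro sum_mono mult_left_mono)
        fix \<sigma> assume s: "\<sigma> \<in> int_faces S"
        have "up \<sigma> * G\<^sup>2 \<le> R * G\<^sup>2" using up[OF s] by (intro mult_right_mono) auto
        moreover have "up \<sigma> * ((norm (u' \<sigma>))\<^sup>2 / 4 - G\<^sup>2) \<le> up \<sigma> * (dn \<sigma> * (u' \<sigma> \<bullet> u' \<sigma>) - g \<sigma> \<bullet> u' \<sigma>)"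
          using low[OF s] up[OF s] by (intro mult_left_mono) auto
        ultimately show "up \<sigma> * ((norm (u' \<sigma>))\<^sup>2 / 4) - R * G\<^sup>2 \<le> up \<sigma> * (dn \<sigma> * (u' \<sigma> \<bullet> u' \<sigma>) - g \<sigma> \<bullet> u' \<sigma>)"
          unfolding right_diff_distrib[of "up \<sigma>" "(norm (u' \<sigma>))\<^sup>2 / 4"] by linarith
      qed simp
      finally show ?thesis .
    qed
    have Enn: "- (Dm * (R * G\<^sup>2)) \<le> E"
    proof -
      have "0 \<le> (\<Sum>\<sigma>\<in>int_faces S. vol (diam S \<sigma>) * (up \<sigma> * ((norm (u' \<sigma>))\<^sup>2 / 4)))"
        using up(1) by (intro sum_nonneg mult_nonneg_nonneg) (auto intro: less_imp_le)
      then show ?thesis using Elow by linarith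
    qed
    define X where "X = (\<Sum>K\<in>cells S. vol K * (x K)\<^sup>2)"
    \<comment> \<open>Compared with \<open>p K * x K\<close>, which dominates
      \<open>(x K)\<^sup>2\<close>, the product with the density increment has the extra term
      \<open>p K * (\<rho> K - 1)\<close>; it costs half of \<open>(x K)\<^sup>2\<close> and a
      remainder of order \<open>\<epsilon>\<^sup>2\<close>. The tested momentum balance
      \<open>E\<close> is bounded below, so \<open>\<epsilon>\<^sup>2 * E\<close> adds a term of the
      same order.\<close>
    have Xeq: "X \<le> \<epsilon>\<^sup>2 * M"
    proof -
      have "X + \<epsilon>\<^sup>2 * E \<le> (\<Sum>K\<in>cells S. vol K * (1/2 * (x K)\<^sup>2 + 1/2 * (L * A * \<epsilon>)\<^sup>2))"
        unfolding X_def E sum_negf[symmetric] sum.distrib[symmetric]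
      proof (rule sum_mono)
        fix K assume K: "K \<in> cells S"
        have "p K * (\<rho> K - 1) \<le> \<bar>p K\<bar> * \<bar>\<rho> K - 1\<bar>" by (metis abs_ge_self abs_mult)
        also have "\<dots> \<le> (L * \<bar>x K\<bar>) * (A * \<epsilon>)" using xp(2)[OF K] near[OF K] L0 by (intro mult_mono) auto
        also have "\<dots> = \<bar>x K\<bar> * (L * A * \<epsilon>)" by simp
        also have "\<dots> \<le> 1/2 * (x K)\<^sup>2 + 1/2 * (L * A * \<epsilon>)\<^sup>2"
          using sum_squares_bound[of "\<bar>x K\<bar>" "L * A * \<epsilon>"] by simp
        finally have 1: "p K * (\<rho> K - 1) \<le> 1/2 * (x K)\<^sup>2 + 1/2 * (L * A * \<epsilon>)\<^sup>2" .
        have "p K * (\<rho>' K - \<rho> K) = p K * x K - p K * (\<rho> K - 1)" by (simp add: x_def algebra_simps)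
        then have "(x K)\<^sup>2 - p K * (\<rho>' K - \<rho> K) \<le> 1/2 * (x K)\<^sup>2 + 1/2 * (L * A * \<epsilon>)\<^sup>2"
          using 1 xp(1)[OF K] by linarith
        then have "vol K * ((x K)\<^sup>2 - p K * (\<rho>' K - \<rho> K)) \<le> vol K * (1/2 * (x K)\<^sup>2 + 1/2 * (L * A * \<epsilon>)\<^sup>2)"
          by (rule mult_left_mono) simp
        then show "vol K * (x K)\<^sup>2 + - (vol K * (p K * (\<rho>' K - \<rho> K))) \<le> vol K * (1/2 * (x K)\<^sup>2 + 1/2 * (L * A * \<epsilon>)\<^sup>2)"
          by (simp add: right_diff_distrib)
      qed
      also have "\<dots> = X / 2 + V * (L * A)\<^sup>2 * \<epsilon>\<^sup>2 / 2"
        by (simp add: X_def V_def sum_vol_cells[symmetric] distrib_left sum.distrib sum_distrib_left sum_distrib_right sum_divide_distrib power_mult_distrib mult.assoc)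
      finally have "X \<le> V * (L * A)\<^sup>2 * \<epsilon>\<^sup>2 - 2 * (\<epsilon>\<^sup>2 * E)" by linarith
      moreover have "\<epsilon>\<^sup>2 * (- (Dm * (R * G\<^sup>2))) \<le> \<epsilon>\<^sup>2 * E" by (rule mult_left_mono[OF Enn]) simp
      moreover have "\<epsilon>\<^sup>2 * M = V * (L * A)\<^sup>2 * \<epsilon>\<^sup>2 - 2 * (\<epsilon>\<^sup>2 * (- (Dm * (R * G\<^sup>2))))"
        by (simp add: M_def distrib_left mult_ac)
      ultimately show ?thesis by linarith
    qed
    have xB: "\<bar>x K\<bar> \<le> B * \<epsilon>" if K: "K \<in> cells S" for K
    proof -
      have "vol K * (x K)\<^sup>2 \<le> X" unfolding X_def by (rule member_le_sum[OF K]) (simp_all add: finite_cells)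
      then have "vol K * (x K)\<^sup>2 \<le> \<epsilon>\<^sup>2 * M" using Xeq by linarith
      then have "\<bar>x K\<bar>\<^sup>2 \<le> M / vol K * \<epsilon>\<^sup>2" using vol_cell_pos[OF K] by (simp add: field_simps)
      then have "\<bar>x K\<bar> \<le> sqrt (M / vol K * \<epsilon>\<^sup>2)" by (rule real_le_rsqrt)
      also have "\<dots> = sqrt (M / vol K) * \<epsilon>" using e by (subst real_sqrt_mult) simp
      also have "\<dots> \<le> B * \<epsilon>"
      proof (rule mult_right_mono)
        show "sqrt (M / vol K) \<le> B" unfolding B_def
          by (rule member_le_sum[OF K]) (use M0 finite_cells in simp_all)
      qed (use e in simp)
      finally show ?thesis .
    qed
    \<comment> \<open>The kinetic energy is weighted by the upwind density, which must stay away
      from 0; this is where \<open>B * \<epsilon> \<le> 1/2\<close> enters. The 8 in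
      \<open>U\<close> combines this weight 1/2 with the factor 1/4 left by Young's
      inequality.\<close>
    have uU: "norm (u' \<sigma>) \<le> U" if B2: "B * \<epsilon> \<le> 1/2" and s: "\<sigma> \<in> int_faces S" for \<sigma>
    proof -
      have "\<epsilon>\<^sup>2 * E \<le> (\<Sum>K\<in>cells S. vol K * (L * B * (B + A) * \<epsilon>\<^sup>2))"
        unfolding E sum_negf[symmetric]
      proof (rule sum_mono)
        fix K assume K: "K \<in> cells S"
        have "- (p K * (\<rho>' K - \<rho> K)) \<le> \<bar>p K\<bar> * \<bar>\<rho>' K - \<rho> K\<bar>" by (metis abs_ge_minus_self abs_mult)
        also have "\<dots> \<le> (L * (B * \<epsilon>)) * (B * \<epsilon> + A * \<epsilon>)"
        proof (rule mult_mono)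
          show "\<bar>p K\<bar> \<le> L * (B * \<epsilon>)" using xp(2)[OF K] mult_left_mono[OF xB[OF K] L0] by linarith
          show "\<bar>\<rho>' K - \<rho> K\<bar> \<le> B * \<epsilon> + A * \<epsilon>" using xB[OF K] near[OF K] unfolding x_def by linarith
        qed (use L0 B0 e in auto)
        also have "\<dots> = L * B * (B + A) * \<epsilon>\<^sup>2" by (simp add: power2_eq_square algebra_simps)
        finally have "vol K * (- (p K * (\<rho>' K - \<rho> K))) \<le> vol K * (L * B * (B + A) * \<epsilon>\<^sup>2)"
          by (rule mult_left_mono) simp
        then show "- (vol K * (p K * (\<rho>' K - \<rho> K))) \<le> vol K * (L * B * (B + A) * \<epsilon>\<^sup>2)" by simp
      qed
      also have "\<dots> = \<epsilon>\<^sup>2 * (V * (L * B * (B + A)))"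
        by (simp add: V_def sum_vol_cells[symmetric] sum_distrib_left sum_distrib_right mult_ac)
      finally have EZ: "E \<le> V * (L * B * (B + A))" using e by simp
      have "vol (diam S \<sigma>) * (1/2 * ((norm (u' \<sigma>))\<^sup>2 / 4)) \<le> vol (diam S \<sigma>) * (up \<sigma> * ((norm (u' \<sigma>))\<^sup>2 / 4))"
      proof (intro mult_left_mono mult_right_mono)
        have "\<bar>\<rho>' K - 1\<bar> \<le> 1/2" if "K \<in> cells S" for K using xB[OF that] B2 unfolding x_def by linarith
        then have "\<bar>up \<sigma> - 1\<bar> \<le> 1/2"
          using upwind_cases[of \<rho>' u' \<sigma>] face_cells(5,6)[OF s] unfolding up_def by auto
        then show "1/2 \<le> up \<sigma>" by linarith
      qed auto
      also have "\<dots> \<le> (\<Sum>\<sigma>\<in>int_faces S. vol (diam S \<sigma>) * (up \<sigma> * ((norm (u' \<sigma>))\<^sup>2 / 4)))"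
      proof (rule member_le_sum[OF s])
        show "0 \<le> vol (diam S \<tau>) * (up \<tau> * ((norm (u' \<tau>))\<^sup>2 / 4))" if "\<tau> \<in> int_faces S - {\<sigma>}" for \<tau>
          using up(1)[of \<tau>] that by (simp add: less_imp_le)
      qed (rule finite_int_faces)
      also have "\<dots> \<le> Z" using Elow EZ by (simp add: Z_def)
      finally have "(norm (u' \<sigma>))\<^sup>2 \<le> 8 * Z / vol (diam S \<sigma>)" using vol_diam(2)[OF s] by (simp add: field_simps)
      then have "norm (u' \<sigma>) \<le> sqrt (8 * Z / vol (diam S \<sigma>))" by (rule real_le_rsqrt)
      also have "\<dots> \<le> U" unfolding U_def
        by (rule member_le_sum[OF s]) (use Z0 finite_int_faces in simp_all)
      finally show ?thesis .
    qed
    show ?thesis using xB uU by (auto simp: x_def)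
  qed
  show ?thesis
  proof (rule exI[of _ B], rule exI[of _ U], rule conjI[OF B0], intro allI impI, elim conjE)
    fix \<epsilon> \<rho> \<rho>' u' g dn
    assume a: "0 < \<epsilon>" "\<epsilon> \<le> 1"
      "\<forall>K\<in>cells S. \<rho> K > 0 \<and> \<rho>' K > 0 \<and> \<bar>\<rho> K - 1\<bar> \<le> A * \<epsilon> \<and> (1 / \<delta>t) * (\<rho>' K - \<rho> K) + div_mass S \<rho>' u' K = 0"
      "\<forall>\<sigma>\<in>int_faces S. dn \<sigma> \<ge> 1/2 \<and> norm (g \<sigma>) \<le> G \<and>
        dn \<sigma> *\<^sub>R u' \<sigma> - g \<sigma> + (\<delta>t / \<epsilon>\<^sup>2) *\<^sub>R grad_p S (\<lambda>K. \<rho>' K powr \<gamma>) \<sigma> = 0"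
    show "(\<forall>K\<in>cells S. \<bar>\<rho>' K - 1\<bar> \<le> B * \<epsilon>) \<and> (B * \<epsilon> \<le> 1/2 \<longrightarrow> (\<forall>\<sigma>\<in>int_faces S. norm (u' \<sigma>) \<le> U))"
      using main[of \<epsilon> \<rho> \<rho>' u' dn g] a by blast
  qed
qed

end

text \<open>Applying a linear stability estimate to differences of two members of the sequence
  yields convergence without a candidate for the limit.\<close>

lemma convergent_by_stability:
  fixes X :: "nat \<Rightarrow> 'a::banach" and Y :: "'i \<Rightarrow> nat \<Rightarrow> 'b::metric_space"
  assumes fin: "finite I" and Y: "\<And>i. i \<in> I \<Longrightarrow> convergent (Y i)"
    and bound: "\<And>m k. dist (X m) (X k) \<le> C * (\<Sum>i\<in>I. dist (Y i m) (Y i k))"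
  shows "convergent X"
proof -
  have "Cauchy X"
  proof (rule metric_CauchyI)
    fix e :: real assume e: "0 < e"
    define d where "d = e / ((\<bar>C\<bar> + 1) * (real (card I) + 1))"
    have pos: "0 < (\<bar>C\<bar> + 1) * (real (card I) + 1)" by (intro mult_pos_pos) auto
    have d: "d > 0" using e pos by (simp add: d_def)
    have "\<forall>i\<in>I. \<exists>M. \<forall>m\<ge>M. \<forall>k\<ge>M. dist (Y i m) (Y i k) < d"
      using convergent_Cauchy[OF Y] d unfolding Cauchy_def by blast
    then obtain M where M: "\<And>i m k. i \<in> I \<Longrightarrow> m \<ge> M i \<Longrightarrow> k \<ge> M i \<Longrightarrow> dist (Y i m) (Y i k) < d" by metis
    define N where "N = (\<Sum>i\<in>I. M i)"
    have N: "M i \<le> N" if "i \<in> I" for i unfolding N_def using that fin by (intro member_le_sum) auto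
    have "dist (X m) (X k) < e" if mk: "m \<ge> N" "k \<ge> N" for m k
    proof -
      let ?s = "\<Sum>i\<in>I. dist (Y i m) (Y i k)"
      have s0: "0 \<le> ?s" by (rule sum_nonneg) simp
      have "?s \<le> (\<Sum>i\<in>I. d)"
        by (rule sum_mono) (use M N mk in \<open>meson less_imp_le order_trans\<close>)
      then have s: "?s \<le> real (card I) * d" by simp
      have "dist (X m) (X k) \<le> \<bar>C\<bar> * ?s" using bound[of m k] mult_right_mono[OF abs_ge_self s0, of C] by linarith
      also have "\<dots> \<le> \<bar>C\<bar> * (real (card I) * d)" using s by (rule mult_left_mono) simp
      also have "\<dots> < (\<bar>C\<bar> + 1) * (real (card I) + 1) * d"
      proof -
        have "0 < d * (\<bar>C\<bar> + real (card I) + 1)" using d by (intro mult_pos_pos) auto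
        then show ?thesis by (simp add: algebra_simps)
      qed
      also have "\<dots> = e" using pos by (simp add: d_def)
      finally show ?thesis .
    qed
    then show "\<exists>M. \<forall>m\<ge>M. \<forall>n\<ge>M. dist (X m) (X n) < e" by blast
  qed
  then show ?thesis by (rule Cauchy_convergent)
qed

section \<open>Uniqueness for the limit scheme, and passage to the limit in one time step\<close>

context staggered_discretization
begin

lemma HE0_diff: "u \<in> HE0 S \<Longrightarrow> v \<in> HE0 S \<Longrightarrow> (\<lambda>\<sigma>. u \<sigma> - v \<sigma>) \<in> HE0 S"
  by (simp add: HE0_def)

lemma div_vel_diff: "div_vel S (\<lambda>\<sigma>. u \<sigma> - v \<sigma>) K = div_vel S u K - div_vel S v K"
  by (simp add: div_vel_def inner_diff_left right_diff_distrib sum_subtractf diff_divide_distrib)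

lemma cell_mean_diff: "cell_mean S (\<lambda>K. q K - r K) = cell_mean S q - cell_mean S r"
  by (simp add: cell_mean_def right_diff_distrib sum_subtractf diff_divide_distrib)

lemma cell_mean_const: "cell_mean S (\<lambda>K. c) = c"
  using vol_region_pos by (simp add: cell_mean_def sum_distrib_right[symmetric] sum_vol_cells)

lemma cell_mean_delta_p: "cell_mean S (delta_p S \<gamma> e r) = 0"
proof -
  have "cell_mean S (delta_p S \<gamma> e r) = cell_mean S (\<lambda>K. r K powr \<gamma> - cell_mean S (\<lambda>L. r L powr \<gamma>)) / e\<^sup>2"
    by (simp add: cell_mean_def delta_p_def sum_divide_distrib mult.commute)
  then show ?thesis by (simp add: cell_mean_diff cell_mean_const)
qed

lemma grad_delta_p: "grad_p S (delta_p S \<gamma> e r) \<sigma> = (1 / e\<^sup>2) *\<^sub>R grad_p S (\<lambda>K. r K powr \<gamma>) \<sigma>"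
proof -
  have "delta_p S \<gamma> e r = (\<lambda>K. (1 / e\<^sup>2) * r K powr \<gamma> + (- cell_mean S (\<lambda>L. r L powr \<gamma>) / e\<^sup>2))"
    by (simp add: delta_p_def fun_eq_iff diff_divide_distrib)
  then show ?thesis using grad_p_linear(1)[of "1 / e\<^sup>2" "\<lambda>K. r K powr \<gamma>" "- cell_mean S (\<lambda>L. r L powr \<gamma>) / e\<^sup>2" \<sigma>] by simp
qed

text \<open>The explicit terms depend on the old velocity only and cancel in the difference of two
  solutions, whose residuals are therefore zero. The zero mean removes the free additive constant of
  the pressure.\<close>

lemma incompressible_step_unique:
  assumes dt: "\<delta>t > 0"
    and 1: "incompressible_step S \<mu> lam \<delta>t u v q" "cell_mean S q = 0"
    and 2: "incompressible_step S \<mu> lam \<delta>t u v' q'" "cell_mean S q' = 0"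
  shows "(\<forall>\<sigma>\<in>faces S. v \<sigma> = v' \<sigma>) \<and> (\<forall>K\<in>cells S. q K = q' K)"
proof -
  obtain C where C: "\<And>u q. u \<in> HE0 S \<Longrightarrow> cell_mean S q = 0 \<Longrightarrow>
    (\<Sum>\<sigma>\<in>int_faces S. norm (u \<sigma>)) + (\<Sum>K\<in>cells S. \<bar>q K\<bar>)
     \<le> C * ((\<Sum>\<sigma>\<in>int_faces S. norm (u \<sigma> + \<delta>t *\<^sub>R grad_p S q \<sigma>)) + (\<Sum>K\<in>cells S. \<bar>div_vel S u K\<bar>))"
    using saddle_point_stability[OF dt] by blast
  let ?w = "\<lambda>\<sigma>. v \<sigma> - v' \<sigma>" and ?r = "\<lambda>K. q K - q' K"
  have H: "v \<in> HE0 S" "v' \<in> HE0 S" using 1 2 by (auto simp: incompressible_step_def)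
  have "?w \<sigma> + \<delta>t *\<^sub>R grad_p S ?r \<sigma> = 0" if s: "\<sigma> \<in> int_faces S" for \<sigma>
  proof -
    have "(1 / \<delta>t) *\<^sub>R (v \<sigma> - u \<sigma>) + grad_p S q \<sigma> = (1 / \<delta>t) *\<^sub>R (v' \<sigma> - u \<sigma>) + grad_p S q' \<sigma>"
    proof -
      let ?X = "conv_up S (\<lambda>K. 1) u u \<sigma> - div_tau S \<mu> lam u \<sigma>"
      have "((1 / \<delta>t) *\<^sub>R (v \<sigma> - u \<sigma>) + grad_p S q \<sigma>) + ?X = 0" "((1 / \<delta>t) *\<^sub>R (v' \<sigma> - u \<sigma>) + grad_p S q' \<sigma>) + ?X = 0"
        using 1(1) 2(1) s by (simp_all add: incompressible_step_def add_ac add_diff_eq diff_add_eq)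
      then show ?thesis by (metis add_right_cancel)
    qed
    then have "(1 / \<delta>t) *\<^sub>R ?w \<sigma> + grad_p S ?r \<sigma> = 0"
      by (simp add: grad_p_linear(2) scaleR_diff_right algebra_simps)
    then have "\<delta>t *\<^sub>R ((1 / \<delta>t) *\<^sub>R ?w \<sigma> + grad_p S ?r \<sigma>) = 0" by simp
    then show ?thesis using dt by (simp add: scaleR_add_right)
  qed
  moreover have "div_vel S ?w K = 0" if "K \<in> cells S" for K
    using 1(1) 2(1) that by (simp add: div_vel_diff incompressible_step_def)
  ultimately have "(\<Sum>\<sigma>\<in>int_faces S. norm (?w \<sigma>)) + (\<Sum>K\<in>cells S. \<bar>?r K\<bar>) \<le> 0"
    using C[OF HE0_diff[OF H], of ?r] 1(2) 2(2) by (simp add: cell_mean_diff)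
  moreover have "0 \<le> (\<Sum>\<sigma>\<in>int_faces S. norm (?w \<sigma>))" "0 \<le> (\<Sum>K\<in>cells S. \<bar>?r K\<bar>)"
    by (auto intro: sum_nonneg)
  ultimately have "(\<Sum>\<sigma>\<in>int_faces S. norm (?w \<sigma>)) = 0" "(\<Sum>K\<in>cells S. \<bar>?r K\<bar>) = 0" by linarith+
  then have z: "\<forall>\<sigma>\<in>int_faces S. v \<sigma> = v' \<sigma>" "\<forall>K\<in>cells S. q K = q' K"
    by (simp_all add: sum_nonneg_eq_0_iff finite_int_faces finite_cells)
  have "\<forall>\<sigma>\<in>ext_faces S. v \<sigma> = v' \<sigma>" using H by (simp add: HE0_def)
  then show ?thesis using z faces_union by blast
qed

text \<open>The sequences \<open>r0, r1, r2\<close> stand for three successive densities, \<open>v1, v2\<close> for two successive velocities.\<close>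

lemma scheme_step_limit:
  assumes g1: "\<gamma> \<ge> 1" and dt: "\<delta>t > 0" and eps: "\<And>m. \<epsilon> m > 0" "\<epsilon> \<longlonglongrightarrow> 0"
    and pos1: "\<And>m K. K \<in> cells S \<Longrightarrow> r1 m K > 0"
    and near1: "\<forall>\<^sub>F m in sequentially. \<forall>K\<in>cells S. \<bar>r1 m K - 1\<bar> \<le> A * \<epsilon> m"
    and r0: "\<And>K. K \<in> cells S \<Longrightarrow> (\<lambda>m. r0 m K) \<longlonglongrightarrow> 1"
    and v1: "\<And>\<sigma>. \<sigma> \<in> faces S \<Longrightarrow> (\<lambda>m. v1 m \<sigma>) \<longlonglongrightarrow> ul \<sigma>"
    and H2: "\<And>m. v2 m \<in> HE0 S"
    and mass: "\<And>m K. K \<in> cells S \<Longrightarrow> (1 / \<delta>t) * (r2 m K - r1 m K) + div_mass S (r2 m) (v2 m) K = 0"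
    and mom: "\<And>m \<sigma>. \<sigma> \<in> int_faces S \<Longrightarrow>
        (1 / \<delta>t) *\<^sub>R (dual_density S (r1 m) \<sigma> *\<^sub>R v2 m \<sigma> - dual_density S (r0 m) \<sigma> *\<^sub>R v1 m \<sigma>)
        + conv_up S (r1 m) (v1 m) (v1 m) \<sigma> - div_tau S \<mu> lam (v1 m) \<sigma>
        + (1 / (\<epsilon> m)\<^sup>2) *\<^sub>R grad_p S (\<lambda>K. r2 m K powr \<gamma>) \<sigma> = 0"
  obtains B where "\<And>m K. K \<in> cells S \<Longrightarrow> r2 m K > 0"
    "\<forall>\<^sub>F m in sequentially. \<forall>K\<in>cells S. \<bar>r2 m K - 1\<bar> \<le> B * \<epsilon> m"
    "\<And>K. K \<in> cells S \<Longrightarrow> (\<lambda>m. r1 m K) \<longlonglongrightarrow> 1"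
    "\<And>\<sigma>. \<sigma> \<in> faces S \<Longrightarrow> convergent (\<lambda>m. v2 m \<sigma>)"
    "\<And>K. K \<in> cells S \<Longrightarrow> convergent (\<lambda>m. delta_p S \<gamma> (\<epsilon> m) (r2 m) K)"
    "\<And>ul' pl. (\<And>\<sigma>. \<sigma> \<in> faces S \<Longrightarrow> (\<lambda>m. v2 m \<sigma>) \<longlonglongrightarrow> ul' \<sigma>) \<Longrightarrow>
       (\<And>K. K \<in> cells S \<Longrightarrow> (\<lambda>m. delta_p S \<gamma> (\<epsilon> m) (r2 m) K) \<longlonglongrightarrow> pl K) \<Longrightarrow>
       incompressible_step S \<mu> lam \<delta>t ul ul' pl \<and> cell_mean S pl = 0"
proof -
  have pos2: "r2 m K > 0" if "K \<in> cells S" for m K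
    by (rule density_positive[OF dt pos1 mass that])
  have squeeze: "(\<lambda>m. r m K) \<longlonglongrightarrow> 1"
    if "\<forall>\<^sub>F m in sequentially. \<forall>K\<in>cells S. \<bar>r m K - 1\<bar> \<le> D * \<epsilon> m" "K \<in> cells S" for r :: "nat \<Rightarrow> 'd cellfun" and D K
  proof -
    have "(\<lambda>m. r m K - 1) \<longlonglongrightarrow> 0"
    proof (rule Lim_null_comparison)
      show "\<forall>\<^sub>F m in sequentially. norm (r m K - 1) \<le> D * \<epsilon> m"
        using that(1) by eventually_elim (use that(2) in simp)
      show "(\<lambda>m. D * \<epsilon> m) \<longlonglongrightarrow> 0" using tendsto_mult_right_zero[OF eps(2)] .
    qed
    then show ?thesis by (simp add: LIM_zero_iff)
  qed
  define A' where "A' = \<bar>A\<bar>"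
  have near1': "\<forall>\<^sub>F m in sequentially. \<forall>K\<in>cells S. \<bar>r1 m K - 1\<bar> \<le> A' * \<epsilon> m"
    using near1
  proof eventually_elim
    case (elim m)
    have "A * \<epsilon> m \<le> A' * \<epsilon> m" using eps(1)[of m] by (simp add: A'_def mult_right_mono)
    then show ?case using elim by force
  qed
  note r1 = squeeze[OF near1]
  \<comment> \<open>All explicit terms of the momentum balance, multiplied by \<delta>t. They
    converge since both densities tend to 1 and the old velocity converges; the limit
    \<open>gl\<close> is the right-hand side of the limit scheme.\<close>
  define g where "g m \<sigma> = dual_density S (r0 m) \<sigma> *\<^sub>R v1 m \<sigma> - \<delta>t *\<^sub>R (conv_up S (r1 m) (v1 m) (v1 m) \<sigma> - div_tau S \<mu> lam (v1 m) \<sigma>)" for m \<sigma>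
  define gl where "gl \<sigma> = ul \<sigma> - \<delta>t *\<^sub>R (conv_up S (\<lambda>_. 1) ul ul \<sigma> - div_tau S \<mu> lam ul \<sigma>)" for \<sigma>
  define dn where "dn m = dual_density S (r1 m)" for m
  have dn: "(\<lambda>m. dn m \<sigma>) \<longlonglongrightarrow> 1" if s: "\<sigma> \<in> int_faces S" for \<sigma>
    using dual_density_tendsto[of r1 "\<lambda>_. 1" sequentially, OF r1 s] by (simp add: dn_def dual_density_one[OF s])
  have gl: "(\<lambda>m. g m \<sigma>) \<longlonglongrightarrow> gl \<sigma>" if s: "\<sigma> \<in> int_faces S" for \<sigma>
  proof -
    have f: "\<sigma> \<in> faces S" using s by (simp add: faces_union)
    have d0: "(\<lambda>m. dual_density S (r0 m) \<sigma>) \<longlonglongrightarrow> 1"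
      using dual_density_tendsto[of r0 "\<lambda>_. 1" sequentially, OF r0 s] by (simp add: dual_density_one[OF s])
    have c: "(\<lambda>m. conv_up S (r1 m) (v1 m) (v1 m) \<sigma>) \<longlonglongrightarrow> conv_up S (\<lambda>_. 1) ul ul \<sigma>"
      by (rule conv_up_tendsto[OF f r1 v1])
    have t: "(\<lambda>m. div_tau S \<mu> lam (v1 m) \<sigma>) \<longlonglongrightarrow> div_tau S \<mu> lam ul \<sigma>"
      by (rule div_tau_tendsto[OF f v1])
    have "(\<lambda>m. g m \<sigma>) \<longlonglongrightarrow> 1 *\<^sub>R ul \<sigma> - \<delta>t *\<^sub>R (conv_up S (\<lambda>_. 1) ul ul \<sigma> - div_tau S \<mu> lam ul \<sigma>)"
      unfolding g_def by (intro tendsto_intros d0 c t v1 f)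
    then show ?thesis by (simp add: gl_def)
  qed
  have mom': "dn m \<sigma> *\<^sub>R v2 m \<sigma> - g m \<sigma> + (\<delta>t / (\<epsilon> m)\<^sup>2) *\<^sub>R grad_p S (\<lambda>K. r2 m K powr \<gamma>) \<sigma> = 0"
    if s: "\<sigma> \<in> int_faces S" for m \<sigma>
  proof -
    have "\<delta>t *\<^sub>R ((1 / \<delta>t) *\<^sub>R (dual_density S (r1 m) \<sigma> *\<^sub>R v2 m \<sigma> - dual_density S (r0 m) \<sigma> *\<^sub>R v1 m \<sigma>)
        + conv_up S (r1 m) (v1 m) (v1 m) \<sigma> - div_tau S \<mu> lam (v1 m) \<sigma>
        + (1 / (\<epsilon> m)\<^sup>2) *\<^sub>R grad_p S (\<lambda>K. r2 m K powr \<gamma>) \<sigma>) = 0"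
      using mom[OF s, of m] by simp
    then show ?thesis using dt by (simp add: g_def dn_def scaleR_add_right scaleR_diff_right algebra_simps)
  qed
  \<comment> \<open>The added 1 is the margin that makes \<open>G\<close> a bound for
    \<open>g m\<close> for all large \<open>m\<close>.\<close>
  define G where "G = (\<Sum>\<sigma>\<in>int_faces S. norm (gl \<sigma>)) + 1"
  have G0: "G \<ge> 0" unfolding G_def by (intro add_nonneg_nonneg sum_nonneg) auto
  have ev_g: "\<forall>\<^sub>F m in sequentially. \<forall>\<sigma>\<in>int_faces S. norm (g m \<sigma>) \<le> G"
  proof (intro eventually_ball_finite finite_int_faces ballI)
    fix \<sigma> assume s: "\<sigma> \<in> int_faces S"
    have "norm (gl \<sigma>) \<le> (\<Sum>\<sigma>\<in>int_faces S. norm (gl \<sigma>))" by (rule member_le_sum[OF s]) (simp_all add: finite_int_faces)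
    then have "norm (gl \<sigma>) < G" by (simp add: G_def)
    then have "\<forall>\<^sub>F m in sequentially. norm (g m \<sigma>) < G" by (rule order_tendstoD(2)[OF tendsto_norm[OF gl[OF s]]])
    then show "\<forall>\<^sub>F m in sequentially. norm (g m \<sigma>) \<le> G" by (rule eventually_mono) simp
  qed
  have ev_dn: "\<forall>\<^sub>F m in sequentially. \<forall>\<sigma>\<in>int_faces S. dn m \<sigma> \<ge> 1/2"
  proof (intro eventually_ball_finite finite_int_faces ballI)
    fix \<sigma> assume s: "\<sigma> \<in> int_faces S"
    have "\<forall>\<^sub>F m in sequentially. dn m \<sigma> > 1/2" by (rule order_tendstoD(1)[OF dn[OF s]]) simp
    then show "\<forall>\<^sub>F m in sequentially. dn m \<sigma> \<ge> 1/2" by (rule eventually_mono) simp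
  qed
  have ev_eps: "\<forall>\<^sub>F m in sequentially. \<epsilon> m \<le> 1"
  proof (rule eventually_mono)
    show "\<forall>\<^sub>F m in sequentially. \<epsilon> m < 1" by (rule order_tendstoD(2)[OF eps(2)]) simp
  qed simp
  obtain B U where B0: "B \<ge> 0" and BU: "\<And>e \<rho> \<rho>' u' g dn. 0 < e \<and> e \<le> 1 \<and>
     (\<forall>K\<in>cells S. \<rho> K > 0 \<and> \<rho>' K > 0 \<and> \<bar>\<rho> K - 1\<bar> \<le> A' * e \<and> (1 / \<delta>t) * (\<rho>' K - \<rho> K) + div_mass S \<rho>' u' K = 0) \<and>
     (\<forall>\<sigma>\<in>int_faces S. dn \<sigma> \<ge> 1/2 \<and> norm (g \<sigma>) \<le> G \<and>
        dn \<sigma> *\<^sub>R u' \<sigma> - g \<sigma> + (\<delta>t / e\<^sup>2) *\<^sub>R grad_p S (\<lambda>K. \<rho>' K powr \<gamma>) \<sigma> = 0) \<Longrightarrow>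
     (\<forall>K\<in>cells S. \<bar>\<rho>' K - 1\<bar> \<le> B * e) \<and> (B * e \<le> 1/2 \<longrightarrow> (\<forall>\<sigma>\<in>int_faces S. norm (u' \<sigma>) \<le> U))"
    using energy_step[OF g1 dt G0, of A'] unfolding A'_def by (metis abs_ge_zero)
  have ev: "\<forall>\<^sub>F m in sequentially. (\<forall>K\<in>cells S. \<bar>r2 m K - 1\<bar> \<le> B * \<epsilon> m) \<and> (B * \<epsilon> m \<le> 1/2 \<longrightarrow> (\<forall>\<sigma>\<in>int_faces S. norm (v2 m \<sigma>) \<le> U))"
    using ev_g ev_dn ev_eps near1'
  proof eventually_elim
    case (elim m)
    show ?case
      by (rule BU[of "\<epsilon> m" "r1 m" "r2 m" "v2 m" "dn m" "g m"])
        (use elim eps(1) pos1 pos2 mass mom' in blast)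
  qed
  have near2: "\<forall>\<^sub>F m in sequentially. \<forall>K\<in>cells S. \<bar>r2 m K - 1\<bar> \<le> B * \<epsilon> m"
    using ev by eventually_elim blast
  note r2 = squeeze[OF near2]
  have "(\<lambda>m. B * \<epsilon> m) \<longlonglongrightarrow> 0" using tendsto_mult_right_zero[OF eps(2)] .
  then have "\<forall>\<^sub>F m in sequentially. B * \<epsilon> m < 1/2" by (rule order_tendstoD(2)) simp
  then have evU: "\<forall>\<^sub>F m in sequentially. \<forall>\<sigma>\<in>int_faces S. norm (v2 m \<sigma>) \<le> U"
    using ev by eventually_elim auto
  define \<pi> where "\<pi> m = delta_p S \<gamma> (\<epsilon> m) (r2 m)" for m
  \<comment> \<open>The momentum residual of the stability estimate. It differs from
    \<open>g m\<close> by \<open>(1 - dn m \<sigma>) *\<^sub>R v2 m \<sigma>\<close>, which tends to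
    0 because the new velocity is already known to be bounded.\<close>
  define h where "h m \<sigma> = v2 m \<sigma> + \<delta>t *\<^sub>R grad_p S (\<pi> m) \<sigma>" for m \<sigma>
  have h: "(\<lambda>m. h m \<sigma>) \<longlonglongrightarrow> gl \<sigma>" if s: "\<sigma> \<in> int_faces S" for \<sigma>
  proof -
    have eq: "h m \<sigma> = g m \<sigma> + (1 - dn m \<sigma>) *\<^sub>R v2 m \<sigma>" for m
    proof -
      have "\<delta>t *\<^sub>R grad_p S (\<pi> m) \<sigma> = (\<delta>t / (\<epsilon> m)\<^sup>2) *\<^sub>R grad_p S (\<lambda>K. r2 m K powr \<gamma>) \<sigma>"
        by (simp add: \<pi>_def grad_delta_p)
      also have "\<dots> = g m \<sigma> - dn m \<sigma> *\<^sub>R v2 m \<sigma>"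
        using mom'[OF s, of m] by (simp add: add_eq_0_iff)
      finally show ?thesis by (simp add: h_def scaleR_diff_left)
    qed
    have "(\<lambda>m. (1 - dn m \<sigma>) *\<^sub>R v2 m \<sigma>) \<longlonglongrightarrow> 0"
    proof (rule Lim_null_comparison)
      show "\<forall>\<^sub>F m in sequentially. norm ((1 - dn m \<sigma>) *\<^sub>R v2 m \<sigma>) \<le> \<bar>1 - dn m \<sigma>\<bar> * U"
        using evU by eventually_elim (use s in \<open>simp add: mult_left_mono\<close>)
      have "(\<lambda>m. \<bar>1 - dn m \<sigma>\<bar> * U) \<longlonglongrightarrow> \<bar>1 - 1\<bar> * U" by (intro tendsto_intros dn s)
      then show "(\<lambda>m. \<bar>1 - dn m \<sigma>\<bar> * U) \<longlonglongrightarrow> 0" by simp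
    qed
    from tendsto_add[OF gl[OF s] this] show ?thesis by (simp add: eq)
  qed
  \<comment> \<open>The mass balance controls the divergence of the mass flux; replacing the upwind
    density by 1 changes each flux by at most a multiple of \<open>\<epsilon> m\<close>.\<close>
  have dv: "(\<lambda>m. div_vel S (v2 m) K) \<longlonglongrightarrow> 0" if K: "K \<in> cells S" for K
  proof -
    have "(\<lambda>m. div_mass S (r2 m) (v2 m) K) \<longlonglongrightarrow> - ((1 / \<delta>t) * (1 - 1))"
    proof -
      have "div_mass S (r2 m) (v2 m) K = - ((1 / \<delta>t) * (r2 m K - r1 m K))" for m using mass[OF K, of m] by linarith
      then show ?thesis by (simp only:) (intro tendsto_intros r1 r2 K)
    qed
    moreover have "(\<lambda>m. div_mass S (r2 m) (v2 m) K - div_vel S (v2 m) K) \<longlonglongrightarrow> (1 / vol K) * (\<Sum>\<sigma>\<in>facets K. 0)"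
    proof -
      have eq: "div_mass S (r2 m) (v2 m) K - div_vel S (v2 m) K
        = (1 / vol K) * (\<Sum>\<sigma>\<in>facets K. flux S (r2 m) (v2 m) K \<sigma> - flux S (\<lambda>_. 1) (v2 m) K \<sigma>)" for m
        unfolding div_vel_eq_mass[OF H2] div_mass_def by (simp add: sum_subtractf right_diff_distrib)
      have "(\<lambda>m. flux S (r2 m) (v2 m) K \<sigma> - flux S (\<lambda>_. 1) (v2 m) K \<sigma>) \<longlonglongrightarrow> 0" if s: "\<sigma> \<in> facets K" for \<sigma>
      proof (cases "\<sigma> \<in> ext_faces S")
        case True
        then show ?thesis by (simp add: flux_def)
      next
        case False
        then have i: "\<sigma> \<in> int_faces S" using faces_split[OF K s] by simp
        have Kc: "K \<in> cells_of S \<sigma>" using K s by (simp add: cells_of_def)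
        have nK: "norm (outward_normal K \<sigma>) = 1" using convex_body.norm_normal[OF cell_body[OF K] s] .
        show ?thesis
        proof (rule Lim_null_comparison)
          show "\<forall>\<^sub>F m in sequentially. norm (flux S (r2 m) (v2 m) K \<sigma> - flux S (\<lambda>_. 1) (v2 m) K \<sigma>) \<le> area \<sigma> * (B * \<epsilon> m) * U"
            using near2 evU
          proof eventually_elim
            case (elim m)
            have u1: "upwind (\<lambda>_. 1) (v2 m) \<sigma> = 1" by (simp add: upwind_def)
            have "flux S (r2 m) (v2 m) K \<sigma> - flux S (\<lambda>_. 1) (v2 m) K \<sigma>
              = area \<sigma> * (upwind (r2 m) (v2 m) \<sigma> - 1) * (v2 m \<sigma> \<bullet> outward_normal K \<sigma>)"
              unfolding flux_upwind[OF i Kc] u1 by (simp add: algebra_simps)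
            then have "norm (flux S (r2 m) (v2 m) K \<sigma> - flux S (\<lambda>_. 1) (v2 m) K \<sigma>)
              = area \<sigma> * \<bar>upwind (r2 m) (v2 m) \<sigma> - 1\<bar> * \<bar>v2 m \<sigma> \<bullet> outward_normal K \<sigma>\<bar>"
              using area_int_pos[OF i] by (simp add: abs_mult)
            also have "\<dots> \<le> area \<sigma> * (B * \<epsilon> m) * U"
            proof (intro mult_mono mult_left_mono)
              show "\<bar>upwind (r2 m) (v2 m) \<sigma> - 1\<bar> \<le> B * \<epsilon> m"
                using upwind_cases[of "r2 m" "v2 m" \<sigma>] elim(1) face_cells(5,6)[OF i] by metis
              have "\<bar>v2 m \<sigma> \<bullet> outward_normal K \<sigma>\<bar> \<le> norm (v2 m \<sigma>) * norm (outward_normal K \<sigma>)" by (rule Cauchy_Schwarz_ineq2)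
              then show "\<bar>v2 m \<sigma> \<bullet> outward_normal K \<sigma>\<bar> \<le> U" using elim(2) i nK by force
            qed (use area_int_pos[OF i] B0 eps(1)[of m] in auto)
            finally show ?case .
          qed
          have "(\<lambda>m. area \<sigma> * (B * \<epsilon> m) * U) \<longlonglongrightarrow> area \<sigma> * (B * 0) * U" by (intro tendsto_intros eps(2))
          then show "(\<lambda>m. area \<sigma> * (B * \<epsilon> m) * U) \<longlonglongrightarrow> 0" by simp
        qed
      qed
      then show ?thesis unfolding eq by (intro tendsto_intros)
    qed
    ultimately show ?thesis using tendsto_diff by fastforce
  qed
  obtain C where C: "\<And>u q. u \<in> HE0 S \<Longrightarrow> cell_mean S q = 0 \<Longrightarrow>
    (\<Sum>\<sigma>\<in>int_faces S. norm (u \<sigma>)) + (\<Sum>K\<in>cells S. \<bar>q K\<bar>)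
     \<le> C * ((\<Sum>\<sigma>\<in>int_faces S. norm (u \<sigma> + \<delta>t *\<^sub>R grad_p S q \<sigma>)) + (\<Sum>K\<in>cells S. \<bar>div_vel S u K\<bar>))"
    using saddle_point_stability[OF dt] by blast
  \<comment> \<open>Both kinds of residual need a common value type, so the scalar divergence is
    placed on a unit vector, which preserves distances.\<close>
  define Y where "Y i m = (case i of Inl \<sigma> \<Rightarrow> h m \<sigma> | Inr K \<Rightarrow> div_vel S (v2 m) K *\<^sub>R axis undefined 1)" for i m
  define I where "I = int_faces S <+> cells S"
  have Isum: "(\<Sum>i\<in>I. dist (Y i m) (Y i k)) = (\<Sum>\<sigma>\<in>int_faces S. norm (h m \<sigma> - h k \<sigma>)) + (\<Sum>K\<in>cells S. \<bar>div_vel S (v2 m) K - div_vel S (v2 k) K\<bar>)" for m k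
    unfolding I_def by (subst sum.Plus) (simp_all add: finite_int_faces finite_cells Y_def dist_norm scaleR_diff_left[symmetric] norm_axis_1)
  have Ifin: "finite I" by (simp add: I_def finite_int_faces finite_cells)
  have Yconv: "convergent (Y i)" if "i \<in> I" for i
  proof (cases i)
    case (Inl \<sigma>)
    then show ?thesis using h[of \<sigma>] that by (auto simp: I_def Y_def[abs_def] convergent_def)
  next
    case (Inr K)
    then have "K \<in> cells S" using that by (auto simp: I_def)
    then have "(\<lambda>m. div_vel S (v2 m) K *\<^sub>R (axis undefined 1 :: real^'d)) \<longlonglongrightarrow> 0 *\<^sub>R axis undefined 1" by (intro tendsto_intros dv)
    then show ?thesis using Inr by (auto simp: Y_def[abs_def] convergent_def)
  qed
  have stab: "(\<Sum>\<sigma>\<in>int_faces S. norm (v2 m \<sigma> - v2 k \<sigma>)) + (\<Sum>K\<in>cells S. \<bar>\<pi> m K - \<pi> k K\<bar>) \<le> C * (\<Sum>i\<in>I. dist (Y i m) (Y i k))" for m k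
  proof -
    have "(v2 m \<sigma> - v2 k \<sigma>) + \<delta>t *\<^sub>R grad_p S (\<lambda>K. \<pi> m K - \<pi> k K) \<sigma> = h m \<sigma> - h k \<sigma>" for \<sigma>
      by (simp add: h_def grad_p_linear(2) scaleR_diff_right)
    then show ?thesis
      using C[OF HE0_diff[OF H2 H2], of "\<lambda>K. \<pi> m K - \<pi> k K" m k]
      by (simp add: Isum cell_mean_diff \<pi>_def cell_mean_delta_p div_vel_diff)
  qed
  have conv_v: "convergent (\<lambda>m. v2 m \<sigma>)" if s: "\<sigma> \<in> int_faces S" for \<sigma>
  proof (rule convergent_by_stability[OF Ifin Yconv])
    fix m k
    have "norm (v2 m \<sigma> - v2 k \<sigma>) \<le> (\<Sum>\<sigma>\<in>int_faces S. norm (v2 m \<sigma> - v2 k \<sigma>))"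
      by (rule member_le_sum[OF s]) (simp_all add: finite_int_faces)
    moreover have "0 \<le> (\<Sum>K\<in>cells S. \<bar>\<pi> m K - \<pi> k K\<bar>)" by (rule sum_nonneg) simp
    ultimately show "dist (v2 m \<sigma>) (v2 k \<sigma>) \<le> C * (\<Sum>i\<in>I. dist (Y i m) (Y i k))" using stab[of m k] unfolding dist_norm[of "v2 m \<sigma>"] by linarith
  qed
  have conv_p: "convergent (\<lambda>m. \<pi> m K)" if K: "K \<in> cells S" for K
  proof (rule convergent_by_stability[OF Ifin Yconv])
    fix m k
    have "\<bar>\<pi> m K - \<pi> k K\<bar> \<le> (\<Sum>K\<in>cells S. \<bar>\<pi> m K - \<pi> k K\<bar>)"
      by (rule member_le_sum[OF K]) (simp_all add: finite_cells)
    moreover have "0 \<le> (\<Sum>\<sigma>\<in>int_faces S. norm (v2 m \<sigma> - v2 k \<sigma>))" by (rule sum_nonneg) simp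
    ultimately show "dist (\<pi> m K) (\<pi> k K) \<le> C * (\<Sum>i\<in>I. dist (Y i m) (Y i k))" using stab[of m k] unfolding dist_real_def[of "\<pi> m K"] by linarith
  qed
  have ext0: "v2 m \<sigma> = 0" if "\<sigma> \<in> ext_faces S" for m \<sigma>
    using H2[of m] that by (simp add: HE0_def)
  have conv_f: "convergent (\<lambda>m. v2 m \<sigma>)" if "\<sigma> \<in> faces S" for \<sigma>
    using that conv_v[of \<sigma>] ext0[of \<sigma>] unfolding faces_union by (auto simp: convergent_const)
  have fin: "incompressible_step S \<mu> lam \<delta>t ul ul' pl \<and> cell_mean S pl = 0"
    if ul': "\<And>\<sigma>. \<sigma> \<in> faces S \<Longrightarrow> (\<lambda>m. v2 m \<sigma>) \<longlonglongrightarrow> ul' \<sigma>" and pl: "\<And>K. K \<in> cells S \<Longrightarrow> (\<lambda>m. \<pi> m K) \<longlonglongrightarrow> pl K" for ul' pl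
  proof (rule conjI)
  show "incompressible_step S \<mu> lam \<delta>t ul ul' pl"
    unfolding incompressible_step_def
  proof (intro conjI ballI)
    have "ul' \<sigma> = 0" if s: "\<sigma> \<in> ext_faces S" for \<sigma>
      using ul'[of \<sigma>] s unfolding faces_union by (simp add: ext0[OF s] LIMSEQ_const_iff)
    then show "ul' \<in> HE0 S" by (simp add: HE0_def)
    show "div_vel S ul' K = 0" if "K \<in> cells S" for K
      using LIMSEQ_unique[OF div_vel_tendsto[OF that ul'] dv[OF that]] .
    fix \<sigma> assume s: "\<sigma> \<in> int_faces S"
    have f: "\<sigma> \<in> faces S" using s by (simp add: faces_union)
    have "(\<lambda>m. h m \<sigma>) \<longlonglongrightarrow> ul' \<sigma> + \<delta>t *\<^sub>R grad_p S pl \<sigma>"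
      unfolding h_def by (intro tendsto_intros ul' f grad_p_tendsto[OF s pl])
    then have "ul' \<sigma> + \<delta>t *\<^sub>R grad_p S pl \<sigma> = gl \<sigma>" using LIMSEQ_unique h[OF s] by blast
    then have "(1 / \<delta>t) *\<^sub>R (ul' \<sigma> + \<delta>t *\<^sub>R grad_p S pl \<sigma>) = (1 / \<delta>t) *\<^sub>R gl \<sigma>" by simp
    then show "(1 / \<delta>t) *\<^sub>R (ul' \<sigma> - ul \<sigma>) + conv_up S (\<lambda>K. 1) ul ul \<sigma> - div_tau S \<mu> lam ul \<sigma> + grad_p S pl \<sigma> = 0"
      using dt by (simp add: gl_def scaleR_add_right scaleR_diff_right algebra_simps)
  qed
  show "cell_mean S pl = 0"
  proof -
    have "(\<lambda>m. cell_mean S (\<pi> m)) \<longlonglongrightarrow> cell_mean S pl"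
      unfolding cell_mean_def by (intro tendsto_intros pl)
    moreover have "(\<lambda>m. cell_mean S (\<pi> m)) = (\<lambda>_. 0)" by (simp add: \<pi>_def cell_mean_delta_p)
    ultimately have "(\<lambda>_::nat. 0) \<longlonglongrightarrow> cell_mean S pl" by (simp only:)
    then show ?thesis by (simp add: LIMSEQ_const_iff)
  qed
  qed
  show ?thesis by (rule that[OF pos2 near2 r1 conv_f conv_p[unfolded \<pi>_def] fin[unfolded \<pi>_def]])
qed

end

section \<open>L2 calculus on the domain, and its link with Borel integrals over the whole
  space\<close>

section \<open>Square integrable functions\<close>

lemma L2D:
  assumes "f \<in> L2 \<Omega>"
  shows "f \<in> borel_measurable (lebesgue_on \<Omega>)" "integrable (lebesgue_on \<Omega>) (\<lambda>x. (norm (f x))\<^sup>2)"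
  using assms by (auto simp: L2_def)

lemma l2_norm_nonneg: "0 \<le> l2_norm \<Omega> f"
  by (simp add: l2_norm_def)

lemma L2_uminus: "f \<in> L2 \<Omega> \<Longrightarrow> (\<lambda>x. - f x) \<in> L2 \<Omega>"
  by (simp add: L2_def)

lemma l2_norm_commute: "l2_norm \<Omega> (\<lambda>x. f x - g x) = l2_norm \<Omega> (\<lambda>x. g x - f x)"
  by (simp add: l2_norm_def norm_minus_commute)

lemma l2_Cauchy_Schwarz:
  assumes f: "f \<in> L2 \<Omega>" and g: "g \<in> L2 \<Omega>"
  shows "integrable (lebesgue_on \<Omega>) (\<lambda>x. norm (f x) * norm (g x))"
    and "(LINT x|lebesgue_on \<Omega>. norm (f x) * norm (g x)) \<le> l2_norm \<Omega> f * l2_norm \<Omega> g"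
proof -
  have m: "(\<lambda>x. norm (f x)) \<in> borel_measurable (lebesgue_on \<Omega>)" "(\<lambda>x. norm (g x)) \<in> borel_measurable (lebesgue_on \<Omega>)"
    using L2D(1)[OF f] L2D(1)[OF g] by measurable
  note cs = Cauchy_Schwarz_integral[OF m L2D(2)[OF f] L2D(2)[OF g]]
  show "integrable (lebesgue_on \<Omega>) (\<lambda>x. norm (f x) * norm (g x))" by (rule cs(1))
  show "(LINT x|lebesgue_on \<Omega>. norm (f x) * norm (g x)) \<le> l2_norm \<Omega> f * l2_norm \<Omega> g"
    using cs(2) unfolding l2_norm_def by linarith
qed

lemma L2_add:
  assumes f: "f \<in> L2 \<Omega>" and g: "g \<in> L2 \<Omega>"
  shows "(\<lambda>x. f x + g x) \<in> L2 \<Omega>" and "l2_norm \<Omega> (\<lambda>x. f x + g x) \<le> l2_norm \<Omega> f + l2_norm \<Omega> g"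
proof -
  let ?M = "lebesgue_on \<Omega>"
  let ?h = "\<lambda>x. (norm (f x))\<^sup>2 + 2 * (norm (f x) * norm (g x)) + (norm (g x))\<^sup>2"
  have m: "(\<lambda>x. f x + g x) \<in> borel_measurable ?M" using L2D(1)[OF f] L2D(1)[OF g] by measurable
  have hi: "integrable ?M ?h" using L2D(2)[OF f] L2D(2)[OF g] l2_Cauchy_Schwarz(1)[OF f g] by simp
  have le: "(norm (f x + g x))\<^sup>2 \<le> ?h x" for x
  proof -
    have "(norm (f x + g x))\<^sup>2 \<le> (norm (f x) + norm (g x))\<^sup>2" by (intro power_mono norm_triangle_ineq norm_ge_zero)
    then show ?thesis by (simp add: power2_sum mult.assoc)
  qed
  have i: "integrable ?M (\<lambda>x. (norm (f x + g x))\<^sup>2)"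
    by (rule Bochner_Integration.integrable_bound[OF hi]) (use m le in \<open>auto intro!: AE_I2 intro: order_trans[OF _ abs_ge_self]\<close>)
  show "(\<lambda>x. f x + g x) \<in> L2 \<Omega>" using m i by (simp add: L2_def)
  have "(LINT x|?M. (norm (f x + g x))\<^sup>2) \<le> (LINT x|?M. ?h x)" by (rule integral_mono[OF i hi le])
  also have "\<dots> = (LINT x|?M. (norm (f x))\<^sup>2) + 2 * (LINT x|?M. norm (f x) * norm (g x)) + (LINT x|?M. (norm (g x))\<^sup>2)"
    using L2D(2)[OF f] L2D(2)[OF g] l2_Cauchy_Schwarz(1)[OF f g] by simp
  also have "\<dots> \<le> (l2_norm \<Omega> f)\<^sup>2 + 2 * (l2_norm \<Omega> f * l2_norm \<Omega> g) + (l2_norm \<Omega> g)\<^sup>2"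
    using l2_Cauchy_Schwarz(2)[OF f g] by (simp add: l2_norm_def)
  also have "\<dots> = (l2_norm \<Omega> f + l2_norm \<Omega> g)\<^sup>2" by (simp add: power2_sum)
  finally have "sqrt (LINT x|?M. (norm (f x + g x))\<^sup>2) \<le> sqrt ((l2_norm \<Omega> f + l2_norm \<Omega> g)\<^sup>2)"
    by (rule real_sqrt_le_mono)
  then show "l2_norm \<Omega> (\<lambda>x. f x + g x) \<le> l2_norm \<Omega> f + l2_norm \<Omega> g"
    unfolding l2_norm_def[of \<Omega> "\<lambda>x. f x + g x"] real_sqrt_abs
      abs_of_nonneg[OF add_nonneg_nonneg[OF l2_norm_nonneg l2_norm_nonneg]] .
qed

lemma L2_diff:
  assumes f: "f \<in> L2 \<Omega>" and g: "g \<in> L2 \<Omega>"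
  shows "(\<lambda>x. f x - g x) \<in> L2 \<Omega>" and "l2_norm \<Omega> (\<lambda>x. f x - g x) \<le> l2_norm \<Omega> f + l2_norm \<Omega> g"
  using L2_add[OF f L2_uminus[OF g]] by (simp_all add: l2_norm_def)

lemma l2_norm_triangle:
  assumes f: "f \<in> L2 \<Omega>" and g: "g \<in> L2 \<Omega>" and h: "h \<in> L2 \<Omega>"
  shows "l2_norm \<Omega> (\<lambda>x. f x - h x) \<le> l2_norm \<Omega> (\<lambda>x. f x - g x) + l2_norm \<Omega> (\<lambda>x. g x - h x)"
  using L2_add(2)[OF L2_diff(1)[OF f g] L2_diff(1)[OF g h]] by simp

lemma L2_component:
  fixes f :: "real^'d::finite \<Rightarrow> real^'d"
  assumes f: "f \<in> L2 \<Omega>"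
  shows "(\<lambda>x. f x $ i) \<in> L2 \<Omega>" and "l2_norm \<Omega> (\<lambda>x. f x $ i) \<le> l2_norm \<Omega> f"
proof -
  have m: "(\<lambda>x. f x $ i) \<in> borel_measurable (lebesgue_on \<Omega>)"
    using borel_measurable_inner[OF L2D(1)[OF f] borel_measurable_const[of "axis i 1"]] by (simp add: inner_axis)
  have le: "(norm (f x $ i))\<^sup>2 \<le> (norm (f x))\<^sup>2" for x
    by (intro power_mono) (simp_all add: component_le_norm_cart)
  have i: "integrable (lebesgue_on \<Omega>) (\<lambda>x. (norm (f x $ i))\<^sup>2)"
    by (rule Bochner_Integration.integrable_bound[OF L2D(2)[OF f]]) (use m le in \<open>auto intro!: AE_I2\<close>)
  show "(\<lambda>x. f x $ i) \<in> L2 \<Omega>" using m i by (simp add: L2_def)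
  show "l2_norm \<Omega> (\<lambda>x. f x $ i) \<le> l2_norm \<Omega> f"
    unfolding l2_norm_def by (intro real_sqrt_le_mono integral_mono[OF i L2D(2)[OF f] le])
qed

lemma L2_of_components:
  fixes f :: "real^'d::finite \<Rightarrow> real^'d"
  assumes f: "\<And>i. (\<lambda>x. f x $ i) \<in> L2 \<Omega>"
  shows "f \<in> L2 \<Omega>"
proof -
  have "f \<in> borel_measurable (lebesgue_on \<Omega>)"
  proof -
    have "(\<lambda>x. \<Sum>i\<in>UNIV. (f x $ i) *\<^sub>R (axis i 1 :: real^'d)) \<in> borel_measurable (lebesgue_on \<Omega>)"
      by (intro borel_measurable_sum borel_measurable_scaleR borel_measurable_const L2D(1)[OF f])
    moreover have "(\<lambda>x. \<Sum>i\<in>UNIV. (f x $ i) *\<^sub>R (axis i 1 :: real^'d)) = f"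
      by (simp only: scalar_mult_eq_scaleR[symmetric] basis_expansion)
    ultimately show ?thesis by (simp only:)
  qed
  moreover have "(norm (f x))\<^sup>2 = (\<Sum>i\<in>UNIV. (norm (f x $ i))\<^sup>2)" for x
    by (simp add: norm_vec_def L2_set_def sum_nonneg)
  moreover have "integrable (lebesgue_on \<Omega>) (\<lambda>x. \<Sum>i\<in>UNIV. (norm (f x $ i))\<^sup>2)"
    using L2D(2)[OF f] by simp
  ultimately show ?thesis by (simp add: L2_def)
qed

text \<open>Bridge between \<open>lebesgue_on \<Omega>\<close>, where the Sobolev norms live, and
  \<open>lborel\<close>, where slicing takes place.\<close>

lemma integral_lebesgue_on_support:
  fixes f :: "real^'d::finite \<Rightarrow> 'b::euclidean_space"
  assumes O: "\<Omega> \<in> sets lebesgue" and f: "f \<in> borel_measurable borel" and z: "\<And>x. x \<notin> \<Omega> \<Longrightarrow> f x = 0"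
  shows "(LINT x|lebesgue_on \<Omega>. f x) = (LINT x|lborel. f x)"
    and "integrable (lebesgue_on \<Omega>) f \<longleftrightarrow> integrable lborel f"
proof -
  have eq: "(\<lambda>x. indicator \<Omega> x *\<^sub>R f x) = f" using z by (auto simp: indicator_def fun_eq_iff)
  have f': "f \<in> borel_measurable lborel" using f by simp
  show "(LINT x|lebesgue_on \<Omega>. f x) = (LINT x|lborel. f x)"
    using O by (subst integral_restrict_space) (simp_all add: eq integral_completion[OF f'])
  show "integrable (lebesgue_on \<Omega>) f \<longleftrightarrow> integrable lborel f"
    using O by (subst integrable_restrict_space) (simp_all add: eq integrable_completion[OF f'])
qed

lemma c1c_diff:
  assumes a: "c1c \<phi>" and b: "c1c \<psi>"
  shows "c1c (\<lambda>x. \<phi> x - \<psi> x)" and "grad (\<lambda>x. \<phi> x - \<psi> x) x = grad \<phi> x - grad \<psi> x"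
proof -
  have g: "grad (\<lambda>x. \<phi> x - \<psi> x) x = grad \<phi> x - grad \<psi> x" for x
  proof (rule grad_eqI)
    have "((\<lambda>x. \<phi> x - \<psi> x) has_derivative (\<lambda>h. grad \<phi> x \<bullet> h - grad \<psi> x \<bullet> h)) (at x)"
      using a b by (intro has_derivative_diff has_derivative_grad) (auto simp: c1c_def)
    then show "((\<lambda>x. \<phi> x - \<psi> x) has_derivative (\<lambda>h. (grad \<phi> x - grad \<psi> x) \<bullet> h)) (at x)"
      by (simp add: inner_diff_left)
  qed
  then show "grad (\<lambda>x. \<phi> x - \<psi> x) x = grad \<phi> x - grad \<psi> x" .
  have "pd i (\<lambda>x. \<phi> x - \<psi> x) = (\<lambda>x. pd i \<phi> x - pd i \<psi> x)" for i
  proof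
    fix x
    show "pd i (\<lambda>x. \<phi> x - \<psi> x) x = pd i \<phi> x - pd i \<psi> x"
      using arg_cong[OF g[of x], of "\<lambda>v. v \<bullet> axis i 1"] by (simp only: inner_diff_left grad_inner_axis)
  qed
  moreover have "bounded {x. \<phi> x - \<psi> x \<noteq> 0}"
    by (rule bounded_subset[of "{x. \<phi> x \<noteq> 0} \<union> {x. \<psi> x \<noteq> 0}"]) (use a b in \<open>auto simp: c1c_def\<close>)
  ultimately show "c1c (\<lambda>x. \<phi> x - \<psi> x)"
    using a b by (auto simp: c1c_def intro!: continuous_on_diff differentiable_diff)
qed

lemma c1c_L2:
  assumes O: "\<Omega> \<in> sets lebesgue" and \<phi>: "c1c \<phi>" and z: "\<And>x. x \<notin> \<Omega> \<Longrightarrow> \<phi> x = 0" "\<And>x. x \<notin> \<Omega> \<Longrightarrow> grad \<phi> x = 0"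
  shows "\<phi> \<in> L2 \<Omega>" "grad \<phi> \<in> L2 \<Omega>"
    "l2_norm \<Omega> \<phi> = sqrt (LINT x|lborel. (\<phi> x)\<^sup>2)" "l2_norm \<Omega> (grad \<phi>) = sqrt (LINT x|lborel. (norm (grad \<phi> x))\<^sup>2)"
proof -
  have m: "\<phi> \<in> borel_measurable borel" "grad \<phi> \<in> borel_measurable borel"
    using c1c_continuous[OF \<phi>] c1c_grad_continuous[OF \<phi>] by (auto intro: borel_measurable_continuous_onI)
  have m2: "(\<lambda>x. (\<phi> x)\<^sup>2) \<in> borel_measurable borel" "(\<lambda>x. (norm (grad \<phi> x))\<^sup>2) \<in> borel_measurable borel"
    using m by measurable
  have mm: "f \<in> borel_measurable (lebesgue_on \<Omega>)" if "f \<in> borel_measurable borel" for f :: "real^'a \<Rightarrow> 'b::euclidean_space"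
    by (intro measurable_restrict_space1 measurable_completion) (use that in simp)
  note i1 = integral_lebesgue_on_support[OF O m2(1)] and i2 = integral_lebesgue_on_support[OF O m2(2)]
  show "\<phi> \<in> L2 \<Omega>" using mm[OF m(1)] i1(2) z(1) c1c_square_integrable(1)[OF \<phi>] by (simp add: L2_def)
  show "grad \<phi> \<in> L2 \<Omega>" using mm[OF m(2)] i2(2) z(2) c1c_square_integrable(2)[OF \<phi>] by (simp add: L2_def)
  show "l2_norm \<Omega> \<phi> = sqrt (LINT x|lborel. (\<phi> x)\<^sup>2)" using i1(1) z(1) by (simp add: l2_norm_def)
  show "l2_norm \<Omega> (grad \<phi>) = sqrt (LINT x|lborel. (norm (grad \<phi> x))\<^sup>2)" using i2(1) z(2) by (simp add: l2_norm_def)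
qed

lemma test_function_support:
  assumes "test_function \<Omega> \<phi>" "x \<notin> \<Omega>"
  shows "\<phi> x = 0" "grad \<phi> x = 0"
proof -
  have "closure {x. \<phi> x \<noteq> 0} \<subseteq> \<Omega>" using assms(1) by (simp add: test_function_def)
  then show "\<phi> x = 0" "grad \<phi> x = 0"
    using assms(2) closure_subset[of "{x. \<phi> x \<noteq> 0}"] c1c_grad_support[OF test_function_c1c[OF assms(1)]] by blast+
qed

section \<open>Face integrals of traces and their continuity\<close>

section \<open>Traces\<close>

locale flat_facet =
  fixes \<sigma> :: "(real^'d::finite) set" and n :: "real^'d" and c :: real
  assumes n: "norm n = 1" and aff: "affine hull \<sigma> = {x. n \<bullet> x = c}" and compact: "compact \<sigma>"
begin

lemma borel: "\<sigma> \<in> sets borel"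
  using compact by (simp add: borel_compact)

lemma surf_finite: "finite_measure (surf \<sigma>)"
proof
  obtain B where B: "\<And>x. x \<in> \<sigma> \<Longrightarrow> norm x \<le> B"
    using compact_imp_bounded[OF compact] unfolding bounded_iff by auto
  have "norm x \<le> B + \<bar>c\<bar> + \<bar>c\<bar> + 1/2" if x: "x \<in> cylinder \<sigma>" for x
  proof -
    have x': "x \<in> slab n c" "hproj n c x \<in> \<sigma>" using x by (auto simp: cylinder_eq[OF n aff])
    have "norm (hproj n c x - c *\<^sub>R n) \<le> norm (hproj n c x) + norm (c *\<^sub>R n)" by (rule norm_triangle_ineq4)
    then show ?thesis using norm_slab_le[OF n x'(1)] B[OF x'(2)] n by simp
  qed
  then have "bounded (cylinder \<sigma>)" unfolding bounded_iff by blast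
  then have fin: "emeasure lborel (cylinder \<sigma>) < \<infinity>" by (rule emeasure_bounded_finite)
  have cb: "cylinder \<sigma> \<in> sets borel" by (rule cylinder_borel[OF n aff borel])
  have m: "hproj n c \<in> restrict_space lborel (cylinder \<sigma>) \<rightarrow>\<^sub>M borel"
    by (rule measurable_restrict_space1) simp
  have "emeasure (surf \<sigma>) (space (surf \<sigma>)) = emeasure (restrict_space lborel (cylinder \<sigma>)) (cylinder \<sigma>)"
    unfolding surf_def aff closest_point_hyperplane[OF n]
    by (subst emeasure_distr[OF m]) (simp_all add: space_restrict_space)
  also have "\<dots> = emeasure lborel (cylinder \<sigma>)" using cb by (simp add: emeasure_restrict_space)
  finally show "emeasure (surf \<sigma>) (space (surf \<sigma>)) \<noteq> \<infinity>" using fin by simp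
qed

lemma sets_surf [simp]: "sets (surf \<sigma>) = sets borel"
  by (simp add: surf_def)

lemma set_integrable_continuous:
  fixes f :: "real^'d \<Rightarrow> real"
  assumes "continuous_on UNIV f"
  shows "set_integrable (surf \<sigma>) \<sigma> f"
proof -
  interpret finite_measure "surf \<sigma>" by (rule surf_finite)
  have "compact (f ` \<sigma>)" by (rule compact_continuous_image[OF continuous_on_subset[OF assms] compact]) simp
  then obtain B where B: "\<And>x. x \<in> \<sigma> \<Longrightarrow> norm (f x) \<le> B" using compact_imp_bounded bounded_iff by (metis image_eqI)
  have m: "(\<lambda>x. indicator \<sigma> x *\<^sub>R f x) \<in> borel_measurable (surf \<sigma>)"
    using borel borel_measurable_continuous_onI[OF assms] by (simp add: measurable_cong_sets[OF sets_surf refl])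
  show ?thesis unfolding set_integrable_def
  proof (rule integrable_const_bound[of _ "\<bar>B\<bar>", OF _ m], rule AE_I2)
    fix x
    show "norm (indicator \<sigma> x *\<^sub>R f x) \<le> \<bar>B\<bar>" using B[of x] by (cases "x \<in> \<sigma>") auto
  qed
qed

lemma integral_le_sqrt_area:
  fixes f :: "real^'d \<Rightarrow> real"
  assumes f: "set_integrable (surf \<sigma>) \<sigma> f" and f2: "set_integrable (surf \<sigma>) \<sigma> (\<lambda>x. (f x)\<^sup>2)"
  shows "\<bar>LINT x:\<sigma>|surf \<sigma>. f x\<bar> \<le> sqrt (LINT x:\<sigma>|surf \<sigma>. (f x)\<^sup>2) * sqrt (area \<sigma>)"
proof -
  interpret finite_measure "surf \<sigma>" by (rule surf_finite)
  have m1: "(\<lambda>x. indicator \<sigma> x *\<^sub>R f x) \<in> borel_measurable (surf \<sigma>)" using f by (auto simp: set_integrable_def)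
  have m2: "(indicator \<sigma> :: real^'d \<Rightarrow> real) \<in> borel_measurable (surf \<sigma>)" by (rule borel_measurable_indicator) (use borel in simp)
  have sq: "(\<lambda>x. (indicator \<sigma> x *\<^sub>R f x)\<^sup>2) = (\<lambda>x. indicator \<sigma> x *\<^sub>R (f x)\<^sup>2)" "(\<lambda>x. (indicator \<sigma> x :: real)\<^sup>2) = indicator \<sigma>"
    by (auto simp: fun_eq_iff indicator_def)
  have i2: "integrable (surf \<sigma>) (\<lambda>x. (indicator \<sigma> x :: real)\<^sup>2)" unfolding sq using borel by (intro integrable_real_indicator) (simp_all add: emeasure_eq_measure)
  have "\<bar>LINT x|surf \<sigma>. (indicator \<sigma> x *\<^sub>R f x) * indicator \<sigma> x\<bar> \<le> sqrt (LINT x|surf \<sigma>. (indicator \<sigma> x *\<^sub>R f x)\<^sup>2) * sqrt (LINT x|surf \<sigma>. (indicator \<sigma> x)\<^sup>2)"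
    by (rule Cauchy_Schwarz_integral(2)[OF m1 m2 _ i2]) (use f2 in \<open>simp only: sq set_integrable_def\<close>)
  moreover have "(\<lambda>x. (indicator \<sigma> x *\<^sub>R f x) * indicator \<sigma> x) = (\<lambda>x. indicator \<sigma> x *\<^sub>R f x)" by (auto simp: fun_eq_iff indicator_def)
  moreover have "(LINT x|surf \<sigma>. indicator \<sigma> x) = area \<sigma>" using borel by (simp add: area_def)
  ultimately show ?thesis unfolding set_lebesgue_integral_def sq by (simp only:)
qed

text \<open>Traces are defined through L2 convergence on \<sigma>; the finite area turns it into
  convergence of the integrals.\<close>

lemma trace_integral_limit:
  assumes tr: "is_trace \<Omega> \<sigma> f g" and ap: "h1_approx \<Omega> \<phi> f"
  shows "(\<lambda>k. LINT x:\<sigma>|surf \<sigma>. \<phi> k x) \<longlonglongrightarrow> (LINT x:\<sigma>|surf \<sigma>. g x)"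
proof -
  have g: "set_integrable (surf \<sigma>) \<sigma> g" "set_integrable (surf \<sigma>) \<sigma> (\<lambda>x. (g x)\<^sup>2)"
    and lim: "(\<lambda>k. LINT x:\<sigma>|surf \<sigma>. (\<phi> k x - g x)\<^sup>2) \<longlonglongrightarrow> 0"
    using tr ap by (auto simp: is_trace_def)
  have c: "continuous_on UNIV (\<phi> k)" for k
    using ap c1c_continuous[OF test_function_c1c] by (auto simp: h1_approx_def)
  have p: "set_integrable (surf \<sigma>) \<sigma> (\<phi> k)" "set_integrable (surf \<sigma>) \<sigma> (\<lambda>x. (\<phi> k x)\<^sup>2)" for k
    by (auto intro!: set_integrable_continuous c continuous_intros)
  have d: "set_integrable (surf \<sigma>) \<sigma> (\<lambda>x. \<phi> k x - g x)" for k using p(1) g(1) by (rule set_integral_diff)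
  have d2: "set_integrable (surf \<sigma>) \<sigma> (\<lambda>x. (\<phi> k x - g x)\<^sup>2)" for k
  proof -
    have sq: "(indicator \<sigma> x *\<^sub>R h x)\<^sup>2 = indicator \<sigma> x *\<^sub>R (h x)\<^sup>2" for h :: "real^'d \<Rightarrow> real" and x
      by (auto simp: indicator_def)
    have pr: "integrable (surf \<sigma>) (\<lambda>x. (indicator \<sigma> x *\<^sub>R \<phi> k x) * (indicator \<sigma> x *\<^sub>R g x))"
      by (rule Cauchy_Schwarz_integral(1)) (use p[of k] g in \<open>simp_all only: set_integrable_def sq borel_measurable_integrable\<close>)
    have "integrable (surf \<sigma>) (\<lambda>x. indicator \<sigma> x *\<^sub>R (\<phi> k x)\<^sup>2 - 2 * ((indicator \<sigma> x *\<^sub>R \<phi> k x) * (indicator \<sigma> x *\<^sub>R g x)) + indicator \<sigma> x *\<^sub>R (g x)\<^sup>2)"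
      using p(2)[of k] g(2) pr unfolding set_integrable_def by (intro Bochner_Integration.integrable_add Bochner_Integration.integrable_diff integrable_mult_right)
    moreover have "indicator \<sigma> x *\<^sub>R (\<phi> k x)\<^sup>2 - 2 * ((indicator \<sigma> x *\<^sub>R \<phi> k x) * (indicator \<sigma> x *\<^sub>R g x)) + indicator \<sigma> x *\<^sub>R (g x)\<^sup>2
       = indicator \<sigma> x *\<^sub>R (\<phi> k x - g x)\<^sup>2" for x by (auto simp: indicator_def power2_diff)
    ultimately show ?thesis unfolding set_integrable_def by (simp only:)
  qed
  have "(\<lambda>k. (LINT x:\<sigma>|surf \<sigma>. \<phi> k x) - (LINT x:\<sigma>|surf \<sigma>. g x)) \<longlonglongrightarrow> 0"
  proof (rule Lim_null_comparison)
    show "\<forall>\<^sub>F k in sequentially. norm ((LINT x:\<sigma>|surf \<sigma>. \<phi> k x) - (LINT x:\<sigma>|surf \<sigma>. g x)) \<le> sqrt (LINT x:\<sigma>|surf \<sigma>. (\<phi> k x - g x)\<^sup>2) * sqrt (area \<sigma>)"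
    proof (intro always_eventually allI)
      fix k
      show "norm ((LINT x:\<sigma>|surf \<sigma>. \<phi> k x) - (LINT x:\<sigma>|surf \<sigma>. g x)) \<le> sqrt (LINT x:\<sigma>|surf \<sigma>. (\<phi> k x - g x)\<^sup>2) * sqrt (area \<sigma>)"
        using integral_le_sqrt_area[OF d d2, of k] set_integral_diff(2)[OF p(1) g(1), of k] by simp
    qed
    have "(\<lambda>k. sqrt (LINT x:\<sigma>|surf \<sigma>. (\<phi> k x - g x)\<^sup>2) * sqrt (area \<sigma>)) \<longlonglongrightarrow> sqrt 0 * sqrt (area \<sigma>)" by (intro tendsto_intros lim)
    then show "(\<lambda>k. sqrt (LINT x:\<sigma>|surf \<sigma>. (\<phi> k x - g x)\<^sup>2) * sqrt (area \<sigma>)) \<longlonglongrightarrow> 0" by simp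
  qed
  then show ?thesis by (simp add: LIM_zero_iff)
qed

end

lemma wgrad_L2: "f \<in> H1 \<Omega> \<Longrightarrow> wgrad \<Omega> f \<in> L2 \<Omega>"
  unfolding H1_def wgrad_def by (smt (verit) mem_Collect_eq someI_ex weak_gradient_def)

text \<open>The trace inequality is applied to differences of approximating test functions, and the
  limit is taken at the end. The two weak gradients are kept apart because \<open>wgrad\<close> is a
  choice, so that the one chosen for \<open>f - f'\<close> need not be their difference
  pointwise.\<close>

lemma (in flat_facet) trace_difference:
  assumes O: "\<Omega> \<in> sets lebesgue" and f: "f \<in> H10 \<Omega>" "f' \<in> H10 \<Omega>" and tr: "is_trace \<Omega> \<sigma> f g" "is_trace \<Omega> \<sigma> f' g'"
  shows "\<bar>(LINT x:\<sigma>|surf \<sigma>. g x) - (LINT x:\<sigma>|surf \<sigma>. g' x)\<bar>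
    \<le> sqrt (2 * (l2_norm \<Omega> (\<lambda>x. f x - f' x) * l2_norm \<Omega> (\<lambda>x. wgrad \<Omega> f x - wgrad \<Omega> f' x))) * sqrt (area \<sigma>)"
proof -
  obtain \<phi> \<phi>' where ap: "h1_approx \<Omega> \<phi> f" "h1_approx \<Omega> \<phi>' f'" using f by (auto simp: H10_def)
  have fL: "f \<in> L2 \<Omega>" "f' \<in> L2 \<Omega>" "wgrad \<Omega> f \<in> L2 \<Omega>" "wgrad \<Omega> f' \<in> L2 \<Omega>"
    using f wgrad_L2 by (auto simp: H10_def H1_def)
  have tf: "test_function \<Omega> (\<phi> k)" "test_function \<Omega> (\<phi>' k)" for k using ap by (auto simp: h1_approx_def)
  note cc = test_function_c1c[OF tf(1)] test_function_c1c[OF tf(2)]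
  define \<psi> where "\<psi> k x = \<phi> k x - \<phi>' k x" for k x
  have \<psi>: "c1c (\<psi> k)" "grad (\<psi> k) x = grad (\<phi> k) x - grad (\<phi>' k) x" for k x
    unfolding \<psi>_def[abs_def] using c1c_diff[OF cc] by auto
  note pL = c1c_L2[OF O cc(1) test_function_support[OF tf(1)]] and pL' = c1c_L2[OF O cc(2) test_function_support[OF tf(2)]]
  have zero: "\<psi> k x = 0" "grad (\<psi> k) x = 0" if "x \<notin> \<Omega>" for k x
    using that test_function_support[OF tf(1)] test_function_support[OF tf(2)] by (simp_all add: \<psi>(2) \<psi>_def)
  have psL: "l2_norm \<Omega> (\<psi> k) = sqrt (LINT x|lborel. (\<psi> k x)\<^sup>2)" "l2_norm \<Omega> (grad (\<psi> k)) = sqrt (LINT x|lborel. (norm (grad (\<psi> k) x))\<^sup>2)" for k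
    by (rule c1c_L2[OF O \<psi>(1)[of k]]; rule zero; assumption)+
  define a where "a k = l2_norm \<Omega> (\<lambda>x. \<phi> k x - f x) + l2_norm \<Omega> (\<lambda>x. f x - f' x) + l2_norm \<Omega> (\<lambda>x. \<phi>' k x - f' x)" for k
  define b where "b k = l2_norm \<Omega> (\<lambda>x. grad (\<phi> k) x - wgrad \<Omega> f x) + l2_norm \<Omega> (\<lambda>x. wgrad \<Omega> f x - wgrad \<Omega> f' x) + l2_norm \<Omega> (\<lambda>x. grad (\<phi>' k) x - wgrad \<Omega> f' x)" for k
  have ak: "l2_norm \<Omega> (\<psi> k) \<le> a k" for k
    using l2_norm_triangle[OF pL(1) fL(1) pL'(1), of k k] l2_norm_triangle[OF fL(1,2) pL'(1), of k]
      l2_norm_commute[of \<Omega> f' "\<phi>' k"] unfolding a_def \<psi>_def by linarith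
  have bk: "l2_norm \<Omega> (grad (\<psi> k)) \<le> b k" for k
  proof -
    have "grad (\<psi> k) = (\<lambda>x. grad (\<phi> k) x - grad (\<phi>' k) x)" using \<psi>(2) by blast
    then show ?thesis
      using l2_norm_triangle[OF pL(2) fL(3) pL'(2), of k k] l2_norm_triangle[OF fL(3,4) pL'(2), of k]
        l2_norm_commute[of \<Omega> "wgrad \<Omega> f'" "grad (\<phi>' k)"] unfolding b_def by simp
  qed
  have alim: "a \<longlonglongrightarrow> 0 + l2_norm \<Omega> (\<lambda>x. f x - f' x) + 0" unfolding a_def using ap by (intro tendsto_intros) (auto simp: h1_approx_def)
  have blim: "b \<longlonglongrightarrow> 0 + l2_norm \<Omega> (\<lambda>x. wgrad \<Omega> f x - wgrad \<Omega> f' x) + 0" unfolding b_def using ap by (intro tendsto_intros) (auto simp: h1_approx_def)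
  have le: "\<bar>(LINT x:\<sigma>|surf \<sigma>. \<phi> k x) - (LINT x:\<sigma>|surf \<sigma>. \<phi>' k x)\<bar> \<le> sqrt (2 * (a k * b k)) * sqrt (area \<sigma>)" for k
  proof -
    have c: "continuous_on UNIV (\<phi> k)" "continuous_on UNIV (\<phi>' k)" "continuous_on UNIV (\<psi> k)"
      using c1c_continuous cc \<psi>(1) by blast+
    have "(LINT x:\<sigma>|surf \<sigma>. \<phi> k x) - (LINT x:\<sigma>|surf \<sigma>. \<phi>' k x) = (LINT x:\<sigma>|surf \<sigma>. \<psi> k x)"
      unfolding \<psi>_def by (rule set_integral_diff(2)[symmetric]) (intro set_integrable_continuous c)+
    also have "\<bar>\<dots>\<bar> \<le> sqrt (LINT x:\<sigma>|surf \<sigma>. (\<psi> k x)\<^sup>2) * sqrt (area \<sigma>)"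
      by (intro integral_le_sqrt_area set_integrable_continuous continuous_intros c)
    also have "\<dots> \<le> sqrt (2 * (a k * b k)) * sqrt (area \<sigma>)"
    proof (intro mult_right_mono real_sqrt_le_mono)
      have "(LINT x:\<sigma>|surf \<sigma>. (\<psi> k x)\<^sup>2) \<le> 2 * (l2_norm \<Omega> (\<psi> k) * l2_norm \<Omega> (grad (\<psi> k)))"
        unfolding psL by (rule trace_inequality[OF n aff borel \<psi>(1)])
      also have "\<dots> \<le> 2 * (a k * b k)"
        by (intro mult_left_mono mult_mono ak bk order_trans[OF l2_norm_nonneg ak]) (auto simp: l2_norm_nonneg)
      finally show "(LINT x:\<sigma>|surf \<sigma>. (\<psi> k x)\<^sup>2) \<le> 2 * (a k * b k)" .
    qed (simp add: area_def)
    finally show ?thesis .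
  qed
  show ?thesis
  proof (rule LIMSEQ_le)
    show "(\<lambda>k. \<bar>(LINT x:\<sigma>|surf \<sigma>. \<phi> k x) - (LINT x:\<sigma>|surf \<sigma>. \<phi>' k x)\<bar>) \<longlonglongrightarrow> \<bar>(LINT x:\<sigma>|surf \<sigma>. g x) - (LINT x:\<sigma>|surf \<sigma>. g' x)\<bar>"
      by (intro tendsto_intros trace_integral_limit[OF tr(1) ap(1)] trace_integral_limit[OF tr(2) ap(2)])
    have "(\<lambda>k. sqrt (2 * (a k * b k)) * sqrt (area \<sigma>)) \<longlonglongrightarrow> sqrt (2 * ((0 + l2_norm \<Omega> (\<lambda>x. f x - f' x) + 0) * (0 + l2_norm \<Omega> (\<lambda>x. wgrad \<Omega> f x - wgrad \<Omega> f' x) + 0))) * sqrt (area \<sigma>)"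
      by (intro tendsto_intros alim blim)
    then show "(\<lambda>k. sqrt (2 * (a k * b k)) * sqrt (area \<sigma>)) \<longlonglongrightarrow> sqrt (2 * (l2_norm \<Omega> (\<lambda>x. f x - f' x) * l2_norm \<Omega> (\<lambda>x. wgrad \<Omega> f x - wgrad \<Omega> f' x))) * sqrt (area \<sigma>)" by simp
  qed (use le in blast)
qed

section \<open>Discrete initial velocities and densities as \<epsilon> tends to 0\<close>

section \<open>Initial data\<close>

text \<open>Splits the assumption on the data, an inequality in extended reals because of
  \<open>linf_norm\<close>, into three separate bounds; an infinite supremum norm is excluded
  beforehand.\<close>

lemma ereal_sum_bound:
  fixes L :: ereal
  assumes le: "ereal a + ereal b + ereal c * L \<le> ereal C" and nn: "0 \<le> a" "0 \<le> b" "0 < c" "0 \<le> L"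
  shows "a \<le> C" "b \<le> C" "L \<le> ereal (C / c)"
proof -
  have "L \<noteq> \<infinity>" using le nn(3) by auto
  then obtain l where l: "L = ereal l" using nn(4) by (cases L) auto
  have l0: "0 \<le> l" using nn(4) l by simp
  have s: "a + b + c * l \<le> C" using le by (simp add: l)
  have "0 \<le> c * l" using nn(3) l0 by simp
  then show "a \<le> C" "b \<le> C" using s nn by linarith+
  have "c * l \<le> C" using s nn by linarith
  then show "L \<le> ereal (C / c)" using nn(3) by (simp add: l field_simps)
qed

text \<open>The square is natural here: the trace inequality bounds the square of a difference by an
  L2 distance to the first power.\<close>

lemma convergent_of_square_bound:
  fixes T d :: "nat \<Rightarrow> real"
  assumes d: "d \<longlonglongrightarrow> 0" and c: "0 \<le> c" and bound: "\<And>m k. (T m - T k)\<^sup>2 \<le> c * (d m + d k)"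
  shows "convergent T"
proof -
  have "Cauchy T"
  proof (rule metric_CauchyI)
    fix e :: real assume e: "0 < e"
    have "e\<^sup>2 / (2 * (c + 1)) > 0" using e c by simp
    then have "\<forall>\<^sub>F m in sequentially. d m < e\<^sup>2 / (2 * (c + 1))" by (rule order_tendstoD(2)[OF d])
    then obtain N where N: "\<And>m. m \<ge> N \<Longrightarrow> d m < e\<^sup>2 / (2 * (c + 1))" unfolding eventually_sequentially by blast
    have "dist (T m) (T k) < e" if mk: "m \<ge> N" "k \<ge> N" for m k
    proof -
      have "c * (d m + d k) \<le> c * (2 * (e\<^sup>2 / (2 * (c + 1))))" using N[OF mk(1)] N[OF mk(2)] c by (intro mult_left_mono) auto
      also have "\<dots> = c / (c + 1) * e\<^sup>2" using c by (simp add: field_simps)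
      also have "\<dots> < 1 * e\<^sup>2" using c e by (intro mult_strict_right_mono) auto
      finally have "(T m - T k)\<^sup>2 < e\<^sup>2" using bound[of m k] by linarith
      then have "\<bar>T m - T k\<bar> < e" using e abs_le_square_iff[of e "T m - T k"] by (simp add: not_le[symmetric])
      then show ?thesis by (simp add: dist_real_def)
    qed
    then show "\<exists>M. \<forall>m\<ge>M. \<forall>n\<ge>M. dist (T m) (T n) < e" by blast
  qed
  then show ?thesis by (rule Cauchy_convergent)
qed

text \<open>\<open>is_trace\<close> provides integrability of the components only; the vector
  integrand is reassembled from them before a component of its integral is taken.\<close>

lemma set_integral_component:
  fixes g :: "'a \<Rightarrow> real^'d::finite"
  assumes "\<And>i. set_integrable M A (\<lambda>x. g x $ i)"
  shows "(LINT x:A|M. g x) $ i = (LINT x:A|M. g x $ i)"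
proof -
  have eq: "indicator A x *\<^sub>R g x = (\<Sum>i\<in>UNIV. (indicator A x *\<^sub>R (g x $ i)) *\<^sub>R (axis i 1 :: real^'d))" for x
  proof -
    have "g x = (\<Sum>i\<in>UNIV. (g x $ i) *\<^sub>R (axis i 1 :: real^'d))"
      by (simp only: scalar_mult_eq_scaleR[symmetric] basis_expansion)
    then have "indicator A x *\<^sub>R g x = indicator A x *\<^sub>R (\<Sum>i\<in>UNIV. (g x $ i) *\<^sub>R (axis i 1 :: real^'d))" by simp
    then show ?thesis by (simp only: scaleR_sum_right scaleR_scaleR real_scaleR_def)
  qed
  have int: "integrable M (\<lambda>x. indicator A x *\<^sub>R g x)" unfolding eq
    using assms unfolding set_integrable_def by (intro Bochner_Integration.integrable_sum integrable_scaleR_left)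
  have "(LINT x:A|M. g x) $ i = (LINT x|M. indicator A x *\<^sub>R g x) \<bullet> axis i 1"
    by (simp add: set_lebesgue_integral_def inner_axis)
  also have "\<dots> = (LINT x|M. (indicator A x *\<^sub>R g x) \<bullet> axis i 1)"
    by (rule integral_inner_left[symmetric]) (rule int)
  finally show ?thesis by (simp add: set_lebesgue_integral_def inner_axis)
qed

context staggered_discretization
begin

lemma facet_flat:
  assumes "K \<in> cells S" "\<sigma> \<in> facets K"
  shows "flat_facet \<sigma> (outward_normal K \<sigma>) (facet_offset K \<sigma>)"
proof
  interpret K: convex_body K by (rule cell_body[OF assms(1)])
  show "norm (outward_normal K \<sigma>) = 1" "affine hull \<sigma> = {x. outward_normal K \<sigma> \<bullet> x = facet_offset K \<sigma>}" "compact \<sigma>"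
    using K.norm_normal[OF assms(2)] K.facet_aff[OF assms(2)] K.facet_polytope[OF assms(2)] polytope_imp_compact by auto
qed

lemma int_face_flat: "\<sigma> \<in> int_faces S \<Longrightarrow> flat_facet \<sigma> (outward_normal (first_cell \<sigma>) \<sigma>) (facet_offset (first_cell \<sigma>) \<sigma>)"
  using facet_flat[OF face_cells(5,7)] by blast

lemma region_sets: "region S \<in> sets lebesgue"
  using region_lmeasurable by (rule fmeasurableD)

lemma indicator_L2:
  assumes "K \<in> cells S"
  shows "(indicator K :: real^'d \<Rightarrow> real) \<in> L2 (region S)"
proof -
  interpret finite_measure "lebesgue_on (region S)" using region_lmeasurable by (rule finite_measure_lebesgue_on)
  have "K \<in> sets borel" using convex_body.closed[OF cell_body[OF assms]] by (rule borel_closed)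
  then have m: "(indicator K :: real^'d \<Rightarrow> real) \<in> borel_measurable (lebesgue_on (region S))"
    by (intro measurable_restrict_space1 measurable_completion) simp
  then have "integrable (lebesgue_on (region S)) (indicator K :: real^'d \<Rightarrow> real)"
    by (intro integrable_const_bound[of _ 1] AE_I2) (simp_all add: indicator_def)
  moreover have "(\<lambda>x. (norm (indicator K x :: real))\<^sup>2) = (indicator K :: real^'d \<Rightarrow> real)"
    by (simp add: fun_eq_iff indicator_def)
  ultimately have "integrable (lebesgue_on (region S)) (\<lambda>x. (norm (indicator K x :: real))\<^sup>2)" by (simp only:)
  then show ?thesis using m unfolding L2_def by blast
qed

lemma integral_indicator_L2_bound:
  assumes K: "K \<in> cells S" and h: "h \<in> L2 (region S)"
  shows "integrable (lebesgue_on (region S)) (\<lambda>x. indicator K x * h x)"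
    "\<bar>LINT x|lebesgue_on (region S). indicator K x * h x\<bar> \<le> l2_norm (region S) (indicator K :: real^'d \<Rightarrow> real) * l2_norm (region S) h"
proof -
  have m: "(\<lambda>x. indicator K x * h x) \<in> borel_measurable (lebesgue_on (region S))"
    using L2D(1)[OF indicator_L2[OF K]] L2D(1)[OF h] by measurable
  note cs = l2_Cauchy_Schwarz[OF indicator_L2[OF K] h]
  show i: "integrable (lebesgue_on (region S)) (\<lambda>x. indicator K x * h x)"
    by (rule Bochner_Integration.integrable_bound[OF cs(1) m]) (simp add: abs_mult)
  have "\<bar>LINT x|lebesgue_on (region S). indicator K x * h x\<bar> \<le> (LINT x|lebesgue_on (region S). \<bar>indicator K x * h x\<bar>)"
    by (rule integral_abs_bound)
  then show "\<bar>LINT x|lebesgue_on (region S). indicator K x * h x\<bar> \<le> l2_norm (region S) (indicator K :: real^'d \<Rightarrow> real) * l2_norm (region S) h"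
    using cs(2) by (simp add: abs_mult)
qed

text \<open>Density of test functions: the volume term passes to the limit by L2 convergence of the
  gradients tested with the indicator of \<open>K\<close>, the interior faces by the definition of
  the trace. External faces contribute nothing, since test functions vanish on the frontier of the
  region.\<close>

lemma cell_divergence_theorem:
  assumes K: "K \<in> cells S" and f: "f \<in> H10 (region S)"
    and tr: "\<And>\<sigma>. \<sigma> \<in> facets K \<Longrightarrow> \<sigma> \<in> int_faces S \<Longrightarrow> is_trace (region S) \<sigma> f (G \<sigma>)"
  shows "(LINT x|lebesgue_on (region S). indicator K x * (wgrad (region S) f x $ i))
    = (\<Sum>\<sigma>\<in>facets K. if \<sigma> \<in> int_faces S then outward_normal K \<sigma> $ i * (LINT x:\<sigma>|surf \<sigma>. G \<sigma> x) else 0)"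
proof -
  interpret K: convex_body K by (rule cell_body[OF K])
  let ?O = "region S" and ?w = "wgrad (region S) f"
  obtain \<phi> where ap: "h1_approx ?O \<phi> f" using f by (auto simp: H10_def)
  have tf: "test_function ?O (\<phi> k)" for k using ap by (simp add: h1_approx_def)
  note cc = test_function_c1c[OF tf]
  have wL: "?w \<in> L2 ?O" using f wgrad_L2 by (auto simp: H10_def)
  have gL: "grad (\<phi> k) \<in> L2 ?O" for k by (rule c1c_L2(2)[OF region_sets cc[of k]]; rule test_function_support[OF tf]; assumption)
  have Kb: "K \<in> sets borel" using K.closed by (rule borel_closed)
  have lhs: "(LINT x:K|lborel. pd i (\<phi> k) x) = (LINT x|lebesgue_on ?O. indicator K x * (grad (\<phi> k) x $ i))" for k
  proof -
    have m: "(\<lambda>x. indicator K x * (grad (\<phi> k) x $ i)) \<in> borel_measurable borel"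
    proof -
      have "pd i (\<phi> k) \<in> borel_measurable borel" using cc[of k] by (auto simp: c1c_def intro: borel_measurable_continuous_onI)
      then have "(\<lambda>x. indicator K x * pd i (\<phi> k) x) \<in> borel_measurable borel"
        by (intro borel_measurable_times borel_measurable_indicator Kb)
      then show ?thesis by (simp add: grad_def)
    qed
    have "(LINT x|lebesgue_on ?O. indicator K x * (grad (\<phi> k) x $ i)) = (LINT x|lborel. indicator K x * (grad (\<phi> k) x $ i))"
      by (rule integral_lebesgue_on_support(1)[OF region_sets m]) (simp add: test_function_support[OF tf])
    then show ?thesis by (simp add: set_lebesgue_integral_def grad_def)
  qed
  have L: "(\<lambda>k. LINT x:K|lborel. pd i (\<phi> k) x) \<longlonglongrightarrow> (LINT x|lebesgue_on ?O. indicator K x * (?w x $ i))"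
  proof -
    have "(\<lambda>k. (LINT x|lebesgue_on ?O. indicator K x * (grad (\<phi> k) x $ i)) - (LINT x|lebesgue_on ?O. indicator K x * (?w x $ i))) \<longlonglongrightarrow> 0"
    proof (rule Lim_null_comparison)
      let ?c = "l2_norm ?O (indicator K :: real^'d \<Rightarrow> real)"
      show "\<forall>\<^sub>F k in sequentially. norm ((LINT x|lebesgue_on ?O. indicator K x * (grad (\<phi> k) x $ i)) - (LINT x|lebesgue_on ?O. indicator K x * (?w x $ i))) \<le> ?c * l2_norm ?O (\<lambda>x. grad (\<phi> k) x - ?w x)"
      proof (intro always_eventually allI)
        fix k
        have dL: "(\<lambda>x. grad (\<phi> k) x - ?w x) \<in> L2 ?O" using L2_diff(1)[OF gL wL] .
        have "(LINT x|lebesgue_on ?O. indicator K x * (grad (\<phi> k) x $ i)) - (LINT x|lebesgue_on ?O. indicator K x * (?w x $ i))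
          = (LINT x|lebesgue_on ?O. indicator K x * ((grad (\<phi> k) x - ?w x) $ i))"
          using integral_indicator_L2_bound(1)[OF K L2_component(1)[OF gL]] integral_indicator_L2_bound(1)[OF K L2_component(1)[OF wL]]
          by (simp add: right_diff_distrib)
        also have "\<bar>\<dots>\<bar> \<le> ?c * l2_norm ?O (\<lambda>x. (grad (\<phi> k) x - ?w x) $ i)"
          by (rule integral_indicator_L2_bound(2)[OF K L2_component(1)[OF dL]])
        also have "\<dots> \<le> ?c * l2_norm ?O (\<lambda>x. grad (\<phi> k) x - ?w x)"
          by (rule mult_left_mono[OF L2_component(2)[OF dL] l2_norm_nonneg])
        finally show "norm ((LINT x|lebesgue_on ?O. indicator K x * (grad (\<phi> k) x $ i)) - (LINT x|lebesgue_on ?O. indicator K x * (?w x $ i))) \<le> ?c * l2_norm ?O (\<lambda>x. grad (\<phi> k) x - ?w x)"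
          by simp
      qed
      show "(\<lambda>k. ?c * l2_norm ?O (\<lambda>x. grad (\<phi> k) x - ?w x)) \<longlonglongrightarrow> 0"
        using ap by (intro tendsto_mult_right_zero) (simp add: h1_approx_def)
    qed
    then show ?thesis unfolding lhs by (simp add: LIM_zero_iff)
  qed
  have R: "(\<lambda>k. \<Sum>\<sigma>\<in>facets K. outward_normal K \<sigma> $ i * (LINT x:\<sigma>|surf \<sigma>. \<phi> k x))
    \<longlonglongrightarrow> (\<Sum>\<sigma>\<in>facets K. if \<sigma> \<in> int_faces S then outward_normal K \<sigma> $ i * (LINT x:\<sigma>|surf \<sigma>. G \<sigma> x) else 0)"
  proof (rule tendsto_sum)
    fix \<sigma> assume s: "\<sigma> \<in> facets K"
    show "(\<lambda>k. outward_normal K \<sigma> $ i * (LINT x:\<sigma>|surf \<sigma>. \<phi> k x)) \<longlonglongrightarrow> (if \<sigma> \<in> int_faces S then outward_normal K \<sigma> $ i * (LINT x:\<sigma>|surf \<sigma>. G \<sigma> x) else 0)"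
    proof (cases "\<sigma> \<in> int_faces S")
      case True
      then show ?thesis
        using flat_facet.trace_integral_limit[OF facet_flat[OF K s] tr[OF s True] ap] by (simp add: tendsto_mult_left)
    next
      case False
      then have "\<sigma> \<in> ext_faces S" using faces_split[OF K s] by blast
      then have "\<sigma> \<inter> ?O = {}"
        using region_props(1) by (auto simp: ext_faces_def frontier_def interior_open)
      then have z: "\<phi> k x = 0" if "x \<in> \<sigma>" for k x using test_function_support(1)[OF tf] that by blast
      have "(\<lambda>x. indicator \<sigma> x *\<^sub>R \<phi> k x) = (\<lambda>_. 0)" for k using z by (auto simp: fun_eq_iff indicator_def)
      then have "(LINT x:\<sigma>|surf \<sigma>. \<phi> k x) = 0" for k by (simp only: set_lebesgue_integral_def Bochner_Integration.integral_zero)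
      then show ?thesis using False by simp
    qed
  qed
  have eq: "(\<lambda>k. LINT x:K|lborel. pd i (\<phi> k) x) = (\<lambda>k. \<Sum>\<sigma>\<in>facets K. outward_normal K \<sigma> $ i * (LINT x:\<sigma>|surf \<sigma>. \<phi> k x))"
    using K.divergence_theorem[OF cc] by blast
  show ?thesis by (rule LIMSEQ_unique[OF L[unfolded eq] R])
qed

lemma weak_div_L2:
  assumes "\<And>i. (\<lambda>x. v x $ i) \<in> H10 (region S)"
  shows "weak_div (region S) v \<in> L2 (region S)"
proof -
  have c: "(\<lambda>x. wgrad (region S) (\<lambda>y. v y $ i) x $ i) \<in> L2 (region S)" for i
    using assms[of i] by (intro L2_component(1) wgrad_L2) (simp add: H10_def)
  have "(\<lambda>x. \<Sum>i\<in>I. wgrad (region S) (\<lambda>y. v y $ i) x $ i) \<in> L2 (region S)" if "finite I" for I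
    using that
  proof (induction I rule: finite_induct)
    case empty
    then show ?case by (simp add: L2_def)
  next
    case (insert j I)
    then show ?case using L2_add(1)[OF c[of j] insert.IH] by simp
  qed
  then show ?thesis unfolding weak_div_def[abs_def] by simp
qed

lemma area_face_mean:
  assumes s: "\<sigma> \<in> int_faces S" and g: "\<And>i. is_trace (region S) \<sigma> (f i) (\<lambda>x. g x $ i)"
  shows "area \<sigma> * (face_mean \<sigma> g $ i) = (LINT x:\<sigma>|surf \<sigma>. g x $ i)"
proof -
  have "set_integrable (surf \<sigma>) \<sigma> (\<lambda>x. g x $ i)" for i using g[of i] by (simp add: is_trace_def)
  then have "(LINT x:\<sigma>|surf \<sigma>. g x) $ i = (LINT x:\<sigma>|surf \<sigma>. g x $ i)" by (rule set_integral_component)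
  then show ?thesis using area_int_pos[OF s] by (simp add: face_mean_def)
qed

text \<open>Taking face means commutes with the divergence, without any error term: this is the
  divergence theorem on \<open>K\<close> for each velocity component, summed over the
  components.\<close>

lemma div_vel_face_means:
  assumes K: "K \<in> cells S" and v: "\<And>i. (\<lambda>x. v x $ i) \<in> H10 (region S)" and u: "u \<in> HE0 S"
    and m: "\<And>\<sigma>. \<sigma> \<in> int_faces S \<Longrightarrow> \<exists>g. (\<forall>i. is_trace (region S) \<sigma> (\<lambda>x. v x $ i) (\<lambda>x. g x $ i)) \<and> u \<sigma> = face_mean \<sigma> g"
  shows "vol K * div_vel S u K = (LINT x|lebesgue_on (region S). indicator K x * weak_div (region S) v x)"
proof -
  let ?O = "region S"
  obtain G where G: "\<And>\<sigma> i. \<sigma> \<in> int_faces S \<Longrightarrow> is_trace ?O \<sigma> (\<lambda>x. v x $ i) (\<lambda>x. G \<sigma> x $ i)"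
    "\<And>\<sigma>. \<sigma> \<in> int_faces S \<Longrightarrow> u \<sigma> = face_mean \<sigma> (G \<sigma>)" using m by metis
  have face: "area \<sigma> * (u \<sigma> \<bullet> outward_normal K \<sigma>)
      = (\<Sum>i\<in>UNIV. if \<sigma> \<in> int_faces S then outward_normal K \<sigma> $ i * (LINT x:\<sigma>|surf \<sigma>. G \<sigma> x $ i) else 0)" if s: "\<sigma> \<in> facets K" for \<sigma>
  proof (cases "\<sigma> \<in> int_faces S")
    case True
    have "area \<sigma> * (u \<sigma> \<bullet> outward_normal K \<sigma>) = (\<Sum>i\<in>UNIV. outward_normal K \<sigma> $ i * (area \<sigma> * (face_mean \<sigma> (G \<sigma>) $ i)))"
      by (simp add: G(2)[OF True] inner_vec_def sum_distrib_left mult_ac)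
    then show ?thesis using True by (simp add: area_face_mean[OF True G(1)[OF True]])
  next
    case False
    then have "u \<sigma> = 0" using faces_split[OF K s] u by (auto simp: HE0_def)
    then show ?thesis using False by simp
  qed
  have wi: "integrable (lebesgue_on ?O) (\<lambda>x. indicator K x * (wgrad ?O (\<lambda>y. v y $ i) x $ i))" for i
    using v[of i] by (intro integral_indicator_L2_bound(1)[OF K] L2_component(1) wgrad_L2) (simp add: H10_def)
  have "vol K * div_vel S u K = (\<Sum>\<sigma>\<in>facets K. area \<sigma> * (u \<sigma> \<bullet> outward_normal K \<sigma>))"
    using vol_cell_pos[OF K] by (simp add: div_vel_def)
  also have "\<dots> = (\<Sum>\<sigma>\<in>facets K. \<Sum>i\<in>UNIV. if \<sigma> \<in> int_faces S then outward_normal K \<sigma> $ i * (LINT x:\<sigma>|surf \<sigma>. G \<sigma> x $ i) else 0)"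
    by (rule sum.cong[OF refl face])
  also have "\<dots> = (\<Sum>i\<in>UNIV. \<Sum>\<sigma>\<in>facets K. if \<sigma> \<in> int_faces S then outward_normal K \<sigma> $ i * (LINT x:\<sigma>|surf \<sigma>. G \<sigma> x $ i) else 0)"
    by (rule sum.swap)
  also have "\<dots> = (\<Sum>i\<in>UNIV. LINT x|lebesgue_on ?O. indicator K x * (wgrad ?O (\<lambda>y. v y $ i) x $ i))"
    by (intro sum.cong refl cell_divergence_theorem[symmetric, OF K v] G(1))
  also have "\<dots> = (LINT x|lebesgue_on ?O. indicator K x * weak_div ?O v x)"
    unfolding weak_div_def sum_distrib_left by (rule Bochner_Integration.integral_sum[symmetric]) (rule wi)
  finally show ?thesis .
qed

lemma wgrad_le_h1_norm: "l2_norm (region S) (wgrad (region S) (\<lambda>x. v x $ i)) \<le> h1_norm (region S) v"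
proof -
  let ?w = "\<lambda>i. l2_norm (region S) (wgrad (region S) (\<lambda>x. v x $ i))"
  have "(?w i)\<^sup>2 \<le> (\<Sum>i\<in>UNIV. (?w i)\<^sup>2)" by (rule member_le_sum) simp_all
  then have "(?w i)\<^sup>2 \<le> (l2_norm (region S) v)\<^sup>2 + (\<Sum>i\<in>UNIV. (?w i)\<^sup>2)" by (simp add: add_increasing)
  then show ?thesis unfolding h1_norm_def by (rule real_le_rsqrt)
qed

text \<open>In the trace estimate for a difference the gradient factor is merely bounded, by
  \<open>C + C\<close>, and the L2 factor is at most \<open>d m + d k\<close>; so no convergence of
  gradients is involved.\<close>

lemma face_means_convergent:
  assumes s: "\<sigma> \<in> int_faces S" and v: "\<And>m i. (\<lambda>x. v m x $ i) \<in> H10 (region S)"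
    and h1: "\<And>m. h1_norm (region S) (v m) \<le> C" and w: "w \<in> L2 (region S)"
    and lim: "(\<lambda>m. l2_norm (region S) (\<lambda>x. v m x - w x)) \<longlonglongrightarrow> 0"
    and m: "\<And>m. \<exists>g. (\<forall>i. is_trace (region S) \<sigma> (\<lambda>x. v m x $ i) (\<lambda>x. g x $ i)) \<and> u m = face_mean \<sigma> g"
  shows "convergent u"
proof -
  interpret s: flat_facet \<sigma> "outward_normal (first_cell \<sigma>) \<sigma>" "facet_offset (first_cell \<sigma>) \<sigma>" by (rule int_face_flat[OF s])
  let ?O = "region S"
  obtain G where G: "\<And>m i. is_trace ?O \<sigma> (\<lambda>x. v m x $ i) (\<lambda>x. G m x $ i)" "\<And>m. u m = face_mean \<sigma> (G m)" using m by metis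
  have C0: "0 \<le> C" using order_trans[OF l2_norm_nonneg wgrad_le_h1_norm] h1[of 0] by (rule order_trans)
  have vL: "v m \<in> L2 ?O" for m using v by (intro L2_of_components) (simp add: H10_def H1_def)
  have wL: "wgrad ?O (\<lambda>x. v m x $ i) \<in> L2 ?O" for m i
    by (rule wgrad_L2) (use v[of m i] in \<open>simp add: H10_def\<close>)
  define d where "d m = l2_norm ?O (\<lambda>x. v m x - w x)" for m
  have conv: "convergent (\<lambda>m. LINT x:\<sigma>|surf \<sigma>. G m x $ i)" for i
  proof (rule convergent_of_square_bound)
    show "d \<longlonglongrightarrow> 0" using lim by (simp add: d_def[abs_def])
    show "0 \<le> 4 * C * area \<sigma>" using C0 by (simp add: area_def)
    fix m k
    have "\<bar>(LINT x:\<sigma>|surf \<sigma>. G m x $ i) - (LINT x:\<sigma>|surf \<sigma>. G k x $ i)\<bar>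
      \<le> sqrt (2 * (l2_norm ?O (\<lambda>x. v m x $ i - v k x $ i) * l2_norm ?O (\<lambda>x. wgrad ?O (\<lambda>x. v m x $ i) x - wgrad ?O (\<lambda>x. v k x $ i) x))) * sqrt (area \<sigma>)"
      by (rule s.trace_difference[OF region_sets v v G(1) G(1)])
    also have "\<dots> \<le> sqrt (2 * ((d m + d k) * (C + C))) * sqrt (area \<sigma>)"
    proof (intro mult_right_mono real_sqrt_le_mono mult_left_mono mult_mono)
      have "l2_norm ?O (\<lambda>x. v m x $ i - v k x $ i) \<le> l2_norm ?O (\<lambda>x. v m x - v k x)"
        using L2_component(2)[OF L2_diff(1)[OF vL vL], of m k i] by simp
      also have "\<dots> \<le> d m + d k"
        using l2_norm_triangle[OF vL w vL, of m k] l2_norm_commute[of ?O w "v k"] by (simp add: d_def)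
      finally show "l2_norm ?O (\<lambda>x. v m x $ i - v k x $ i) \<le> d m + d k" .
      show "l2_norm ?O (\<lambda>x. wgrad ?O (\<lambda>x. v m x $ i) x - wgrad ?O (\<lambda>x. v k x $ i) x) \<le> C + C"
        using L2_diff(2)[OF wL wL, of m i k i] wgrad_le_h1_norm[of "v m" i] wgrad_le_h1_norm[of "v k" i] h1[of m] h1[of k] by linarith
    qed (auto simp: l2_norm_nonneg d_def area_def)
    finally have "\<bar>(LINT x:\<sigma>|surf \<sigma>. G m x $ i) - (LINT x:\<sigma>|surf \<sigma>. G k x $ i)\<bar>\<^sup>2 \<le> (sqrt (2 * ((d m + d k) * (C + C))) * sqrt (area \<sigma>))\<^sup>2"
      by (rule power_mono) simp
    also have "\<dots> = 2 * ((d m + d k) * (C + C)) * area \<sigma>"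
      using C0 by (simp add: power_mult_distrib d_def l2_norm_nonneg area_def)
    finally show "((LINT x:\<sigma>|surf \<sigma>. G m x $ i) - (LINT x:\<sigma>|surf \<sigma>. G k x $ i))\<^sup>2 \<le> 4 * C * area \<sigma> * (d m + d k)"
      by (simp add: algebra_simps)
  qed
  have comp: "u m $ i = (LINT x:\<sigma>|surf \<sigma>. G m x $ i) / area \<sigma>" for m i
    using area_face_mean[OF s G(1), of m i] area_int_pos[OF s] by (simp add: G(2) field_simps)
  have "\<forall>i. \<exists>l. (\<lambda>m. u m $ i) \<longlonglongrightarrow> l"
  proof
    fix i
    obtain l where "(\<lambda>m. LINT x:\<sigma>|surf \<sigma>. G m x $ i) \<longlonglongrightarrow> l" using conv[of i] by (auto simp: convergent_def)
    then have "(\<lambda>m. u m $ i) \<longlonglongrightarrow> l / area \<sigma>" unfolding comp using area_int_pos[OF s] by (intro tendsto_intros) auto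
    then show "\<exists>l. (\<lambda>m. u m $ i) \<longlonglongrightarrow> l" by blast
  qed
  then obtain l where "\<And>i. (\<lambda>m. u m $ i) \<longlonglongrightarrow> l i" by metis
  then have "u \<longlonglongrightarrow> (\<chi> i. l i)" by (intro vec_tendstoI) simp
  then show ?thesis by (auto simp: convergent_def)
qed

text \<open>Positivity does not follow from closeness to 1, since \<open>D\<close> may exceed 1; it
  holds because a positive function has a positive integral over a set of positive measure.\<close>

lemma cell_mean_near_one:
  assumes K: "K \<in> cells S" and m: "f \<in> borel_measurable (lebesgue_on (region S))"
    and pos: "AE x in lebesgue_on (region S). f x > 0" and near: "AE x in lebesgue_on (region S). \<bar>f x - 1\<bar> \<le> D"
  shows "(1 / vol K) * (LINT x:interior K|lebesgue. f x) > 0" "\<bar>(1 / vol K) * (LINT x:interior K|lebesgue. f x) - 1\<bar> \<le> D"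
proof -
  interpret K: convex_body K by (rule cell_body[OF K])
  let ?O = "region S"
  \<comment> \<open>\<open>interior K\<close> is known to lie in the closure of the region, whose
    frontier is a null set.\<close>
  have AEO: "AE x in lebesgue. x \<in> interior K \<longrightarrow> x \<in> ?O"
  proof -
    have "AE x in lebesgue. x \<notin> frontier ?O"
      using frontier_region_negligible by (intro AE_not_in) (simp add: negligible_iff_null_sets)
    then show ?thesis
    proof eventually_elim
      case (elim x)
      have "interior K \<subseteq> closure ?O" using interior_subset K Union_cells by blast
      then show ?case using elim region_props(1) by (auto simp: frontier_def interior_open)
    qed
  qed
  have Osets: "?O \<inter> space lebesgue \<in> sets lebesgue" using region_sets by simp
  have AE': "AE x in lebesgue. x \<in> interior K \<longrightarrow> f x > 0 \<and> \<bar>f x - 1\<bar> \<le> D"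
    using AEO pos near unfolding AE_restrict_space_iff[OF Osets] by eventually_elim auto
  have Um: "interior K \<in> lmeasurable" using interior_cell[OF K] by (simp add: lmeasurable_open)
  have Us: "interior K \<in> sets lebesgue" using Um by (rule fmeasurableD)
  have fm: "(\<lambda>x. indicator (interior K) x * f x) \<in> borel_measurable lebesgue"
  proof (rule borel_measurable_AE)
    have "(\<lambda>x. f x * indicator ?O x) \<in> borel_measurable lebesgue"
      using m unfolding borel_measurable_restrict_space_iff[OF Osets] by (simp add: mult.commute)
    then show "(\<lambda>x. indicator (interior K) x * (f x * indicator ?O x)) \<in> borel_measurable lebesgue"
      by (rule borel_measurable_times[OF borel_measurable_indicator[OF Us]])
    show "AE x in lebesgue. indicator (interior K) x * (f x * indicator ?O x) = indicator (interior K) x * f x"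
      using AEO by eventually_elim (auto simp: indicator_def)
  qed
  have i1: "integrable lebesgue (indicator (interior K) :: real^'d \<Rightarrow> real)" using Um by (simp add: lmeasurable_iff_integrable)
  have fi: "integrable lebesgue (\<lambda>x. indicator (interior K) x * f x)"
  proof (rule Bochner_Integration.integrable_bound[OF _ fm])
    show "integrable lebesgue (\<lambda>x. (1 + \<bar>D\<bar>) * indicator (interior K) x)" using i1 by simp
    show "AE x in lebesgue. norm (indicator (interior K) x * f x) \<le> norm ((1 + \<bar>D\<bar>) * indicator (interior K) x)"
      using AE' by eventually_elim (auto simp: indicator_def abs_mult)
  qed
  have vK: "vol (interior K) = vol K"
    by (rule measure_interior) (use K.compact compact_imp_bounded negligible_convex_frontier[OF K.convex] in auto)
  let ?I = "LINT x|lebesgue. indicator (interior K) x * f x"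
  have Ieq: "(LINT x:interior K|lebesgue. f x) = ?I" by (simp add: set_lebesgue_integral_def)
  have I1: "(LINT x|lebesgue. indicator (interior K) x * (f x - 1)) = ?I - vol K"
    using fi i1 Us vK by (simp add: right_diff_distrib)
  have "\<bar>LINT x|lebesgue. indicator (interior K) x * (f x - 1)\<bar> \<le> (LINT x|lebesgue. \<bar>indicator (interior K) x * (f x - 1)\<bar>)"
    by (rule integral_abs_bound)
  also have "\<dots> \<le> (LINT x|lebesgue. D * indicator (interior K) x)"
  proof (rule integral_mono_AE)
    show "integrable lebesgue (\<lambda>x. \<bar>indicator (interior K) x * (f x - 1)\<bar>)"
      using fi i1 by (simp add: right_diff_distrib)
    show "integrable lebesgue (\<lambda>x. D * indicator (interior K) x)" using i1 by simp
    show "AE x in lebesgue. \<bar>indicator (interior K) x * (f x - 1)\<bar> \<le> D * indicator (interior K) x"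
      using AE' by eventually_elim (auto simp: indicator_def)
  qed
  also have "\<dots> = D * vol K" using Us vK by simp
  finally have "\<bar>?I - vol K\<bar> \<le> D * vol K" unfolding I1 .
  moreover have "\<bar>(1 / vol K) * ?I - 1\<bar> = \<bar>?I - vol K\<bar> / vol K"
  proof -
    have "(1 / vol K) * ?I - 1 = (?I - vol K) / vol K" using K.vol_pos by (simp add: field_simps)
    then show ?thesis using K.vol_pos by (simp add: abs_divide)
  qed
  ultimately show "\<bar>(1 / vol K) * (LINT x:interior K|lebesgue. f x) - 1\<bar> \<le> D"
    unfolding Ieq using K.vol_pos by (simp add: pos_divide_le_eq)
  have nn: "AE x in lebesgue. 0 \<le> indicator (interior K) x * f x"
    using AE' by eventually_elim (auto simp: indicator_def)
  have "?I \<noteq> 0"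
  proof
    assume "?I = 0"
    then have "AE x in lebesgue. indicator (interior K) x * f x = 0"
      using integral_nonneg_eq_0_iff_AE[OF fi nn] by simp
    then have "AE x in lebesgue. x \<notin> interior K" using AE' by eventually_elim (auto simp: indicator_def)
    then have "interior K \<in> null_sets lebesgue" using Us by (simp add: AE_iff_null_sets)
    then have "vol (interior K) = 0" by (simp add: measure_eq_0_null_sets)
    then show False using vK K.vol_pos by simp
  qed
  moreover have "0 \<le> ?I" by (rule integral_nonneg_AE[OF nn])
  ultimately show "(1 / vol K) * (LINT x:interior K|lebesgue. f x) > 0" unfolding Ieq using K.vol_pos by simp
qed

end

section \<open>From coordinatewise convergence to convergence in an arbitrary discrete norm\<close>

lemma discrete_norm_axioms:
  assumes "discrete_norm I \<nu>"
  shows discrete_norm_eq_0: "\<nu> f = 0 \<longleftrightarrow> (\<forall>i\<in>I. f i = 0)"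
    and discrete_norm_scaleR: "\<nu> (\<lambda>i. c *\<^sub>R f i) = \<bar>c\<bar> * \<nu> f"
    and discrete_norm_triangle: "\<nu> (\<lambda>i. f i + g i) \<le> \<nu> f + \<nu> g"
proof -
  have d: "\<forall>f. \<nu> f = 0 \<longleftrightarrow> (\<forall>i\<in>I. f i = 0)" "\<forall>c f. \<nu> (\<lambda>i. c *\<^sub>R f i) = \<bar>c\<bar> * \<nu> f"
    "\<forall>f g. \<nu> (\<lambda>i. f i + g i) \<le> \<nu> f + \<nu> g"
    using iffD1[OF discrete_norm_def assms] by simp_all
  show "\<nu> f = 0 \<longleftrightarrow> (\<forall>i\<in>I. f i = 0)" by (rule d(1)[THEN spec])
  show "\<nu> (\<lambda>i. c *\<^sub>R f i) = \<bar>c\<bar> * \<nu> f" by (rule d(2)[THEN spec, THEN spec])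
  show "\<nu> (\<lambda>i. f i + g i) \<le> \<nu> f + \<nu> g" by (rule d(3)[THEN spec, THEN spec])
qed

lemma discrete_norm_sum:
  assumes \<nu>: "discrete_norm I \<nu>" and "finite A"
  shows "\<nu> (\<lambda>i. \<Sum>k\<in>A. f k i) \<le> (\<Sum>k\<in>A. \<nu> (f k))"
  using \<open>finite A\<close>
proof (induction A rule: finite_induct)
  case empty
  have "\<nu> (\<lambda>i. 0) = 0" by (simp add: discrete_norm_eq_0[OF \<nu>])
  then show ?case by simp
next
  case (insert a A)
  have "\<nu> (\<lambda>i. f a i + (\<Sum>k\<in>A. f k i)) \<le> \<nu> (f a) + \<nu> (\<lambda>i. \<Sum>k\<in>A. f k i)"
    by (rule discrete_norm_triangle[OF \<nu>])
  then show ?case using insert by simp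
qed

text \<open>Triangle inequality for \<open>f\<close> and its negative, whose sum has norm 0 and
  whose norms agree.\<close>

lemma discrete_norm_nonneg:
  assumes \<nu>: "discrete_norm I \<nu>"
  shows "0 \<le> \<nu> f"
proof -
  have "\<nu> (\<lambda>i. f i + (-1) *\<^sub>R f i) \<le> \<nu> f + \<nu> (\<lambda>i. (-1) *\<^sub>R f i)"
    by (rule discrete_norm_triangle[OF \<nu>])
  moreover have "\<nu> (\<lambda>i. f i + (-1) *\<^sub>R f i) = 0" by (simp add: discrete_norm_eq_0[OF \<nu>])
  moreover have "\<nu> (\<lambda>i. (-1) *\<^sub>R f i) = \<bar>-1\<bar> * \<nu> f" by (rule discrete_norm_scaleR[OF \<nu>])
  ultimately show ?thesis by simp
qed

text \<open>Every discrete norm is at most a weighted sum of the coordinates in the finite basis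
  \<open>e\<close>. A family coincides with its expansion on \<open>I\<close> only; the rest
  vanishes on \<open>I\<close> and has norm 0.\<close>

lemma discrete_norm_tendsto_0:
  fixes F :: "nat \<Rightarrow> 'i \<Rightarrow> 'b::euclidean_space"
  assumes \<nu>: "discrete_norm I \<nu>" and fin: "finite I" and lim: "\<And>i. i \<in> I \<Longrightarrow> (\<lambda>m. F m i) \<longlonglongrightarrow> 0"
  shows "(\<lambda>m. \<nu> (F m)) \<longlonglongrightarrow> 0"
proof -
  define e where "e k = (\<lambda>i. if i = fst k then snd k else (0::'b))" for k :: "'i \<times> 'b"
  let ?A = "I \<times> (Basis :: 'b set)"
  have bound: "\<nu> f \<le> (\<Sum>k\<in>?A. \<bar>f (fst k) \<bullet> snd k\<bar> * \<nu> (e k))" for f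
  proof -
    define g where "g i = (\<Sum>k\<in>?A. (f (fst k) \<bullet> snd k) *\<^sub>R e k i)" for i
    have g: "g i = f i" if i: "i \<in> I" for i
    proof -
      have "g i = (\<Sum>j\<in>I. \<Sum>b\<in>Basis. (f j \<bullet> b) *\<^sub>R (if i = j then b else 0))"
        by (simp add: g_def sum.cartesian_product e_def case_prod_unfold)
      also have "\<dots> = (\<Sum>j\<in>I. if j = i then f i else 0)"
        by (rule sum.cong[OF refl]) (simp add: euclidean_representation)
      also have "\<dots> = f i" using i fin by simp
      finally show ?thesis .
    qed
    have "\<nu> (\<lambda>i. f i - g i) = 0" by (simp add: discrete_norm_eq_0[OF \<nu>] g)
    moreover have "\<nu> (\<lambda>i. g i + (f i - g i)) \<le> \<nu> g + \<nu> (\<lambda>i. f i - g i)"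
      by (rule discrete_norm_triangle[OF \<nu>])
    ultimately have "\<nu> f \<le> \<nu> g" by simp
    also have "\<nu> g \<le> (\<Sum>k\<in>?A. \<nu> (\<lambda>i. (f (fst k) \<bullet> snd k) *\<^sub>R e k i))"
      unfolding g_def by (rule discrete_norm_sum[OF \<nu>]) (simp add: fin)
    also have "\<dots> = (\<Sum>k\<in>?A. \<bar>f (fst k) \<bullet> snd k\<bar> * \<nu> (e k))"
      by (rule sum.cong[OF refl discrete_norm_scaleR[OF \<nu>]])
    finally show ?thesis .
  qed
  have "(\<lambda>m. \<Sum>k\<in>?A. \<bar>F m (fst k) \<bullet> snd k\<bar> * \<nu> (e k)) \<longlonglongrightarrow> (\<Sum>k\<in>?A. \<bar>0 \<bullet> snd k\<bar> * \<nu> (e k))"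
    by (intro tendsto_intros lim) auto
  then have "(\<lambda>m. \<Sum>k\<in>?A. \<bar>F m (fst k) \<bullet> snd k\<bar> * \<nu> (e k)) \<longlonglongrightarrow> 0" by simp
  then show ?thesis
    by (rule real_tendsto_sandwich[OF always_eventually always_eventually tendsto_const, rotated 2])
      (simp_all only: discrete_norm_nonneg[OF \<nu>] bound simp_thms)
qed

context staggered_discretization
begin

lemma lq_norm_bound:
  assumes q: "1 \<le> q" and D: "0 \<le> D" and r: "\<And>K. K \<in> cells S \<Longrightarrow> \<bar>r K - 1\<bar> \<le> D"
  shows "lq_norm (region S) q (\<lambda>x. cellwise S r x - 1) \<le> vol (region S) powr (1 / q) * D"
proof -
  let ?M = "lebesgue_on (region S)" and ?h = "\<lambda>x. \<bar>cellwise S r x - 1\<bar> powr q"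
  interpret finite_measure ?M using region_lmeasurable by (rule finite_measure_lebesgue_on)
  have "(LINT x|?M. ?h x) \<le> vol (region S) * D powr q"
  proof (cases "integrable ?M ?h")
    case True
    have "(LINT x|?M. ?h x) \<le> (LINT x|?M. D powr q)"
    proof (rule integral_mono_AE[OF True])
      show "AE x in ?M. ?h x \<le> D powr q"
        using AE_in_cell_interior
      proof eventually_elim
        case (elim x)
        then obtain K where "K \<in> cells S" "x \<in> interior K" by blast
        then show ?case using r cellwise_eq q by (simp add: powr_mono2)
      qed
    qed simp
    also have "\<dots> = vol (region S) * D powr q"
      using region_sets by (simp add: measure_restrict_space)
    finally show ?thesis .
  next
    case False
    \<comment> \<open>The integral of a non-integrable function is 0 by convention.\<close>
    then show ?thesis by (simp add: not_integrable_integral_eq)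
  qed
  then have "lq_norm (region S) q (\<lambda>x. cellwise S r x - 1) \<le> (vol (region S) * D powr q) powr (1 / q)"
    unfolding lq_norm_def using q by (intro powr_mono2) auto
  also have "\<dots> = vol (region S) powr (1 / q) * D"
    using q D by (simp add: powr_mult powr_powr)
  finally show ?thesis .
qed

text \<open>Comparison with the zero function, whose essential supremum is 0 because the region has
  positive measure.\<close>

lemma linf_norm_nonneg: "0 \<le> linf_norm (region S) f"
proof -
  have "emeasure lebesgue (region S) \<noteq> 0"
    using vol_region_pos unfolding measure_def by (metis enn2real_0 less_irrefl)
  then have "emeasure (lebesgue_on (region S)) (space (lebesgue_on (region S))) \<noteq> 0"
    using region_sets by (simp add: emeasure_restrict_space del: emeasure_completion)
  then have "esssup (lebesgue_on (region S)) (\<lambda>x. 0::ereal) = 0" by (rule esssup_const)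
  moreover have "esssup (lebesgue_on (region S)) (\<lambda>x. 0::ereal) \<le> linf_norm (region S) f"
    unfolding linf_norm_def by (rule esssup_mono) auto
  ultimately show ?thesis by simp
qed

text \<open>Base case of the induction in time. The limit velocity is shown to be divergence free
  first: \<open>\<rho> m (-1)\<close> differs from \<open>\<rho> m 0\<close> by \<delta>t times a
  mass divergence that tends to the divergence of this limit.\<close>

lemma initial_data_limit:
  assumes eps: "\<And>m. \<epsilon> m > 0" "\<epsilon> \<longlonglongrightarrow> 0" and dt: "\<delta>t > 0"
    and data: "data_assumption (region S) \<epsilon> \<rho>0 u0"
    and init: "\<And>m. SI_init S \<delta>t (\<rho>0 m) (u0 m) (\<rho> m) (u m)"
  obtains C where "\<And>m K. K \<in> cells S \<Longrightarrow> \<rho> m 0 K > 0" "\<And>m K. K \<in> cells S \<Longrightarrow> \<bar>\<rho> m 0 K - 1\<bar> \<le> C * \<epsilon> m"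
    "\<And>\<sigma>. \<sigma> \<in> faces S \<Longrightarrow> convergent (\<lambda>m. u m 0 \<sigma>)" "\<And>K. K \<in> cells S \<Longrightarrow> (\<lambda>m. \<rho> m (-1) K) \<longlonglongrightarrow> 1"
proof -
  let ?O = "region S"
  obtain C where C: "\<And>m. ereal (h1_norm ?O (u0 m)) + ereal (1 / \<epsilon> m * l2_norm ?O (weak_div ?O (u0 m)))
        + ereal (1 / \<epsilon> m) * linf_norm ?O (\<lambda>x. \<rho>0 m x - 1) \<le> ereal C"
    using data unfolding data_assumption_def by blast
  obtain w where w: "w \<in> L2 ?O" "(\<lambda>m. l2_norm ?O (\<lambda>x. u0 m x - w x)) \<longlonglongrightarrow> 0"
    using data unfolding data_assumption_def by blast
  have pos0: "AE x in lebesgue_on ?O. \<rho>0 m x > 0" and meas0: "\<rho>0 m \<in> borel_measurable (lebesgue_on ?O)"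
    and H10: "(\<lambda>x. u0 m x $ i) \<in> H10 ?O" for m i
    using data unfolding data_assumption_def by blast+
  have h1: "h1_norm ?O (u0 m) \<le> C" and wd: "1 / \<epsilon> m * l2_norm ?O (weak_div ?O (u0 m)) \<le> C"
    and li: "linf_norm ?O (\<lambda>x. \<rho>0 m x - 1) \<le> ereal (C / (1 / \<epsilon> m))" for m
  proof -
    have nn: "0 \<le> h1_norm ?O (u0 m)" "0 \<le> 1 / \<epsilon> m * l2_norm ?O (weak_div ?O (u0 m))" "0 < 1 / \<epsilon> m"
      using order_trans[OF l2_norm_nonneg wgrad_le_h1_norm] eps(1)[of m]
      by (blast, simp_all add: l2_norm_nonneg)
    show "h1_norm ?O (u0 m) \<le> C" "1 / \<epsilon> m * l2_norm ?O (weak_div ?O (u0 m)) \<le> C" "linf_norm ?O (\<lambda>x. \<rho>0 m x - 1) \<le> ereal (C / (1 / \<epsilon> m))"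
      using ereal_sum_bound[OF C[of m] nn linf_norm_nonneg] by blast+
  qed
  have near0: "AE x in lebesgue_on ?O. \<bar>\<rho>0 m x - 1\<bar> \<le> C * \<epsilon> m" for m
  proof -
    have "AE x in lebesgue_on ?O. ereal \<bar>\<rho>0 m x - 1\<bar> \<le> linf_norm ?O (\<lambda>x. \<rho>0 m x - 1)"
      unfolding linf_norm_def by (rule esssup_AE)
    then show ?thesis
    proof eventually_elim
      case (elim x)
      then have "ereal \<bar>\<rho>0 m x - 1\<bar> \<le> ereal (C / (1 / \<epsilon> m))" using li[of m] by (rule order_trans)
      then show ?case by simp
    qed
  qed
  have \<rho>0: "\<rho> m 0 K = (1 / vol K) * (LINT x:interior K|lebesgue. \<rho>0 m x)" if "K \<in> cells S" for m K
    using init[of m] that by (simp add: SI_init_def)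
  have r: "\<rho> m 0 K > 0" "\<bar>\<rho> m 0 K - 1\<bar> \<le> C * \<epsilon> m" if "K \<in> cells S" for m K
    unfolding \<rho>0[OF that] by (rule cell_mean_near_one[OF that meas0 pos0 near0])+
  have H: "u m 0 \<in> HE0 S" for m using init[of m] by (simp add: SI_init_def)
  have tr: "\<exists>g. (\<forall>i. is_trace ?O \<sigma> (\<lambda>x. u0 m x $ i) (\<lambda>x. g x $ i)) \<and> u m 0 \<sigma> = face_mean \<sigma> g" if "\<sigma> \<in> int_faces S" for m \<sigma>
    using init[of m] that unfolding SI_init_def by blast
  have ext0: "u m 0 \<sigma> = 0" if "\<sigma> \<in> ext_faces S" for m \<sigma> using H[of m] that by (simp add: HE0_def)
  have conv: "convergent (\<lambda>m. u m 0 \<sigma>)" if f: "\<sigma> \<in> faces S" for \<sigma>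
  proof (cases "\<sigma> \<in> int_faces S")
    case True
    show ?thesis by (rule face_means_convergent[OF True H10 h1 w tr[OF True]])
  next
    case False
    then have "\<sigma> \<in> ext_faces S" using f faces_union by blast
    then show ?thesis by (simp add: ext0 convergent_const)
  qed
  define ul where "ul \<sigma> = lim (\<lambda>m. u m 0 \<sigma>)" for \<sigma>
  have ul: "(\<lambda>m. u m 0 \<sigma>) \<longlonglongrightarrow> ul \<sigma>" if "\<sigma> \<in> faces S" for \<sigma>
    using conv[OF that] by (simp add: ul_def convergent_LIMSEQ_iff)
  have ulH: "ul \<in> HE0 S" by (simp add: HE0_def ul_def ext0)
  have r1: "(\<lambda>m. \<rho> m 0 K) \<longlonglongrightarrow> 1" if K: "K \<in> cells S" for K
  proof -
    have "(\<lambda>m. \<rho> m 0 K - 1) \<longlonglongrightarrow> 0"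
    proof (rule Lim_null_comparison)
      show "\<forall>\<^sub>F m in sequentially. norm (\<rho> m 0 K - 1) \<le> C * \<epsilon> m" using r(2)[OF K] by (simp add: always_eventually)
      show "(\<lambda>m. C * \<epsilon> m) \<longlonglongrightarrow> 0" by (rule tendsto_mult_right_zero[OF eps(2)])
    qed
    then show ?thesis by (simp add: LIM_zero_iff)
  qed
  have div0: "div_vel S ul K = 0" if K: "K \<in> cells S" for K
  proof -
    let ?c = "l2_norm ?O (indicator K :: real^'d \<Rightarrow> real)"
    have "(\<lambda>m. vol K * div_vel S (u m 0) K) \<longlonglongrightarrow> 0"
    proof (rule Lim_null_comparison)
      show "\<forall>\<^sub>F m in sequentially. norm (vol K * div_vel S (u m 0) K) \<le> ?c * (C * \<epsilon> m)"
      proof (intro always_eventually allI)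
        fix m
        have "vol K * div_vel S (u m 0) K = (LINT x|lebesgue_on ?O. indicator K x * weak_div ?O (u0 m) x)"
          by (rule div_vel_face_means[OF K H10 H]) (rule tr)
        then have "\<bar>vol K * div_vel S (u m 0) K\<bar> \<le> ?c * l2_norm ?O (weak_div ?O (u0 m))"
          by (simp only:) (rule integral_indicator_L2_bound(2)[OF K weak_div_L2[OF H10]])
        also have "\<dots> \<le> ?c * (C * \<epsilon> m)"
          using wd[of m] eps(1)[of m] by (intro mult_left_mono l2_norm_nonneg) (simp add: field_simps)
        finally show "norm (vol K * div_vel S (u m 0) K) \<le> ?c * (C * \<epsilon> m)" by simp
      qed
      show "(\<lambda>m. ?c * (C * \<epsilon> m)) \<longlonglongrightarrow> 0" by (intro tendsto_mult_right_zero eps(2))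
    qed
    moreover have "(\<lambda>m. vol K * div_vel S (u m 0) K) \<longlonglongrightarrow> vol K * div_vel S ul K"
      by (intro tendsto_intros div_vel_tendsto[OF K ul])
    ultimately have "vol K * div_vel S ul K = 0" by (rule LIMSEQ_unique[rotated])
    then show ?thesis using vol_cell_pos[OF K] by simp
  qed
  have rm: "(\<lambda>m. \<rho> m (-1) K) \<longlonglongrightarrow> 1" if K: "K \<in> cells S" for K
  proof -
    have eq: "\<rho> m (-1) K = \<rho> m 0 K + \<delta>t * div_mass S (\<rho> m 0) (u m 0) K" for m
    proof -
      have "(1 / \<delta>t) * (\<rho> m 0 K - \<rho> m (-1) K) = - div_mass S (\<rho> m 0) (u m 0) K"
        using init[of m] K unfolding SI_init_def by (simp add: add_eq_0_iff)
      then have "\<rho> m 0 K - \<rho> m (-1) K = - (\<delta>t * div_mass S (\<rho> m 0) (u m 0) K)" using dt by (simp add: field_simps)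
      then show ?thesis by simp
    qed
    have "(\<lambda>m. div_mass S (\<rho> m 0) (u m 0) K) \<longlonglongrightarrow> div_mass S (\<lambda>_. 1) ul K"
      by (rule div_mass_tendsto[OF K r1 ul])
    then have "(\<lambda>m. div_mass S (\<rho> m 0) (u m 0) K) \<longlonglongrightarrow> 0"
      using div0[OF K] div_vel_eq_mass[OF ulH, of K] by simp
    from tendsto_add[OF r1[OF K] tendsto_mult[OF tendsto_const[of \<delta>t] this]]
    show ?thesis by (simp add: eq)
  qed
  show ?thesis by (rule that[OF r conv rm])
qed

end

section \<open>Induction over the time levels, rates and norms\<close>

theorem theorem7p8:
  fixes S :: "'d::finite staggered"
    and \<mu> lam \<gamma> T \<delta>t :: real and N :: int
    and \<epsilon> :: "nat \<Rightarrow> real"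
    and \<rho>0 :: "nat \<Rightarrow> real^'d \<Rightarrow> real" and u0 :: "nat \<Rightarrow> real^'d \<Rightarrow> real^'d"
    and \<rho> :: "nat \<Rightarrow> int \<Rightarrow> 'd cellfun" and u :: "nat \<Rightarrow> int \<Rightarrow> 'd facefun"
  assumes dim: "CARD('d) = 2 \<or> CARD('d) = 3"
    and mesh: "staggered_mesh S"
    and viscosity: "\<mu> > 0" "\<mu> + lam > 0"
    and gamma: "\<gamma> \<ge> 1"
    and time: "T > 0" "\<delta>t > 0" "N = \<lfloor>T / \<delta>t\<rfloor>"
    and eps: "\<And>m. \<epsilon> m > 0" "\<epsilon> \<longlonglongrightarrow> 0"
    and data: "data_assumption (region S) \<epsilon> \<rho>0 u0"
    and sol: "\<And>m. SI_solution S \<mu> lam \<gamma> \<delta>t N (\<epsilon> m) (\<rho>0 m) (u0 m) (\<rho> m) (u m)"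
    and cfl: "\<And>m n. 1 \<le> n \<Longrightarrow> n \<le> N \<Longrightarrow> CFL S \<mu> lam \<delta>t (\<rho> m n) (u m n)"
  shows "(\<lambda>m. linf_lq_norm S N \<gamma> (\<lambda>n x. cellwise S (\<rho> m n) x - 1)) \<longlonglongrightarrow> 0 \<and>
    (\<forall>q. 1 \<le> q \<and> q \<le> min 2 \<gamma> \<longrightarrow> (\<exists>C>0. \<forall>\<^sub>F m in sequentially.
       linf_lq_norm S N q (\<lambda>n x. cellwise S (\<rho> m n) x - 1) \<le> C * \<epsilon> m)) \<and>
    (\<exists>(ul :: int \<Rightarrow> 'd facefun) (pl :: int \<Rightarrow> 'd cellfun).
       (\<forall>\<nu>. discrete_norm ({0..N} \<times> int_faces S) \<nu> \<longrightarrow>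
          (\<lambda>m. \<nu> (\<lambda>(n, \<sigma>). u m n \<sigma> - ul n \<sigma>)) \<longlonglongrightarrow> 0) \<and>
       (\<forall>\<nu>. discrete_norm ({1..N} \<times> cells S) \<nu> \<longrightarrow>
          (\<lambda>m. \<nu> (\<lambda>(n, K). delta_p S \<gamma> (\<epsilon> m) (\<rho> m n) K - pl n K)) \<longlonglongrightarrow> 0) \<and>
       ul 0 \<in> HE0 S \<and>
       (\<forall>n\<in>{0..<N}.
          incompressible_step S \<mu> lam \<delta>t (ul n) (ul (n + 1)) (pl (n + 1)) \<and>
          cell_mean S (pl (n + 1)) = 0 \<and>
          (\<forall>v q. incompressible_step S \<mu> lam \<delta>t (ul n) v q \<and> cell_mean S q = 0 \<longrightarrow>
             (\<forall>\<sigma>\<in>faces S. v \<sigma> = ul (n + 1) \<sigma>) \<and> (\<forall>K\<in>cells S. q K = pl (n + 1) K))))"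
proof -
  interpret staggered_discretization S by unfold_locales (rule dim, rule mesh)
  have N0: "0 \<le> N" using time by simp
  have init: "SI_init S \<delta>t (\<rho>0 m) (u0 m) (\<rho> m) (u m)" for m using sol[of m] by (simp add: SI_solution_def)
  have step: "SI_step S \<mu> lam \<gamma> \<delta>t (\<epsilon> m) (\<rho> m) (u m) n" if "n \<in> {0..<N}" for m n
    using sol[of m] that by (simp add: SI_solution_def)
  \<comment> \<open>The limits are named before they are known to exist; the induction supplies
    convergence at each level.\<close>
  define ul where "ul n \<sigma> = lim (\<lambda>m. u m n \<sigma>)" for n \<sigma>
  define pl where "pl n K = lim (\<lambda>m. delta_p S \<gamma> (\<epsilon> m) (\<rho> m n) K)" for n K
  \<comment> \<open>Induction hypothesis. The density at level \<open>n - 1\<close> is included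
    because it multiplies the old velocity in the momentum balance; for \<open>n = 0\<close> it is
    the artificial level -1.\<close>
  define Q where "Q n \<longleftrightarrow> (\<forall>m. \<forall>K\<in>cells S. \<rho> m n K > 0) \<and>
     (\<exists>A. \<forall>\<^sub>F m in sequentially. \<forall>K\<in>cells S. \<bar>\<rho> m n K - 1\<bar> \<le> A * \<epsilon> m) \<and>
     (\<forall>K\<in>cells S. (\<lambda>m. \<rho> m (n - 1) K) \<longlonglongrightarrow> 1) \<and> (\<forall>\<sigma>\<in>faces S. convergent (\<lambda>m. u m n \<sigma>))" for n
  have Q0: "Q 0"
  proof -
    obtain C where C: "\<And>m K. K \<in> cells S \<Longrightarrow> \<rho> m 0 K > 0" "\<And>m K. K \<in> cells S \<Longrightarrow> \<bar>\<rho> m 0 K - 1\<bar> \<le> C * \<epsilon> m"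
      "\<And>\<sigma>. \<sigma> \<in> faces S \<Longrightarrow> convergent (\<lambda>m. u m 0 \<sigma>)" "\<And>K. K \<in> cells S \<Longrightarrow> (\<lambda>m. \<rho> m (-1) K) \<longlonglongrightarrow> 1"
      using initial_data_limit[OF eps time(2) data init] by blast
    have "\<forall>\<^sub>F m in sequentially. \<forall>K\<in>cells S. \<bar>\<rho> m 0 K - 1\<bar> \<le> C * \<epsilon> m"
      by (intro always_eventually allI ballI C(2))
    then show ?thesis unfolding Q_def using C(1,3,4) by auto
  qed
  have Qstep: "Q (n + 1) \<and> (\<forall>K\<in>cells S. convergent (\<lambda>m. delta_p S \<gamma> (\<epsilon> m) (\<rho> m (n + 1)) K)) \<and>
      incompressible_step S \<mu> lam \<delta>t (ul n) (ul (n + 1)) (pl (n + 1)) \<and> cell_mean S (pl (n + 1)) = 0"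
    if n: "n \<in> {0..<N}" and Qn: "Q n" for n
  proof -
    obtain A where A: "\<forall>\<^sub>F m in sequentially. \<forall>K\<in>cells S. \<bar>\<rho> m n K - 1\<bar> \<le> A * \<epsilon> m" using Qn unfolding Q_def by blast
    have pos: "\<And>m K. K \<in> cells S \<Longrightarrow> \<rho> m n K > 0" and r0: "\<And>K. K \<in> cells S \<Longrightarrow> (\<lambda>m. \<rho> m (n - 1) K) \<longlonglongrightarrow> 1"
      using Qn unfolding Q_def by blast+
    have v1: "(\<lambda>m. u m n \<sigma>) \<longlonglongrightarrow> ul n \<sigma>" if "\<sigma> \<in> faces S" for \<sigma>
      using Qn that unfolding Q_def ul_def by (simp add: convergent_LIMSEQ_iff)
    have H2: "\<And>m. u m (n + 1) \<in> HE0 S"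
      and mass: "\<And>m K. K \<in> cells S \<Longrightarrow> (1 / \<delta>t) * (\<rho> m (n + 1) K - \<rho> m n K) + div_mass S (\<rho> m (n + 1)) (u m (n + 1)) K = 0"
      and mom: "\<And>m \<sigma>. \<sigma> \<in> int_faces S \<Longrightarrow>
        (1 / \<delta>t) *\<^sub>R (dual_density S (\<rho> m n) \<sigma> *\<^sub>R u m (n + 1) \<sigma> - dual_density S (\<rho> m (n - 1)) \<sigma> *\<^sub>R u m n \<sigma>)
        + conv_up S (\<rho> m n) (u m n) (u m n) \<sigma> - div_tau S \<mu> lam (u m n) \<sigma>
        + (1 / (\<epsilon> m)\<^sup>2) *\<^sub>R grad_p S (\<lambda>K. \<rho> m (n + 1) K powr \<gamma>) \<sigma> = 0"
      using step[OF n] unfolding SI_step_def by blast+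
    obtain B where B: "\<And>m K. K \<in> cells S \<Longrightarrow> \<rho> m (n + 1) K > 0"
      "\<forall>\<^sub>F m in sequentially. \<forall>K\<in>cells S. \<bar>\<rho> m (n + 1) K - 1\<bar> \<le> B * \<epsilon> m"
      "\<And>K. K \<in> cells S \<Longrightarrow> (\<lambda>m. \<rho> m n K) \<longlonglongrightarrow> 1"
      "\<And>\<sigma>. \<sigma> \<in> faces S \<Longrightarrow> convergent (\<lambda>m. u m (n + 1) \<sigma>)"
      "\<And>K. K \<in> cells S \<Longrightarrow> convergent (\<lambda>m. delta_p S \<gamma> (\<epsilon> m) (\<rho> m (n + 1)) K)"
      "\<And>ul' pl. (\<And>\<sigma>. \<sigma> \<in> faces S \<Longrightarrow> (\<lambda>m. u m (n + 1) \<sigma>) \<longlonglongrightarrow> ul' \<sigma>) \<Longrightarrow>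
         (\<And>K. K \<in> cells S \<Longrightarrow> (\<lambda>m. delta_p S \<gamma> (\<epsilon> m) (\<rho> m (n + 1)) K) \<longlonglongrightarrow> pl K) \<Longrightarrow>
         incompressible_step S \<mu> lam \<delta>t (ul n) ul' pl \<and> cell_mean S pl = 0"
      by (rule scheme_step_limit[OF gamma time(2) eps pos A r0 v1 H2 mass mom]) blast+
    have "Q (n + 1)" unfolding Q_def using B(1-4) by auto
    moreover have "incompressible_step S \<mu> lam \<delta>t (ul n) (ul (n + 1)) (pl (n + 1)) \<and> cell_mean S (pl (n + 1)) = 0"
    proof (rule B(6))
      show "(\<lambda>m. u m (n + 1) \<sigma>) \<longlonglongrightarrow> ul (n + 1) \<sigma>" if "\<sigma> \<in> faces S" for \<sigma>
        using B(4)[OF that] unfolding ul_def convergent_LIMSEQ_iff .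
      show "(\<lambda>m. delta_p S \<gamma> (\<epsilon> m) (\<rho> m (n + 1)) K) \<longlonglongrightarrow> pl (n + 1) K" if "K \<in> cells S" for K
        using B(5)[OF that] unfolding pl_def convergent_LIMSEQ_iff .
    qed
    ultimately show ?thesis using B(5) by blast
  qed
  have Q: "Q n" if n: "0 \<le> n" "n \<le> N" for n
    using n
  proof (induction n rule: int_ge_induct)
    case base
    show ?case by (rule Q0)
  next
    case (step i)
    then show ?case using Qstep[of i] by simp
  qed
  have near: "\<exists>C\<ge>0. \<forall>\<^sub>F m in sequentially. \<forall>n\<in>{0..N}. \<forall>K\<in>cells S. \<bar>\<rho> m n K - 1\<bar> \<le> C * \<epsilon> m"
  proof -
    have "\<forall>n\<in>{0..N}. \<exists>A. \<forall>\<^sub>F m in sequentially. \<forall>K\<in>cells S. \<bar>\<rho> m n K - 1\<bar> \<le> A * \<epsilon> m"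
      using Q unfolding Q_def by simp
    then obtain A where A: "\<forall>n\<in>{0..N}. \<forall>\<^sub>F m in sequentially. \<forall>K\<in>cells S. \<bar>\<rho> m n K - 1\<bar> \<le> A n * \<epsilon> m"
      by (rule bchoice[THEN exE])
    \<comment> \<open>There are finitely many time levels, so the sum of their constants serves for
      all of them.\<close>
    define C where "C = (\<Sum>n\<in>{0..N}. \<bar>A n\<bar>)"
    have "\<forall>\<^sub>F m in sequentially. \<forall>n\<in>{0..N}. \<forall>K\<in>cells S. \<bar>\<rho> m n K - 1\<bar> \<le> A n * \<epsilon> m"
      using A by (intro eventually_ball_finite) auto
    then have "\<forall>\<^sub>F m in sequentially. \<forall>n\<in>{0..N}. \<forall>K\<in>cells S. \<bar>\<rho> m n K - 1\<bar> \<le> C * \<epsilon> m"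
    proof eventually_elim
      case (elim m)
      show ?case
      proof (intro ballI)
        fix n K assume n: "n \<in> {0..N}" and K: "K \<in> cells S"
        have "\<bar>A n\<bar> \<le> C" unfolding C_def by (rule member_le_sum[OF n]) simp_all
        then have "A n * \<epsilon> m \<le> C * \<epsilon> m" using eps(1)[of m] by (intro mult_right_mono) auto
        with bspec[OF bspec[OF elim n] K] show "\<bar>\<rho> m n K - 1\<bar> \<le> C * \<epsilon> m" by linarith
      qed
    qed
    moreover have "0 \<le> C" unfolding C_def by (rule sum_nonneg) simp
    ultimately show ?thesis by blast
  qed
  \<comment> \<open>A bound on every cell controls each L^q norm; the instance
    \<open>q = \<gamma>\<close> also yields the first claim.\<close>
  have rate: "\<exists>C>0. \<forall>\<^sub>F m in sequentially. linf_lq_norm S N q (\<lambda>n x. cellwise S (\<rho> m n) x - 1) \<le> C * \<epsilon> m" if q: "1 \<le> q" for q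
  proof -
    obtain C where C: "C \<ge> 0" "\<forall>\<^sub>F m in sequentially. \<forall>n\<in>{0..N}. \<forall>K\<in>cells S. \<bar>\<rho> m n K - 1\<bar> \<le> C * \<epsilon> m"
      using near by blast
    let ?v = "vol (region S) powr (1 / q)"
    have "\<forall>\<^sub>F m in sequentially. linf_lq_norm S N q (\<lambda>n x. cellwise S (\<rho> m n) x - 1) \<le> (?v * C + 1) * \<epsilon> m"
      using C(2)
    proof eventually_elim
      case (elim m)
      have "lq_norm (region S) q (\<lambda>x. cellwise S (\<rho> m n) x - 1) \<le> (?v * C + 1) * \<epsilon> m" if "n \<in> {0..N}" for n
      proof -
        have "lq_norm (region S) q (\<lambda>x. cellwise S (\<rho> m n) x - 1) \<le> ?v * (C * \<epsilon> m)"
          by (rule lq_norm_bound[OF q]) (use elim that C(1) eps(1)[of m] in auto)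
        also have "\<dots> \<le> (?v * C + 1) * \<epsilon> m" using eps(1)[of m] by (simp add: algebra_simps)
        finally show ?thesis .
      qed
      then show ?case unfolding linf_lq_norm_def using N0 by (subst Max_le_iff) auto
    qed
    moreover have "?v * C + 1 > 0" using C(1) by (simp add: add_nonneg_pos)
    ultimately show ?thesis by blast
  qed
  have conv: "(\<lambda>m. linf_lq_norm S N \<gamma> (\<lambda>n x. cellwise S (\<rho> m n) x - 1)) \<longlonglongrightarrow> 0"
  proof -
    obtain C where C: "\<forall>\<^sub>F m in sequentially. linf_lq_norm S N \<gamma> (\<lambda>n x. cellwise S (\<rho> m n) x - 1) \<le> C * \<epsilon> m"
      using rate[OF gamma] by blast
    show ?thesis
    proof (rule tendsto_sandwich[OF _ C tendsto_const])
      have "0 \<le> linf_lq_norm S N \<gamma> (\<lambda>n x. cellwise S (\<rho> m n) x - 1)" for m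
      proof -
        have "lq_norm (region S) \<gamma> (\<lambda>x. cellwise S (\<rho> m 0) x - 1) \<le> linf_lq_norm S N \<gamma> (\<lambda>n x. cellwise S (\<rho> m n) x - 1)"
          unfolding linf_lq_norm_def using N0 by (intro Max_ge) auto
        moreover have "0 \<le> lq_norm (region S) \<gamma> (\<lambda>x. cellwise S (\<rho> m 0) x - 1)" by (simp add: lq_norm_def)
        ultimately show ?thesis by linarith
      qed
      then show "\<forall>\<^sub>F m in sequentially. 0 \<le> linf_lq_norm S N \<gamma> (\<lambda>n x. cellwise S (\<rho> m n) x - 1)"
        by (intro always_eventually allI)
      show "(\<lambda>m. C * \<epsilon> m) \<longlonglongrightarrow> 0" by (rule tendsto_mult_right_zero[OF eps(2)])
    qed
  qed
  have ulim: "(\<lambda>m. u m n \<sigma>) \<longlonglongrightarrow> ul n \<sigma>" if "n \<in> {0..N}" "\<sigma> \<in> faces S" for n \<sigma>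
    using Q[of n] that unfolding Q_def ul_def by (simp add: convergent_LIMSEQ_iff)
  \<comment> \<open>The pressure at level \<open>n\<close> is produced by the step starting from
    \<open>n - 1\<close>, hence the range begins at 1.\<close>
  have plim: "(\<lambda>m. delta_p S \<gamma> (\<epsilon> m) (\<rho> m n) K) \<longlonglongrightarrow> pl n K" if "n \<in> {1..N}" "K \<in> cells S" for n K
    using Qstep[of "n - 1"] Q[of "n - 1"] that unfolding pl_def by (simp add: convergent_LIMSEQ_iff)
  have normu: "(\<lambda>m. \<nu> (\<lambda>(n, \<sigma>). u m n \<sigma> - ul n \<sigma>)) \<longlonglongrightarrow> 0" if "discrete_norm ({0..N} \<times> int_faces S) \<nu>" for \<nu> :: "(int \<times> (real^'d) set \<Rightarrow> real^'d) \<Rightarrow> real"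
  proof (rule discrete_norm_tendsto_0[OF that])
    show "finite ({0..N} \<times> int_faces S)" using finite_int_faces by simp
    fix i assume i: "i \<in> {0..N} \<times> int_faces S"
    then have "(\<lambda>m. u m (fst i) (snd i)) \<longlonglongrightarrow> ul (fst i) (snd i)" by (intro ulim) (auto simp: faces_union)
    then show "(\<lambda>m. case i of (n, \<sigma>) \<Rightarrow> u m n \<sigma> - ul n \<sigma>) \<longlonglongrightarrow> 0" by (simp add: case_prod_unfold LIM_zero)
  qed
  have normp: "(\<lambda>m. \<nu> (\<lambda>(n, K). delta_p S \<gamma> (\<epsilon> m) (\<rho> m n) K - pl n K)) \<longlonglongrightarrow> 0" if "discrete_norm ({1..N} \<times> cells S) \<nu>" for \<nu> :: "(int \<times> (real^'d) set \<Rightarrow> real) \<Rightarrow> real"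
  proof (rule discrete_norm_tendsto_0[OF that])
    show "finite ({1..N} \<times> cells S)" using finite_cells by simp
    fix i assume i: "i \<in> {1..N} \<times> cells S"
    then have "(\<lambda>m. delta_p S \<gamma> (\<epsilon> m) (\<rho> m (fst i)) (snd i)) \<longlonglongrightarrow> pl (fst i) (snd i)" by (intro plim) auto
    then show "(\<lambda>m. case i of (n, K) \<Rightarrow> delta_p S \<gamma> (\<epsilon> m) (\<rho> m n) K - pl n K) \<longlonglongrightarrow> 0" by (simp add: case_prod_unfold LIM_zero)
  qed
  have ul0: "ul 0 \<in> HE0 S"
  proof -
    have "u m 0 \<sigma> = 0" if "\<sigma> \<in> ext_faces S" for m \<sigma> using init[of m] that by (simp add: SI_init_def HE0_def)
    then show ?thesis by (simp add: HE0_def ul_def)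
  qed
  have inc: "incompressible_step S \<mu> lam \<delta>t (ul n) (ul (n + 1)) (pl (n + 1))" "cell_mean S (pl (n + 1)) = 0" if "n \<in> {0..<N}" for n
    using Qstep[OF that] Q[of n] that by auto
  have uniq: "(\<forall>\<sigma>\<in>faces S. v \<sigma> = ul (n + 1) \<sigma>) \<and> (\<forall>K\<in>cells S. q K = pl (n + 1) K)"
    if "n \<in> {0..<N}" "incompressible_step S \<mu> lam \<delta>t (ul n) v q \<and> cell_mean S q = 0" for n v q
    using that incompressible_step_unique[OF time(2) _ _ inc[OF that(1)]] by blast
  show ?thesis
    by (intro conjI allI impI ballI conv exI[of _ ul] exI[of _ pl] normu normp ul0 rate) (use inc uniq in blast)+
qed

end
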